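(* Let $P_d$ be a probability distribution on $\mathbb{Z}_+=\{0,1,2,\dots\}$ and $\delta\in[0,1]$, and assume it is not the case that both $d=1$ almost surely under $P_d$ and $\delta\in\{0,1\}$. Let $\mathcal{Q}$ be the associated BP operator (without survey). Then the following distributions all exist and are identical: (a) the limiting LLR distribution of broadcasting on trees with noiseless leaf observations, i.e. the weak limit of $\mathcal{Q}^hB_0$ as $h\to\infty$, where $B_0$ is the unit mass at $+\infty$; (b) the limiting LLR distribution of robust reconstruction with any non-trivial initialization, i.e. the weak limit of $\mathcal{Q}^h\mu_{r}$ as $h\to\infty$ for any non-trivial LLR distribution $\mu_r$; (c) the dominant BP fixed point, i.e. a fixed point $\mu^*$ of $\mathcal{Q}$ such that any other fixed point $\mu$ of $\mathcal{Q}$ satisfies $\mu\preceq\mu^*$.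
   Context: A probability distribution $\mu$ on $(-\infty,+\infty]$ is an LLR distribution if $\int e^{-r}d\mu(r)\le 1$. Its complement is the (unique) probability distribution $\mu^-$ on $[-\infty,+\infty)$ with $\mu^-[E]=\int e^{-r}\mathbf{1}\{r\in E\}\,d\mu(r)$ for every measurable $E\subseteq(-\infty,+\infty)$. The trivial distribution is $\delta_0$, the unit mass at $0$. Weak convergence is that of probability measures on $(-\infty,+\infty]$. BP operator without survey: for an LLR distribution $\mu$ with complement $\mu^-$, $\mathcal{Q}\mu$ is the law of $R=\sum_{u=1}^dF_\delta(\hat R_u)$, where $F_\delta(x)=\ln\frac{(1-\delta)e^x+\delta}{\delta e^x+1-\delta}$ (extended continuously to $\pm\infty$), $d\sim P_d$, $\hat R_u\sim(1-\delta)\mu+\delta\mu^-$ i.i.d., all jointly independent. $\mu$ is a fixed point if $\mathcal{Q}\mu=\mu$. In broadcasting on a random tree with offspring distribution $P_d$, a fair root bit is propagated along edges, each flipping it independently with probability $\delta$; in robust reconstruction each vertex at depth $h$ is observed independently through a binary-input channel whose log-likelihood-ratio distribution (given input $0$) is $\mu_r$. The LLR distribution (given root bit $0$) of the root bit based on the tree and these observations is $\mathcal{Q}^h\mu_r$; noiseless observation corresponds to $\mu_r=B_0$. Degradation: for LLR distributions $\mu_Y,\mu_Z$ with complements $\mu_Y^-,\mu_Z^-$, $\mu_Y\preceq\mu_Z$ means that there is a Markov kernel $K$ on $[-\infty,+\infty]$ which maps $\mu_Z$ to $\mu_Y$ and maps $\mu_Z^-$ to $\mu_Y^-$ (i.e.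 $\mu_Y=\int K(z,\cdot)d\mu_Z(z)$ and $\mu_Y^-=\int K(z,\cdot)d\mu_Z^-(z)$). *)

theory Defs
  imports "HOL-Probability.Probability" "HOL-Real_Asymp.Real_Asymp"
begin

(* Distributions on (-\<infinity>,+\<infinity>] and on [-\<infinity>,+\<infinity>) are both represented as Borel probability measures
   on ereal that do not charge the excluded endpoint. *)

definition dist_above_MInf :: "ereal measure \<Rightarrow> bool" where
  "dist_above_MInf \<mu> \<longleftrightarrow> prob_space \<mu> \<and> sets \<mu> = sets borel \<and> emeasure \<mu> {-\<infinity>} = 0"

definition exp_neg :: "ereal \<Rightarrow> ennreal" where
  "exp_neg x = (case x of ereal r \<Rightarrow> ennreal (exp (- r)) | PInfty \<Rightarrow> 0 | MInfty \<Rightarrow> \<infinity>)"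

definition llr_distribution :: "ereal measure \<Rightarrow> bool" where
  "llr_distribution \<mu> \<longleftrightarrow> dist_above_MInf \<mu> \<and> (\<integral>\<^sup>+ r. exp_neg r \<partial>\<mu>) \<le> 1"

(* The mass missing from the density exp (-r) with respect to \<mu> sits at -\<infinity>. The characterization
   and the uniqueness of the complement are lemmas complement_LLR and complement_unique. *)
definition complement :: "ereal measure \<Rightarrow> ereal measure" where
  "complement \<mu> = measure_of UNIV (sets borel)
     (\<lambda>E. (\<integral>\<^sup>+ r. exp_neg r * indicator E r \<partial>\<mu>)
          + (1 - (\<integral>\<^sup>+ r. exp_neg r \<partial>\<mu>)) * indicator E (-\<infinity>))"

abbreviation trivial_dist :: "ereal measure" where
  "trivial_dist \<equiv> return borel 0"

abbreviation noiseless_dist :: "ereal measure" where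
  "noiseless_dist \<equiv> return borel \<infinity>"

(* The test functions are the bounded continuous ones on the space (-\<infinity>,+\<infinity>]; they need not extend
   continuously to -\<infinity>. *)
definition llr_weakly_converges :: "(nat \<Rightarrow> ereal measure) \<Rightarrow> ereal measure \<Rightarrow> bool" where
  "llr_weakly_converges M \<mu> \<longleftrightarrow>
     (\<forall>h. dist_above_MInf (M h)) \<and> dist_above_MInf \<mu> \<and>
     (\<forall>f :: ereal \<Rightarrow> real. continuous_on {-\<infinity><..} f \<longrightarrow> bounded (f ` {-\<infinity><..}) \<longrightarrow>
        (\<lambda>h. LINT r:{-\<infinity><..}|M h. f r) \<longlonglongrightarrow> (LINT r:{-\<infinity><..}|\<mu>. f r))"

definition degraded :: "ereal measure \<Rightarrow> ereal measure \<Rightarrow> bool" (infix \<open>\<preceq>\<^sub>L\<close> 50) where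
  "\<mu>Y \<preceq>\<^sub>L \<mu>Z \<longleftrightarrow> (\<exists>K \<in> borel \<rightarrow>\<^sub>M prob_algebra borel.
     \<mu>Y = \<mu>Z \<bind> K \<and> complement \<mu>Y = complement \<mu>Z \<bind> K)"

definition mixture :: "real \<Rightarrow> ereal measure \<Rightarrow> ereal measure \<Rightarrow> ereal measure" where
  "mixture p M N = measure_of UNIV (sets borel)
     (\<lambda>E. ennreal (1 - p) * emeasure M E + ennreal p * emeasure N E)"

(* The values at the infinite points are those of the continuous extension, see
   continuous_on_bp_edge. *)
definition bp_edge :: "real \<Rightarrow> ereal \<Rightarrow> ereal" where
  "bp_edge \<delta> x = (case x of
       ereal r \<Rightarrow> ereal (ln (((1 - \<delta>) * exp r + \<delta>) / (\<delta> * exp r + (1 - \<delta>))))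
     | PInfty \<Rightarrow> (if \<delta> = 0 then \<infinity> else if \<delta> = 1 then -\<infinity> else ereal (ln ((1 - \<delta>) / \<delta>)))
     | MInfty \<Rightarrow> (if \<delta> = 0 then -\<infinity> else if \<delta> = 1 then \<infinity> else ereal (ln (\<delta> / (1 - \<delta>)))))"

(* For an LLR distribution \<mu> the summands almost surely differ from -\<infinity>, so that the convention
   \<infinity> + (-\<infinity>) = \<infinity> of ereal plays no role. *)
definition bp_op :: "nat pmf \<Rightarrow> real \<Rightarrow> ereal measure \<Rightarrow> ereal measure" where
  "bp_op P \<delta> \<mu> =
     distr (measure_pmf P \<Otimes>\<^sub>M (\<Pi>\<^sub>M u\<in>(UNIV :: nat set). mixture \<delta> \<mu> (complement \<mu>))) borel
       (\<lambda>(d, r). \<Sum>u<d. bp_edge \<delta> (r u))"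

definition bp_fixed_point :: "nat pmf \<Rightarrow> real \<Rightarrow> ereal measure \<Rightarrow> bool" where
  "bp_fixed_point P \<delta> \<mu> \<longleftrightarrow> llr_distribution \<mu> \<and> bp_op P \<delta> \<mu> = \<mu>"

definition dominant_bp_fixed_point :: "nat pmf \<Rightarrow> real \<Rightarrow> ereal measure \<Rightarrow> bool" where
  "dominant_bp_fixed_point P \<delta> \<mu> \<longleftrightarrow> bp_fixed_point P \<delta> \<mu> \<and>
     (\<forall>\<nu>. bp_fixed_point P \<delta> \<nu> \<and> \<nu> \<noteq> \<mu> \<longrightarrow> \<nu> \<preceq>\<^sub>L \<mu>)"

lemma exp_neg_simps [simp]:
  "exp_neg (ereal r) = ennreal (exp (- r))" "exp_neg \<infinity> = 0" "exp_neg (-\<infinity>) = \<infinity>"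
  by (simp_all add: exp_neg_def)

lemma measurable_exp_neg [measurable]: "exp_neg \<in> borel_measurable borel"
proof -
  have "exp_neg = (\<lambda>x. if x = \<infinity> then 0 else if x = -\<infinity> then \<infinity> else ennreal (exp (- real_of_ereal x)))"
  proof
    fix x show "exp_neg x = (if x = \<infinity> then 0 else if x = -\<infinity> then \<infinity> else ennreal (exp (- real_of_ereal x)))"
      by (cases x) auto
  qed
  also have "\<dots> \<in> borel_measurable borel" by measurable
  finally show ?thesis .
qed

lemma sets_complement [simp, measurable_cong]: "sets (complement \<mu>) = sets borel"
  using sets.sigma_sets_eq[of "borel :: ereal measure"] by (simp add: complement_def)

lemma space_complement [simp]: "space (complement \<mu>) = UNIV"
  by (simp add: complement_def)

lemma emeasure_complement:
  assumes "sets \<mu> = sets borel" and "E \<in> sets borel"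
  shows "emeasure (complement \<mu>) E = (\<integral>\<^sup>+ r. exp_neg r * indicator E r \<partial>\<mu>)
           + (1 - (\<integral>\<^sup>+ r. exp_neg r \<partial>\<mu>)) * indicator E (-\<infinity>)"
proof (rule emeasure_measure_of[OF complement_def])
  note [measurable_cong] = assms(1)
  show "countably_additive (sets (complement \<mu>)) (\<lambda>E. (\<integral>\<^sup>+ r. exp_neg r * indicator E r \<partial>\<mu>)
          + (1 - (\<integral>\<^sup>+ r. exp_neg r \<partial>\<mu>)) * indicator E (-\<infinity>))"
  proof (rule countably_additiveI)
    fix A :: "nat \<Rightarrow> ereal set"
    assume A: "range A \<subseteq> sets (complement \<mu>)" and disj: "disjoint_family A"
    then have [measurable]: "\<And>i. A i \<in> sets borel" by auto
    have "(\<Sum>i. \<integral>\<^sup>+ r. exp_neg r * indicator (A i) r \<partial>\<mu>)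
          = (\<integral>\<^sup>+ r. (\<Sum>i. exp_neg r * indicator (A i) r) \<partial>\<mu>)"
      by (rule nn_integral_suminf[symmetric]) measurable
    also have "\<dots> = (\<integral>\<^sup>+ r. exp_neg r * indicator (\<Union>(range A)) r \<partial>\<mu>)"
      by (simp add: suminf_indicator[OF disj])
    finally show "(\<Sum>i. (\<integral>\<^sup>+ r. exp_neg r * indicator (A i) r \<partial>\<mu>)
          + (1 - (\<integral>\<^sup>+ r. exp_neg r \<partial>\<mu>)) * indicator (A i) (-\<infinity>))
        = (\<integral>\<^sup>+ r. exp_neg r * indicator (\<Union>(range A)) r \<partial>\<mu>)
          + (1 - (\<integral>\<^sup>+ r. exp_neg r \<partial>\<mu>)) * indicator (\<Union>(range A)) (-\<infinity>)"
      by (simp add: suminf_add[symmetric] suminf_indicator[OF disj])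
  qed
qed (use assms in \<open>auto simp: positive_def\<close>)

lemma complement_LLR:
  assumes "llr_distribution \<mu>"
  shows "prob_space (complement \<mu>)"
    and "emeasure (complement \<mu>) {\<infinity>} = 0"
    and "\<And>E. E \<in> sets borel \<Longrightarrow> E \<subseteq> {-\<infinity><..<\<infinity>} \<Longrightarrow>
           emeasure (complement \<mu>) E = (\<integral>\<^sup>+ r. exp_neg r * indicator E r \<partial>\<mu>)"
proof -
  have s: "sets \<mu> = sets borel" and le: "(\<integral>\<^sup>+ r. exp_neg r \<partial>\<mu>) \<le> 1"
    using assms by (auto simp: llr_distribution_def dist_above_MInf_def)
  show "prob_space (complement \<mu>)"
    using le by (intro prob_spaceI) (simp add: emeasure_complement[OF s] add_diff_inverse_ennreal)
  have "(\<integral>\<^sup>+ r. exp_neg r * indicator {\<infinity>} r \<partial>\<mu>) = (\<integral>\<^sup>+ r. 0 \<partial>\<mu>)"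
    by (intro nn_integral_cong) (auto simp: indicator_def)
  then show "emeasure (complement \<mu>) {\<infinity>} = 0"
    by (simp add: emeasure_complement[OF s])
  fix E :: "ereal set" assume E: "E \<in> sets borel" and "E \<subseteq> {-\<infinity><..<\<infinity>}"
  then have "-\<infinity> \<notin> E" by auto
  with E show "emeasure (complement \<mu>) E = (\<integral>\<^sup>+ r. exp_neg r * indicator E r \<partial>\<mu>)"
    by (simp add: emeasure_complement[OF s])
qed

lemma complement_unique:
  assumes "llr_distribution \<mu>"
    and "prob_space \<nu>" and s: "sets \<nu> = sets borel" and top: "emeasure \<nu> {\<infinity>} = 0"
    and eq: "\<And>E. E \<in> sets borel \<Longrightarrow> E \<subseteq> {-\<infinity><..<\<infinity>} \<Longrightarrow>
           emeasure \<nu> E = (\<integral>\<^sup>+ r. exp_neg r * indicator E r \<partial>\<mu>)"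
  shows "\<nu> = complement \<mu>"
proof (rule measure_eqI)
  let ?c = "complement \<mu>" and ?R = "{-\<infinity><..<\<infinity>} :: ereal set"
  note c = complement_LLR[OF assms(1)]
  interpret N: prob_space \<nu> by fact
  interpret C: prob_space ?c by (fact c(1))
  have sp: "space \<nu> = UNIV" using sets_eq_imp_space_eq[OF s] by simp
  have split: "emeasure M E = emeasure M (E \<inter> ?R) + emeasure M {-\<infinity>} * indicator E (-\<infinity>)"
    if M: "sets M = sets borel" "emeasure M {\<infinity>} = 0" and E: "E \<in> sets borel"
    for M :: "ereal measure" and E
  proof -
    have "E = (E \<inter> ?R) \<union> ((E \<inter> {-\<infinity>}) \<union> (E \<inter> {\<infinity>}))"
      by (auto simp: less_top[symmetric] top_ereal_def)
    then have "emeasure M E = emeasure M ((E \<inter> ?R) \<union> ((E \<inter> {-\<infinity>}) \<union> (E \<inter> {\<infinity>})))" by simp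
    also have "\<dots> = emeasure M (E \<inter> ?R) + emeasure M ((E \<inter> {-\<infinity>}) \<union> (E \<inter> {\<infinity>}))"
      using M(1) E by (intro plus_emeasure[symmetric]) auto
    also have "emeasure M ((E \<inter> {-\<infinity>}) \<union> (E \<inter> {\<infinity>})) = emeasure M (E \<inter> {-\<infinity>}) + emeasure M (E \<inter> {\<infinity>})"
      using M(1) E by (intro plus_emeasure[symmetric]) auto
    also have "emeasure M (E \<inter> {\<infinity>}) = 0"
      using M E emeasure_mono[of "E \<inter> {\<infinity>}" "{\<infinity>}" M] by auto
    also have "emeasure M (E \<inter> {-\<infinity>}) = emeasure M {-\<infinity>} * indicator E (-\<infinity>)"
      by (cases "-\<infinity> \<in> E") auto
    finally show ?thesis by simp
  qed
  have R: "emeasure \<nu> (E \<inter> ?R) = emeasure ?c (E \<inter> ?R)" if "E \<in> sets borel" for E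
    using that by (simp add: eq c(3))
  have "emeasure \<nu> UNIV = emeasure ?c UNIV"
    using N.emeasure_space_1 C.emeasure_space_1 sp by simp
  then have "emeasure \<nu> {-\<infinity>} = emeasure ?c {-\<infinity>}"
    using split[OF s top, of UNIV] split[OF sets_complement c(2), of UNIV] R[of UNIV]
      N.emeasure_finite C.emeasure_finite
    by (auto simp: ennreal_add_left_cancel)
  then show "emeasure \<nu> E = emeasure ?c E" if "E \<in> sets \<nu>" for E
    using that s split[OF s top, of E] split[OF sets_complement c(2), of E] R[of E] by simp
qed (simp add: s)

lemma sets_mixture [simp, measurable_cong]: "sets (mixture p M N) = sets borel"
  using sets.sigma_sets_eq[of "borel :: ereal measure"] by (simp add: mixture_def)

lemma emeasure_mixture:
  assumes "sets M = sets borel" "sets N = sets borel" and "E \<in> sets borel"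
  shows "emeasure (mixture p M N) E = ennreal (1 - p) * emeasure M E + ennreal p * emeasure N E"
proof (rule emeasure_measure_of[OF mixture_def])
  show "countably_additive (sets (mixture p M N))
          (\<lambda>E. ennreal (1 - p) * emeasure M E + ennreal p * emeasure N E)"
  proof (rule countably_additiveI)
    fix A :: "nat \<Rightarrow> ereal set"
    assume "range A \<subseteq> sets (mixture p M N)" and "disjoint_family A"
    then show "(\<Sum>i. ennreal (1 - p) * emeasure M (A i) + ennreal p * emeasure N (A i))
        = ennreal (1 - p) * emeasure M (\<Union>(range A)) + ennreal p * emeasure N (\<Union>(range A))"
      using assms(1,2) by (simp add: suminf_add[symmetric] suminf_emeasure)
  qed
qed (use assms in \<open>auto simp: positive_def\<close>)

lemma continuous_on_bp_edge:
  assumes "0 \<le> \<delta>" "\<delta> \<le> 1"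
  shows "continuous_on UNIV (bp_edge \<delta>)"
proof -
  consider "\<delta> = 0" | "\<delta> = 1" | "0 < \<delta>" "\<delta> < 1" using assms by linarith
  then show ?thesis
  proof cases
    case 1
    have "bp_edge 0 x = x" for x by (cases x) (auto simp: bp_edge_def)
    with 1 show ?thesis by (simp add: continuous_on_id)
  next
    case 2
    have "bp_edge 1 x = - x" for x by (cases x) (auto simp: bp_edge_def ln_div)
    with 2 show ?thesis by (simp add: continuous_on_eq_continuous_at isCont_def)
  next
    case 3
    define g where "g r = ln (((1 - \<delta>) * exp r + \<delta>) / (\<delta> * exp r + (1 - \<delta>)))" for r
    have fin: "bp_edge \<delta> (ereal r) = ereal (g r)" for r by (simp add: bp_edge_def g_def)
    have top: "bp_edge \<delta> \<infinity> = ereal (ln ((1 - \<delta>) / \<delta>))"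
      and bot: "bp_edge \<delta> (-\<infinity>) = ereal (ln (\<delta> / (1 - \<delta>)))" using 3 by (auto simp: bp_edge_def)
    have at_PInf: "at (\<infinity>::ereal) = filtermap ereal at_top"
    proof -
      have "UNIV - {\<infinity>} = {..<\<infinity>::ereal} - {\<infinity>}" by auto
      then show ?thesis unfolding at_left_PInf[symmetric] at_within_def by simp
    qed
    have at_MInf: "at (-\<infinity>::ereal) = filtermap ereal at_bot"
    proof -
      have "UNIV - {-\<infinity>} = {-\<infinity><..} - {-\<infinity>::ereal}" by auto
      then show ?thesis unfolding at_right_MInf[symmetric] at_within_def by simp
    qed
    have "(bp_edge \<delta> \<longlongrightarrow> bp_edge \<delta> x) (at x)" for x
    proof (cases x)
      case (real r)
      have "0 < (1 - \<delta>) * exp r + \<delta>" "0 < \<delta> * exp r + (1 - \<delta>)"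
        using 3 by (auto intro!: add_pos_pos)
      then have "isCont g r" unfolding g_def by (intro continuous_intros) auto
      then show ?thesis unfolding real at_ereal by (simp add: filterlim_filtermap fin isCont_def)
    next
      case PInf
      have "(g \<longlongrightarrow> ln ((1 - \<delta>) * inverse \<delta>)) at_top" unfolding g_def using 3 by real_asymp
      then have "(g \<longlongrightarrow> ln ((1 - \<delta>) / \<delta>)) at_top" by (simp add: divide_inverse)
      then show ?thesis unfolding PInf top at_PInf by (simp add: filterlim_filtermap fin)
    next
      case MInf
      have "(g \<longlongrightarrow> ln (\<delta> * inverse (1 - \<delta>))) at_bot" unfolding g_def using 3 by real_asymp
      then have "(g \<longlongrightarrow> ln (\<delta> / (1 - \<delta>))) at_bot" by (simp add: divide_inverse)
      then show ?thesis unfolding MInf bot at_MInf by (simp add: filterlim_filtermap fin)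
    qed
    then show ?thesis by (simp add: continuous_on_eq_continuous_at isCont_def)
  qed
qed

lemma measurable_bp_sum:
  assumes "0 \<le> \<delta>" "\<delta> \<le> 1"
  shows "(\<lambda>(d, r). \<Sum>u<d. bp_edge \<delta> (r u)) \<in>
    borel_measurable (measure_pmf P \<Otimes>\<^sub>M (\<Pi>\<^sub>M u\<in>(UNIV :: nat set). mixture \<delta> \<mu> (complement \<mu>)))"
proof -
  have [measurable]: "bp_edge \<delta> \<in> borel_measurable borel"
    using assms by (intro borel_measurable_continuous_onI continuous_on_bp_edge)
  show ?thesis
    unfolding case_prod_beta'
    by (rule measurable_compose_countable[where g = fst]) measurable
qed

end

theory Submission
  imports Defs
begin

text \<open>Write a log-likelihood ratio as \<open>r = ln ((1 + x) / (1 - x))\<close> with a bias \<open>x \<in> [-1, 1]\<close>. An LLR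
  distribution is then \<open>(1 + x) dA(x)\<close> for a unique centred law \<open>A\<close> of biases, its complement is
  \<open>(1 - x) dA(x)\<close>, an edge multiplies biases by \<open>l = 1 - 2 \<delta>\<close>, and independent observations are combined
  by the addition \<open>(a + b) / (1 + a b)\<close> of biases, which gives an operation \<open>\<star>\<close> on laws. The law
  \<open>A\<close> is determined by the convex functional
  \<open>(p, q) \<mapsto> \<integral> \<bar>p + q x\<bar> dA(x)\<close>; pointwise comparison of these functionals is an order which the
  recursion \<open>T\<close> preserves, and pointwise convergence is weak convergence.

  The iterates of the noiseless law decrease to a fixed law \<open>A\<close>. If \<open>A\<close> is trivial, every other law is
  squeezed to it. Otherwise every nontrivial law dominates a scaled noiseless law and hence has iterates
  above those of some \<open>c A\<close> with \<open>0 < c \<le> 1\<close>. The stringy tree inequality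
  \<open>c (A \<star> B) \<sqsubseteq> c A \<star> c B\<close> makes the iterates of \<open>c A\<close> increase to a fixed law \<open>B\<close> with
  \<open>c A \<sqsubseteq> B \<sqsubseteq> A\<close>, and \<open>B = A\<close>: for \<open>0 < \<bar>l\<bar> < 1\<close> one takes \<open>c\<close> maximal with \<open>c A \<sqsubseteq> B\<close>; if \<open>c < 1\<close>,
  the two functionals touch at some point, where the stringy tree inequality is strict. For
  \<open>\<bar>l\<bar> = 1\<close> Hellinger type integrals are multiplicative under \<open>\<star>\<close>, and at a fixed law they are fixed points of
  the generating function of the degree, which forces fixed laws to live on \<open>{-1, 0, 1}\<close>.

  The order by functionals is weaker on its face than degradation. Degradation of a fixed law \<open>C\<close> from \<open>A\<close> comes from
  couplings \<open>(x, y)\<close> with \<open>E (x | y) = y\<close>: one exists between the noiseless law and \<open>C\<close>, the recursion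
  carries it to all iterates, it survives the limit, and its disintegration is the Markov kernel.\<close>

section \<open>Bias laws\<close>

text \<open>Blackwell's theorem would turn the order by functionals into degradation. It is avoided:
  only fixed laws have to be degraded from \<open>A\<close>, and from the noiseless law there is an
  explicit coupling, with density \<open>1 + x y\<close>. Its passage to the limit needs compactness
  for laws on the square. A Borel code of the square by the line, undone by a continuous curve,
  reduces this to weak compactness on the line. The uniqueness argument is shaped by where the
  functionals of \<open>c A\<close> and \<open>B\<close> can touch. By homogeneity and symmetry only
  the ratio \<open>t = |p| / |q|\<close> matters. If all biases under a scaled \<open>A\<close> are
  at most \<open>t\<close> in absolute value, its functional has the trivial value \<open>t\<close>;
  hence the witnesses against slightly larger \<open>c\<close> lie in a bounded range of ratios and
  accumulate. At \<open>t = 0\<close> the inequality for a single \<star> is an equality, so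
  strictness is gained at \<open>t > 0\<close> only. Touching at \<open>t = 0\<close> is therefore
  carried through one step of the recursion to the ratio \<open>c s\<close>, where \<open>s\<close>
  is the essential supremum of \<open>|x|\<close> under \<open>A\<close> and strictness
  applies.\<close>

definition bias_law :: "real measure \<Rightarrow> bool" where
  "bias_law A \<longleftrightarrow> prob_space A \<and> sets A = sets borel \<and> (AE x in A. \<bar>x\<bar> \<le> 1) \<and> (\<integral>x. x \<partial>A) = 0"

text \<open>The \<open>L\<^sup>1\<close> distance between the multiples \<open>(p + q)/2\<close> of \<open>(1 + x) dA\<close> and \<open>(q - p)/2\<close> of
  \<open>(1 - x) dA\<close>.\<close>

definition spread :: "real measure \<Rightarrow> real \<Rightarrow> real \<Rightarrow> real" where
  "spread A p q = (\<integral>x. \<bar>p + q * x\<bar> \<partial>A)"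

definition bias_add :: "real \<Rightarrow> real \<Rightarrow> real" (infixl \<open>\<boxplus>\<close> 65) where
  "a \<boxplus> b = (a + b) / (1 + a * b)"

definition scale :: "real \<Rightarrow> real measure \<Rightarrow> real measure" where
  "scale c A = distr A borel (\<lambda>x. c * x)"

text \<open>Given the root bit, the two observations are independent; averaging over the bit leaves the joint
  density \<open>1 + a b\<close> of the biases. If \<open>1 + a b = 0\<close>, the density vanishes and the junk value of \<open>a \<boxplus> b\<close> is harmless.\<close>

definition star :: "real measure \<Rightarrow> real measure \<Rightarrow> real measure" where
  "star A B = distr (density (A \<Otimes>\<^sub>M B) (\<lambda>(a, b). ennreal (1 + a * b))) borel (\<lambda>(a, b). a \<boxplus> b)"

section \<open>Elementary estimates for bias laws and their spreads\<close>

lemma measurable_bias_add [measurable (raw)]: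
  assumes "f \<in> borel_measurable M" "g \<in> borel_measurable M"
  shows "(\<lambda>x. f x \<boxplus> g x) \<in> borel_measurable M"
  using assms unfolding bias_add_def by measurable

lemma bias_lawD:
  assumes "bias_law A"
  shows "prob_space A" "sets A = sets borel" "AE x in A. \<bar>x\<bar> \<le> 1" "(\<integral>x. x \<partial>A) = 0"
  using assms by (auto simp: bias_law_def)

lemma bias_law_integrable:
  assumes A: "bias_law A" and f: "f \<in> borel_measurable borel"
    and bound: "\<And>x. \<bar>x\<bar> \<le> 1 \<Longrightarrow> \<bar>f x\<bar> \<le> C"
  shows "integrable A (f :: real \<Rightarrow> real)"
proof -
  interpret prob_space A using A by (simp add: bias_law_def)
  note [measurable_cong] = bias_lawD(2)[OF A]
  note [measurable] = f
  show ?thesis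
    using bias_lawD(3)[OF A] by (intro integrable_const_bound[where B = C]) (auto elim!: eventually_mono dest: bound)
qed

lemma bias_law_integral_affine:
  assumes "bias_law A"
  shows "(\<integral>x. p + q * x \<partial>A) = p"
proof -
  interpret prob_space A using assms by (simp add: bias_law_def)
  have "integrable A (\<lambda>x. x)" by (rule bias_law_integrable[OF assms, of _ 1]) auto
  then show ?thesis using bias_lawD(4)[OF assms] by (simp add: prob_space)
qed

lemma integrable_spread: "bias_law A \<Longrightarrow> integrable A (\<lambda>x. \<bar>p + q * x\<bar>)"
proof (rule bias_law_integrable[where C = "\<bar>p\<bar> + \<bar>q\<bar>"])
  fix x :: real assume "\<bar>x\<bar> \<le> 1"
  then have "\<bar>q * x\<bar> \<le> \<bar>q\<bar>" by (simp add: abs_mult mult_left_le)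
  then show "\<bar>\<bar>p + q * x\<bar>\<bar> \<le> \<bar>p\<bar> + \<bar>q\<bar>" by linarith
qed auto

lemma integral_mono_bias_law:
  assumes A: "bias_law A" and f: "f \<in> borel_measurable borel" and g: "g \<in> borel_measurable borel"
    and "\<And>x. \<bar>x\<bar> \<le> 1 \<Longrightarrow> \<bar>f x\<bar> \<le> C" "\<And>x. \<bar>x\<bar> \<le> 1 \<Longrightarrow> \<bar>g x\<bar> \<le> C"
    and "\<And>x. \<bar>x\<bar> \<le> 1 \<Longrightarrow> f x \<le> g x"
  shows "(\<integral>x. f x \<partial>A) \<le> (\<integral>x. (g x :: real) \<partial>A)"
  using bias_lawD(3)[OF A] assms
  by (intro integral_mono_AE bias_law_integrable[OF A]) (auto elim!: eventually_mono)

lemma spread_le: "bias_law A \<Longrightarrow> spread A p q \<le> \<bar>p\<bar> + \<bar>q\<bar>"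
proof -
  assume A: "bias_law A"
  interpret prob_space A using A by (simp add: bias_law_def)
  have b: "\<bar>p + q * x\<bar> \<le> \<bar>p\<bar> + \<bar>q\<bar>" if "\<bar>x\<bar> \<le> 1" for x :: real
  proof -
    have "\<bar>q * x\<bar> \<le> \<bar>q\<bar>" using that by (simp add: abs_mult mult_left_le)
    then show ?thesis by linarith
  qed
  have "spread A p q \<le> (\<integral>x. \<bar>p\<bar> + \<bar>q\<bar> \<partial>A)"
    unfolding spread_def
    by (rule integral_mono_bias_law[OF A, where C = "\<bar>p\<bar> + \<bar>q\<bar>"]) (auto intro: b)
  then show ?thesis by (simp add: prob_space)
qed

lemma spread_ge: "bias_law A \<Longrightarrow> \<bar>p\<bar> \<le> spread A p q"
  using bias_law_integral_affine[of A p q] integral_abs_bound[of A "\<lambda>x. p + q * x"]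
  by (simp add: spread_def)

lemma spread_nonneg: "0 \<le> spread A p q"
  by (simp add: spread_def)

lemma spread_cmult: "spread A (c * p) (c * q) = \<bar>c\<bar> * spread A p q"
proof -
  have "\<bar>c * p + c * q * x\<bar> = \<bar>c\<bar> * \<bar>p + q * x\<bar>" for x
    by (simp add: abs_mult[symmetric] algebra_simps)
  then show ?thesis by (simp add: spread_def)
qed

lemma spread_minus: "spread A (- p) (- q) = spread A p q"
  using spread_cmult[of A "-1" p q] by simp

lemma spread_0_right: "bias_law A \<Longrightarrow> spread A p 0 = \<bar>p\<bar>"
  using prob_space.prob_space[of A] by (simp add: spread_def bias_law_def)

text \<open>The triangle inequality for the integrand, with the error bounded by
  \<open>spread_le\<close>. The constant is the same for all laws, which makes finite nets
  sufficient in the limit arguments.\<close>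

lemma spread_lipschitz:
  assumes A: "bias_law A"
  shows "\<bar>spread A p q - spread A p' q'\<bar> \<le> \<bar>p - p'\<bar> + \<bar>q - q'\<bar>"
proof -
  have "spread A p q \<le> spread A p' q' + (\<bar>p - p'\<bar> + \<bar>q - q'\<bar>)" for p q p' q'
  proof -
    have i: "integrable A (\<lambda>x. \<bar>p + q * x\<bar>)" for p q by (rule integrable_spread[OF A])
    have "spread A p q \<le> (\<integral>x. \<bar>p' + q' * x\<bar> + \<bar>(p - p') + (q - q') * x\<bar> \<partial>A)"
      unfolding spread_def by (intro integral_mono Bochner_Integration.integrable_add i) (auto simp: algebra_simps)
    also have "\<dots> = spread A p' q' + spread A (p - p') (q - q')"
      unfolding spread_def by (intro Bochner_Integration.integral_add i)
    finally show ?thesis using spread_le[OF A, of "p - p'" "q - q'"] by linarith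
  qed
  from this[of p q p' q'] this[of p' q' p q] show ?thesis by (simp add: abs_le_iff abs_minus_commute)
qed

lemma continuous_on_spread:
  assumes A: "bias_law A" and f: "continuous_on S f" and g: "continuous_on S g"
  shows "continuous_on S (\<lambda>x. spread A (f x) (g x))"
proof -
  have "continuous_on UNIV (\<lambda>z. spread A (fst z) (snd z))"
  proof (rule lipschitz_on_continuous_on[of 2])
    show "2-lipschitz_on UNIV (\<lambda>z. spread A (fst z) (snd z))"
    proof (rule lipschitz_onI)
      fix x y :: "real \<times> real"
      have "dist (spread A (fst x) (snd x)) (spread A (fst y) (snd y)) \<le> dist (fst x) (fst y) + dist (snd x) (snd y)"
        using spread_lipschitz[OF A, of "fst x" "snd x" "fst y" "snd y"] by (simp add: dist_real_def)
      also have "\<dots> \<le> 2 * dist x y" using dist_fst_le[of x y] dist_snd_le[of x y] by simp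
      finally show "dist (spread A (fst x) (snd x)) (spread A (fst y) (snd y)) \<le> 2 * dist x y" .
    qed simp
  qed
  then show ?thesis
    using continuous_on_compose2[of UNIV "\<lambda>z. spread A (fst z) (snd z)" S "\<lambda>x. (f x, g x)"]
      continuous_on_Pair[OF f g] by simp
qed

lemma measurable_spread [measurable (raw)]:
  assumes "bias_law A" and [measurable]: "f \<in> borel_measurable M" "g \<in> borel_measurable M"
  shows "(\<lambda>x. spread A (f x) (g x)) \<in> borel_measurable M"
proof -
  have "(\<lambda>z. spread A (fst z) (snd z)) \<in> borel_measurable (borel :: (real \<times> real) measure)"
    by (intro borel_measurable_continuous_onI continuous_on_spread[OF assms(1)] continuous_intros)
  then have "(\<lambda>z. spread A (fst z) (snd z)) \<in> borel_measurable (borel \<Otimes>\<^sub>M borel)"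
    by (simp add: borel_prod)
  from measurable_compose[OF _ this, of "\<lambda>x. (f x, g x)"] show ?thesis by simp
qed

lemma bias_law_real_distribution: "bias_law A \<Longrightarrow> real_distribution A"
  by (auto simp: bias_law_def real_distribution_def real_distribution_axioms_def dest: sets_eq_imp_space_eq)

text \<open>When \<open>p\<close> is lowered from \<open>-t\<close> by a small \<open>h\<close>, the
  change of \<open>|p + x|\<close> divided by \<open>h\<close> tends to 1 for
  \<open>x \<le> t\<close> and to -1 for \<open>x > t\<close>. A one-sided derivative of the spread
  is thus \<open>2 * cdf A t - 1\<close>, and the cdf determines the law.\<close>

lemma bias_law_eqI:
  assumes A: "bias_law A" and B: "bias_law B" and eq: "\<And>p q. spread A p q = spread B p q"
  shows "A = B"
proof (rule cdf_unique)
  show "real_distribution A" "real_distribution B"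
    using A B by (simp_all add: bias_law_real_distribution)
  have lim: "(\<lambda>n. (spread A (-t - inverse (real (Suc n))) 1 - spread A (-t) 1) / inverse (real (Suc n)))
        \<longlonglongrightarrow> 2 * cdf A t - 1" if A: "bias_law A" for A t
  proof -
    interpret prob_space A using A by (simp add: bias_law_def)
    note [measurable_cong] = bias_lawD(2)[OF A]
    have sp[simp]: "space A = UNIV" using bias_lawD(2)[OF A] sets_eq_imp_space_eq by force
    define g where "g n x = (\<bar>-t - inverse (real (Suc n)) + 1 * x\<bar> - \<bar>-t + 1 * x\<bar>) / inverse (real (Suc n))" for n and x :: real
    have "(\<lambda>n. \<integral>x. g n x \<partial>A) \<longlonglongrightarrow> (\<integral>x. 2 * indicator {..t} x - 1 \<partial>A)"
    proof (rule integral_dominated_convergence[where w = "\<lambda>_. 1"])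
      show "AE x in A. (\<lambda>n. g n x) \<longlonglongrightarrow> 2 * indicator {..t} x - 1"
      proof (rule AE_I2)
        fix x
        have "\<forall>\<^sub>F n in sequentially. g n x = 2 * indicator {..t} x - 1"
        proof (cases "x \<le> t")
          case True
          then have "\<bar>-t - inverse (real (Suc n)) + x\<bar> = t + inverse (real (Suc n)) - x" for n
            by (simp add: abs_if) (smt (verit) inverse_nonnegative_iff_nonnegative of_nat_0_le_iff)
          then show ?thesis using True by (simp add: g_def field_simps)
        next
          case False
          have "(\<lambda>n. inverse (real (Suc n))) \<longlonglongrightarrow> 0" by (rule LIMSEQ_inverse_real_of_nat)
          then have "\<forall>\<^sub>F n in sequentially. inverse (real (Suc n)) < x - t"
            using False by (intro order_tendstoD) auto
          then show ?thesis
          proof eventually_elim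
            case (elim n)
            then have "\<bar>-t - inverse (real (Suc n)) + 1 * x\<bar> = x - t - inverse (real (Suc n))"
              "\<bar>-t + 1 * x\<bar> = x - t" using False by simp_all
            then show ?case unfolding g_def using False by simp
          qed
        qed
        then show "(\<lambda>n. g n x) \<longlonglongrightarrow> 2 * indicator {..t} x - 1" by (rule tendsto_eventually)
      qed
      show "AE x in A. norm (g n x) \<le> 1" for n
      proof (rule AE_I2)
        fix x
        have "\<bar>\<bar>-t - inverse (real (Suc n)) + 1 * x\<bar> - \<bar>-t + 1 * x\<bar>\<bar> \<le> inverse (real (Suc n))"
          by (smt (verit) inverse_nonnegative_iff_nonnegative of_nat_0_le_iff)
        moreover have "\<bar>a / b\<bar> \<le> 1" if "\<bar>a\<bar> \<le> b" "0 < b" for a b :: real using that by (simp add: abs_divide)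
        ultimately show "norm (g n x) \<le> 1" unfolding g_def real_norm_def by (metis inverse_positive_iff_positive of_nat_0_less_iff zero_less_Suc)
      qed
    qed (auto simp: g_def)
    moreover have "(\<integral>x. g n x \<partial>A) = (spread A (-t - inverse (real (Suc n))) 1 - spread A (-t) 1) / inverse (real (Suc n))" for n
      unfolding g_def spread_def
      by (subst Bochner_Integration.integral_divide_zero,
          subst Bochner_Integration.integral_diff[OF integrable_spread[OF A] integrable_spread[OF A]]) (rule refl)
    moreover have "(\<integral>x. 2 * indicator {..t} x - 1 \<partial>A) = 2 * cdf A t - 1"
      using bias_law_integrable[OF A, of "indicator {..t}" 1] prob_space[unfolded sp]
      by (subst Bochner_Integration.integral_diff) (auto simp: cdf_def)
    ultimately show ?thesis by simp
  qed
  show "cdf A = cdf B"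
  proof
    fix t
    have "2 * cdf A t - 1 = 2 * cdf B t - 1"
      using LIMSEQ_unique[OF lim[OF A, of t]] lim[OF B, of t] eq by simp
    then show "cdf A t = cdf B t" by simp
  qed
qed

lemma bias_law_scale:
  assumes A: "bias_law A" and c: "\<bar>c\<bar> \<le> 1"
  shows "bias_law (scale c A)"
proof -
  interpret prob_space A using A by (simp add: bias_law_def)
  note [measurable_cong] = bias_lawD(2)[OF A]
  have "AE x in A. \<bar>c * x\<bar> \<le> 1"
    using bias_lawD(3)[OF A] by eventually_elim (use c in \<open>auto simp: abs_mult mult_le_one\<close>)
  moreover have "(\<integral>x. c * x \<partial>A) = 0" using bias_lawD(4)[OF A] by simp
  ultimately show ?thesis
    unfolding bias_law_def scale_def by (auto simp: prob_space_distr AE_distr_iff integral_distr)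
qed

lemma spread_scale: "bias_law A \<Longrightarrow> spread (scale c A) p q = spread A p (c * q)"
  unfolding spread_def scale_def
  by (subst integral_distr) (auto simp: bias_law_def ac_simps cong: measurable_cong_sets)

lemma scale_scale: "bias_law A \<Longrightarrow> scale c (scale d A) = scale (c * d) A"
  unfolding scale_def
  by (subst distr_distr) (auto simp: bias_law_def comp_def intro!: distr_cong cong: measurable_cong_sets)

subsection \<open>The star product\<close>

lemma pair_bias_law:
  assumes A: "bias_law A" and B: "bias_law B"
  shows "pair_prob_space A B" "sets (A \<Otimes>\<^sub>M B) = sets (borel \<Otimes>\<^sub>M borel)"
    "AE z in A \<Otimes>\<^sub>M B. \<bar>fst z\<bar> \<le> 1 \<and> \<bar>snd z\<bar> \<le> 1"
proof -
  interpret A: prob_space A using A by (simp add: bias_law_def)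
  interpret B: prob_space B using B by (simp add: bias_law_def)
  interpret pair_prob_space A B ..
  note [measurable_cong] = bias_lawD(2)[OF A] bias_lawD(2)[OF B]
  show "pair_prob_space A B" ..
  show "sets (A \<Otimes>\<^sub>M B) = sets (borel \<Otimes>\<^sub>M borel)"
    using bias_lawD(2)[OF A] bias_lawD(2)[OF B] by (rule sets_pair_measure_cong)
  show "AE z in A \<Otimes>\<^sub>M B. \<bar>fst z\<bar> \<le> 1 \<and> \<bar>snd z\<bar> \<le> 1"
    using bias_lawD(3)[OF A] bias_lawD(3)[OF B]
    by (intro AE_pair_measure) (auto elim!: eventually_mono)
qed

lemma pair_bias_law_integrable:
  assumes A: "bias_law A" and B: "bias_law B" and f: "f \<in> borel_measurable (borel \<Otimes>\<^sub>M borel)"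
    and bound: "\<And>a b. \<bar>a\<bar> \<le> 1 \<Longrightarrow> \<bar>b\<bar> \<le> 1 \<Longrightarrow> \<bar>f (a, b)\<bar> \<le> C"
  shows "integrable (A \<Otimes>\<^sub>M B) (f :: real \<times> real \<Rightarrow> real)"
proof -
  interpret pair_prob_space A B by (rule pair_bias_law(1)[OF A B])
  note [measurable_cong] = pair_bias_law(2)[OF A B]
  note [measurable] = f
  have "AE z in A \<Otimes>\<^sub>M B. norm (f z) \<le> C"
    using pair_bias_law(3)[OF A B] by eventually_elim (use bound in \<open>auto simp: split_paired_all\<close>)
  then show ?thesis by (intro P.integrable_const_bound[where B = C]) auto
qed

lemma one_add_mult_nonneg: "\<bar>a\<bar> \<le> 1 \<Longrightarrow> \<bar>b\<bar> \<le> 1 \<Longrightarrow> 0 \<le> 1 + a * (b :: real)"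
  using mult_mono[of "\<bar>a\<bar>" 1 "\<bar>b\<bar>" 1] by (simp add: abs_mult[symmetric] abs_le_iff)

text \<open>Biases with \<open>1 + a b = 0\<close> must be 1 and -1, so that \<open>a + b\<close>
  vanishes too; the identity survives the default value of the division.\<close>

lemma bias_add_cancel:
  assumes "\<bar>a\<bar> \<le> 1" "\<bar>b\<bar> \<le> 1"
  shows "(1 + a * b) * (a \<boxplus> b) = a + b"
proof (cases "1 + a * b = 0")
  case True
  then have ab: "a * b = -1" by simp
  have "\<bar>a\<bar> * \<bar>b\<bar> = 1" using ab by (simp flip: abs_mult)
  then have "\<bar>a\<bar> = 1" using assms by (metis abs_ge_zero antisym mult.right_neutral mult_left_mono)
  then have "a = 1 \<or> a = -1" by linarith
  then show ?thesis using ab True by (auto simp: bias_add_def)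
qed (simp add: bias_add_def)

lemma abs_bias_add_le_1:
  assumes "\<bar>a\<bar> \<le> 1" "\<bar>b\<bar> \<le> 1"
  shows "\<bar>a \<boxplus> b\<bar> \<le> 1"
proof -
  have "(1 - a) * (1 - b) \<ge> 0" "(1 + a) * (1 + b) \<ge> 0" using assms by (auto simp: abs_le_iff)
  then have "\<bar>a + b\<bar> \<le> 1 + a * b" by (simp add: algebra_simps abs_le_iff)
  then show ?thesis using one_add_mult_nonneg[OF assms] unfolding bias_add_def
    by (cases "1 + a * b = 0") (auto simp: abs_divide)
qed

lemma nn_integral_star:
  assumes A: "bias_law A" and B: "bias_law B" and f[measurable]: "f \<in> borel_measurable borel"
  shows "(\<integral>\<^sup>+x. f x \<partial>star A B) = (\<integral>\<^sup>+z. ennreal (1 + fst z * snd z) * f (fst z \<boxplus> snd z) \<partial>(A \<Otimes>\<^sub>M B))"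
proof -
  note [measurable_cong] = pair_bias_law(2)[OF A B]
  show ?thesis unfolding star_def
    by (subst nn_integral_distr) (auto simp: nn_integral_density case_prod_beta')
qed

lemma integral_star:
  assumes A: "bias_law A" and B: "bias_law B" and f[measurable]: "f \<in> borel_measurable borel"
  shows "(\<integral>x. f x \<partial>star A B) = (\<integral>z. (1 + fst z * snd z) * (f (fst z \<boxplus> snd z) :: real) \<partial>(A \<Otimes>\<^sub>M B))"
proof -
  note [measurable_cong] = pair_bias_law(2)[OF A B]
  have "AE z in A \<Otimes>\<^sub>M B. 0 \<le> 1 + fst z * snd z"
    using pair_bias_law(3)[OF A B] by eventually_elim (auto intro: one_add_mult_nonneg)
  then show ?thesis unfolding star_def case_prod_beta'
    by (subst integral_distr) (auto simp: integral_density)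
qed

lemma sets_star [simp]: "sets (star A B) = sets borel"
  by (simp add: star_def)

text \<open>Pairs with \<open>1 + a b = 0\<close> have density zero, so nothing has to be checked
  for them.\<close>

lemma AE_star:
  assumes A: "bias_law A" and B: "bias_law B" and [measurable]: "Measurable.pred borel Q"
    and AE: "AE z in A \<Otimes>\<^sub>M B. 1 + fst z * snd z \<noteq> 0 \<longrightarrow> Q (fst z \<boxplus> snd z)"
  shows "AE x in star A B. Q x"
proof -
  note [measurable_cong] = pair_bias_law(2)[OF A B]
  have "AE z in density (A \<Otimes>\<^sub>M B) (\<lambda>z. ennreal (1 + fst z * snd z)). Q (fst z \<boxplus> snd z)"
    using AE by (subst AE_density) (auto elim!: eventually_mono)
  then show ?thesis unfolding star_def case_prod_beta' by (subst AE_distr_iff) auto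
qed

text \<open>Independence and centring remove every term but the constant. Applied to
  \<open>1 + a b\<close> and to \<open>a + b\<close>, this gives total mass 1 and mean 0 for
  \<open>star A B\<close>.\<close>

lemma integral_mult_pair:
  assumes A: "bias_law A" and B: "bias_law B"
  shows "(\<integral>z. p + q * fst z + r * snd z + s * (fst z * snd z) \<partial>(A \<Otimes>\<^sub>M B)) = p"
proof -
  interpret pair_prob_space A B by (rule pair_bias_law(1)[OF A B])
  note [measurable_cong] = bias_lawD(2)[OF A] bias_lawD(2)[OF B]
  let ?f = "\<lambda>z. p + q * fst z + r * snd z + s * (fst z * snd z)"
  have i: "integrable (A \<Otimes>\<^sub>M B) ?f"
  proof (rule pair_bias_law_integrable[OF A B, where C = "\<bar>p\<bar> + \<bar>q\<bar> + \<bar>r\<bar> + \<bar>s\<bar>"])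
    fix a b :: real assume ab: "\<bar>a\<bar> \<le> 1" "\<bar>b\<bar> \<le> 1"
    have "\<bar>q * a\<bar> \<le> \<bar>q\<bar>" "\<bar>r * b\<bar> \<le> \<bar>r\<bar>" "\<bar>s * (a * b)\<bar> \<le> \<bar>s\<bar>"
      using ab by (auto simp: abs_mult mult_left_le mult_le_one)
    then show "\<bar>?f (a, b)\<bar> \<le> \<bar>p\<bar> + \<bar>q\<bar> + \<bar>r\<bar> + \<bar>s\<bar>" unfolding fst_conv snd_conv by linarith
  qed measurable
  have "(\<integral>z. ?f z \<partial>(A \<Otimes>\<^sub>M B)) = (\<integral>a. (\<integral>b. ?f (a, b) \<partial>B) \<partial>A)"
    by (rule integral_fst'[OF i, symmetric])
  also have "\<dots> = (\<integral>a. p + q * a \<partial>A)"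
  proof (rule Bochner_Integration.integral_cong[OF refl])
    fix a
    show "(\<integral>b. ?f (a, b) \<partial>B) = p + q * a"
      using bias_law_integral_affine[OF B, of "p + q * a" "r + s * a"] by (simp add: algebra_simps)
  qed
  also have "\<dots> = p" by (rule bias_law_integral_affine[OF A])
  finally show ?thesis .
qed

lemma bias_law_star:
  assumes A: "bias_law A" and B: "bias_law B"
  shows "bias_law (star A B)"
  unfolding bias_law_def
proof (intro conjI)
  interpret pair_prob_space A B by (rule pair_bias_law(1)[OF A B])
  note [measurable_cong] = pair_bias_law(2)[OF A B]
  have nn: "AE z in A \<Otimes>\<^sub>M B. 0 \<le> 1 + fst z * snd z"
    using pair_bias_law(3)[OF A B] by eventually_elim (auto intro: one_add_mult_nonneg)
  have i: "integrable (A \<Otimes>\<^sub>M B) (\<lambda>z. 1 + fst z * snd z)"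
    by (rule pair_bias_law_integrable[OF A B, of _ 2])
       (auto simp: abs_mult intro!: order_trans[OF abs_triangle_ineq] mult_le_one)
  have "(\<integral>\<^sup>+x. 1 \<partial>star A B) = ennreal (\<integral>z. 1 + fst z * snd z \<partial>(A \<Otimes>\<^sub>M B))"
    using nn_integral_star[OF A B, of "\<lambda>_. 1"] nn_integral_eq_integral[OF i nn] by simp
  also have "\<dots> = 1" using integral_mult_pair[OF A B, of 1 0 0 1] by simp
  finally show "prob_space (star A B)" by (intro prob_spaceI) simp
  show "sets (star A B) = sets borel" by simp
  have "AE z in A \<Otimes>\<^sub>M B. 1 + fst z * snd z \<noteq> 0 \<longrightarrow> \<bar>fst z \<boxplus> snd z\<bar> \<le> 1"
    using pair_bias_law(3)[OF A B] by eventually_elim (auto intro: abs_bias_add_le_1)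
  then show "AE x in star A B. \<bar>x\<bar> \<le> 1" by (intro AE_star[OF A B]) auto
  have "(\<integral>x. x \<partial>star A B) = (\<integral>z. (1 + fst z * snd z) * (fst z \<boxplus> snd z) \<partial>(A \<Otimes>\<^sub>M B))"
    by (rule integral_star[OF A B]) auto
  also have "\<dots> = (\<integral>z. 0 + 1 * fst z + 1 * snd z + 0 * (fst z * snd z) \<partial>(A \<Otimes>\<^sub>M B))"
  proof (intro integral_cong_AE)
    show "AE z in A \<Otimes>\<^sub>M B. (1 + fst z * snd z) * (fst z \<boxplus> snd z) = 0 + 1 * fst z + 1 * snd z + 0 * (fst z * snd z)"
      using pair_bias_law(3)[OF A B] by eventually_elim (simp add: bias_add_cancel)
  qed auto
  also have "\<dots> = 0" by (rule integral_mult_pair[OF A B])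
  finally show "(\<integral>x. x \<partial>star A B) = 0" .
qed

lemma spread_star_pair:
  assumes A: "bias_law A" and B: "bias_law B"
  shows "spread (star A B) p q = (\<integral>z. \<bar>p * (1 + fst z * snd z) + q * (fst z + snd z)\<bar> \<partial>(A \<Otimes>\<^sub>M B))"
proof -
  note [measurable_cong] = pair_bias_law(2)[OF A B]
  have "spread (star A B) p q = (\<integral>z. (1 + fst z * snd z) * \<bar>p + q * (fst z \<boxplus> snd z)\<bar> \<partial>(A \<Otimes>\<^sub>M B))"
    unfolding spread_def by (rule integral_star[OF A B]) auto
  also have "\<dots> = (\<integral>z. \<bar>p * (1 + fst z * snd z) + q * (fst z + snd z)\<bar> \<partial>(A \<Otimes>\<^sub>M B))"
  proof (intro integral_cong_AE)
    show "AE z in A \<Otimes>\<^sub>M B. (1 + fst z * snd z) * \<bar>p + q * (fst z \<boxplus> snd z)\<bar>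
        = \<bar>p * (1 + fst z * snd z) + q * (fst z + snd z)\<bar>"
      using pair_bias_law(3)[OF A B]
    proof eventually_elim
      case (elim z)
      then have "(1 + fst z * snd z) * \<bar>p + q * (fst z \<boxplus> snd z)\<bar>
        = \<bar>p * (1 + fst z * snd z) + q * ((1 + fst z * snd z) * (fst z \<boxplus> snd z))\<bar>"
        using one_add_mult_nonneg[of "fst z" "snd z"]
        by (simp add: abs_mult_pos' ring_distribs(1) ac_simps)
      then show ?case using elim by (simp add: bias_add_cancel)
    qed
  qed auto
  finally show ?thesis .
qed

lemma pair_abs_bound:
  fixes a b p q c :: real
  assumes "\<bar>a\<bar> \<le> 1" "\<bar>b\<bar> \<le> 1" "\<bar>c\<bar> \<le> 1"
  shows "\<bar>\<bar>p * (1 + c * (a * b)) + q * (a + b)\<bar>\<bar> \<le> 2 * \<bar>p\<bar> + 2 * \<bar>q\<bar>"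
proof -
  have "\<bar>c * (a * b)\<bar> \<le> 1" using assms by (simp add: abs_mult mult_le_one)
  then have "\<bar>1 + c * (a * b)\<bar> \<le> 2" "\<bar>a + b\<bar> \<le> 2" using assms by linarith+
  then have "\<bar>p * (1 + c * (a * b))\<bar> \<le> \<bar>p\<bar> * 2" "\<bar>q * (a + b)\<bar> \<le> \<bar>q\<bar> * 2"
    by (auto simp: abs_mult intro: mult_left_mono)
  then show ?thesis by linarith
qed

text \<open>The integrand \<open>|p (1 + a b) + q (a + b)|\<close> equals
  \<open>|(p + q a) + (p a + q) b|\<close>, so the spread of a star product is an average of spreads
  of either factor. Monotonicity and continuity of \<open>star\<close> are read off from
  this.\<close>

lemma spread_star:
  assumes A: "bias_law A" and B: "bias_law B"
  shows "spread (star A B) p q = (\<integral>a. spread B (p + q * a) (p * a + q) \<partial>A)"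
    and "spread (star A B) p q = (\<integral>b. spread A (p + q * b) (p * b + q) \<partial>B)"
proof -
  interpret pair_prob_space A B by (rule pair_bias_law(1)[OF A B])
  let ?f = "\<lambda>z. \<bar>p * (1 + fst z * snd z) + q * (fst z + snd z)\<bar>"
  have i: "integrable (A \<Otimes>\<^sub>M B) ?f"
    by (rule pair_bias_law_integrable[OF A B, of _ "2 * \<bar>p\<bar> + 2 * \<bar>q\<bar>"])
       (auto intro: pair_abs_bound[where c = 1, simplified])
  show "spread (star A B) p q = (\<integral>a. spread B (p + q * a) (p * a + q) \<partial>A)"
    unfolding spread_star_pair[OF A B] integral_fst'[OF i, symmetric]
    by (simp add: spread_def algebra_simps)
  have i': "integrable (A \<Otimes>\<^sub>M B) (\<lambda>(a, b). ?f (a, b))" using i by (simp add: case_prod_beta')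
  show "spread (star A B) p q = (\<integral>b. spread A (p + q * b) (p * b + q) \<partial>B)"
    unfolding spread_star_pair[OF A B] using integral_snd[OF i']
    by (simp add: spread_def case_prod_beta' algebra_simps)
qed

text \<open>As all bias laws have mean 0, and the functions \<open>|p + q x|\<close> together with
  the affine ones generate the convex functions, this is the convex order on laws over
  [-1, 1].\<close>

definition less_informative :: "real measure \<Rightarrow> real measure \<Rightarrow> bool" (infix \<open>\<sqsubseteq>\<close> 50) where
  "A \<sqsubseteq> B \<longleftrightarrow> (\<forall>p q. spread A p q \<le> spread B p q)"

lemma less_informative_refl [simp]: "A \<sqsubseteq> A"
  by (simp add: less_informative_def)

lemma less_informative_trans [trans]: "A \<sqsubseteq> B \<Longrightarrow> B \<sqsubseteq> C \<Longrightarrow> A \<sqsubseteq> C"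
  unfolding less_informative_def by (meson order_trans)

lemma less_informative_antisym: "A \<sqsubseteq> B \<Longrightarrow> B \<sqsubseteq> A \<Longrightarrow> bias_law A \<Longrightarrow> bias_law B \<Longrightarrow> A = B"
  by (rule bias_law_eqI) (auto simp: less_informative_def intro: antisym)

lemma spread_affine_bound:
  assumes A: "bias_law A" and x: "\<bar>x\<bar> \<le> (1::real)"
  shows "\<bar>spread A (p + q * x) (p * x + q)\<bar> \<le> 2 * \<bar>p\<bar> + 2 * \<bar>q\<bar>"
proof -
  have "\<bar>q * x\<bar> \<le> \<bar>q\<bar>" "\<bar>p * x\<bar> \<le> \<bar>p\<bar>" using x by (auto simp: abs_mult mult_left_le)
  then show ?thesis using spread_le[OF A, of "p + q * x" "p * x + q"] spread_nonneg[of A "p + q * x" "p * x + q"]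
    by linarith
qed

lemma star_mono:
  assumes A: "bias_law A" and B: "bias_law B" and A': "bias_law A'" and B': "bias_law B'"
    and "A \<sqsubseteq> A'" "B \<sqsubseteq> B'"
  shows "star A B \<sqsubseteq> star A' B'"
proof -
  have "star A B \<sqsubseteq> star A B'"
    unfolding less_informative_def spread_star(1)[OF A B] spread_star(1)[OF A B']
    using assms by (auto intro!: integral_mono_bias_law[OF A] spread_affine_bound
       simp: less_informative_def)
  also have "star A B' \<sqsubseteq> star A' B'"
    unfolding less_informative_def spread_star(2)[OF A B'] spread_star(2)[OF A' B']
    using assms by (auto intro!: integral_mono_bias_law[OF B'] spread_affine_bound
       simp: less_informative_def)
  finally show ?thesis .
qed

lemma scale_mono: "bias_law A \<Longrightarrow> bias_law B \<Longrightarrow> A \<sqsubseteq> B \<Longrightarrow> scale c A \<sqsubseteq> scale c B"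
  by (simp add: less_informative_def spread_scale)

definition star_power :: "nat \<Rightarrow> real measure \<Rightarrow> real measure" where
  "star_power d A = (star A ^^ d) (return borel 0)"

lemma star_power_simps [simp]:
  "star_power 0 A = return borel 0" "star_power (Suc d) A = star A (star_power d A)"
  by (simp_all add: star_power_def)

definition bias_step :: "nat pmf \<Rightarrow> real \<Rightarrow> real measure \<Rightarrow> real measure" where
  "bias_step P l A = measure_pmf P \<bind> (\<lambda>d. star_power d (scale l A))"

definition fair_law :: "real measure" where
  "fair_law = distr (measure_pmf (pmf_of_set {-1, 1})) borel (\<lambda>x. x)"

text \<open>Bias laws live on [-1, 1] only almost surely. Composition with the clamp makes a test
  function that is controlled on [-1, 1] bounded everywhere, as weak convergence and integration
  over mixtures require, without changing its integral.\<close>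

definition clamp1 :: "real \<Rightarrow> real" where
  "clamp1 x = max (-1) (min 1 x)"

lemma clamp1_eq [simp]: "\<bar>x\<bar> \<le> 1 \<Longrightarrow> clamp1 x = x"
  by (auto simp: clamp1_def)

lemma abs_clamp1_le [simp]: "\<bar>clamp1 x\<bar> \<le> 1"
  by (auto simp: clamp1_def)

lemma continuous_clamp1 [continuous_intros]:
  "continuous_on S f \<Longrightarrow> continuous_on S (\<lambda>x. clamp1 (f x))"
  unfolding clamp1_def by (intro continuous_intros)

lemma measurable_clamp1 [measurable]: "clamp1 \<in> borel_measurable borel"
  by (intro borel_measurable_continuous_onI continuous_intros)

lemma integral_clamp1:
  assumes A: "bias_law A" and f: "f \<in> borel_measurable borel"
  shows "(\<integral>x. f (clamp1 x) \<partial>A) = (\<integral>x. (f x :: real) \<partial>A)"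
proof (rule integral_cong_AE)
  note [measurable_cong] = bias_lawD(2)[OF A]
  note [measurable] = f
  show "(\<lambda>x. f (clamp1 x)) \<in> borel_measurable A" "f \<in> borel_measurable A" by measurable
  show "AE x in A. f (clamp1 x) = f x"
    using bias_lawD(3)[OF A] by eventually_elim simp
qed

lemma spread_clamp1: "bias_law A \<Longrightarrow> spread A p q = (\<integral>x. \<bar>p + q * clamp1 x\<bar> \<partial>A)"
  unfolding spread_def by (rule integral_clamp1[symmetric]) auto

section \<open>The least and the greatest bias law\<close>

lemma bias_law_return_0: "bias_law (return borel 0)"
  by (auto simp: bias_law_def prob_space_return AE_return integral_return)

lemma spread_return_0 [simp]: "spread (return borel 0) p q = \<bar>p\<bar>"
  by (simp add: spread_def integral_return)

lemma bias_law_fair: "bias_law fair_law"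
  unfolding bias_law_def fair_law_def
  by (auto simp: measure_pmf.prob_space_distr AE_distr_iff AE_measure_pmf_iff integral_distr
        integral_pmf_of_set)

lemma spread_fair: "spread fair_law p q = max \<bar>p\<bar> \<bar>q\<bar>"
  unfolding spread_def fair_law_def
  by (auto simp: integral_distr integral_pmf_of_set)

text \<open>The convex function \<open>|p + q x|\<close> lies below its chord over [-1, 1]. The
  integral of the chord depends on the mean alone, and equals the value at the law that sits on the
  two endpoints.\<close>

lemma less_informative_fair: "bias_law A \<Longrightarrow> A \<sqsubseteq> fair_law"
proof -
  assume A: "bias_law A"
  interpret prob_space A using A by (simp add: bias_law_def)
  have "spread A p q \<le> max \<bar>p\<bar> \<bar>q\<bar>" for p q
  proof -
    have "\<bar>p + q * x\<bar> \<le> ((\<bar>p + q\<bar> + \<bar>p - q\<bar>) / 2) + ((\<bar>p + q\<bar> - \<bar>p - q\<bar>) / 2) * x" if "\<bar>x\<bar> \<le> 1" for x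
    proof -
      have "\<bar>p + q * x\<bar> = \<bar>(1 + x) / 2 * (p + q) + (1 - x) / 2 * (p - q)\<bar>"
        by (rule arg_cong[where f = abs]) (simp add: field_simps)
      also have "\<dots> \<le> (1 + x) / 2 * \<bar>p + q\<bar> + (1 - x) / 2 * \<bar>p - q\<bar>"
        using that by (intro order_trans[OF abs_triangle_ineq]) (simp add: abs_mult)
      finally show ?thesis by (simp add: field_simps)
    qed note * = this
    have "spread A p q \<le> (\<integral>x. ((\<bar>p + q\<bar> + \<bar>p - q\<bar>) / 2) + ((\<bar>p + q\<bar> - \<bar>p - q\<bar>) / 2) * x \<partial>A)"
      unfolding spread_def
    proof (rule integral_mono_AE)
      show "integrable A (\<lambda>x. ((\<bar>p + q\<bar> + \<bar>p - q\<bar>) / 2) + ((\<bar>p + q\<bar> - \<bar>p - q\<bar>) / 2) * x)"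
        using bias_law_integrable[OF A, of "\<lambda>x. x" 1] by simp
      show "AE x in A. \<bar>p + q * x\<bar> \<le> ((\<bar>p + q\<bar> + \<bar>p - q\<bar>) / 2) + ((\<bar>p + q\<bar> - \<bar>p - q\<bar>) / 2) * x"
        using bias_lawD(3)[OF A] by eventually_elim (rule *)
    qed (rule integrable_spread[OF A])
    also have "\<dots> = max \<bar>p\<bar> \<bar>q\<bar>" unfolding bias_law_integral_affine[OF A] by (auto simp: abs_if max_def)
    finally show ?thesis .
  qed
  then show ?thesis by (simp add: less_informative_def spread_fair)
qed

lemma return_0_less_informative: "bias_law A \<Longrightarrow> return borel 0 \<sqsubseteq> A"
  by (simp add: less_informative_def spread_ge)

text \<open>Every nontrivial law dominates some scaled noiseless law. Passing from
  \<open>(0, q)\<close> to \<open>(p, q)\<close> costs at most \<open>|p|\<close>, which is itself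
  at most \<open>spread A p q\<close>; hence \<open>|q| * spread A 0 1\<close> is at most twice the
  spread, and this is the factor 2 in the hypothesis.\<close>

lemma fair_law_less_informative:
  assumes A: "bias_law A" and "0 \<le> c" "2 * c \<le> spread A 0 1"
  shows "scale c fair_law \<sqsubseteq> A"
  unfolding less_informative_def
proof (intro allI)
  fix p q :: real
  have "\<bar>q\<bar> * spread A 0 1 = spread A 0 q" using spread_cmult[of A q 0 1] by simp
  also have "\<dots> \<le> spread A p q + \<bar>p\<bar>" using spread_lipschitz[OF A, of 0 q p q] by simp
  finally have "\<bar>q\<bar> * spread A 0 1 \<le> 2 * spread A p q" using spread_ge[OF A, of p q] by simp
  moreover have "\<bar>q\<bar> * (2 * c) \<le> \<bar>q\<bar> * spread A 0 1" using assms by (intro mult_left_mono) auto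
  moreover have "\<bar>c * q\<bar> * 2 = \<bar>q\<bar> * (2 * c)" using assms by (simp add: abs_mult)
  ultimately have "\<bar>c * q\<bar> \<le> spread A p q" by linarith
  then show "spread (scale c fair_law) p q \<le> spread A p q"
    using spread_ge[OF A, of p q] by (simp add: spread_scale[OF bias_law_fair] spread_fair)
qed

lemma return_0_if_spread:
  assumes A: "bias_law A" and "spread A 0 1 = 0"
  shows "A = return borel 0"
proof (rule bias_law_eqI[OF A bias_law_return_0])
  fix p q :: real
  have "spread A p q \<le> \<bar>p\<bar> + spread A 0 q"
    using spread_lipschitz[OF A, of p q 0 q] by simp
  also have "spread A 0 q = 0" using spread_cmult[of A q 0 1] assms by simp
  finally show "spread A p q = spread (return borel 0) p q" using spread_ge[OF A, of p q] by simp
qed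

section \<open>The recursion on bias laws\<close>

lemma bias_law_star_power: "bias_law A \<Longrightarrow> bias_law (star_power d A)"
  by (induction d) (auto intro: bias_law_star bias_law_return_0)

lemma measurable_pmf_kernel:
  fixes P :: "nat pmf"
  shows "(\<And>d. subprob_space (K d)) \<Longrightarrow> (\<And>d. sets (K d) = sets N) \<Longrightarrow> K \<in> measurable (measure_pmf P) (subprob_algebra N)"
  by (auto simp: measurable_pmf_measure1 space_subprob_algebra)

lemma bias_law_mixture:
  assumes K: "\<And>d. bias_law (K d)"
  shows "bias_law (measure_pmf P \<bind> K)"
    and "spread (measure_pmf P \<bind> K) p q = (\<integral>d. spread (K d) p q \<partial>measure_pmf (P :: nat pmf))"
proof -
  let ?M = "measure_pmf P \<bind> K"
  have m: "K \<in> measurable (measure_pmf P) (subprob_algebra borel)"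
    by (intro measurable_pmf_kernel) (use K in \<open>auto simp: bias_law_def prob_space_imp_subprob_space\<close>)
  have s: "sets ?M = sets borel" by (subst sets_bind[where N = borel]) (use K in \<open>auto simp: bias_law_def\<close>)
  have ps: "prob_space ?M"
    by (rule measure_pmf.prob_space_bind[OF _ m]) (use K in \<open>auto simp: bias_law_def\<close>)
  have ae: "AE x in ?M. \<bar>x\<bar> \<le> 1"
    by (subst AE_bind[OF m]) (use K in \<open>auto simp: bias_law_def\<close>)
  have int: "(\<integral>x. f (clamp1 x) \<partial>?M) = (\<integral>d. (\<integral>x. f (clamp1 x) \<partial>K d) \<partial>P)"
    if [measurable]: "f \<in> borel_measurable borel" and "\<And>x. \<bar>x\<bar> \<le> 1 \<Longrightarrow> \<bar>f x\<bar> \<le> C" for f :: "real \<Rightarrow> real" and C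
    using that K
    by (intro integral_bind[where K = borel and B = C and B' = 1])
       (auto simp: bias_law_def prob_space.emeasure_space_1 space_subprob_algebra prob_space_imp_subprob_space)
  have fix0: "(\<integral>x. f (clamp1 x) \<partial>?M) = (\<integral>x. f x \<partial>?M)" if "f \<in> borel_measurable borel" for f :: "real \<Rightarrow> real"
  proof (rule integral_cong_AE)
    note [measurable_cong] = s
    note [measurable] = that
    show "(\<lambda>x. f (clamp1 x)) \<in> borel_measurable ?M" "f \<in> borel_measurable ?M" by measurable
    show "AE x in ?M. f (clamp1 x) = f x" using ae by eventually_elim simp
  qed
  have "(\<integral>x. clamp1 x \<partial>K d) = 0" for d
    using integral_clamp1[OF K, of "\<lambda>x. x"] bias_lawD(4)[OF K] by simp
  then have "(\<integral>x. x \<partial>?M) = 0"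
    using fix0[of "\<lambda>x. x"] int[of "\<lambda>x. x" 1] by simp
  then show b: "bias_law ?M" using s ps ae by (simp add: bias_law_def)
  show "spread ?M p q = (\<integral>d. spread (K d) p q \<partial>P)"
    unfolding spread_clamp1[OF b] spread_clamp1[OF K]
  proof (rule int[of "\<lambda>x. \<bar>p + q * x\<bar>" "\<bar>p\<bar> + \<bar>q\<bar>"])
    fix x :: real assume "\<bar>x\<bar> \<le> 1"
    then have "\<bar>q * x\<bar> \<le> \<bar>q\<bar>" by (simp add: abs_mult mult_left_le)
    then show "\<bar>\<bar>p + q * x\<bar>\<bar> \<le> \<bar>p\<bar> + \<bar>q\<bar>" by linarith
  qed auto
qed

lemma bias_law_step: "bias_law A \<Longrightarrow> \<bar>l\<bar> \<le> 1 \<Longrightarrow> bias_law (bias_step P l A)"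
  unfolding bias_step_def by (intro bias_law_mixture bias_law_star_power bias_law_scale)

lemma spread_step:
  "bias_law A \<Longrightarrow> \<bar>l\<bar> \<le> 1 \<Longrightarrow> spread (bias_step P l A) p q = (\<integral>d. spread (star_power d (scale l A)) p q \<partial>P)"
  unfolding bias_step_def by (intro bias_law_mixture bias_law_star_power bias_law_scale)

lemma integrable_pmf_spread:
  assumes K: "\<And>d. bias_law (K d)"
  shows "integrable (measure_pmf P) (\<lambda>d :: nat. spread (K d) p q)"
  using spread_le[OF K, of _ p q] spread_nonneg[of "K _" p q]
  by (intro measure_pmf.integrable_const_bound[where B = "\<bar>p\<bar> + \<bar>q\<bar>"]) auto

lemma star_power_mono: "A \<sqsubseteq> B \<Longrightarrow> bias_law A \<Longrightarrow> bias_law B \<Longrightarrow> star_power d A \<sqsubseteq> star_power d B"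
  by (induction d) (auto intro!: star_mono bias_law_star_power)

lemma bias_step_mono:
  assumes "A \<sqsubseteq> B" "bias_law A" "bias_law B" "\<bar>l\<bar> \<le> 1"
  shows "bias_step P l A \<sqsubseteq> bias_step P l B"
proof -
  have "star_power d (scale l A) \<sqsubseteq> star_power d (scale l B)" for d
    using assms by (intro star_power_mono scale_mono bias_law_scale)
  then show ?thesis using assms unfolding less_informative_def
    by (auto simp: spread_step intro!: integral_mono integrable_pmf_spread bias_law_star_power bias_law_scale)
qed

lemma bias_law_iterate: "bias_law A \<Longrightarrow> \<bar>l\<bar> \<le> 1 \<Longrightarrow> bias_law ((bias_step P l ^^ h) A)"
  by (induction h) (auto intro: bias_law_step)

lemma iterate_mono:
  "A \<sqsubseteq> B \<Longrightarrow> bias_law A \<Longrightarrow> bias_law B \<Longrightarrow> \<bar>l\<bar> \<le> 1 \<Longrightarrow> (bias_step P l ^^ h) A \<sqsubseteq> (bias_step P l ^^ h) B"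
  by (induction h) (auto intro!: bias_step_mono bias_law_iterate)

subsection \<open>Convergence\<close>

definition spread_conv :: "(nat \<Rightarrow> real measure) \<Rightarrow> real measure \<Rightarrow> bool" where
  "spread_conv A B \<longleftrightarrow> (\<forall>p q. (\<lambda>h. spread (A h) p q) \<longlonglongrightarrow> spread B p q)"

lemma weak_conv_integral_clamp1:
  assumes A: "\<And>h. bias_law (A h)" and M: "real_distribution M" and w: "weak_conv_m A M"
    and f: "continuous_on {-1..1} (f :: real \<Rightarrow> real)"
  shows "(\<lambda>h. \<integral>x. f (clamp1 x) \<partial>A h) \<longlonglongrightarrow> (\<integral>x. f (clamp1 x) \<partial>M)"
proof -
  have "compact (f ` {-1..1})" using f by (intro compact_continuous_image) auto
  then obtain C where C: "\<And>x. x \<in> {-1..1} \<Longrightarrow> \<bar>f x\<bar> \<le> C"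
    using compact_imp_bounded bounded_iff by (metis (no_types) image_eqI real_norm_def)
  have c: "continuous_on UNIV (\<lambda>x. f (clamp1 x))"
    by (rule continuous_on_compose2[OF f]) (auto simp: clamp1_def intro!: continuous_intros)
  show ?thesis
    using c C by (intro weak_conv_imp_integral_bdd_continuous_conv[OF _ M w, where B = C] bias_law_real_distribution A)
      (auto simp: continuous_on_eq_continuous_at clamp1_def)
qed

lemma weak_limit_bias_law:
  assumes A: "\<And>h. bias_law (A h)" and M: "real_distribution M" and w: "weak_conv_m A M"
  shows "bias_law M" "spread_conv A M"
proof -
  interpret M: real_distribution M by (rule M)
  \<comment> \<open>A bounded continuous function that vanishes exactly on [-1, 1]; its integrals
    pass to the limit and confine the limit law to this interval.\<close>
  define g where "g x = min 1 \<bar>x - clamp1 x\<bar>" for x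
  have g: "continuous_on UNIV g" unfolding g_def by (intro continuous_intros)
  have "(\<lambda>h. \<integral>x. g x \<partial>A h) \<longlonglongrightarrow> (\<integral>x. g x \<partial>M)"
    using g by (intro weak_conv_imp_integral_bdd_continuous_conv[OF _ M w, where B = 1] bias_law_real_distribution A)
      (auto simp: continuous_on_eq_continuous_at g_def)
  moreover have "(\<integral>x. g x \<partial>A h) = 0" for h
  proof -
    have "AE x in A h. g x = 0"
      using bias_lawD(3)[OF A[of h]] by eventually_elim (simp add: g_def)
    then show ?thesis by (rule integral_eq_zero_AE)
  qed
  ultimately have "(\<integral>x. g x \<partial>M) = 0" by (simp add: LIMSEQ_const_iff)
  moreover have [measurable]: "g \<in> borel_measurable borel" by (rule borel_measurable_continuous_onI[OF g])
  have "integrable M g" by (rule M.integrable_const_bound[of _ 1]) (auto simp: g_def)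
  ultimately have "AE x in M. g x = 0"
    by (subst (asm) integral_nonneg_eq_0_iff_AE) (auto simp: g_def)
  then have ae: "AE x in M. \<bar>x\<bar> \<le> 1"
    by eventually_elim (auto simp: g_def clamp1_def min_def max_def split: if_splits)
  have fixM: "(\<integral>x. f (clamp1 x) \<partial>M) = (\<integral>x. f x \<partial>M)" if "f \<in> borel_measurable borel" for f :: "real \<Rightarrow> real"
  proof (rule integral_cong_AE)
    note [measurable] = that
    show "(\<lambda>x. f (clamp1 x)) \<in> borel_measurable M" "f \<in> borel_measurable M" by measurable
    show "AE x in M. f (clamp1 x) = f x" using ae by eventually_elim simp
  qed
  have "(\<lambda>h. \<integral>x. clamp1 x \<partial>A h) \<longlonglongrightarrow> (\<integral>x. clamp1 x \<partial>M)"
    using weak_conv_integral_clamp1[OF A M w, of "\<lambda>x. x"] by (simp add: continuous_on_id)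
  moreover have "(\<integral>x. clamp1 x \<partial>A h) = 0" for h
    using integral_clamp1[OF A, of "\<lambda>x. x"] bias_lawD(4)[OF A] by simp
  ultimately have "(\<integral>x. clamp1 x \<partial>M) = 0" by (simp add: LIMSEQ_const_iff)
  then show M': "bias_law M"
    using ae fixM[of "\<lambda>x. x"] M.prob_space_axioms by (simp add: bias_law_def)
  show "spread_conv A M"
    unfolding spread_conv_def spread_clamp1[OF M'] spread_clamp1[OF A]
    by (intro allI weak_conv_integral_clamp1[OF A M w, of "\<lambda>x. \<bar>p + q * x\<bar>" for p q]) (intro continuous_intros)
qed

lemma tight_bias_law: "(\<And>h. bias_law (A h)) \<Longrightarrow> tight A"
  unfolding tight_def
proof (intro conjI allI impI)
  fix e :: real assume A: "\<And>h. bias_law (A h)" and e: "0 < e"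
  \<comment> \<open>The interval is open on the left, so it starts below -1, where there may be an
    atom.\<close>
  have "1 - e < measure (A h) {-2<..1}" for h
  proof -
    interpret prob_space "A h" using A by (simp add: bias_law_def)
    note [measurable_cong] = bias_lawD(2)[OF A[of h]]
    have "prob {-2<..1} = 1"
      using bias_lawD(2,3)[OF A[of h]] by (subst prob_eq_1) (auto elim!: eventually_mono)
    then show ?thesis using e by simp
  qed
  then show "\<exists>a b. a < b \<and> (\<forall>h. 1 - e < measure (A h) {a<..b})"
    by (intro exI[of _ "-2"] exI[of _ 1]) auto
qed (simp add: bias_law_real_distribution)

lemma bias_law_subseq_limit:
  assumes A: "\<And>h. bias_law (A h)"
  obtains r B where "strict_mono (r :: nat \<Rightarrow> nat)" "bias_law B" "spread_conv (A \<circ> r) B"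
proof -
  obtain r M where r: "strict_mono (r :: nat \<Rightarrow> nat)" "real_distribution M" "weak_conv_m (A \<circ> id \<circ> r) M"
    using tight_imp_convergent_subsubsequence[OF tight_bias_law[of A, OF A], of id]
    by (auto simp: strict_mono_def)
  then show ?thesis using weak_limit_bias_law[of "A \<circ> r" M] A that by auto
qed

lemma bias_law_limit:
  assumes A: "\<And>h. bias_law (A h)" and L: "\<And>p q. (\<lambda>h. spread (A h) p q) \<longlonglongrightarrow> L p q"
  obtains B where "bias_law B" "spread_conv A B" "\<And>p q. spread B p q = L p q"
proof -
  obtain r B where r: "strict_mono (r :: nat \<Rightarrow> nat)" "bias_law B" "spread_conv (A \<circ> r) B"
    using bias_law_subseq_limit[OF A] .
  have eq: "spread B p q = L p q" for p q
  proof (rule LIMSEQ_unique)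
    show "(\<lambda>n. spread (A (r n)) p q) \<longlonglongrightarrow> spread B p q" using r(3) by (simp add: spread_conv_def)
    show "(\<lambda>n. spread (A (r n)) p q) \<longlonglongrightarrow> L p q"
      using LIMSEQ_subseq_LIMSEQ[OF L r(1), of p q] by (simp add: comp_def)
  qed
  show ?thesis by (rule that[OF r(2) _ eq]) (use L in \<open>simp add: spread_conv_def eq\<close>)
qed

text \<open>All these laws live on [-1, 1], hence are tight, and each weak subsequential limit has
  the spreads of \<open>B\<close>, so it is \<open>B\<close>.\<close>

lemma spread_conv_imp_weak_conv:
  assumes A: "\<And>h. bias_law (A h)" and B: "bias_law B" and conv: "spread_conv A B"
  shows "weak_conv_m A B"
proof (rule tight_subseq_weak_converge)
  fix s :: "nat \<Rightarrow> nat" and M assume s: "strict_mono s" "real_distribution M" "weak_conv_m (A \<circ> s) M"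
  have M: "bias_law M" "spread_conv (A \<circ> s) M"
    using weak_limit_bias_law[of "A \<circ> s" M] A s by auto
  have "M = B"
  proof (rule bias_law_eqI[OF M(1) B])
    fix p q
    have "(\<lambda>h. spread (A (s h)) p q) \<longlonglongrightarrow> spread M p q" using M(2) by (auto simp: spread_conv_def comp_def)
    moreover have "(\<lambda>h. spread (A (s h)) p q) \<longlonglongrightarrow> spread B p q"
      using LIMSEQ_subseq_LIMSEQ[OF _ s(1), of "\<lambda>h. spread (A h) p q"] conv by (auto simp: spread_conv_def comp_def)
    ultimately show "spread M p q = spread B p q" by (rule LIMSEQ_unique)
  qed
  then show "weak_conv_m (A \<circ> s) B" using s by simp
qed (auto intro: bias_law_real_distribution tight_bias_law A B)

lemma spread_conv_integral:
  assumes "\<And>h. bias_law (A h)" "bias_law B" "spread_conv A B" "continuous_on {-1..1} (f :: real \<Rightarrow> real)"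
  shows "(\<lambda>h. \<integral>x. f (clamp1 x) \<partial>A h) \<longlonglongrightarrow> (\<integral>x. f (clamp1 x) \<partial>B)"
  using assms by (intro weak_conv_integral_clamp1 spread_conv_imp_weak_conv bias_law_real_distribution)

lemma spread_conv_unique:
  assumes "spread_conv A B" "spread_conv A C" "bias_law B" "bias_law C"
  shows "B = C"
proof (rule bias_law_eqI[OF assms(3,4)])
  show "spread B p q = spread C p q" for p q
    using assms(1,2) LIMSEQ_unique unfolding spread_conv_def by blast
qed

lemma spread_conv_squeeze:
  assumes "spread_conv A L" "spread_conv C L" "\<And>h. A h \<sqsubseteq> B h" "\<And>h. B h \<sqsubseteq> C h"
  shows "spread_conv B L"
  unfolding spread_conv_def
proof (intro allI)
  fix p q
  show "(\<lambda>h. spread (B h) p q) \<longlonglongrightarrow> spread L p q"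
    by (rule tendsto_sandwich[of "\<lambda>h. spread (A h) p q" _ _ "\<lambda>h. spread (C h) p q"])
      (use assms in \<open>auto simp: spread_conv_def less_informative_def\<close>)
qed

text \<open>In \<open>spread_star\<close> both the integrand and the law vary with \<open>h\<close>.
  The integrands are Lipschitz in \<open>a\<close> with a common constant, so their pointwise
  convergence is uniform on [-1, 1]. After exchanging the integrand for its limit, only weak
  convergence of \<open>A h\<close> is needed.\<close>

lemma spread_conv_star:
  assumes A: "\<And>h. bias_law (A h)" "bias_law A'" "spread_conv A A'"
    and B: "\<And>h. bias_law (B h)" "bias_law B'" "spread_conv B B'"
  shows "spread_conv (\<lambda>h. star (A h) (B h)) (star A' B')"
  unfolding spread_conv_def
proof (intro allI)
  fix p q :: real
  define f where "f C a = spread C (p + q * a) (p * a + q)" for C a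
  have lip: "\<bar>f C a - f C a'\<bar> \<le> (\<bar>p\<bar> + \<bar>q\<bar>) * \<bar>a - a'\<bar>" if "bias_law C" for C a a'
  proof -
    have "(p + q * a) - (p + q * a') = q * (a - a')" "(p * a + q) - (p * a' + q) = p * (a - a')"
      by (simp_all add: algebra_simps)
    then have "\<bar>f C a - f C a'\<bar> \<le> \<bar>q * (a - a')\<bar> + \<bar>p * (a - a')\<bar>"
      using spread_lipschitz[OF that, of "p + q * a" "p * a + q" "p + q * a'" "p * a' + q"]
      by (simp add: f_def)
    also have "\<dots> = (\<bar>p\<bar> + \<bar>q\<bar>) * \<bar>a - a'\<bar>" by (simp only: abs_mult distrib_right add.commute)
    finally show ?thesis .
  qed
  have cont: "continuous_on S (f C)" if "bias_law C" for C S
    unfolding f_def by (intro continuous_on_spread[OF that] continuous_intros)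
  have meas[measurable]: "f C \<in> borel_measurable borel" if "bias_law C" for C
    by (rule borel_measurable_continuous_onI[OF cont[OF that]])
  have bd: "\<bar>f C a\<bar> \<le> 2 * \<bar>p\<bar> + 2 * \<bar>q\<bar>" if "bias_law C" "\<bar>a\<bar> \<le> 1" for C a
    unfolding f_def by (rule spread_affine_bound[OF that])
  have unif: "\<forall>\<^sub>F h in sequentially. \<forall>a\<in>{-1..1}. \<bar>f (B h) a - f B' a\<bar> \<le> e" if e: "0 < e" for e
  proof -
    \<comment> \<open>The mesh keeps each of the two Lipschitz errors below \<open>e / 4\<close>;
      together with \<open>e / 2\<close> at the points of the net they add up to
      \<open>e\<close>.\<close>
    define d where "d = e / (4 * (\<bar>p\<bar> + \<bar>q\<bar> + 1))"
    have d: "0 < d" using e by (simp add: d_def)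
    have d': "(\<bar>p\<bar> + \<bar>q\<bar>) * d \<le> e / 4"
      using e by (simp add: d_def field_simps)
    obtain k :: "real set" where k: "finite k" "k \<subseteq> {-1..1}" "{-1..1} \<subseteq> (\<Union>x\<in>k. ball x d)"
      using spec[OF seq_compact_imp_totally_bounded[OF compact_imp_seq_compact[OF compact_Icc[of "-1::real" 1]]], of d] d
      by auto
    have "\<forall>\<^sub>F h in sequentially. \<forall>x\<in>k. \<bar>f (B h) x - f B' x\<bar> < e / 2"
    proof (intro eventually_ball_finite k ballI)
      fix x
      have lim: "(\<lambda>h. f (B h) x) \<longlonglongrightarrow> f B' x" using B(3) by (simp add: spread_conv_def f_def)
      show "\<forall>\<^sub>F h in sequentially. \<bar>f (B h) x - f B' x\<bar> < e / 2"
        using tendstoD[OF lim, of "e / 2"] e by (simp add: dist_real_def)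
    qed
    then show ?thesis
    proof eventually_elim
      case (elim h)
      show ?case
      proof
        fix a :: real assume "a \<in> {-1..1}"
        then have "a \<in> (\<Union>x\<in>k. ball x d)" by (rule subsetD[OF k(3)])
        then obtain x where x: "x \<in> k" "\<bar>a - x\<bar> < d" by (auto simp: dist_real_def abs_minus_commute)
        have "(\<bar>p\<bar> + \<bar>q\<bar>) * \<bar>a - x\<bar> \<le> (\<bar>p\<bar> + \<bar>q\<bar>) * d" using x(2) by (intro mult_left_mono) auto
        then have "\<bar>f (B h) a - f (B h) x\<bar> \<le> e / 4" "\<bar>f B' a - f B' x\<bar> \<le> e / 4"
          using lip[OF B(1), of h a x] lip[OF B(2), of a x] d' by linarith+
        moreover have "\<bar>f (B h) x - f B' x\<bar> < e / 2" using elim x(1) by blast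
        ultimately show "\<bar>f (B h) a - f B' a\<bar> \<le> e" by linarith
      qed
    qed
  qed
  have i: "integrable (A h) (f C)" if "bias_law C" for h C
    by (rule bias_law_integrable[OF A(1) meas[OF that] bd[OF that]])
  have "(\<lambda>h. (\<integral>a. f (B h) a \<partial>A h) - (\<integral>a. f B' a \<partial>A h)) \<longlonglongrightarrow> 0"
    unfolding tendsto_iff dist_real_def
  proof (intro allI impI)
    fix e :: real assume "0 < e"
    then have "0 < e / 2" by simp
    from unif[OF this] show "\<forall>\<^sub>F h in sequentially. \<bar>(\<integral>a. f (B h) a \<partial>A h) - (\<integral>a. f B' a \<partial>A h) - 0\<bar> < e"
    proof eventually_elim
      case (elim h)
      interpret prob_space "A h" using A(1) by (simp add: bias_law_def)
      have "\<bar>(\<integral>a. f (B h) a \<partial>A h) - (\<integral>a. f B' a \<partial>A h)\<bar> = \<bar>\<integral>a. f (B h) a - f B' a \<partial>A h\<bar>"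
        by (subst Bochner_Integration.integral_diff[OF i i]) (auto intro: B)
      also have "\<dots> \<le> (\<integral>a. \<bar>f (B h) a - f B' a\<bar> \<partial>A h)" by (rule integral_abs_bound)
      also have "\<dots> \<le> (\<integral>a. e / 2 \<partial>A h)"
      proof (rule integral_mono_AE)
        show "AE a in A h. \<bar>f (B h) a - f B' a\<bar> \<le> e / 2"
          using bias_lawD(3)[OF A(1)[of h]] 
        proof eventually_elim
          fix a :: real assume "\<bar>a\<bar> \<le> 1"
          then have "a \<in> {-1..1}" by auto
          then show "\<bar>f (B h) a - f B' a\<bar> \<le> e / 2" using elim by blast
        qed
      qed (auto intro!: i B)
      also have "\<dots> < e" using \<open>0 < e\<close> by (simp add: prob_space)
      finally show ?case by simp
    qed
  qed
  moreover have "(\<lambda>h. \<integral>a. f B' a \<partial>A h) \<longlonglongrightarrow> (\<integral>a. f B' a \<partial>A')"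
    using spread_conv_integral[OF A cont[OF B(2)]]
    unfolding integral_clamp1[OF A(1) meas[OF B(2)]] integral_clamp1[OF A(2) meas[OF B(2)]] .
  ultimately have "(\<lambda>h. \<integral>a. f (B h) a \<partial>A h) \<longlonglongrightarrow> (\<integral>a. f B' a \<partial>A')"
    by (rule Lim_transform[rotated])
  then show "(\<lambda>h. spread (star (A h) (B h)) p q) \<longlonglongrightarrow> spread (star A' B') p q"
    unfolding spread_star(1)[OF A(1) B(1)] spread_star(1)[OF A(2) B(2)] f_def .
qed

lemma spread_conv_scale:
  "(\<And>h. bias_law (A h)) \<Longrightarrow> bias_law B \<Longrightarrow> spread_conv A B \<Longrightarrow> spread_conv (\<lambda>h. scale c (A h)) (scale c B)"
  by (simp add: spread_conv_def spread_scale)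

lemma spread_conv_star_power:
  "(\<And>h. bias_law (A h)) \<Longrightarrow> bias_law B \<Longrightarrow> spread_conv A B \<Longrightarrow> spread_conv (\<lambda>h. star_power d (A h)) (star_power d B)"
proof (induction d)
  case 0
  show ?case by (simp add: spread_conv_def)
next
  case (Suc d)
  then show ?case by (simp add: spread_conv_star bias_law_star_power)
qed

lemma spread_conv_step:
  assumes A: "\<And>h. bias_law (A h)" "bias_law B" "spread_conv A B" and l: "\<bar>l\<bar> \<le> 1"
  shows "spread_conv (\<lambda>h. bias_step P l (A h)) (bias_step P l B)"
  unfolding spread_conv_def spread_step[OF A(1) l] spread_step[OF A(2) l]
proof (intro allI integral_dominated_convergence)
  fix p q
  show "AE d in measure_pmf P. (\<lambda>h. spread (star_power d (scale l (A h))) p q) \<longlonglongrightarrow> spread (star_power d (scale l B)) p q"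
    using spread_conv_star_power[OF _ _ spread_conv_scale[OF A, of l]] A l
    by (auto simp: spread_conv_def bias_law_scale)
  show "AE d in measure_pmf P. norm (spread (star_power d (scale l (A h))) p q) \<le> \<bar>p\<bar> + \<bar>q\<bar>" for h
    using spread_le[of "star_power _ (scale l (A h))" p q] A(1) l spread_nonneg
    by (auto simp: bias_law_star_power bias_law_scale)
qed auto

section \<open>Uniqueness of the nontrivial fixed law\<close>

subsection \<open>Symmetric laws\<close>

definition symmetric_law :: "real measure \<Rightarrow> bool" where
  "symmetric_law A \<longleftrightarrow> scale (-1) A = A"

lemma symmetric_law_spread: "symmetric_law A \<Longrightarrow> bias_law A \<Longrightarrow> spread A p (- q) = spread A p q"
  using spread_scale[of A "-1" p q] by (simp add: symmetric_law_def)

lemma symmetric_lawI: "bias_law A \<Longrightarrow> (\<And>p q. spread A p (- q) = spread A p q) \<Longrightarrow> symmetric_law A"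
  unfolding symmetric_law_def by (rule bias_law_eqI) (auto simp: spread_scale intro!: bias_law_scale)

lemma symmetric_law_spread_abs:
  assumes "symmetric_law A" "bias_law A"
  shows "spread A \<bar>p\<bar> \<bar>q\<bar> = spread A p q"
  using symmetric_law_spread[OF assms] spread_minus[of A p q] spread_minus[of A p "-q"]
  by (cases "p \<ge> 0"; cases "q \<ge> 0") simp_all

lemma symmetric_law_integral:
  assumes "symmetric_law A" "bias_law A" and [measurable]: "f \<in> borel_measurable borel"
  shows "(\<integral>x. f (- x) \<partial>A) = (\<integral>x. (f x :: real) \<partial>A)"
proof -
  note [measurable_cong] = bias_lawD(2)[OF assms(2)]
  have "(\<integral>x. f x \<partial>A) = (\<integral>x. f x \<partial>scale (-1) A)" using assms by (simp add: symmetric_law_def)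
  also have "\<dots> = (\<integral>x. f (- x) \<partial>A)" unfolding scale_def by (subst integral_distr) auto
  finally show ?thesis ..
qed

lemma symmetric_law_scale:
  "symmetric_law A \<Longrightarrow> bias_law A \<Longrightarrow> \<bar>c\<bar> \<le> 1 \<Longrightarrow> symmetric_law (scale c A)"
  by (intro symmetric_lawI bias_law_scale) (auto simp: spread_scale symmetric_law_spread)

lemma scale_abs: "symmetric_law A \<Longrightarrow> bias_law A \<Longrightarrow> scale \<bar>c\<bar> A = scale c A"
  using scale_scale[of A c "-1"] by (cases "c \<ge> 0") (auto simp: symmetric_law_def)

lemma symmetric_law_return_0: "symmetric_law (return borel 0)"
  by (intro symmetric_lawI bias_law_return_0) simp

lemma symmetric_law_fair: "symmetric_law fair_law"
  by (intro symmetric_lawI bias_law_fair) (simp add: spread_fair)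

lemma symmetric_law_star:
  assumes A: "bias_law A" "symmetric_law A" and B: "bias_law B" "symmetric_law B"
  shows "symmetric_law (star A B)"
proof (rule symmetric_lawI[OF bias_law_star[OF A(1) B(1)]])
  fix p q
  have "spread (star A B) p (- q) = (\<integral>a. spread B (p + q * (- a)) (p * a - q) \<partial>A)"
    by (simp add: spread_star(1)[OF A(1) B(1)])
  also have "\<dots> = (\<integral>a. spread B (p + q * (- a)) (p * (- a) + q) \<partial>A)"
    using symmetric_law_spread[OF B(2,1), of _ "p * _ - q"] by simp
  also have "\<dots> = (\<integral>a. spread B (p + q * a) (p * a + q) \<partial>A)"
    by (rule symmetric_law_integral[OF A(2,1)]) (use B in measurable)
  finally show "spread (star A B) p (- q) = spread (star A B) p q" by (simp add: spread_star(1)[OF A(1) B(1)])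
qed

lemma symmetric_law_star_power:
  "bias_law A \<Longrightarrow> symmetric_law A \<Longrightarrow> symmetric_law (star_power d A)"
  by (induction d) (auto intro: symmetric_law_star bias_law_star_power symmetric_law_return_0)

lemma symmetric_law_step:
  "bias_law A \<Longrightarrow> symmetric_law A \<Longrightarrow> \<bar>l\<bar> \<le> 1 \<Longrightarrow> symmetric_law (bias_step P l A)"
  by (intro symmetric_lawI bias_law_step)
    (simp_all add: spread_step symmetric_law_spread symmetric_law_star_power symmetric_law_scale
       bias_law_star_power bias_law_scale)

lemma symmetric_law_iterate:
  "bias_law A \<Longrightarrow> symmetric_law A \<Longrightarrow> \<bar>l\<bar> \<le> 1 \<Longrightarrow> symmetric_law ((bias_step P l ^^ h) A)"
  by (induction h) (auto intro: symmetric_law_step bias_law_iterate)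

lemma symmetric_law_limit:
  assumes "\<And>h. bias_law (A h)" "\<And>h. symmetric_law (A h)" "bias_law B" "spread_conv A B"
  shows "symmetric_law B"
proof (rule symmetric_lawI[OF assms(3)])
  fix p q
  have "(\<lambda>h. spread (A h) p (- q)) \<longlonglongrightarrow> spread B p (- q)" "(\<lambda>h. spread (A h) p q) \<longlonglongrightarrow> spread B p q"
    using assms(4) by (auto simp: spread_conv_def)
  moreover have "spread (A h) p (- q) = spread (A h) p q" for h by (rule symmetric_law_spread[OF assms(2,1)])
  ultimately show "spread B p (- q) = spread B p q" by (simp add: LIMSEQ_unique)
qed

subsection \<open>The stringy tree inequality\<close>

text \<open>For symmetric laws the integrand of \<open>spread (star A B)\<close> may be averaged over the four choices of signs
  of the two biases; after the averaging the stringy tree inequality holds pointwise.\<close>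

definition sign_mean :: "real \<Rightarrow> real \<Rightarrow> real \<Rightarrow> real \<times> real \<Rightarrow> real" where
  "sign_mean c p r z = (max \<bar>p * (1 + c * (fst z * snd z))\<bar> \<bar>r * (fst z + snd z)\<bar>
     + max \<bar>p * (1 - c * (fst z * snd z))\<bar> \<bar>r * (fst z - snd z)\<bar>) / 2"

lemma symmetric_pair_integral:
  assumes A: "bias_law A" "symmetric_law A" and B: "bias_law B" "symmetric_law B"
    and [measurable]: "f \<in> borel_measurable (borel \<Otimes>\<^sub>M borel)"
  shows "(\<integral>z. f (- fst z, snd z) \<partial>(A \<Otimes>\<^sub>M B)) = (\<integral>z. (f z :: real) \<partial>(A \<Otimes>\<^sub>M B))"
    and "(\<integral>z. f (fst z, - snd z) \<partial>(A \<Otimes>\<^sub>M B)) = (\<integral>z. (f z :: real) \<partial>(A \<Otimes>\<^sub>M B))"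
proof -
  note [measurable_cong] = bias_lawD(2)[OF A(1)] bias_lawD(2)[OF B(1)]
  have *: "distr A borel (\<lambda>x. c * x) \<Otimes>\<^sub>M distr B borel (\<lambda>x. d * x)
      = distr (A \<Otimes>\<^sub>M B) (borel \<Otimes>\<^sub>M borel) (\<lambda>(x, y). (c * x, d * y))" if "\<bar>c\<bar> \<le> 1" "\<bar>d\<bar> \<le> 1" for c d
    using bias_law_scale[OF B(1) that(2)]
    by (intro pair_measure_distr) (auto simp: scale_def bias_law_def prob_space_imp_sigma_finite)
  have A1: "distr A borel (\<lambda>x. -1 * x) = A" and B1: "distr B borel (\<lambda>x. -1 * x) = B"
    using A(2) B(2) by (simp_all add: symmetric_law_def scale_def)
  have A2: "distr A borel (\<lambda>x. 1 * x) = A" and B2: "distr B borel (\<lambda>x. 1 * x) = B"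
    by (simp_all add: distr_id2 bias_lawD(2)[OF A(1)] bias_lawD(2)[OF B(1)])
  have "(\<integral>z. f z \<partial>(A \<Otimes>\<^sub>M B)) = (\<integral>z. f z \<partial>distr (A \<Otimes>\<^sub>M B) (borel \<Otimes>\<^sub>M borel) (\<lambda>(x, y). (-1 * x, 1 * y)))"
    using *[of "-1" 1, unfolded A1 B2] by simp
  also have "\<dots> = (\<integral>z. f (- fst z, snd z) \<partial>(A \<Otimes>\<^sub>M B))"
    by (subst integral_distr) (auto simp: case_prod_beta')
  finally show "(\<integral>z. f (- fst z, snd z) \<partial>(A \<Otimes>\<^sub>M B)) = (\<integral>z. f z \<partial>(A \<Otimes>\<^sub>M B))" ..
  have "(\<integral>z. f z \<partial>(A \<Otimes>\<^sub>M B)) = (\<integral>z. f z \<partial>distr (A \<Otimes>\<^sub>M B) (borel \<Otimes>\<^sub>M borel) (\<lambda>(x, y). (1 * x, -1 * y)))"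
    using *[of 1 "-1", unfolded A2 B1] by simp
  also have "\<dots> = (\<integral>z. f (fst z, - snd z) \<partial>(A \<Otimes>\<^sub>M B))"
    by (subst integral_distr) (auto simp: case_prod_beta')
  finally show "(\<integral>z. f (fst z, - snd z) \<partial>(A \<Otimes>\<^sub>M B)) = (\<integral>z. f z \<partial>(A \<Otimes>\<^sub>M B))" ..
qed

lemma sign_mean_integral:
  assumes A: "bias_law A" "symmetric_law A" and B: "bias_law B" "symmetric_law B" and c: "\<bar>c\<bar> \<le> 1"
  shows "integrable (A \<Otimes>\<^sub>M B) (sign_mean c p r)"
    and "(\<integral>z. \<bar>p * (1 + c * (fst z * snd z)) + r * (fst z + snd z)\<bar> \<partial>(A \<Otimes>\<^sub>M B)) = (\<integral>z. sign_mean c p r z \<partial>(A \<Otimes>\<^sub>M B))"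
proof -
  define F where "F z = \<bar>p * (1 + c * (fst z * snd z)) + r * (fst z + snd z)\<bar>" for z
  have [measurable]: "F \<in> borel_measurable (borel \<Otimes>\<^sub>M borel)" unfolding F_def by measurable
  have bd: "\<bar>F (a, b)\<bar> \<le> 2 * \<bar>p\<bar> + 2 * \<bar>r\<bar>" if "\<bar>a\<bar> \<le> 1" "\<bar>b\<bar> \<le> 1" for a b
    using pair_abs_bound[OF that c] by (simp add: F_def)
  have i: "integrable (A \<Otimes>\<^sub>M B) (\<lambda>z. F (s * fst z, t * snd z))" if "\<bar>s\<bar> = 1" "\<bar>t\<bar> = 1" for s t
    by (rule pair_bias_law_integrable[OF A(1) B(1), of _ "2 * \<bar>p\<bar> + 2 * \<bar>r\<bar>"])
       (use that in \<open>auto intro!: bd simp: abs_mult\<close>)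
  have eq: "sign_mean c p r z = (F (1 * fst z, 1 * snd z) + F (- 1 * fst z, -1 * snd z)
      + F (1 * fst z, -1 * snd z) + F (- 1 * fst z, 1 * snd z)) / 4" for z
  proof -
    \<comment> \<open>This identity turns the mean over the four sign choices into the two maxima of
      \<open>sign_mean\<close>: equal signs give the first, opposite signs the second.\<close>
    have m: "max \<bar>u\<bar> \<bar>v\<bar> = (\<bar>u + v\<bar> + \<bar>u - v\<bar>) / 2" for u v :: real by (auto simp: max_def abs_if)
    show ?thesis unfolding sign_mean_def m F_def fst_conv snd_conv
      by (simp add: algebra_simps add_divide_distrib)
  qed
  have eq': "sign_mean c p r = (\<lambda>z. (F (1 * fst z, 1 * snd z) + F (- 1 * fst z, -1 * snd z)
      + F (1 * fst z, -1 * snd z) + F (- 1 * fst z, 1 * snd z)) / 4)" by (rule ext) (rule eq)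
  show "integrable (A \<Otimes>\<^sub>M B) (sign_mean c p r)"
    unfolding eq' by (intro integrable_divide Bochner_Integration.integrable_add i) auto
  have "(\<integral>z. sign_mean c p r z \<partial>(A \<Otimes>\<^sub>M B)) =
     ((\<integral>z. F (1 * fst z, 1 * snd z) \<partial>(A \<Otimes>\<^sub>M B)) + (\<integral>z. F (-1 * fst z, -1 * snd z) \<partial>(A \<Otimes>\<^sub>M B))
      + (\<integral>z. F (1 * fst z, -1 * snd z) \<partial>(A \<Otimes>\<^sub>M B)) + (\<integral>z. F (-1 * fst z, 1 * snd z) \<partial>(A \<Otimes>\<^sub>M B))) / 4"
    unfolding eq'
    by (subst integral_divide_zero, subst Bochner_Integration.integral_add,
        (intro Bochner_Integration.integrable_add i; simp), (intro i; simp),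
        subst Bochner_Integration.integral_add, (intro Bochner_Integration.integrable_add i; simp), (intro i; simp),
        subst Bochner_Integration.integral_add, (intro i; simp), (intro i; simp)) (rule refl)
  also have "(\<integral>z. F (-1 * fst z, 1 * snd z) \<partial>(A \<Otimes>\<^sub>M B)) = (\<integral>z. F z \<partial>(A \<Otimes>\<^sub>M B))"
    using symmetric_pair_integral(1)[OF A B, of F] by simp
  also have "(\<integral>z. F (1 * fst z, -1 * snd z) \<partial>(A \<Otimes>\<^sub>M B)) = (\<integral>z. F z \<partial>(A \<Otimes>\<^sub>M B))"
    using symmetric_pair_integral(2)[OF A B, of F] by simp
  also have "(\<integral>z. F (-1 * fst z, -1 * snd z) \<partial>(A \<Otimes>\<^sub>M B)) = (\<integral>z. F z \<partial>(A \<Otimes>\<^sub>M B))"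
    using symmetric_pair_integral(2)[OF A B, of "\<lambda>z. F (- fst z, snd z)"] symmetric_pair_integral(1)[OF A B, of F]
    by simp
  finally show "(\<integral>z. \<bar>p * (1 + c * (fst z * snd z)) + r * (fst z + snd z)\<bar> \<partial>(A \<Otimes>\<^sub>M B)) = (\<integral>z. sign_mean c p r z \<partial>(A \<Otimes>\<^sub>M B))"
    by (simp add: F_def)
qed

text \<open>Both sides of the stringy tree inequality have the linear term
  \<open>c q (a + b)\<close>. They differ in the coefficient of \<open>a b\<close> only: it is 1 if
  the scaling follows the star product and \<open>c\<^sup>2\<close> if it precedes it.\<close>

lemma spread_star_sign_mean:
  assumes A: "bias_law A" "symmetric_law A" and B: "bias_law B" "symmetric_law B" and c: "0 \<le> c" "c \<le> 1"
  shows "spread (scale c (star A B)) p q = (\<integral>z. sign_mean 1 p (c * q) z \<partial>(A \<Otimes>\<^sub>M B))"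
    and "spread (star (scale c A) (scale c B)) p q = (\<integral>z. sign_mean (c\<^sup>2) p (c * q) z \<partial>(A \<Otimes>\<^sub>M B))"
proof -
  interpret pair_prob_space A B by (rule pair_bias_law(1)[OF A(1) B(1)])
  note [measurable_cong] = bias_lawD(2)[OF A(1)] bias_lawD(2)[OF B(1)]
  show "spread (scale c (star A B)) p q = (\<integral>z. sign_mean 1 p (c * q) z \<partial>(A \<Otimes>\<^sub>M B))"
    using sign_mean_integral(2)[OF A B, of 1 p "c * q"]
    by (simp add: spread_scale bias_law_star A B spread_star_pair)
  have c2: "\<bar>c\<^sup>2\<bar> \<le> 1" using c by (simp add: power_le_one)
  have sc: "bias_law (scale c A)" "bias_law (scale c B)" using A B c by (auto intro: bias_law_scale)
  have i: "integrable (A \<Otimes>\<^sub>M B) (\<lambda>z. \<bar>p * (1 + c\<^sup>2 * (fst z * snd z)) + (c * q) * (fst z + snd z)\<bar>)"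
    by (rule pair_bias_law_integrable[OF A(1) B(1), of _ "2 * \<bar>p\<bar> + 2 * \<bar>c * q\<bar>"])
      (use pair_abs_bound[OF _ _ c2, of _ _ p "c * q"] in auto)
  have "spread (star (scale c A) (scale c B)) p q = (\<integral>a. spread (scale c B) (p + q * a) (p * a + q) \<partial>scale c A)"
    by (rule spread_star(1)[OF sc])
  also have "\<dots> = (\<integral>a. spread B (p + q * (c * a)) (c * (p * (c * a) + q)) \<partial>A)"
    unfolding spread_scale[OF B(1)] by (subst (1) scale_def, subst integral_distr) (use B in auto)
  also have "\<dots> = (\<integral>a. (\<integral>b. \<bar>p * (1 + c\<^sup>2 * (a * b)) + (c * q) * (a + b)\<bar> \<partial>B) \<partial>A)"
    unfolding spread_def by (simp add: algebra_simps power2_eq_square)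
  also have "\<dots> = (\<integral>z. \<bar>p * (1 + c\<^sup>2 * (fst z * snd z)) + (c * q) * (fst z + snd z)\<bar> \<partial>(A \<Otimes>\<^sub>M B))"
    using integral_fst'[OF i] by simp
  also have "\<dots> = (\<integral>z. sign_mean (c\<^sup>2) p (c * q) z \<partial>(A \<Otimes>\<^sub>M B))"
    by (rule sign_mean_integral(2)[OF A B c2])
  finally show "spread (star (scale c A) (scale c B)) p q = (\<integral>z. sign_mean (c\<^sup>2) p (c * q) z \<partial>(A \<Otimes>\<^sub>M B))" .
qed

lemma sign_mean_abs: "sign_mean c p r (a, b) = sign_mean c \<bar>p\<bar> \<bar>r\<bar> (\<bar>a\<bar>, \<bar>b\<bar>)"
proof -
  have 1: "\<bar>x * y\<bar> = \<bar>\<bar>x\<bar> * y\<bar>" for x y :: real by (simp add: abs_mult)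
  have 2: "\<bar>- a - b\<bar> = \<bar>a + b\<bar>" "\<bar>- a + b\<bar> = \<bar>a - b\<bar>" by linarith+
  show ?thesis
    unfolding sign_mean_def fst_conv snd_conv
    by (subst (1 2 3 4) 1; cases "0 \<le> a"; cases "0 \<le> b")
       (simp_all add: abs_mult 2 add.commute max.commute abs_minus_commute)
qed

text \<open>Lowering the coefficient of \<open>a b\<close> moves weight from the
  \<open>p\<close>-entry of the first maximum to that of the second. If the first maximum is
  \<open>r (a + b)\<close>, nothing is lost. Otherwise, by \<open>both\<close>, the two
  \<open>p\<close>-entries are the maxima for coefficient 1, and their sum \<open>2 p\<close> does
  not depend on the coefficient. The gain is strict if, for the coefficient \<open>c\<close>, the
  first maximum is attained by the \<open>r\<close>-entry alone and the second by the
  \<open>p\<close>-entry alone.\<close>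

lemma sign_mean_nonneg_mono:
  fixes p r a b c :: real
  assumes ab: "0 \<le> a" "a \<le> 1" "0 \<le> b" "b \<le> 1" and p: "0 \<le> p" and r: "0 \<le> r" and c: "0 \<le> c" "c \<le> 1"
  shows "sign_mean 1 p r (a, b) \<le> sign_mean c p r (a, b)"
    and "r * \<bar>a - b\<bar> < p * (1 - c * (a * b)) \<Longrightarrow> p * (1 + c * (a * b)) < r * (a + b) \<Longrightarrow> c < 1 \<Longrightarrow>
      sign_mean 1 p r (a, b) < sign_mean c p r (a, b)"
proof -
  have ab1: "0 \<le> a * b" "a * b \<le> 1" using ab by (auto intro: mult_le_one)
  have cab: "0 \<le> c * (a * b)" "c * (a * b) \<le> a * b" using ab1 c by (auto intro: mult_left_le_one_le)
  have e: "sign_mean d p r (a, b) = (max (p * (1 + d * (a * b))) (r * (a + b))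
     + max (p * (1 - d * (a * b))) (r * \<bar>a - b\<bar>)) / 2" if "0 \<le> d * (a * b)" "d * (a * b) \<le> 1" for d
    using that p r ab unfolding sign_mean_def by (simp add: abs_mult)
  have e1: "sign_mean 1 p r (a, b) = (max (p * (1 + a * b)) (r * (a + b)) + max (p * (1 - a * b)) (r * \<bar>a - b\<bar>)) / 2"
    using e[of 1] ab1 by simp
  note ec = e[of c, OF cab(1) order_trans[OF cab(2) ab1(2)]]
  \<comment> \<open>For biases in [0, 1], combining opposite observations yields no more than
    combining agreeing ones: \<open>|a - b| / (1 - a b)\<close> is at most
    \<open>(a + b) / (1 + a b)\<close>, here in a form without divisions.\<close>
  have both: "r * \<bar>a - b\<bar> \<le> p * (1 - a * b)" if "r * (a + b) \<le> p * (1 + a * b)"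
  proof -
    have "a * a * b \<le> b" "a * b * b \<le> a"
      using ab ab1 mult_mono[of "a * a" 1 b b] mult_mono[of a a "b * b" 1] by (auto simp: mult_le_one ac_simps)
    then have "\<bar>a - b\<bar> * (1 + a * b) \<le> (a + b) * (1 - a * b)"
      by (cases "a \<ge> b") (auto simp: algebra_simps)
    then have "r * (\<bar>a - b\<bar> * (1 + a * b)) \<le> r * ((a + b) * (1 - a * b))" using r by (rule mult_left_mono)
    also have "\<dots> \<le> p * (1 + a * b) * (1 - a * b)"
      using mult_right_mono[OF that, of "1 - a * b"] ab1 by (simp add: ac_simps)
    finally have "(r * \<bar>a - b\<bar>) * (1 + a * b) \<le> (p * (1 - a * b)) * (1 + a * b)" by (simp add: ac_simps)
    then show ?thesis using ab1 by (auto dest: mult_right_le_imp_le)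
  qed
  have pm: "p * (1 - a * b) \<le> p * (1 - c * (a * b))" using p cab by (intro mult_left_mono) auto
  have sum2: "p * (1 + d) + p * (1 - d) = 2 * p" for d by (simp add: algebra_simps)
  show "sign_mean 1 p r (a, b) \<le> sign_mean c p r (a, b)"
    using both pm sum2[of "a * b"] sum2[of "c * (a * b)"] unfolding e1 ec
    by (cases "r * (a + b) \<le> p * (1 + a * b)") (auto simp: max_def)
  assume s: "r * \<bar>a - b\<bar> < p * (1 - c * (a * b))" "p * (1 + c * (a * b)) < r * (a + b)" and c1: "c < 1"
  have "p > 0" using s(1) p mult_nonneg_nonneg[OF r abs_ge_zero[of "a - b"]] by (cases "p = 0") (auto simp del: zero_le_mult_iff)
  moreover have "a * b \<noteq> 0"
  proof
    assume "a * b = 0"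
    then show False using s ab by auto
  qed
  ultimately have "p * (1 - a * b) < p * (1 - c * (a * b))"
    using ab1(1) c1 mult_strict_right_mono[OF c1, of "a * b"] by (intro mult_strict_left_mono) linarith+
  then show "sign_mean 1 p r (a, b) < sign_mean c p r (a, b)"
    using both s pm sum2[of "a * b"] sum2[of "c * (a * b)"] unfolding e1 ec
    by (cases "r * (a + b) \<le> p * (1 + a * b)") (auto simp: max_def)
qed

lemma sign_mean_mono:
  assumes "\<bar>a\<bar> \<le> 1" "\<bar>b\<bar> \<le> 1" "0 \<le> c" "c \<le> 1"
  shows "sign_mean 1 p r (a, b) \<le> sign_mean c p r (a, b)"
    and "\<bar>r\<bar> * \<bar>\<bar>a\<bar> - \<bar>b\<bar>\<bar> < \<bar>p\<bar> * (1 - c * (\<bar>a\<bar> * \<bar>b\<bar>)) \<Longrightarrow> \<bar>p\<bar> * (1 + c * (\<bar>a\<bar> * \<bar>b\<bar>)) < \<bar>r\<bar> * (\<bar>a\<bar> + \<bar>b\<bar>) \<Longrightarrow> c < 1 \<Longrightarrow>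
      sign_mean 1 p r (a, b) < sign_mean c p r (a, b)"
  unfolding sign_mean_abs[of _ p r a b]
  using assms by (auto intro!: sign_mean_nonneg_mono)

lemma stringy_tree_star:
  assumes A: "bias_law A" "symmetric_law A" and B: "bias_law B" "symmetric_law B" and c: "0 \<le> c" "c \<le> 1"
  shows "scale c (star A B) \<sqsubseteq> star (scale c A) (scale c B)"
  unfolding less_informative_def spread_star_sign_mean[OF A B c]
proof (intro allI integral_mono_AE)
  fix p q
  have c2: "0 \<le> c\<^sup>2" "c\<^sup>2 \<le> 1" using c by (auto simp: power_le_one)
  show "AE z in A \<Otimes>\<^sub>M B. sign_mean 1 p (c * q) z \<le> sign_mean (c\<^sup>2) p (c * q) z"
    using pair_bias_law(3)[OF A(1) B(1)] by eventually_elim (use sign_mean_mono(1) c2 in \<open>auto simp: split_paired_all\<close>)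
qed (use c in \<open>auto intro!: sign_mean_integral[OF A B] simp: power_le_one\<close>)

lemma stringy_tree_star_power:
  assumes A: "bias_law A" "symmetric_law A" and c: "0 \<le> c" "c \<le> 1"
  shows "scale c (star_power d A) \<sqsubseteq> star_power d (scale c A)"
proof (induction d)
  case 0
  show ?case by (simp add: less_informative_def spread_scale bias_law_return_0)
next
  case (Suc d)
  have c1: "\<bar>c\<bar> \<le> 1" using c by simp
  have b: "bias_law (star_power d A)" "symmetric_law (star_power d A)" "bias_law (scale c A)"
    using A c1 by (auto intro: bias_law_star_power symmetric_law_star_power bias_law_scale)
  have "scale c (star A (star_power d A)) \<sqsubseteq> star (scale c A) (scale c (star_power d A))"
    by (rule stringy_tree_star[OF A b(1,2) c])
  also have "\<dots> \<sqsubseteq> star (scale c A) (star_power d (scale c A))"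
    using Suc b c1 A by (intro star_mono bias_law_scale bias_law_star_power) auto
  finally show ?case by simp
qed

lemma scale_commute: "bias_law A \<Longrightarrow> scale c (scale d A) = scale d (scale c A)"
  by (simp add: scale_scale mult.commute)

lemma stringy_tree_step:
  assumes A: "bias_law A" "symmetric_law A" and c: "0 \<le> c" "c \<le> 1" and l: "\<bar>l\<bar> \<le> 1"
  shows "scale c (bias_step P l A) \<sqsubseteq> bias_step P l (scale c A)"
  unfolding less_informative_def
proof (intro allI)
  fix p q
  have c1: "\<bar>c\<bar> \<le> 1" using c by simp
  have cA: "bias_law (scale c A)" "bias_law (scale l A)" "symmetric_law (scale l A)"
    "bias_law (scale l (scale c A))"
    using A c1 l by (auto intro: bias_law_scale symmetric_law_scale)
  show "spread (scale c (bias_step P l A)) p q \<le> spread (bias_step P l (scale c A)) p q"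
    unfolding spread_scale[OF bias_law_step[OF A(1) l]] spread_step[OF A(1) l] spread_step[OF cA(1) l]
  proof (intro integral_mono integrable_pmf_spread bias_law_star_power cA)
    fix d
    have "spread (star_power d (scale l A)) p (c * q) = spread (scale c (star_power d (scale l A))) p q"
      by (simp add: spread_scale cA bias_law_star_power)
    also have "\<dots> \<le> spread (star_power d (scale l (scale c A))) p q"
      using stringy_tree_star_power[OF cA(2,3) c] by (simp add: less_informative_def scale_commute[OF A(1), of l c])
    finally show "spread (star_power d (scale l A)) p (c * q) \<le> spread (star_power d (scale l (scale c A))) p q" .
  qed
qed

subsection \<open>Supports\<close>

text \<open>The topological support. A strict pointwise inequality on an open set that meets the
  support becomes a strict inequality between integrals.\<close>

definition law_support :: "'a :: topological_space measure \<Rightarrow> 'a set" where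
  "law_support A = {x. \<forall>U. open U \<longrightarrow> x \<in> U \<longrightarrow> emeasure A U \<noteq> 0}"

lemma law_supportI: "(\<And>U. open U \<Longrightarrow> x \<in> U \<Longrightarrow> emeasure A U \<noteq> 0) \<Longrightarrow> x \<in> law_support A"
  by (simp add: law_support_def)

lemma law_supportD: "x \<in> law_support A \<Longrightarrow> open U \<Longrightarrow> x \<in> U \<Longrightarrow> emeasure A U \<noteq> 0"
  by (simp add: law_support_def)

lemma law_support_AE:
  assumes x: "x \<in> law_support A" and s: "sets A = sets borel" and "AE y in A. y \<notin> U" and U: "open U"
  shows "x \<notin> U"
proof
  assume "x \<in> U"
  note [measurable_cong] = s
  have "U \<in> sets A" using U s by auto
  then have "emeasure A U = 0"
    using assms(3) sets.sets_into_space[of U A] by (subst (asm) AE_iff_measurable[of U]) auto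
  then show False using law_supportD[OF x U \<open>x \<in> U\<close>] by simp
qed

lemma law_support_AE_closed:
  assumes "x \<in> law_support A" "sets A = sets borel" "AE y in A. Q y" "closed {y. Q y}"
  shows "Q x"
  using law_support_AE[OF assms(1,2), of "- {y. Q y}"] assms(3,4) by (auto simp: open_Compl)

lemma law_support_abs_le: "x \<in> law_support A \<Longrightarrow> bias_law A \<Longrightarrow> \<bar>x\<bar> \<le> 1"
proof -
  assume x: "x \<in> law_support A" and A: "bias_law A"
  have "closed {y::real. \<bar>y\<bar> \<le> 1}" by (intro closed_Collect_le continuous_intros)
  from law_support_AE_closed[OF x bias_lawD(2)[OF A] bias_lawD(3)[OF A] this] show ?thesis .
qed

lemma law_support_limit:
  assumes "\<And>n. f n \<in> law_support A" "f \<longlonglongrightarrow> x"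
  shows "x \<in> law_support A"
proof (rule law_supportI)
  fix U assume U: "open U" "x \<in> U"
  then have "\<forall>\<^sub>F n in sequentially. f n \<in> U" using assms(2) by (simp add: topological_tendstoD)
  then obtain n where "f n \<in> U" by (auto simp: eventually_sequentially)
  then show "emeasure A U \<noteq> 0" using law_supportD[OF assms(1) U(1)] by auto
qed

lemma law_support_scale:
  assumes "x \<in> law_support A" "bias_law A"
  shows "c * x \<in> law_support (scale c A)"
proof (rule law_supportI)
  fix U :: "real set" assume U: "open U" "c * x \<in> U"
  have "open ((\<lambda>y. c * y) -` U)" by (intro open_vimage U continuous_intros)
  moreover have "emeasure (scale c A) U = emeasure A ((\<lambda>y. c * y) -` U)"
    unfolding scale_def using U bias_lawD(2)[OF assms(2)] sets_eq_imp_space_eq[OF bias_lawD(2)[OF assms(2)]]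
    by (subst emeasure_distr) (auto cong: measurable_cong_sets)
  ultimately show "emeasure (scale c A) U \<noteq> 0" using law_supportD[OF assms(1)] U by auto
qed

lemma law_support_uminus: "x \<in> law_support A \<Longrightarrow> bias_law A \<Longrightarrow> symmetric_law A \<Longrightarrow> - x \<in> law_support A"
  using law_support_scale[of x A "-1"] by (simp add: symmetric_law_def)

lemma law_support_return_0: "0 \<in> law_support (return borel (0::real))"
  by (intro law_supportI) (auto simp: emeasure_return indicator_def)

lemma law_support_pair:
  assumes A: "bias_law A" and B: "bias_law B" and "a \<in> law_support A" "b \<in> law_support B"
    and U: "open U" "(a, b) \<in> U"
  shows "emeasure (A \<Otimes>\<^sub>M B) U \<noteq> 0"
proof -
  interpret pair_prob_space A B by (rule pair_bias_law(1)[OF A B])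
  note [measurable_cong] = bias_lawD(2)[OF A] bias_lawD(2)[OF B]
  obtain V W where VW: "open V" "open W" "(a, b) \<in> V \<times> W" "V \<times> W \<subseteq> U"
    using open_prod_elim[OF U] by metis
  have "U \<in> sets (A \<Otimes>\<^sub>M B)"
    unfolding pair_bias_law(2)[OF A B] borel_prod using U by simp
  then have "emeasure (A \<Otimes>\<^sub>M B) (V \<times> W) \<le> emeasure (A \<Otimes>\<^sub>M B) U" using VW(4) by (rule emeasure_mono[rotated])
  moreover have "emeasure (A \<Otimes>\<^sub>M B) (V \<times> W) = emeasure A V * emeasure B W"
    using VW bias_lawD(2)[OF A] bias_lawD(2)[OF B] by (intro M2.emeasure_pair_measure_Times) auto
  moreover have "emeasure A V \<noteq> 0" "emeasure B W \<noteq> 0"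
    using VW law_supportD[OF assms(3)] law_supportD[OF assms(4)] by auto
  ultimately show ?thesis by auto
qed

text \<open>Where \<open>1 + a b > 0\<close>, the bias addition is continuous and the density is
  positive, so a neighbourhood of \<open>a \<boxplus> b\<close> pulls back to an open set of pairs
  which carries mass.\<close>

lemma law_support_star:
  assumes A: "bias_law A" and B: "bias_law B" and ab: "a \<in> law_support A" "b \<in> law_support B" "0 < 1 + a * b"
  shows "a \<boxplus> b \<in> law_support (star A B)"
proof (rule law_supportI, rule notI)
  fix U assume U: "open U" "a \<boxplus> b \<in> U" and z: "emeasure (star A B) U = 0"
  note [measurable_cong] = pair_bias_law(2)[OF A B]
  define S where "S = {z :: real \<times> real. 0 < 1 + fst z * snd z}"
  have S: "open S" unfolding S_def by (intro open_Collect_less continuous_intros)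
  have "continuous_on S (\<lambda>z. fst z \<boxplus> snd z)"
    unfolding bias_add_def by (intro continuous_intros) (auto simp: S_def)
  then have V: "open ((\<lambda>z. fst z \<boxplus> snd z) -` U \<inter> S)" using continuous_on_open_vimage[OF S] U(1) by auto
  have [measurable]: "U \<in> sets borel" using U by auto
  have "(\<integral>\<^sup>+z. ennreal (1 + fst z * snd z) * indicator U (fst z \<boxplus> snd z) \<partial>(A \<Otimes>\<^sub>M B)) = 0"
    using nn_integral_star[OF A B, of "indicator U"] z by (simp del: nn_integral_indicator add: nn_integral_indicator[of U "star A B"])
  then have "AE z in A \<Otimes>\<^sub>M B. ennreal (1 + fst z * snd z) * indicator U (fst z \<boxplus> snd z) = 0"
    by (subst (asm) nn_integral_0_iff_AE) auto
  then have ae: "AE z in A \<Otimes>\<^sub>M B. z \<notin> (\<lambda>z. fst z \<boxplus> snd z) -` U \<inter> S"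
    by eventually_elim (auto simp: S_def ennreal_eq_0_iff indicator_def split: if_splits)
  have m: "(\<lambda>z. fst z \<boxplus> snd z) -` U \<inter> S \<in> sets (A \<Otimes>\<^sub>M B)"
    unfolding pair_bias_law(2)[OF A B] borel_prod using V by simp
  have "emeasure (A \<Otimes>\<^sub>M B) ((\<lambda>z. fst z \<boxplus> snd z) -` U \<inter> S) = 0"
    using ae sets.sets_into_space[OF m] by (subst (asm) AE_iff_measurable[OF m]) auto
  then show False using law_support_pair[OF A B ab(1,2) V] U(2) ab(3) by (simp add: S_def)
qed

lemma law_support_mixture:
  assumes K: "\<And>d. bias_law (K d)" and d: "d \<in> set_pmf P" and x: "x \<in> law_support (K d)"
  shows "x \<in> law_support (measure_pmf (P :: nat pmf) \<bind> K)"
proof (rule law_supportI, rule notI)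
  fix U assume U: "open U" "x \<in> U" and z: "emeasure (measure_pmf P \<bind> K) U = 0"
  have m: "K \<in> measurable (measure_pmf P) (subprob_algebra borel)"
    by (intro measurable_pmf_kernel) (use K in \<open>auto simp: bias_law_def prob_space_imp_subprob_space\<close>)
  have "(\<integral>\<^sup>+d. emeasure (K d) U \<partial>measure_pmf P) = 0"
    using z U(1) emeasure_bind[OF _ m, of U] by simp
  then have "emeasure (K d) U = 0"
    using d by (subst (asm) nn_integral_0_iff_AE) (auto simp: AE_measure_pmf_iff)
  then show False using law_supportD[OF x U] by simp
qed

text \<open>The bound \<open>s\<close> is the essential supremum of \<open>|x|\<close>: the infimum
  of the almost sure bounds is one of them, by a countable intersection, and it is positive since
  only the trivial law sits at 0.\<close>

lemma bias_law_ess_bound: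
  assumes A: "bias_law A" "A \<noteq> return borel 0"
  obtains s where "0 < s" "s \<le> 1" "AE x in A. \<bar>x\<bar> \<le> s" "\<And>t. t < s \<Longrightarrow> \<not> (AE x in A. \<bar>x\<bar> \<le> t)"
proof -
  interpret prob_space A using A by (simp add: bias_law_def)
  define S where "S = {t. 0 \<le> t \<and> (AE x in A. \<bar>x\<bar> \<le> t)}"
  have 1: "1 \<in> S" using bias_lawD(3)[OF A(1)] by (simp add: S_def)
  have bdd: "bdd_below S" by (auto simp: S_def bdd_below_def)
  define s where "s = Inf S"
  have s1: "s \<le> 1" unfolding s_def by (rule cInf_lower[OF 1 bdd])
  have s0: "0 \<le> s" unfolding s_def
  proof (rule cInf_greatest)
    show "S \<noteq> {}" using 1 by blast
  qed (simp add: S_def)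
  have "AE x in A. \<forall>n. \<bar>x\<bar> \<le> s + inverse (real (Suc n))"
    unfolding AE_all_countable
  proof
    fix n
    have "Inf S < s + inverse (real (Suc n))" by (simp add: s_def)
    then obtain t where t: "t \<in> S" "t < s + inverse (real (Suc n))" using 1 by (metis cInf_lessD empty_iff)
    then have "AE x in A. \<bar>x\<bar> \<le> t" by (simp add: S_def)
    then show "AE x in A. \<bar>x\<bar> \<le> s + inverse (real (Suc n))" by eventually_elim (use t in linarith)
  qed
  then have ae: "AE x in A. \<bar>x\<bar> \<le> s"
  proof eventually_elim
    case (elim x)
    show ?case
    proof (rule LIMSEQ_le_const)
      show "(\<lambda>n. s + inverse (real (Suc n))) \<longlonglongrightarrow> s"
        using tendsto_add[OF tendsto_const[of s] LIMSEQ_inverse_real_of_nat] by simp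
      show "\<exists>N. \<forall>n\<ge>N. \<bar>x\<bar> \<le> s + inverse (real (Suc n))" using elim by blast
    qed
  qed
  have min: "\<not> (AE x in A. \<bar>x\<bar> \<le> t)" if "t < s" for t
  proof
    assume *: "AE x in A. \<bar>x\<bar> \<le> t"
    have "0 \<le> t"
    proof (rule ccontr)
      assume "\<not> 0 \<le> t"
      from * have "AE x in A. False" by eventually_elim (use \<open>\<not> 0 \<le> t\<close> in linarith)
      then show False by simp
    qed
    then have "t \<in> S" using * by (simp add: S_def)
    then show False using cInf_lower[OF _ bdd, of t] that by (simp add: s_def)
  qed
  have "s \<noteq> 0"
  proof
    assume "s = 0"
    have "spread A 0 1 = 0" unfolding spread_def
      by (rule integral_eq_zero_AE) (use ae \<open>s = 0\<close> in \<open>auto elim!: eventually_mono\<close>)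
    then show False using return_0_if_spread[OF A(1)] A(2) by simp
  qed
  then have "0 < s" using s0 by simp
  then show ?thesis using s1 ae min by (rule that)
qed

text \<open>By minimality of \<open>s\<close> there is mass near \<open>s\<close> or near
  \<open>-s\<close>; symmetry puts it near both.\<close>

lemma ess_bound_in_support:
  assumes A: "bias_law A" "symmetric_law A" and s: "0 < s" "AE x in A. \<bar>x\<bar> \<le> s"
    "\<And>t. t < s \<Longrightarrow> \<not> (AE x in A. \<bar>x\<bar> \<le> t)"
  shows "s \<in> law_support A"
proof (rule law_supportI, rule notI)
  fix U assume U: "open U" "s \<in> U" and z: "emeasure A U = 0"
  note [measurable_cong] = bias_lawD(2)[OF A(1)]
  have [measurable]: "U \<in> sets borel" using U by auto
  have ae1: "AE x in A. x \<notin> U" by (rule AE_not_in) (use z bias_lawD(2)[OF A(1)] in auto)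
  from this have "AE x in scale (-1) A. x \<notin> U" by (simp only: A(2)[unfolded symmetric_law_def])
  then have ae2: "AE x in A. - x \<notin> U" unfolding scale_def by (subst (asm) AE_distr_iff) auto
  obtain e where e: "e > 0" "\<And>y. dist y s < e \<Longrightarrow> y \<in> U" using U by (meson open_dist)
  have "AE x in A. \<bar>x\<bar> \<le> s - min e s / 2" using ae1 ae2 s(2)
  proof eventually_elim
    case (elim x)
    show ?case
    proof (rule ccontr)
      assume "\<not> \<bar>x\<bar> \<le> s - min e s / 2"
      then have "dist \<bar>x\<bar> s < e" using elim(3) e(1) s(1) by (simp add: dist_real_def min_def split: if_splits)
      then have "\<bar>x\<bar> \<in> U" by (rule e(2))
      then show False using elim(1,2) by (cases "x \<ge> 0") auto
    qed
  qed
  moreover have "s - min e s / 2 < s" using e s by auto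
  ultimately show False using s(3) by blast
qed

subsection \<open>Strictness\<close>

text \<open>The conditions on \<open>(a, b)\<close> are those under which \<open>sign_mean\<close>
  is strictly monotone with \<open>p = t\<close> and \<open>r = c\<close>. They are open, so they
  hold with positive probability once \<open>a\<close> and \<open>b\<close> are support
  points.\<close>

lemma stringy_tree_star_strict:
  assumes A: "bias_law A" "symmetric_law A" and B: "bias_law B" "symmetric_law B" and c: "0 \<le> c" "c < 1"
    and ab: "a \<in> law_support A" "b \<in> law_support B"
    and st: "c * \<bar>\<bar>a\<bar> - \<bar>b\<bar>\<bar> < t * (1 - c\<^sup>2 * (\<bar>a\<bar> * \<bar>b\<bar>))" "t * (1 + c\<^sup>2 * (\<bar>a\<bar> * \<bar>b\<bar>)) < c * (\<bar>a\<bar> + \<bar>b\<bar>)" "0 \<le> t"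
  shows "spread (scale c (star A B)) t 1 < spread (star (scale c A) (scale c B)) t 1"
proof -
  have c1: "c \<le> 1" using c by simp
  have c2: "0 \<le> c\<^sup>2" "c\<^sup>2 < 1" "c\<^sup>2 \<le> 1" "\<bar>c\<^sup>2\<bar> \<le> 1" using c by (auto simp: power_less_one_iff abs_square_le_1)
  define D where "D z = sign_mean (c\<^sup>2) t (c * 1) z - sign_mean 1 t (c * 1) z" for z
  have i: "integrable (A \<Otimes>\<^sub>M B) (sign_mean d t (c * 1))" if "\<bar>d\<bar> \<le> 1" for d
    by (rule sign_mean_integral(1)[OF A B that])
  have nn: "AE z in A \<Otimes>\<^sub>M B. 0 \<le> D z"
    using pair_bias_law(3)[OF A(1) B(1)]
  proof eventually_elim
    case (elim z)
    then show ?case using sign_mean_mono(1)[of "fst z" "snd z" "c\<^sup>2" t "c * 1"] c2 by (simp add: D_def)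
  qed
  define U where "U = {z :: real \<times> real. c * \<bar>\<bar>fst z\<bar> - \<bar>snd z\<bar>\<bar> < t * (1 - c\<^sup>2 * (\<bar>fst z\<bar> * \<bar>snd z\<bar>))
     \<and> t * (1 + c\<^sup>2 * (\<bar>fst z\<bar> * \<bar>snd z\<bar>)) < c * (\<bar>fst z\<bar> + \<bar>snd z\<bar>)}"
  have U: "open U" unfolding U_def by (intro open_Collect_conj open_Collect_less continuous_intros)
  have "(\<integral>z. D z \<partial>(A \<Otimes>\<^sub>M B)) \<noteq> 0"
  proof
    assume "(\<integral>z. D z \<partial>(A \<Otimes>\<^sub>M B)) = 0"
    moreover have "integrable (A \<Otimes>\<^sub>M B) D"
      unfolding D_def[abs_def] by (intro Bochner_Integration.integrable_diff i c2(4)) simp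
    ultimately have "AE z in A \<Otimes>\<^sub>M B. D z = 0" using nn by (subst (asm) integral_nonneg_eq_0_iff_AE) auto
    then have ae: "AE z in A \<Otimes>\<^sub>M B. z \<notin> U"
      using pair_bias_law(3)[OF A(1) B(1)]
    proof eventually_elim
      case (elim z)
      show ?case
      proof
        assume "z \<in> U"
        then have "D z > 0" using elim(2) sign_mean_mono(2)[of "fst z" "snd z" "c\<^sup>2" "c * 1" t] c2 c st(3)
          by (simp add: U_def D_def)
        then show False using elim(1) by simp
      qed
    qed
    have m: "U \<in> sets (A \<Otimes>\<^sub>M B)" unfolding pair_bias_law(2)[OF A(1) B(1)] borel_prod using U by simp
    have "emeasure (A \<Otimes>\<^sub>M B) U = 0"
      using ae sets.sets_into_space[OF m] by (subst (asm) AE_iff_measurable[OF m]) auto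
    then show False using law_support_pair[OF A(1) B(1) ab U] st by (simp add: U_def)
  qed
  moreover have "0 \<le> (\<integral>z. D z \<partial>(A \<Otimes>\<^sub>M B))" by (rule integral_nonneg_AE[OF nn])
  ultimately have "0 < (\<integral>z. D z \<partial>(A \<Otimes>\<^sub>M B))" by simp
  also have "\<dots> = spread (star (scale c A) (scale c B)) t 1 - spread (scale c (star A B)) t 1"
    unfolding D_def spread_star_sign_mean[OF A B c(1) c1]
    by (rule Bochner_Integration.integral_diff[OF i[OF c2(4)] i[of 1]]) simp
  finally show ?thesis by simp
qed

text \<open>The bias of \<open>n\<close> agreeing observations of bias \<open>a\<close>. As
  \<open>\<boxplus>\<close> is the addition formula of tanh, \<open>a = tanh u\<close> gives
  \<open>tanh (n u)\<close>.\<close>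

definition bias_sum :: "real \<Rightarrow> nat \<Rightarrow> real" where
  "bias_sum a n = ((\<lambda>b. a \<boxplus> b) ^^ n) 0"

lemma bias_sum_simps [simp]: "bias_sum a 0 = 0" "bias_sum a (Suc n) = a \<boxplus> bias_sum a n"
  by (simp_all add: bias_sum_def)

section \<open>Bounds for iterated bias addition\<close>

lemma bias_add_bounds:
  assumes "0 < a" "a < 1" "0 \<le> b" "b < 1"
  shows "b < a \<boxplus> b" "a \<boxplus> b < 1" "a \<le> a \<boxplus> b" "a \<boxplus> b \<le> a + b"
proof -
  have ab: "0 \<le> a * b" using assms by simp
  then have p: "0 < 1 + a * b" by linarith
  have "b * b < 1" using assms mult_strict_mono'[of b 1 b 1] by simp
  then have "a * b * b < a * 1" using assms mult_strict_left_mono[of "b * b" 1 a] by (simp add: mult.assoc)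
  then show "b < a \<boxplus> b" using p by (simp add: bias_add_def pos_less_divide_eq algebra_simps)
  have "0 < (1 - a) * (1 - b)" using assms by simp
  then show "a \<boxplus> b < 1" using p by (simp add: bias_add_def pos_divide_less_eq algebra_simps)
  have "a * a * b \<le> b" using assms mult_right_mono[of "a * a" 1 b] mult_le_one[of a a] by simp
  then show "a \<le> a \<boxplus> b" using p by (simp add: bias_add_def pos_le_divide_eq algebra_simps)
  have "(a + b) * 1 \<le> (a + b) * (1 + a * b)" using ab assms by (intro mult_left_mono) auto
  then show "a \<boxplus> b \<le> a + b" using p by (simp add: bias_add_def pos_divide_le_eq)
qed

lemma bias_sum_bounds:
  assumes "0 < a" "a < 1"
  shows "0 \<le> bias_sum a n" "bias_sum a n < 1" "bias_sum a n < bias_sum a (Suc n)" "a \<le> bias_sum a (Suc n)"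
proof -
  have *: "0 \<le> bias_sum a n \<and> bias_sum a n < 1" for n
  proof (induction n)
    case (Suc n)
    then show ?case using bias_add_bounds[OF assms, of "bias_sum a n"] assms by auto
  qed simp
  then show "0 \<le> bias_sum a n" "bias_sum a n < 1" by auto
  show "bias_sum a n < bias_sum a (Suc n)" "a \<le> bias_sum a (Suc n)"
    using * bias_add_bounds[OF assms, of "bias_sum a n"] by auto
qed

lemma bias_add_abs_mono:
  assumes "\<bar>x\<bar> \<le> a" "\<bar>y\<bar> \<le> b" "a < 1" "b < 1"
  shows "\<bar>x \<boxplus> y\<bar> \<le> a \<boxplus> b"
proof -
  have *: "x \<boxplus> y \<le> a \<boxplus> b" if "\<bar>x\<bar> \<le> a" "\<bar>y\<bar> \<le> b" for x y
  proof -
    have b1: "b * a < 1" using assms that mult_strict_mono'[of b 1 a 1] by linarith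
    have xy: "\<bar>x * y\<bar> < 1" using that assms mult_strict_mono'[of "\<bar>x\<bar>" 1 "\<bar>y\<bar>" 1] by (simp add: abs_mult)
    have "0 \<le> 1 - b * y" "0 \<le> 1 - a * x"
      using one_add_mult_nonneg[of "-b" y] one_add_mult_nonneg[of "-a" x] assms that by auto
    \<comment> \<open>This expression equals
      \<open>(a + b) (1 + x y) - (x + y) (1 + a b)\<close>.\<close>
    then have "0 \<le> (a - x) * (1 - b * y) + (b - y) * (1 - a * x)"
      using that by (intro add_nonneg_nonneg mult_nonneg_nonneg) auto
    then have "(x + y) * (1 + a * b) \<le> (a + b) * (1 + x * y)" by (simp add: algebra_simps)
    moreover have "0 < 1 + a * b" using that by (smt (verit) mult_nonneg_nonneg)
    moreover have "0 < 1 + x * y" using xy by linarith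
    ultimately show ?thesis unfolding bias_add_def by (simp add: pos_divide_le_eq pos_le_divide_eq)
  qed
  have "(- x) \<boxplus> (- y) = - (x \<boxplus> y)"
    unfolding bias_add_def by (simp add: minus_divide_left)
  then show ?thesis using *[OF assms(1,2)] *[of "-x" "-y"] assms by (simp add: abs_le_iff)
qed

lemma AE_star_power_bias_sum:
  assumes A: "bias_law A" "AE x in A. \<bar>x\<bar> \<le> a" and a: "0 < a" "a < 1"
  shows "AE x in star_power d A. \<bar>x\<bar> \<le> bias_sum a d"
proof (induction d)
  case 0
  show ?case unfolding star_power_simps by (subst AE_return) auto
next
  case (Suc d)
  note B = bias_law_star_power[OF A(1), of d]
  interpret pair_prob_space A "star_power d A" by (rule pair_bias_law(1)[OF A(1) B])
  note [measurable_cong] = bias_lawD(2)[OF A(1)] bias_lawD(2)[OF B]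
  have "AE z in A \<Otimes>\<^sub>M star_power d A. \<bar>fst z\<bar> \<le> a \<and> \<bar>snd z\<bar> \<le> bias_sum a d"
    by (rule AE_pair_measure) (use A(2) Suc in \<open>auto elim!: eventually_mono\<close>)
  then have "AE z in A \<Otimes>\<^sub>M star_power d A. 1 + fst z * snd z \<noteq> 0 \<longrightarrow> \<bar>fst z \<boxplus> snd z\<bar> \<le> bias_sum a (Suc d)"
    by eventually_elim (use bias_sum_bounds[OF a] a in \<open>auto intro!: bias_add_abs_mono\<close>)
  then show ?case unfolding star_power_simps by (intro AE_star[OF A(1) B]) auto
qed

lemma AE_mixture:
  assumes K: "\<And>d. bias_law (K d)" and "\<And>d. d \<in> set_pmf P \<Longrightarrow> AE x in K d. Q x" and Q: "Measurable.pred borel Q"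
  shows "AE x in (measure_pmf (P :: nat pmf) \<bind> K). Q x"
proof -
  have m: "K \<in> measurable (measure_pmf P) (subprob_algebra borel)"
    by (intro measurable_pmf_kernel) (use K in \<open>auto simp: bias_law_def prob_space_imp_subprob_space\<close>)
  show ?thesis by (subst AE_bind[OF m Q]) (use assms in \<open>auto simp: AE_measure_pmf_iff\<close>)
qed

subsection \<open>Noisy edges\<close>

lemma pmf_integral_strict_mono:
  fixes P :: "nat pmf" and f g :: "nat \<Rightarrow> real"
  assumes i: "integrable (measure_pmf P) f" "integrable (measure_pmf P) g" and le: "\<And>d. f d \<le> g d"
    and d: "d \<in> set_pmf P" "f d < g d"
  shows "(\<integral>d. f d \<partial>P) < (\<integral>d. g d \<partial>P)"
proof -
  have "(\<integral>d. g d - f d \<partial>P) \<noteq> 0"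
  proof
    assume "(\<integral>d. g d - f d \<partial>P) = 0"
    then have "AE d in measure_pmf P. g d - f d = 0"
      using le i by (subst (asm) integral_nonneg_eq_0_iff_AE) auto
    then show False using d by (auto simp: AE_measure_pmf_iff)
  qed
  moreover have "0 \<le> (\<integral>d. g d - f d \<partial>P)" using le by (intro integral_nonneg_AE) auto
  ultimately show ?thesis using i by (simp add: Bochner_Integration.integral_diff)
qed

lemma bias_add_0_right [simp]: "a \<boxplus> 0 = a" and bias_add_0_left [simp]: "0 \<boxplus> a = a"
  by (simp_all add: bias_add_def)

lemma one_add_mult_pos: "\<bar>a\<bar> < 1 \<Longrightarrow> \<bar>b\<bar> \<le> 1 \<Longrightarrow> 0 < 1 + a * (b::real)"
proof -
  assume "\<bar>a\<bar> < 1" "\<bar>b\<bar> \<le> 1"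
  then have "\<bar>a\<bar> * \<bar>b\<bar> < 1" by (metis abs_ge_zero mult_left_le order_le_less_trans)
  then show ?thesis by (simp flip: abs_mult)
qed

text \<open>Two further observations with biases \<open>x\<close> and \<open>-x\<close> cancel. The
  bound \<open>|x| < 1\<close> keeps the densities positive on the way.\<close>

lemma star_power_support_add_two:
  assumes L: "bias_law L" "symmetric_law L" and x: "x \<in> law_support L" "\<bar>x\<bar> < 1"
    and w: "w \<in> law_support (star_power n L)"
  shows "w \<in> law_support (star_power (Suc (Suc n)) L)"
proof -
  note b = bias_law_star_power[OF L(1)]
  have w1: "\<bar>w\<bar> \<le> 1" using law_support_abs_le[OF w b] .
  have v: "(- x) \<boxplus> w \<in> law_support (star_power (Suc n) L)"
    unfolding star_power_simps using law_support_uminus[OF x(1) L] w x(2) w1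
    by (intro law_support_star L b one_add_mult_pos) auto
  have v1: "\<bar>(- x) \<boxplus> w\<bar> \<le> 1" using law_support_abs_le[OF v b] .
  have "x \<boxplus> ((- x) \<boxplus> w) \<in> law_support (star_power (Suc (Suc n)) L)"
    unfolding star_power_simps(2)[of "Suc n"] using x v v1
    by (intro law_support_star L b one_add_mult_pos) auto
  moreover have "x \<boxplus> ((- x) \<boxplus> w) = w"
  proof -
    have "1 + - x * w \<noteq> 0" using one_add_mult_pos[of "-x" w] x(2) w1 by auto
    moreover have "x * x < 1" using x(2) by (simp flip: power2_eq_square add: abs_square_less_1)
    ultimately show ?thesis unfolding bias_add_def by (simp add: divide_simps) (simp add: algebra_simps)
  qed
  ultimately show ?thesis by simp
qed

lemma star_power_support_even_odd:
  assumes L: "bias_law L" "symmetric_law L" and x: "x \<in> law_support L" "\<bar>x\<bar> < 1"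
  shows "even d \<Longrightarrow> 0 \<in> law_support (star_power d L)"
    and "odd d \<Longrightarrow> x \<in> law_support (star_power d L)"
proof -
  have 1: "0 \<in> law_support (star_power (2 * k) L)" for k
    by (induction k) (auto simp: law_support_return_0 simp del: star_power_simps(2) intro: star_power_support_add_two[OF L x])
  have 2: "x \<in> law_support (star_power (Suc (2 * k)) L)" for k
  proof (induction k)
    case 0
    have "x \<boxplus> 0 \<in> law_support (star L (return borel 0))"
      using x by (intro law_support_star L bias_law_return_0 law_support_return_0) auto
    then show ?case by simp
  next
    case (Suc k)
    then show ?case using star_power_support_add_two[OF L x Suc] by (simp del: star_power_simps(2))
  qed
  show "even d \<Longrightarrow> 0 \<in> law_support (star_power d L)" using 1 by (auto elim: evenE)
  show "odd d \<Longrightarrow> x \<in> law_support (star_power d L)" using 2 by (auto elim!: oddE simp del: star_power_simps(2))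
qed

text \<open>Since 0 is a support point, any of the \<open>n\<close> observations may be nearly
  uninformative, so that shorter sums occur as well.\<close>

lemma star_power_support_bias_sum:
  assumes L: "bias_law L" and 0: "0 \<in> law_support L" and a: "a \<in> law_support L" "0 < a" "a < 1"
  shows "j \<le> n \<Longrightarrow> bias_sum a j \<in> law_support (star_power n L)"
proof (induction n arbitrary: j)
  case 0
  then show ?case using law_support_return_0 by simp
next
  case (Suc n)
  show ?case
  proof (cases "j \<le> n")
    case True
    have "0 \<boxplus> bias_sum a j \<in> law_support (star L (star_power n L))"
      using Suc.IH[OF True] 0 by (intro law_support_star L bias_law_star_power) auto
    then show ?thesis by simp
  next
    case False
    then have j: "j = Suc n" using Suc.prems by simp
    have "0 \<le> a * bias_sum a n" using bias_sum_bounds[OF a(2,3), of n] a by simp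
    then have "a \<boxplus> bias_sum a n \<in> law_support (star L (star_power n L))"
      using Suc.IH[of n] a by (intro law_support_star L bias_law_star_power) auto
    then show ?thesis using j by simp
  qed
qed

text \<open>The sign of the edge parameter is removed beforehand by \<open>bias_step_abs\<close>, so
  \<open>l\<close> is positive. With \<open>s\<close> the essential supremum of \<open>|x|\<close>
  under \<open>A\<close>, \<open>l < 1\<close> makes \<open>a = l * s\<close> smaller than
  \<open>s\<close> and than 1, which keeps finite bias sums of \<open>a\<close> inside the open
  interval.\<close>

locale nontrivial_fixed_law =
  fixes P :: "nat pmf" and l :: real and A :: "real measure" and s :: real
  assumes A: "bias_law A" "symmetric_law A" and l: "0 < l" "l < 1" and fix_A: "bias_step P l A = A"
    and s: "0 < s" "s \<le> 1" "AE x in A. \<bar>x\<bar> \<le> s" "\<And>t. t < s \<Longrightarrow> \<not> (AE x in A. \<bar>x\<bar> \<le> t)"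
begin

abbreviation "L \<equiv> scale l A"

lemma l1: "\<bar>l\<bar> \<le> 1" using l by simp

lemma L: "bias_law L" "symmetric_law L"
  using A l1 by (auto intro: bias_law_scale symmetric_law_scale)

lemma s_support: "s \<in> law_support A"
  by (rule ess_bound_in_support[OF A s(1,3,4)])

definition a where "a = l * s"

lemma a: "0 < a" "a < 1" "a < s" "a \<in> law_support L"
proof -
  show "0 < a" "a < s" using l s(1) mult_strict_right_mono[of l 1 s] by (auto simp: a_def)
  then show "a < 1" using s(2) by simp
  show "a \<in> law_support L" unfolding a_def by (rule law_support_scale[OF s_support A(1)])
qed

lemma AE_L: "AE x in L. \<bar>x\<bar> \<le> a"
proof -
  note [measurable_cong] = bias_lawD(2)[OF A(1)]
  have "AE x in A. \<bar>l * x\<bar> \<le> a" using s(3) by eventually_elim (use l in \<open>auto simp: abs_mult a_def\<close>)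
  then show ?thesis unfolding scale_def by (subst AE_distr_iff) auto
qed

text \<open>Otherwise the largest possible bias \<open>bias_sum a d\<close> would stay below one and
  the same \<open>s' < s\<close> for all degrees \<open>d\<close> that occur, against the minimality
  of \<open>s\<close> for the fixed law \<open>A\<close>. Degrees 0 and 1 give at most
  \<open>a\<close>, so the degree found is at least 2.\<close>

lemma ex_degree:
  assumes c: "0 \<le> c" "c < 1"
  obtains n where "0 < n" "Suc n \<in> set_pmf P" "s * (1 + c * (a * bias_sum a n)) < a + bias_sum a n"
proof (rule ccontr)
  note obtained = that
  assume "\<not> thesis"
  then have no: "a + bias_sum a n \<le> s * (1 + c * (a * bias_sum a n))" if "0 < n" "Suc n \<in> set_pmf P" for n
    using obtained[OF that] by (meson not_le)
  \<comment> \<open>The failed inequality bounds the bias by \<open>s (1 + c u) / (1 + u)\<close>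
    with \<open>u = a * bias_sum a n\<close>. This decreases in \<open>u\<close>, and
    \<open>u \<ge> a * a\<close>; the second entry is therefore a bound for all degrees at
    once.\<close>
  define s' where "s' = max a (s * ((1 + c * (a * a)) / (1 + a * a)))"
  have aa: "0 < a * a" using a by simp
  have "(1 + c * (a * a)) / (1 + a * a) < 1" using aa mult_strict_right_mono[OF c(2) aa] by (simp add: divide_less_eq_1)
  then have s': "s' < s" using a s mult_strict_left_mono[of "(1 + c * (a * a)) / (1 + a * a)" 1 s] by (simp add: s'_def)
  have b: "bias_sum a d \<le> s'" if d: "d \<in> set_pmf P" for d
  proof -
    consider "d = 0" | "d = 1" | m where "d = Suc (Suc m)" by (metis One_nat_def not0_implies_Suc)
    then show ?thesis
    proof cases
      case (3 m)
      define b where "b = bias_sum a (Suc m)"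
      have ba: "a \<le> b" unfolding b_def by (rule bias_sum_bounds(4)[OF a(1,2)])
      then have ab: "a * a \<le> a * b" using a by (intro mult_left_mono) auto
      have "a + b \<le> s * (1 + c * (a * b))" using no[of "Suc m"] d 3 by (simp add: b_def)
      then have "a \<boxplus> b \<le> s * (1 + c * (a * b)) / (1 + a * b)"
        unfolding bias_add_def using ab aa by (intro divide_right_mono) auto
      also have "\<dots> \<le> s * ((1 + c * (a * a)) / (1 + a * a))"
      proof -
        have "(1 - c) * (a * a) \<le> (1 - c) * (a * b)" using mult_left_mono[OF ab, of "1 - c"] c by simp
        then have "(1 + c * (a * b)) * (1 + a * a) \<le> (1 + c * (a * a)) * (1 + a * b)" by (simp add: algebra_simps)
        then have "(1 + c * (a * b)) / (1 + a * b) \<le> (1 + c * (a * a)) / (1 + a * a)"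
          using ab aa by (simp add: frac_le_eq divide_simps mult.commute)
        then show ?thesis using s by (simp add: mult_left_mono flip: times_divide_eq_right)
      qed
      finally show ?thesis using 3 by (simp add: b_def s'_def)
    qed (use a in \<open>auto simp: s'_def\<close>)
  qed
  have "AE x in bias_step P l A. \<bar>x\<bar> \<le> s'"
    unfolding bias_step_def
  proof (rule AE_mixture[OF bias_law_star_power[OF L(1)]])
    fix d assume "d \<in> set_pmf P"
    from b[OF this] show "AE x in star_power d L. \<bar>x\<bar> \<le> s'"
      using AE_star_power_bias_sum[OF L(1) AE_L a(1,2), of d] by (auto elim!: eventually_mono)
  qed auto
  then show False using s(4)[OF s'] by (simp only: fix_A) 
qed

lemma support_star_power_subset: "d \<in> set_pmf P \<Longrightarrow> x \<in> law_support (star_power d L) \<Longrightarrow> x \<in> law_support A"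
  using law_support_mixture[of "\<lambda>d. star_power d L" d P x] bias_law_star_power[OF L(1)] fix_A
  by (simp add: bias_step_def)

text \<open>An even degree lets the children cancel in pairs. An odd degree leaves one child over
  and carries a support point \<open>x\<close> to \<open>l * x\<close>; starting from
  \<open>s\<close>, the points \<open>l ^ k * s\<close> tend to 0, and the support is
  closed.\<close>

lemma zero_support: "0 \<in> law_support A"
proof -
  obtain n where n: "0 < n" "Suc n \<in> set_pmf P" using ex_degree[of 0] by auto
  have xl: "\<bar>x\<bar> < 1" if "x \<in> law_support L" for x
  proof -
    have "closed {y::real. \<bar>y\<bar> \<le> a}" by (intro closed_Collect_le continuous_intros)
    from law_support_AE_closed[OF that bias_lawD(2)[OF L(1)] AE_L this] show ?thesis using a by simp
  qed
  show ?thesis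
  proof (cases "even (Suc n)")
    case True
    show ?thesis
      by (rule support_star_power_subset[OF n(2)], rule star_power_support_even_odd(1)[OF L a(4) xl[OF a(4)] True])
  next
    case False
    have step: "l * x \<in> law_support A" if "x \<in> law_support A" for x
    proof -
      have "l * x \<in> law_support L" by (rule law_support_scale[OF that A(1)])
      then show ?thesis
        by (intro support_star_power_subset[OF n(2)] star_power_support_even_odd(2)[OF L _ xl False])
    qed
    have "l ^ k * s \<in> law_support A" for k
    proof (induction k)
      case (Suc k)
      then show ?case using step[OF Suc] by (simp add: ac_simps)
    qed (simp add: s_support)
    moreover have "(\<lambda>k. l ^ k * s) \<longlonglongrightarrow> 0"
      using tendsto_mult_right[OF LIMSEQ_power_zero[of l], of s] l by simp
    ultimately show ?thesis by (rule law_support_limit)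
  qed
qed

lemma zero_support_L: "0 \<in> law_support L"
  using law_support_scale[OF zero_support A(1), of l] by simp

text \<open>Strictness is gained in the outermost star product, at the pair of \<open>a\<close> and
  \<open>bias_sum a j\<close> for a suitable \<open>j \<le> n\<close>; all such pairs are available
  because 0 is a support point. The remaining factors only need the weak inequality.\<close>

lemma strict_star_power:
  assumes c: "0 < c" "c < 1" and t: "0 < t" "t \<le> c * s"
    and n: "0 < n" "s * (1 + c\<^sup>2 * (a * bias_sum a n)) < a + bias_sum a n"
  shows "spread (star_power (Suc n) L) t c < spread (star_power (Suc n) (scale c L)) t 1"
proof -
  define b where "b = bias_sum a"
  have c1: "0 \<le> c" "c \<le> 1" "\<bar>c\<bar> \<le> 1" "c\<^sup>2 \<le> 1" "0 < c\<^sup>2" using c by (auto simp: power_le_one)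
  have b0: "0 \<le> b j" "b j < 1" for j using bias_sum_bounds[OF a(1,2)] by (auto simp: b_def)
  define Q where "Q j \<longleftrightarrow> 0 < j \<and> t * (1 + c\<^sup>2 * (a * b j)) < c * (a + b j)" for j
  have "t * (1 + c\<^sup>2 * (a * b n)) \<le> (c * s) * (1 + c\<^sup>2 * (a * b n))"
    using t b0[of n] a by (intro mult_right_mono) auto
  also have "\<dots> < c * (a + b n)" using n(2) c by (simp add: b_def mult.assoc)
  finally have Qn: "Q n" using n by (simp add: Q_def)
  \<comment> \<open>The two conditions of strictness pull in opposite directions. The least
    \<open>j\<close> that satisfies the upper one also satisfies the lower one: for
    \<open>j = 1\<close> the two biases agree, and otherwise failure at \<open>j - 1\<close> yields
    \<open>c * b (j - 1) < t\<close>.\<close>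
  define j where "j = (LEAST j. Q j)"
  have Qj: "Q j" unfolding j_def by (rule LeastI[of Q, OF Qn])
  have jn: "j \<le> n" unfolding j_def by (rule Least_le[of Q, OF Qn])
  have lower: "c * \<bar>a - b j\<bar> < t * (1 - c\<^sup>2 * (a * b j))"
  proof (cases "j = 1")
    case True
    have "c\<^sup>2 * (a * a) \<le> a * a" using a c1 by (intro mult_left_le_one_le) auto
    moreover have "a * a < 1" using a mult_strict_mono'[of a 1 a 1] by simp
    ultimately have "c\<^sup>2 * (a * a) < 1" by linarith
    then show ?thesis using True t by (simp add: b_def)
  next
    case False
    then obtain i where i: "j = Suc i" "0 < i" using Qj by (cases j) (auto simp: Q_def)
    have "\<not> Q i" using not_less_Least[of i Q] i by (simp add: j_def)
    then have ge: "c * (a + b i) \<le> t * (1 + c\<^sup>2 * (a * b i))" using i by (simp add: Q_def)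
    define B where "B = b i"
    have B: "0 \<le> B" "B < 1" using b0 by (auto simp: B_def)
    have bj: "b j = (a + B) / (1 + a * B)" by (simp add: i b_def B_def bias_add_def)
    have aB: "0 \<le> a * B" using a B by simp
    have aa: "a * a < 1" using a mult_strict_mono'[of a 1 a 1] by simp
    have "c\<^sup>2 * (a * B) \<le> a * B" using aB c1 by (intro mult_left_le_one_le) auto
    then have "t * (1 + c\<^sup>2 * (a * B)) \<le> t * (1 + a * B)" using t by (intro mult_left_mono) auto
    with ge have "c * (a + B) \<le> t * (1 + a * B)" by (simp add: B_def)
    then have "c * b j \<le> t" using aB by (simp add: bj pos_divide_le_eq)
    moreover have "B < b j" using bias_sum_bounds(3)[OF a(1,2), of i] by (simp add: i b_def B_def)
    ultimately have cB: "c * B < t" using c mult_strict_left_mono[of B "b j" c] by linarith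
    have c2: "c\<^sup>2 * (a * a) \<le> a * a" using a c1 by (intro mult_left_le_one_le) auto
    have "c * B * (1 - a * a) < t * (1 - a * a)" using cB aa by (intro mult_strict_right_mono) auto
    also have "\<dots> \<le> t * (1 + a * B - c\<^sup>2 * (a * a) - c\<^sup>2 * (a * B))"
      using t c2 \<open>c\<^sup>2 * (a * B) \<le> a * B\<close> by (intro mult_left_mono) auto
    finally have main: "c * (B * (1 - a * a)) / (1 + a * B) < t * (1 + a * B - c\<^sup>2 * (a * a) - c\<^sup>2 * (a * B)) / (1 + a * B)"
      using aB by (intro divide_strict_right_mono) auto
    have "b j - a = B * (1 - a * a) / (1 + a * B)" using aB by (simp add: bj field_simps)
    moreover have "1 - c\<^sup>2 * (a * b j) = (1 + a * B - c\<^sup>2 * (a * a) - c\<^sup>2 * (a * B)) / (1 + a * B)"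
      using aB by (simp add: bj field_simps)
    moreover have "\<bar>a - b j\<bar> = b j - a" using bias_sum_bounds(4)[OF a(1,2), of i] by (simp add: i b_def)
    ultimately show ?thesis using main by (simp add: mult.assoc)
  qed
  note sp = bias_law_star_power[OF L(1), of n] symmetric_law_star_power[OF L, of n]
  have "b j \<in> law_support (star_power n L)"
    unfolding b_def by (rule star_power_support_bias_sum[OF L(1) zero_support_L a(4,1,2) jn])
  then have "spread (scale c (star L (star_power n L))) t 1 < spread (star (scale c L) (scale c (star_power n L))) t 1"
    using Qj lower a b0[of j] t
    by (intro stringy_tree_star_strict[OF L sp c1(1) c(2) a(4)]) (auto simp: Q_def)
  also have "\<dots> \<le> spread (star (scale c L) (star_power n (scale c L))) t 1"
  proof -
    have "star (scale c L) (scale c (star_power n L)) \<sqsubseteq> star (scale c L) (star_power n (scale c L))"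
      using stringy_tree_star_power[OF L c1(1,2)] A l1 sp c1(3)
      by (intro star_mono bias_law_scale bias_law_star_power) auto
    then show ?thesis by (simp add: less_informative_def)
  qed
  finally show ?thesis by (simp add: spread_scale bias_law_star L sp)
qed

lemma termwise:
  assumes c: "0 \<le> c" "c \<le> 1"
  shows "spread (star_power d L) p (c * q) \<le> spread (star_power d (scale c L)) p q"
  using stringy_tree_star_power[OF L c, of d] by (simp add: less_informative_def spread_scale L bias_law_star_power)

text \<open>The equation for \<open>A\<close> is a mean over degrees; each degree satisfies the weak
  inequality and the degree from \<open>ex_degree\<close> the strict one. The endpoint
  \<open>t = c * s\<close>, where \<open>spread A t c\<close> is already \<open>t\<close>, is
  included on purpose: the argument against touching ends there.\<close>

lemma strict_step:
  assumes c: "0 < c" "c < 1" and t: "0 < t" "t \<le> c * s"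
  shows "spread A t c < spread (bias_step P l (scale c A)) t 1"
proof -
  have c1: "0 \<le> c" "c \<le> 1" "\<bar>c\<bar> \<le> 1" "0 \<le> c\<^sup>2" "c\<^sup>2 < 1" using c by (auto simp: power_less_one_iff abs_square_less_1)
  obtain n where n: "0 < n" "Suc n \<in> set_pmf P" "s * (1 + c\<^sup>2 * (a * bias_sum a n)) < a + bias_sum a n"
    using ex_degree[OF c1(4,5)] .
  have "spread A t c = spread (bias_step P l A) t c" by (simp only: fix_A)
  also have "\<dots> = (\<integral>d. spread (star_power d L) t c \<partial>P)" by (rule spread_step[OF A(1) l1])
  also have "\<dots> < (\<integral>d. spread (star_power d (scale c L)) t 1 \<partial>P)"
    using termwise[OF c1(1,2), of _ t 1] strict_star_power[OF c t n(1,3)]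
    by (intro pmf_integral_strict_mono[OF _ _ _ n(2)] integrable_pmf_spread bias_law_star_power bias_law_scale L c1) auto
  also have "\<dots> = spread (bias_step P l (scale c A)) t 1"
    by (simp add: spread_step A l1 bias_law_scale c1 scale_commute[OF A(1), of l c])
  finally show ?thesis .
qed

lemma unique_below:
  assumes B: "bias_law B" "symmetric_law B" "bias_step P l B = B" and BA: "B \<sqsubseteq> A"
    and c0: "0 < c0" "c0 \<le> 1" "scale c0 A \<sqsubseteq> B"
  shows "B = A"
proof -
  define S where "S = {c \<in> {0..1}. \<forall>p q. spread A p (c * q) \<le> spread B p q}"
  have "S = {0..1} \<inter> (\<Inter>p. \<Inter>q. {c. spread A p (c * q) \<le> spread B p q})" by (auto simp: S_def)
  moreover have "closed {c. spread A p (c * q) \<le> spread B p q}" for p q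
    by (intro closed_Collect_le continuous_on_spread[OF A(1)] continuous_intros)
  ultimately have "closed S" by (auto intro!: closed_INT closed_Int)
  moreover have "bounded S" by (rule bounded_subset[of "{0..1}"]) (auto simp: S_def)
  ultimately have "compact S" by (simp add: compact_eq_bounded_closed)
  moreover have c0S: "c0 \<in> S" using c0 by (auto simp: S_def less_informative_def spread_scale[OF A(1)])
  ultimately obtain c where cS: "c \<in> S" and max: "\<And>c'. c' \<in> S \<Longrightarrow> c' \<le> c"
    using compact_attains_sup[of S] by blast
  have c: "0 < c" "c \<le> 1" using max[OF c0S] c0 cS by (auto simp: S_def)
  have cB: "scale c A \<sqsubseteq> B" using cS by (simp add: S_def less_informative_def spread_scale[OF A(1)])
  show ?thesis
  proof (cases "c = 1")
    case True
    then have "A \<sqsubseteq> B" using cS by (simp add: S_def less_informative_def)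
    then show ?thesis using less_informative_antisym[OF BA] A B by simp
  next
    case False
    then have c1: "c < 1" "\<bar>c\<bar> \<le> 1" using c by auto
    have cA: "bias_law (scale c A)" by (rule bias_law_scale[OF A(1) c1(2)])
    have above: "spread (bias_step P l (scale c A)) p q \<le> spread B p q" for p q
      using bias_step_mono[OF cB cA B(1) l1, of P] B(3) by (simp add: less_informative_def)
    have no_touch: "spread A t c < spread B t 1" if "0 < t" "t \<le> c * s" for t
      using strict_step[OF c(1) c1(1) that] above[of t 1] by linarith
    \<comment> \<open>Scales in \<open>(c, 1]\<close> tending to \<open>c\<close>. By maximality of
      \<open>c\<close> each of them violates the comparison at some \<open>(p, q)\<close>, and the
      limit of these witnesses is a touching point.\<close>
    define e where "e n = c + (1 - c) / real (Suc n)" for n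
    have e: "c < e n" "e n \<le> 1" for n
      using c1 divide_left_mono[of 1 "real (Suc n)" "1 - c"] by (simp_all add: e_def del: of_nat_Suc)
    have e_lim: "e \<longlonglongrightarrow> c"
      using tendsto_add[OF tendsto_const[of c] tendsto_mult_right[OF LIMSEQ_inverse_real_of_nat, of "1 - c"]]
      by (simp add: e_def[abs_def] divide_inverse mult.commute)
    have "\<exists>t. 0 \<le> t \<and> t < e n * s \<and> spread B t 1 < spread A t (e n)" for n
    proof -
      have "e n \<notin> S" using max[of "e n"] e[of n] by auto
      then obtain p q where pq: "spread B p q < spread A p (e n * q)"
        using e[of n] c by (auto simp: S_def not_le)
      have "q \<noteq> 0" using pq by (auto simp: spread_0_right A B)
      define t where "t = \<bar>p\<bar> / \<bar>q\<bar>"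
      have pt: "\<bar>p\<bar> = \<bar>q\<bar> * t" using \<open>q \<noteq> 0\<close> by (simp add: t_def)
      have "spread B p q = \<bar>q\<bar> * spread B t 1"
        using symmetric_law_spread_abs[OF B(2,1), of p q] spread_cmult[of B "\<bar>q\<bar>" t 1] by (simp add: pt)
      moreover have "spread A p (e n * q) = \<bar>q\<bar> * spread A t (e n)"
        using symmetric_law_spread_abs[OF A(2,1), of p "e n * q"] spread_cmult[of A "\<bar>q\<bar>" t "e n"] e[of n] c
        by (simp add: pt abs_mult mult.commute)
      ultimately have less: "spread B t 1 < spread A t (e n)" using pq \<open>q \<noteq> 0\<close> by simp
      \<comment> \<open>At larger ratios the integrand does not change sign under \<open>A\<close>,
        so its integral is \<open>t\<close>, which no spread undercuts.\<close>
      have "t < e n * s"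
      proof (rule ccontr)
        assume ts: "\<not> t < e n * s"
        have "spread A t (e n) = (\<integral>x. t + e n * x \<partial>A)"
          unfolding spread_def
        proof (rule integral_cong_AE)
          note [measurable_cong] = bias_lawD(2)[OF A(1)]
          show "(\<lambda>x. \<bar>t + e n * x\<bar>) \<in> borel_measurable A" "(\<lambda>x. t + e n * x) \<in> borel_measurable A" by measurable
          show "AE x in A. \<bar>t + e n * x\<bar> = t + e n * x"
            using s(3)
          proof eventually_elim
            case (elim x)
            then have "\<bar>e n * x\<bar> \<le> e n * s" using e[of n] c by (simp add: abs_mult)
            then show ?case using ts by linarith
          qed
        qed
        then show False using less spread_ge[OF B(1), of t 1] bias_law_integral_affine[OF A(1)] by simp
      qed
      then show ?thesis using less by (intro exI[of _ t]) (simp add: t_def)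
    qed
    then obtain t where t: "\<And>n. 0 \<le> t n" "\<And>n. t n < e n * s" "\<And>n. spread B (t n) 1 < spread A (t n) (e n)"
      by metis
    have "t n \<in> {0..1}" for n
      using t(1,2)[of n] e[of n] s c mult_le_one[of "e n" s] by auto
    then obtain t0 r where r: "t0 \<in> {0..1}" "strict_mono (r :: nat \<Rightarrow> nat)" "(t \<circ> r) \<longlonglongrightarrow> t0"
      using compact_imp_seq_compact[OF compact_Icc[of "0::real" 1]] unfolding seq_compact_def by blast
    have er: "(\<lambda>n. e (r n)) \<longlonglongrightarrow> c" using LIMSEQ_subseq_LIMSEQ[OF e_lim r(2)] by (simp add: comp_def)
    have tr: "(\<lambda>n. t (r n)) \<longlonglongrightarrow> t0" using r(3) by (simp add: comp_def)
    have t0s: "t0 \<le> c * s"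
      by (rule LIMSEQ_le[OF tr tendsto_mult_right[OF er, of s]]) (use t(2) in \<open>auto intro: less_imp_le\<close>)
    have lim: "(\<lambda>n. spread C (f n) (g n)) \<longlonglongrightarrow> spread C x y"
      if "bias_law C" "f \<longlonglongrightarrow> x" "g \<longlonglongrightarrow> y" for C f g x y
    proof -
      have "continuous_on UNIV (\<lambda>z. spread C (fst z) (snd z))"
        by (intro continuous_on_spread that continuous_intros)
      from continuous_on_tendsto_compose[OF this tendsto_Pair[OF that(2,3)]] show ?thesis by simp
    qed
    have touch: "spread B t0 1 \<le> spread A t0 c"
      by (rule LIMSEQ_le[OF lim[OF B(1) tr tendsto_const[of 1]] lim[OF A(1) tr er]])
         (use t(3) in \<open>auto intro: less_imp_le\<close>)
    \<comment> \<open>Positive ratios up to \<open>c * s\<close> are excluded by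
      \<open>no_touch\<close>; the rest of the proof deals with ratio 0.\<close>
    have "t0 = 0" using no_touch[of t0] touch t0s r(1) by force
    obtain n where n: "0 < n" "Suc n \<in> set_pmf P" using ex_degree[of 0] by auto
    let ?C = "scale c L" and ?D = "scale l B"
    have CL: "bias_law ?C" "symmetric_law ?C" and D: "bias_law ?D"
      using L B l1 c1 by (auto intro: bias_law_scale symmetric_law_scale)
    have C': "?C = scale l (scale c A)" by (rule scale_commute[OF A(1)])
    have CD: "?C \<sqsubseteq> ?D" unfolding C' by (rule scale_mono[OF cA B(1) cB])
    \<comment> \<open>Touching at ratio 0 closes a chain of inequalities that holds degree by
      degree. A strict inequality in a single degree of positive probability would break it, so the
      spreads agree in degree \<open>Suc n\<close>.\<close>
    have eq: "spread (star_power (Suc n) ?D) 0 1 \<le> spread (star_power (Suc n) ?C) 0 1"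
    proof (rule ccontr)
      assume "\<not> ?thesis"
      then have "(\<integral>d. spread (star_power d ?C) 0 1 \<partial>P) < (\<integral>d. spread (star_power d ?D) 0 1 \<partial>P)"
        using star_power_mono[OF CD CL(1) D]
        by (intro pmf_integral_strict_mono[OF _ _ _ n(2)] integrable_pmf_spread bias_law_star_power CL D)
           (auto simp: less_informative_def)
      also have "\<dots> = spread B 0 1" using spread_step[OF B(1) l1, of P 0 1] B(3) by simp
      also have "\<dots> \<le> spread A 0 c" using touch \<open>t0 = 0\<close> by simp
      also have "\<dots> = (\<integral>d. spread (star_power d L) 0 c \<partial>P)"
        using spread_step[OF A(1) l1, of P 0 c] fix_A by simp
      also have "\<dots> \<le> (\<integral>d. spread (star_power d ?C) 0 1 \<partial>P)"
        using termwise[of c _ 0 1] c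
        by (intro integral_mono integrable_pmf_spread bias_law_star_power CL L) auto
      finally show False by simp
    qed
    \<comment> \<open>Only one child is compared now, the other \<open>n\<close> staying at the law
      \<open>W\<close> from \<open>?C\<close>. The spread at ratio 0 becomes a
      \<open>W\<close>-average of spreads of that child at ratios \<open>w\<close>, so these agree
      for almost all \<open>w\<close>, hence by continuity on the whole support of
      \<open>W\<close>.\<close>
    define W where "W = star_power n ?C"
    have W: "bias_law W" unfolding W_def by (rule bias_law_star_power[OF CL(1)])
    have "star ?D W \<sqsubseteq> star_power (Suc n) ?D"
      unfolding W_def star_power_simps
      by (intro star_mono star_power_mono CD CL D bias_law_star_power) auto
    then have "spread (star ?D W) 0 1 \<le> spread (star ?C W) 0 1"
      using eq unfolding less_informative_def W_def star_power_simps by (meson order_trans)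
    then have int: "(\<integral>w. spread ?D w 1 \<partial>W) \<le> (\<integral>w. spread ?C w 1 \<partial>W)"
      by (simp add: spread_star(2)[OF D W] spread_star(2)[OF CL(1) W])
    define g where "g w = spread ?D w 1 - spread ?C w 1" for w
    have g0: "0 \<le> g w" for w using CD by (simp add: g_def less_informative_def)
    have i: "integrable W (\<lambda>w. spread C w 1)" if "bias_law C" for C
    proof (rule bias_law_integrable[OF W, of _ 2])
      show "(\<lambda>w. spread C w 1) \<in> borel_measurable borel" using that by measurable
      show "\<bar>spread C w 1\<bar> \<le> 2" if "\<bar>w\<bar> \<le> 1" for w
        using spread_le[OF \<open>bias_law C\<close>, of w 1] spread_nonneg[of C w 1] that by simp
    qed
    have "(\<integral>w. g w \<partial>W) = (\<integral>w. spread ?D w 1 \<partial>W) - (\<integral>w. spread ?C w 1 \<partial>W)"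
      unfolding g_def by (rule Bochner_Integration.integral_diff[OF i[OF D] i[OF CL(1)]])
    then have "(\<integral>w. g w \<partial>W) = 0" using int Bochner_Integration.integral_nonneg[of W g] g0 by simp
    moreover have "integrable W g" unfolding g_def[abs_def] by (rule Bochner_Integration.integrable_diff[OF i[OF D] i[OF CL(1)]])
    ultimately have ae: "AE w in W. g w = 0" using g0 by (subst (asm) integral_nonneg_eq_0_iff_AE) auto
    have cl: "closed {w. g w = 0}"
      unfolding g_def by (intro closed_Collect_eq continuous_on_diff continuous_on_spread D CL continuous_intros)
    have ca: "c * a \<in> law_support ?C" by (rule law_support_scale[OF a(4) L(1)])
    have "0 \<in> law_support ?C" using law_support_scale[OF zero_support_L L(1), of c] by simp
    moreover have "0 < c * a" "c * a < 1" using a c c1 mult_strict_mono'[of c 1 a 1] by auto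
    ultimately have "bias_sum (c * a) 1 \<in> law_support W"
      unfolding W_def using n by (intro star_power_support_bias_sum[OF CL(1)] ca) auto
    then have "c * a \<in> law_support W" by simp
    \<comment> \<open>The support point \<open>c * a\<close> arises from one informative child among
      the \<open>n\<close>. Since \<open>a = l * s\<close>, dividing by \<open>l\<close> gives
      touching of \<open>B\<close> and \<open>c A\<close> at ratio \<open>c * s\<close>.\<close>
    from law_support_AE_closed[OF this bias_lawD(2)[OF W] ae cl] have "g (c * a) = 0" .
    then have "spread B (c * a) l = spread A (c * a) (c * l)"
      by (simp add: g_def spread_scale B A L scale_scale mult.commute)
    moreover have "spread B (c * a) l = l * spread B (c * s) 1" "spread A (c * a) (c * l) = l * spread A (c * s) c"
      using spread_cmult[of B l "c * s" 1] spread_cmult[of A l "c * s" c] l by (simp_all add: a_def ac_simps)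
    ultimately have "spread B (c * s) 1 = spread A (c * s) c" using l by simp
    then show ?thesis using no_touch[of "c * s"] c s by simp
  qed
qed

end

subsection \<open>Deterministic edges\<close>

lemma scale_1: "bias_law A \<Longrightarrow> scale 1 A = A"
  by (simp add: scale_def distr_id2 bias_law_def)

text \<open>The likelihoods under either value of the bit multiply. This underlies both the
  multiplicativity of the Hellinger integrals and the additivity of log-likelihood ratios.\<close>

lemma bias_add_one_plus_minus:
  assumes "\<bar>a\<bar> \<le> 1" "\<bar>b\<bar> \<le> 1"
  shows "(1 + a * b) * (1 + (a \<boxplus> b)) = (1 + a) * (1 + b)" "(1 + a * b) * (1 - (a \<boxplus> b)) = (1 - a) * (1 - b)"
  using bias_add_cancel[OF assms] by (simp_all add: algebra_simps)

text \<open>With \<open>\<alpha> = k / 4\<close> this is the integrand \<open>(1 + x)\<^sup>\<alpha> (1 - x)\<^sup>1\<^sup>-\<^sup>\<alpha>\<close> of an affinity of the two conditional laws.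
  With \<open>u, v\<close> the fourth roots of \<open>1 \<plusminus> x\<close>, the cases \<open>k = 1, 3\<close> minus twice \<open>k = 2\<close> add up to \<open>u v (u - v)\<^sup>2\<close>,
  which vanishes only for \<open>x \<in> {-1, 0, 1}\<close>.\<close>

definition hellinger :: "nat \<Rightarrow> real \<Rightarrow> real" where
  "hellinger k x = root 4 \<bar>1 + x\<bar> ^ k * root 4 \<bar>1 - x\<bar> ^ (4 - k)"

lemma measurable_hellinger [measurable]: "hellinger k \<in> borel_measurable borel"
  unfolding hellinger_def[abs_def]
  by (intro borel_measurable_continuous_onI continuous_intros)

lemma hellinger_bounds:
  assumes "\<bar>x\<bar> \<le> 1" "k \<le> 4"
  shows "0 \<le> hellinger k x" "hellinger k x \<le> 2"
proof -
  show "0 \<le> hellinger k x" by (simp add: hellinger_def)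
  let ?r = "root 4 2"
  have "root 4 \<bar>1 + x\<bar> \<le> ?r" "root 4 \<bar>1 - x\<bar> \<le> ?r" using assms by (auto simp: abs_le_iff)
  then have "hellinger k x \<le> ?r ^ k * ?r ^ (4 - k)" unfolding hellinger_def
    by (intro mult_mono power_mono) auto
  also have "\<dots> = 2" using assms(2) by (simp flip: power_add add: real_root_pow_pos2)
  finally show "hellinger k x \<le> 2" .
qed

text \<open>The exponents \<open>k\<close> and \<open>4 - k\<close> add up to 4, so the fourth roots
  absorb exactly one factor \<open>1 + a b\<close>.\<close>

lemma hellinger_mult:
  assumes ab: "\<bar>a\<bar> \<le> 1" "\<bar>b\<bar> \<le> 1" and k: "k \<le> 4"
  shows "(1 + a * b) * hellinger k (a \<boxplus> b) = hellinger k a * hellinger k b"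
proof -
  have p: "0 \<le> 1 + a * b" by (rule one_add_mult_nonneg[OF ab])
  let ?t = "root 4 (1 + a * b)"
  have "1 + a * b = ?t ^ 4" using p by (simp add: real_root_pow_pos2)
  also have "\<dots> = ?t ^ k * ?t ^ (4 - k)" using k by (simp flip: power_add)
  finally have "(1 + a * b) * hellinger k (a \<boxplus> b) = (?t * root 4 \<bar>1 + (a \<boxplus> b)\<bar>) ^ k * (?t * root 4 \<bar>1 - (a \<boxplus> b)\<bar>) ^ (4 - k)"
    by (simp add: hellinger_def power_mult_distrib)
  also have "?t * root 4 \<bar>1 + (a \<boxplus> b)\<bar> = root 4 \<bar>1 + a\<bar> * root 4 \<bar>1 + b\<bar>"
  proof -
    have "(1 + a * b) * \<bar>1 + (a \<boxplus> b)\<bar> = \<bar>1 + a\<bar> * \<bar>1 + b\<bar>"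
      using p bias_add_one_plus_minus(1)[OF ab] by (metis abs_mult abs_of_nonneg)
    then show ?thesis by (simp flip: real_root_mult)
  qed
  also have "?t * root 4 \<bar>1 - (a \<boxplus> b)\<bar> = root 4 \<bar>1 - a\<bar> * root 4 \<bar>1 - b\<bar>"
  proof -
    have "(1 + a * b) * \<bar>1 - (a \<boxplus> b)\<bar> = \<bar>1 - a\<bar> * \<bar>1 - b\<bar>"
      using p bias_add_one_plus_minus(2)[OF ab] by (metis abs_mult abs_of_nonneg)
    then show ?thesis by (simp flip: real_root_mult)
  qed
  finally show ?thesis by (simp add: hellinger_def power_mult_distrib ac_simps)
qed

lemma hellinger_integrable: "bias_law A \<Longrightarrow> k \<le> 4 \<Longrightarrow> integrable A (hellinger k)"
  by (rule bias_law_integrable[of _ _ 2]) (use hellinger_bounds in \<open>auto simp: abs_le_iff intro: order_trans[of _ 0]\<close>)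

lemma hellinger_star:
  assumes A: "bias_law A" and B: "bias_law B" and k: "k \<le> 4"
  shows "(\<integral>x. hellinger k x \<partial>star A B) = (\<integral>x. hellinger k x \<partial>A) * (\<integral>x. hellinger k x \<partial>B)"
proof -
  interpret pair_prob_space A B by (rule pair_bias_law(1)[OF A B])
  note [measurable_cong] = pair_bias_law(2)[OF A B]
  have "(\<integral>x. hellinger k x \<partial>star A B) = (\<integral>z. (1 + fst z * snd z) * hellinger k (fst z \<boxplus> snd z) \<partial>(A \<Otimes>\<^sub>M B))"
    by (rule integral_star[OF A B]) auto
  also have "\<dots> = (\<integral>z. hellinger k (fst z) * hellinger k (snd z) \<partial>(A \<Otimes>\<^sub>M B))"
  proof (rule integral_cong_AE)
    show "AE z in A \<Otimes>\<^sub>M B. (1 + fst z * snd z) * hellinger k (fst z \<boxplus> snd z) = hellinger k (fst z) * hellinger k (snd z)"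
      using pair_bias_law(3)[OF A B] by eventually_elim (use hellinger_mult k in blast)
  qed auto
  also have "\<dots> = (\<integral>a. (\<integral>b. hellinger k a * hellinger k b \<partial>B) \<partial>A)"
  proof -
    have "integrable (A \<Otimes>\<^sub>M B) (\<lambda>z. hellinger k (fst z) * hellinger k (snd z))"
    proof (rule pair_bias_law_integrable[OF A B, of _ 4])
      fix a b :: real assume "\<bar>a\<bar> \<le> 1" "\<bar>b\<bar> \<le> 1"
      then show "\<bar>hellinger k (fst (a, b)) * hellinger k (snd (a, b))\<bar> \<le> 4"
        using hellinger_bounds[of a k] hellinger_bounds[of b k] k mult_mono[of "hellinger k a" 2 "hellinger k b" 2] by simp
    qed auto
    from integral_fst'[OF this] show ?thesis by simp
  qed
  finally show ?thesis by simp
qed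

lemma hellinger_star_power:
  assumes A: "bias_law A" and k: "k \<le> 4"
  shows "(\<integral>x. hellinger k x \<partial>star_power d A) = (\<integral>x. hellinger k x \<partial>A) ^ d"
proof (induction d)
  case 0
  then show ?case by (simp add: integral_return hellinger_def)
next
  case (Suc d)
  then show ?case by (simp add: hellinger_star A k bias_law_star_power)
qed

lemma hellinger_step:
  assumes A: "bias_law A" and k: "k \<le> 4"
  shows "(\<integral>x. hellinger k x \<partial>bias_step P 1 A) = (\<integral>d. (\<integral>x. hellinger k x \<partial>A) ^ d \<partial>P)"
proof -
  let ?K = "\<lambda>d. star_power d (scale 1 A)"
  have K: "bias_law (?K d)" for d by (simp add: scale_1 A bias_law_star_power)
  note b = bias_law_step[OF A, of 1 P, simplified]
  have m: "?K \<in> measurable (measure_pmf P) (subprob_algebra borel)"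
    by (intro measurable_pmf_kernel) (use K in \<open>auto simp: bias_law_def prob_space_imp_subprob_space\<close>)
  have "(\<integral>x. hellinger k x \<partial>bias_step P 1 A) = (\<integral>x. hellinger k (clamp1 x) \<partial>bias_step P 1 A)"
    by (rule integral_clamp1[OF b, symmetric]) auto
  also have "\<dots> = (\<integral>d. (\<integral>x. hellinger k (clamp1 x) \<partial>?K d) \<partial>P)"
    unfolding bias_step_def
    using m K hellinger_bounds[OF abs_clamp1_le k]
    by (intro integral_bind[where K = borel and B = 2 and B' = 1])
       (auto simp: bias_law_def prob_space.emeasure_space_1 space_subprob_algebra prob_space_imp_subprob_space)
  also have "\<dots> = (\<integral>d. (\<integral>x. hellinger k x \<partial>A) ^ d \<partial>P)"
    by (simp add: scale_1 A integral_clamp1[OF bias_law_star_power[OF A]] hellinger_star_power k)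
  finally show ?thesis .
qed

text \<open>Convexity of \<open>x ^ d\<close>: the right side is the chord over
  \<open>[q1, 1]\<close>, evaluated at \<open>q2 = (1 - w) * q1 + w\<close>.\<close>

lemma power_chord_less:
  fixes q1 q2 :: real
  assumes q: "0 \<le> q1" "q1 < q2" "q2 < 1"
  shows "q2 ^ d \<le> q1 ^ d + (q2 - q1) * (1 - q1 ^ d) / (1 - q1)"
    and "2 \<le> d \<Longrightarrow> q2 ^ d < q1 ^ d + (q2 - q1) * (1 - q1 ^ d) / (1 - q1)"
proof -
  define w where "w = (q2 - q1) / (1 - q1)"
  have w: "0 < w" "w < 1" using q by (auto simp: w_def divide_less_eq_1)
  have "w * (1 - q1) = q2 - q1" using q by (simp add: w_def)
  then have q2: "q2 = (1 - w) * q1 + w" by (simp add: algebra_simps)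
  have rew: "q1 ^ d + (q2 - q1) * (1 - q1 ^ d) / (1 - q1) = (1 - w) * q1 ^ d + w" for d
  proof -
    have "(q2 - q1) * (1 - q1 ^ d) / (1 - q1) = w * (1 - q1 ^ d)" by (simp add: w_def)
    then show ?thesis by (simp add: algebra_simps)
  qed
  \<comment> \<open>The exact gain of one induction step over the chord. It is positive from
    \<open>d = 1\<close> on, whence strictness for exponents at least 2.\<close>
  have diff: "(1 - w) * q1 ^ Suc d + w - q2 * ((1 - w) * q1 ^ d + w) = (1 - w) * w * (1 - q1) * (1 - q1 ^ d)" for d
    unfolding q2 by (simp add: algebra_simps)
  have le: "q2 ^ d \<le> (1 - w) * q1 ^ d + w" for d
  proof (induction d)
    case (Suc d)
    have "q2 * q2 ^ d \<le> q2 * ((1 - w) * q1 ^ d + w)" using Suc q by (intro mult_left_mono) auto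
    moreover have "0 \<le> (1 - w) * w * (1 - q1) * (1 - q1 ^ d)" using w q power_le_one[of q1 d] by auto
    ultimately show ?case using diff[of d] by simp
  qed simp
  then show "q2 ^ d \<le> q1 ^ d + (q2 - q1) * (1 - q1 ^ d) / (1 - q1)" unfolding rew .
  assume "2 \<le> d"
  then obtain n where n: "d = Suc (Suc n)" by (metis add_2_eq_Suc le_Suc_ex)
  have "q2 * q2 ^ Suc n \<le> q2 * ((1 - w) * q1 ^ Suc n + w)" using le[of "Suc n"] q by (intro mult_left_mono) auto
  moreover have "0 < (1 - w) * w * (1 - q1) * (1 - q1 ^ Suc n)" using w q power_less_one_iff[of q1 "Suc n"]
    by (intro mult_pos_pos) (auto simp: power_Suc_less_one)
  ultimately show "q2 ^ d < q1 ^ d + (q2 - q1) * (1 - q1 ^ d) / (1 - q1)"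
    unfolding rew using diff[of "Suc n"] by (simp add: n)
qed

text \<open>The generating function is convex and fixes 1. Two further fixed points
  \<open>q1 < q2\<close> below 1 put three points on a line, so all degrees are at most 1. For
  these, \<open>q2 ^ d - q1 ^ d\<close> reaches \<open>q2 - q1\<close> only at \<open>d = 1\<close>,
  and equality of the means forces \<open>d = 1\<close> almost surely.\<close>

lemma pgf_fixed_point_unique:
  fixes P :: "nat pmf" and q1 q2 :: real
  assumes q: "0 \<le> q1" "q1 < 1" "0 \<le> q2" "q2 < 1"
    and fix_q: "(\<integral>d. q1 ^ d \<partial>P) = q1" "(\<integral>d. q2 ^ d \<partial>P) = q2" and P: "\<not> (AE d in measure_pmf P. d = 1)"
  shows "q1 = q2"
proof -
  have *: False if q: "0 \<le> q1" "q1 < q2" "q2 < 1" and fix_q: "(\<integral>d. q1 ^ d \<partial>P) = q1" "(\<integral>d. q2 ^ d \<partial>P) = q2" for q1 q2 :: real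
  proof -
    have i: "integrable (measure_pmf P) (\<lambda>d. r ^ d)" if "0 \<le> r" "r < 1" for r :: real
      by (rule measure_pmf.integrable_const_bound[where B = 1]) (use that in \<open>auto simp: power_le_one\<close>)
    note i1 = i[OF q(1)] and i2 = i[OF _ q(3)]
    define h where "h d = q1 ^ d + (q2 - q1) * (1 - q1 ^ d) / (1 - q1) - q2 ^ d" for d
    have h0: "0 \<le> h d" for d using power_chord_less(1)[OF q, of d] by (simp add: h_def)
    have ih: "integrable (measure_pmf P) h"
      unfolding h_def[abs_def] using i1 i2 q by (intro Bochner_Integration.integrable_diff Bochner_Integration.integrable_add integrable_divide integrable_mult_right) auto
    have "(\<integral>d. h d \<partial>P) = q1 + (q2 - q1) * (1 - q1) / (1 - q1) - q2"
      unfolding h_def using i1 i2 q fix_q by simp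
    then have "(\<integral>d. h d \<partial>P) = 0" using q by simp
    then have "AE d in measure_pmf P. h d = 0" using h0 ih by (subst (asm) integral_nonneg_eq_0_iff_AE) auto
    then have le1: "d \<in> set_pmf P \<Longrightarrow> d \<le> 1" for d
      using power_chord_less(2)[OF q, of d] by (fastforce simp: AE_measure_pmf_iff h_def)
    define g where "g d = (q2 - q1) - (q2 ^ d - q1 ^ d)" for d :: nat
    have g: "d \<in> set_pmf P \<Longrightarrow> 0 \<le> g d \<and> (g d = 0 \<longrightarrow> d = 1)" for d
      using le1[of d] q by (cases "d = 0") (auto simp: g_def le_Suc_eq)
    have ig: "integrable (measure_pmf P) g"
      unfolding g_def[abs_def] using i1 i2 q by (intro Bochner_Integration.integrable_diff) auto
    have "(\<integral>d. g d \<partial>P) = 0" unfolding g_def using i1 i2 q fix_q by simp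
    then have "AE d in measure_pmf P. g d = 0" using g ig by (subst (asm) integral_nonneg_eq_0_iff_AE) (auto simp: AE_measure_pmf_iff)
    then have "AE d in measure_pmf P. d = 1" using g by (auto simp: AE_measure_pmf_iff)
    then show False using P by simp
  qed
  show ?thesis using *[of q1 q2] *[of q2 q1] q fix_q by (cases q1 q2 rule: linorder_cases) auto
qed

lemma deterministic_fixed_law:
  assumes A: "bias_law A" "symmetric_law A" and nt: "A \<noteq> return borel 0" and fix_A: "bias_step P 1 A = A"
    and P: "\<not> (AE d in measure_pmf P. d = 1)"
  obtains z where "0 \<le> z" "z < 1" "(\<integral>d. z ^ d \<partial>P) = z"
    "\<And>p q. spread A p q = z * \<bar>p\<bar> + (1 - z) * max \<bar>p\<bar> \<bar>q\<bar>"
proof -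
  interpret prob_space A using A by (simp add: bias_law_def)
  note [measurable_cong] = bias_lawD(2)[OF A(1)]
  define Z where "Z k = (\<integral>x. hellinger k x \<partial>A)" for k
  have fixZ: "(\<integral>d. Z k ^ d \<partial>P) = Z k" if "k \<le> 4" for k
    using hellinger_step[OF A(1) that, of P] by (simp add: Z_def fix_A)
  have Z31: "Z 3 = Z 1"
    using symmetric_law_integral[OF A(2,1) measurable_hellinger[of 1]] by (simp add: Z_def hellinger_def numeral_3_eq_3 mult.commute)
  define u v where "u x = root 4 \<bar>1 + x\<bar>" and "v x = root 4 \<bar>1 - x\<bar>" for x :: real
  have uv0: "0 \<le> u x" "0 \<le> v x" for x by (auto simp: u_def v_def)
  have uv4: "u x ^ 4 + v x ^ 4 = 2" if "\<bar>x\<bar> \<le> 1" for x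
    using that by (simp add: u_def v_def real_root_pow_pos2 abs_le_iff)
  have uv_eq: "x = 0" if "\<bar>x\<bar> \<le> 1" "u x = v x" for x
    using that by (auto simp: u_def v_def)
  have h: "hellinger 1 x = u x * v x ^ 3" "hellinger 3 x = u x ^ 3 * v x" "hellinger 2 x = (u x * v x)^2" for x
    by (simp_all add: hellinger_def u_def v_def power_mult_distrib)
  have i: "integrable A (hellinger k)" if "k \<le> 4" for k by (rule hellinger_integrable[OF A(1) that])
  have Z0: "0 \<le> Z k" if "k \<le> 4" for k
    unfolding Z_def using bias_lawD(3)[OF A(1)] by (intro integral_nonneg_AE) (auto elim!: eventually_mono simp: hellinger_bounds that)
  have Z1: "Z 1 < 1"
  proof -
    \<comment> \<open>With \<open>u\<close> and \<open>v\<close> the fourth roots,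
      \<open>u ^ 4 + v ^ 4 = 2\<close> makes this \<open>(u - v) * (u ^ 3 - v ^ 3)\<close>, which is
      nonnegative and vanishes at 0 only. For a nontrivial law its integral
      \<open>2 - 2 * Z 1\<close> is therefore positive.\<close>
    define f where "f x = 2 - hellinger 1 x - hellinger 3 x" for x
    have f: "f x = (u x - v x) * (u x ^ 3 - v x ^ 3)" if "\<bar>x\<bar> \<le> 1" for x
      unfolding f_def h uv4[OF that, symmetric] by (simp add: algebra_simps power4_eq_xxxx power3_eq_cube)
    have f0: "0 \<le> f x \<and> (f x = 0 \<longrightarrow> x = 0)" if "\<bar>x\<bar> \<le> 1" for x
    proof -
      have "0 < (u x - v x) * (u x ^ 3 - v x ^ 3)" if "u x \<noteq> v x"
        using that uv0[of x] power_strict_mono[of "u x" "v x" 3] power_strict_mono[of "v x" "u x" 3]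
        by (cases "u x" "v x" rule: linorder_cases) (auto intro: mult_pos_pos mult_neg_neg)
      then show ?thesis using f[OF that] uv_eq[OF that] by (cases "u x = v x") auto
    qed
    have if': "integrable A f" unfolding f_def[abs_def] by (intro Bochner_Integration.integrable_diff i) auto
    have "(\<integral>x. f x \<partial>A) = 2 - Z 1 - Z 3" unfolding f_def Z_def by (simp add: i prob_space)
    moreover have nn: "AE x in A. 0 \<le> f x" using bias_lawD(3)[OF A(1)] by eventually_elim (use f0 in blast)
    moreover have "(\<integral>x. f x \<partial>A) \<noteq> 0"
    proof
      assume "(\<integral>x. f x \<partial>A) = 0"
      then have "AE x in A. f x = 0" using nn if' by (subst (asm) integral_nonneg_eq_0_iff_AE) auto
      then have "AE x in A. x = 0" using bias_lawD(3)[OF A(1)] by eventually_elim (use f0 in blast)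
      then have "spread A 0 1 = 0" unfolding spread_def by (intro integral_eq_zero_AE) (auto elim!: eventually_mono)
      then show False using return_0_if_spread[OF A(1)] nt by simp
    qed
    ultimately show ?thesis using Z31 integral_nonneg_AE[OF nn] by simp
  qed
  define f where "f x = hellinger 1 x + hellinger 3 x - 2 * hellinger 2 x" for x
  have f: "f x = u x * v x * (u x - v x)\<^sup>2" for x
    unfolding f_def h by (simp add: algebra_simps power2_eq_square power3_eq_cube)
  have if': "integrable A f" unfolding f_def[abs_def]
    by (intro Bochner_Integration.integrable_diff Bochner_Integration.integrable_add integrable_mult_right i) auto
  have int_f: "(\<integral>x. f x \<partial>A) = Z 1 + Z 3 - 2 * Z 2" unfolding f_def Z_def by (simp add: i)
  have nn: "0 \<le> f x" for x unfolding f using uv0 by simp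
  \<comment> \<open>This puts \<open>Z 2\<close> below 1 as well, so both are fixed points of the
    generating function in [0, 1) and must coincide. The nonnegative \<open>f\<close> then
    integrates to 0.\<close>
  have "Z 2 \<le> Z 1" using int_f Bochner_Integration.integral_nonneg[of A f] nn Z31 by simp
  then have "Z 2 = Z 1" using Z0[of 1] Z0[of 2] Z1 fixZ[of 1] fixZ[of 2]
    by (intro pgf_fixed_point_unique[of "Z 2" "Z 1" P, OF _ _ _ _ _ _ P]) linarith+
  then have "(\<integral>x. f x \<partial>A) = 0" using int_f Z31 by simp
  then have "AE x in A. f x = 0" using nn if' by (subst (asm) integral_nonneg_eq_0_iff_AE) auto
  \<comment> \<open>On the remaining values -1, 0 and 1, \<open>hellinger 2\<close> is the indicator
    of 0. Hence \<open>Z 2\<close> is the probability of an uninformative observation, and together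
    with symmetry it determines the law.\<close>
  then have val: "AE x in A. hellinger 2 x = (if x = 0 then 1 else 0) \<and> (x = 0 \<or> \<bar>x\<bar> = 1)"
    using bias_lawD(3)[OF A(1)]
  proof eventually_elim
    case (elim x)
    then have "u x = 0 \<or> v x = 0 \<or> u x = v x" by (simp add: f)
    moreover have "hellinger 2 x = 0 \<and> \<bar>x\<bar> = 1" if "u x = 0 \<or> v x = 0"
      using that by (auto simp: h u_def v_def)
    moreover have "hellinger 2 x = 1 \<and> x = 0" if "u x = v x"
      using uv_eq[OF elim(2) that] by (simp add: hellinger_def)
    ultimately show ?case by (cases "u x = v x") auto
  qed
  have spread: "spread A p q = Z 2 * \<bar>p\<bar> + (1 - Z 2) * max \<bar>p\<bar> \<bar>q\<bar>" for p q
  proof -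
    have "2 * spread A p q = spread A p q + spread A p (- q)" using symmetric_law_spread[OF A(2,1)] by simp
    also have "\<dots> = (\<integral>x. \<bar>p + q * x\<bar> + \<bar>p + (- q) * x\<bar> \<partial>A)"
      unfolding spread_def 
      by (rule Bochner_Integration.integral_add[OF integrable_spread[OF A(1)] integrable_spread[OF A(1)], symmetric])
    also have "\<dots> = (\<integral>x. 2 * (hellinger 2 x * \<bar>p\<bar> + (1 - hellinger 2 x) * max \<bar>p\<bar> \<bar>q\<bar>) \<partial>A)"
    proof (rule integral_cong_AE)
      show "AE x in A. \<bar>p + q * x\<bar> + \<bar>p + (- q) * x\<bar> = 2 * (hellinger 2 x * \<bar>p\<bar> + (1 - hellinger 2 x) * max \<bar>p\<bar> \<bar>q\<bar>)"
        using val
      proof eventually_elim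
        case (elim x)
        have "x = 0 \<or> x = 1 \<or> x = -1" using elim by linarith
        then show ?case using elim by (auto simp: max_def abs_if)
      qed
    qed auto
    also have "\<dots> = 2 * (Z 2 * \<bar>p\<bar> + (1 - Z 2) * max \<bar>p\<bar> \<bar>q\<bar>)"
      using i[of 2] by (simp add: Z_def prob_space)
    finally show ?thesis by simp
  qed
  show ?thesis using that[OF Z0 _ fixZ spread] \<open>Z 2 = Z 1\<close> Z1 by simp
qed

subsection \<open>Convergence of the recursion\<close>

lemma star_return_0: "star (return borel 0) (return borel 0) = return borel 0"
  by (rule bias_law_eqI) (auto simp: spread_star bias_law_return_0 bias_law_star integral_return)

lemma star_power_return_0: "star_power d (return borel 0) = return borel 0"
  by (induction d) (auto simp: star_return_0)

lemma bias_step_return_0: "\<bar>l\<bar> \<le> 1 \<Longrightarrow> bias_step P l (return borel 0) = return borel 0"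
proof -
  assume l: "\<bar>l\<bar> \<le> 1"
  have "scale l (return borel 0) = return borel 0"
    by (simp add: scale_def distr_return)
  then show ?thesis
    by (intro bias_law_eqI) (auto simp: spread_step l bias_law_return_0 bias_law_step star_power_return_0)
qed

lemma bias_step_abs:
  "bias_law A \<Longrightarrow> symmetric_law A \<Longrightarrow> bias_step P \<bar>l\<bar> A = bias_step P l A"
  by (simp add: bias_step_def scale_abs)

lemma fixed_law_unique_below:
  assumes A: "bias_law A" "symmetric_law A" "bias_step P l A = A" "A \<noteq> return borel 0"
    and B: "bias_law B" "symmetric_law B" "bias_step P l B = B" and BA: "B \<sqsubseteq> A"
    and c: "0 < c" "c \<le> 1" "scale c A \<sqsubseteq> B"
    and l: "\<bar>l\<bar> \<le> 1" and P: "\<not> ((AE d in measure_pmf P. d = 1) \<and> \<bar>l\<bar> = 1)"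
  shows "B = A"
proof -
  have fA: "bias_step P \<bar>l\<bar> A = A" and fB: "bias_step P \<bar>l\<bar> B = B"
    using A B by (simp_all add: bias_step_abs)
  consider "\<bar>l\<bar> = 0" | "0 < \<bar>l\<bar>" "\<bar>l\<bar> < 1" | "\<bar>l\<bar> = 1" using l by linarith
  then show ?thesis
  proof cases
    case 1
    \<comment> \<open>An edge with \<open>l = 0\<close> erases all information, so the only fixed
      law is trivial, contrary to the hypothesis on \<open>A\<close>.\<close>
    have "scale 0 A = return borel 0"
      by (rule bias_law_eqI) (auto simp: spread_scale A bias_law_scale bias_law_return_0 spread_0_right)
    then have "bias_step P 0 A = bias_step P 0 (return borel 0)"
      by (simp add: bias_step_def scale_def distr_return)
    then show ?thesis using 1 A(3,4) bias_step_return_0[of 0 P] by simp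
  next
    case 2
    obtain s where s: "0 < s" "s \<le> 1" "AE x in A. \<bar>x\<bar> \<le> s" "\<And>t. t < s \<Longrightarrow> \<not> (AE x in A. \<bar>x\<bar> \<le> t)"
      using bias_law_ess_bound[OF A(1,4)] by metis
    interpret nontrivial_fixed_law P "\<bar>l\<bar>" A s by unfold_locales (use A s 2 fA in auto)
    show ?thesis by (rule unique_below[OF B(1,2) fB BA c])
  next
    case 3
    have P1: "\<not> (AE d in measure_pmf P. d = 1)" using P 3 by simp
    have "B \<noteq> return borel 0"
    proof
      assume B0: "B = return borel 0"
      have "spread (scale c A) 0 1 \<le> 0" using c(3) B0 by (metis less_informative_def spread_return_0 abs_zero)
      then have "spread A 0 (c * 1) \<le> 0" by (simp add: spread_scale A)
      then have "c * spread A 0 1 \<le> 0" using spread_cmult[of A c 0 1] c by simp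
      then have "spread A 0 1 \<le> 0" using c by (simp add: mult_le_0_iff)
      then show False using return_0_if_spread[OF A(1)] A(4) spread_nonneg[of A 0 1] by simp
    qed
    then obtain zB where zB: "0 \<le> zB" "zB < 1" "(\<integral>d. zB ^ d \<partial>P) = zB"
        "\<And>p q. spread B p q = zB * \<bar>p\<bar> + (1 - zB) * max \<bar>p\<bar> \<bar>q\<bar>"
      using deterministic_fixed_law[OF B(1,2) _ _ P1] fB 3 by metis
    obtain zA where zA: "0 \<le> zA" "zA < 1" "(\<integral>d. zA ^ d \<partial>P) = zA"
        "\<And>p q. spread A p q = zA * \<bar>p\<bar> + (1 - zA) * max \<bar>p\<bar> \<bar>q\<bar>"
      using deterministic_fixed_law[OF A(1,2,4) _ P1] fA 3 by metis
    have "zB = zA" using pgf_fixed_point_unique[OF zB(1,2) zA(1,2) zB(3) zA(3) P1] .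
    then show ?thesis using zA zB A B by (intro bias_law_eqI) auto
  qed
qed

lemma iterate_limit_fixed:
  assumes A: "bias_law A" and B: "bias_law B" and conv: "spread_conv (\<lambda>h. (bias_step P l ^^ h) A) B" and l: "\<bar>l\<bar> \<le> 1"
  shows "bias_step P l B = B"
proof (rule spread_conv_unique)
  show "spread_conv (\<lambda>h. bias_step P l ((bias_step P l ^^ h) A)) (bias_step P l B)"
    by (intro spread_conv_step bias_law_iterate A B conv l)
  show "spread_conv (\<lambda>h. bias_step P l ((bias_step P l ^^ h) A)) B"
    unfolding spread_conv_def
  proof (intro allI)
    fix p q
    have "(\<lambda>h. spread ((bias_step P l ^^ h) A) p q) \<longlonglongrightarrow> spread B p q" using conv by (simp add: spread_conv_def)
    from LIMSEQ_Suc[OF this] show "(\<lambda>h. spread (bias_step P l ((bias_step P l ^^ h) A)) p q) \<longlonglongrightarrow> spread B p q" by simp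
  qed
qed (auto intro: bias_law_step B l)

theorem bias_recursion_converges:
  fixes P :: "nat pmf" and l :: real
  assumes l: "\<bar>l\<bar> \<le> 1" and P: "\<not> ((AE d in measure_pmf P. d = 1) \<and> \<bar>l\<bar> = 1)"
  obtains A where "bias_law A" "bias_step P l A = A"
    "spread_conv (\<lambda>h. (bias_step P l ^^ h) fair_law) A"
    "\<And>C. bias_law C \<Longrightarrow> C \<noteq> return borel 0 \<Longrightarrow> spread_conv (\<lambda>h. (bias_step P l ^^ h) C) A"
proof -
  let ?T = "bias_step P l"
  have bT: "bias_law ((?T ^^ h) C)" if "bias_law C" for h C by (rule bias_law_iterate[OF that l])
  have mono_lim: "\<exists>L. \<forall>p q. (\<lambda>h. spread ((?T ^^ h) C) p q) \<longlonglongrightarrow> L p q"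
    if C: "bias_law C" and m: "C \<sqsubseteq> ?T C \<or> ?T C \<sqsubseteq> C" for C
  proof -
    have step: "(?T ^^ h) C \<sqsubseteq> (?T ^^ Suc h) C \<or> (?T ^^ Suc h) C \<sqsubseteq> (?T ^^ h) C" for h
      using m iterate_mono[of C "?T C" l h P] iterate_mono[of "?T C" C l h P] C l
      by (auto simp: bias_law_step funpow_swap1)
    have "convergent (\<lambda>h. spread ((?T ^^ h) C) p q)" for p q
    proof -
      let ?x = "\<lambda>h. spread ((?T ^^ h) C) p q"
      have b: "Bseq ?x"
        by (rule BseqI'[of _ "\<bar>p\<bar> + \<bar>q\<bar>"]) (use spread_le[OF bT[OF C]] spread_nonneg in auto)
      have "monoseq ?x"
        using m
      proof
        assume "C \<sqsubseteq> ?T C"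
        then have "(?T ^^ h) C \<sqsubseteq> (?T ^^ h) (?T C)" for h by (intro iterate_mono C l bias_law_step)
        then show ?thesis by (auto simp: monoseq_Suc less_informative_def funpow_swap1)
      next
        assume "?T C \<sqsubseteq> C"
        then have "(?T ^^ h) (?T C) \<sqsubseteq> (?T ^^ h) C" for h by (intro iterate_mono C l bias_law_step)
        then show ?thesis by (auto simp: monoseq_Suc less_informative_def funpow_swap1)
      qed
      then show ?thesis using b Bseq_monoseq_convergent by blast
    qed
    then show ?thesis unfolding convergent_def by metis
  qed
  have ex_lim: "\<exists>D. bias_law D \<and> spread_conv (\<lambda>h. (?T ^^ h) C) D"
    if C: "bias_law C" and m: "C \<sqsubseteq> ?T C \<or> ?T C \<sqsubseteq> C" for C
  proof -
    obtain L where L: "\<forall>p q. (\<lambda>h. spread ((?T ^^ h) C) p q) \<longlonglongrightarrow> L p q" using mono_lim[OF C m] by (rule exE)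
    show ?thesis
    proof (rule bias_law_limit[of "\<lambda>h. (?T ^^ h) C" L])
      show "bias_law ((?T ^^ h) C)" for h by (rule bT[OF C])
      show "(\<lambda>h. spread ((?T ^^ h) C) p q) \<longlonglongrightarrow> L p q" for p q using L by simp
    qed auto
  qed
  have "?T fair_law \<sqsubseteq> fair_law" by (rule less_informative_fair[OF bias_law_step[OF bias_law_fair l]])
  then have "\<exists>D. bias_law D \<and> spread_conv (\<lambda>h. (?T ^^ h) fair_law) D" by (intro ex_lim bias_law_fair disjI2)
  then obtain A where A: "bias_law A" "spread_conv (\<lambda>h. (?T ^^ h) fair_law) A" by (elim exE conjE)
  have fA: "?T A = A" by (rule iterate_limit_fixed[OF bias_law_fair A l])
  have sA: "symmetric_law A"
    by (rule symmetric_law_limit[OF bT[OF bias_law_fair] _ A])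
       (rule symmetric_law_iterate[OF bias_law_fair symmetric_law_fair l])
  have "spread_conv (\<lambda>h. (?T ^^ h) C) A" if C: "bias_law C" "C \<noteq> return borel 0" for C
  proof -
    have up: "(?T ^^ h) C \<sqsubseteq> (?T ^^ h) fair_law" for h
      by (intro iterate_mono less_informative_fair C bias_law_fair l)
    show ?thesis
    proof (cases "A = return borel 0")
      case True
      have "spread_conv (\<lambda>h. return borel 0) A" by (simp add: True spread_conv_def)
      then show ?thesis
        by (rule spread_conv_squeeze[OF _ A(2) _ up]) (intro return_0_less_informative bT C)
    next
      case False
      define c where "c = spread C 0 1 / 2"
      have "spread C 0 1 \<noteq> 0" using return_0_if_spread[OF C(1)] C(2) by blast
      then have c: "0 < c" "c \<le> 1" using spread_nonneg[of C 0 1] spread_le[OF C(1), of 0 1] by (auto simp: c_def)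
      then have c1: "\<bar>c\<bar> \<le> 1" by simp
      have low: "scale c fair_law \<sqsubseteq> C" by (rule fair_law_less_informative[OF C(1)]) (use c in \<open>auto simp: c_def\<close>)
      let ?B = "scale c A"
      have B: "bias_law ?B" "symmetric_law ?B" using A sA c1 by (auto intro: bias_law_scale symmetric_law_scale)
      have cf: "bias_law (scale c fair_law)" by (rule bias_law_scale[OF bias_law_fair c1])
      have "?B \<sqsubseteq> ?T ?B" using stringy_tree_step[OF A(1) sA _ c(2) l, of P] c fA by simp
      then have "\<exists>D. bias_law D \<and> spread_conv (\<lambda>h. (?T ^^ h) ?B) D" by (intro ex_lim B(1) disjI1)
      then obtain D where D: "bias_law D" "spread_conv (\<lambda>h. (?T ^^ h) ?B) D" by (elim exE conjE)
      have fD: "?T D = D" by (rule iterate_limit_fixed[OF B(1) D l])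
      have sD: "symmetric_law D"
        by (rule symmetric_law_limit[OF bT[OF B(1)] _ D]) (rule symmetric_law_iterate[OF B l])
      have BTB: "?B \<sqsubseteq> (?T ^^ h) ?B" for h
      proof (induction h)
        case (Suc h)
        have "?B \<sqsubseteq> ?T ?B" by fact
        also have "?T ?B \<sqsubseteq> ?T ((?T ^^ h) ?B)" by (intro bias_step_mono Suc B bT l)
        finally show ?case by simp
      qed simp
      \<comment> \<open>Attenuation loses information: the spread at \<open>(p, c q)\<close> is at
        most \<open>c\<close> times the spread at \<open>(p, q)\<close> plus
        \<open>(1 - c) |p|\<close>, and \<open>|p|\<close> is below every spread.\<close>
      have scA: "?B \<sqsubseteq> A"
      proof -
        have "spread A p (c * q) \<le> spread A p q" for p q
        proof -
          have "spread A p (c * q) = spread A (c * p + (1 - c) * p) (c * q)" by (simp add: algebra_simps)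
          also have "\<dots> \<le> spread A (c * p) (c * q) + \<bar>(1 - c) * p\<bar>"
            using spread_lipschitz[OF A(1), of "c * p + (1 - c) * p" "c * q" "c * p" "c * q"] by linarith
          also have "\<dots> \<le> c * spread A p q + (1 - c) * spread A p q"
            using c spread_ge[OF A(1), of p q] spread_cmult[of A c p q] by (simp add: abs_mult mult_left_mono)
          finally show ?thesis by (simp add: algebra_simps)
        qed
        then show ?thesis by (simp add: less_informative_def spread_scale A)
      qed
      have TA: "(?T ^^ h) A = A" for h by (induction h) (auto simp: fA)
      have "(?T ^^ h) ?B \<sqsubseteq> A" for h using iterate_mono[OF scA B(1) A(1) l, of h P] by (simp add: TA)
      then have DA: "D \<sqsubseteq> A"
        unfolding less_informative_def
      proof (intro allI)
        fix p q
        show "spread D p q \<le> spread A p q"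
          by (rule LIMSEQ_le_const2[of "\<lambda>h. spread ((?T ^^ h) ?B) p q"])
             (use D(2) \<open>\<And>h. (?T ^^ h) ?B \<sqsubseteq> A\<close> in \<open>auto simp: less_informative_def spread_conv_def\<close>)
      qed
      have BD: "?B \<sqsubseteq> D"
        unfolding less_informative_def
      proof (intro allI)
        fix p q
        show "spread ?B p q \<le> spread D p q"
          by (rule LIMSEQ_le_const[of "\<lambda>h. spread ((?T ^^ h) ?B) p q"])
             (use D(2) BTB in \<open>auto simp: less_informative_def spread_conv_def\<close>)
      qed
      have "D = A" by (rule fixed_law_unique_below[OF A(1) sA fA False D(1) sD fD DA c BD l P])
      have "A \<sqsubseteq> fair_law" by (rule less_informative_fair[OF A(1)])
      then have "?B \<sqsubseteq> scale c fair_law" by (rule scale_mono[OF A(1) bias_law_fair])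
      also note low
      finally have "?B \<sqsubseteq> C" .
      then have lo: "(?T ^^ h) ?B \<sqsubseteq> (?T ^^ h) C" for h by (intro iterate_mono B C l)
      show ?thesis by (rule spread_conv_squeeze[OF D(2)[unfolded \<open>D = A\<close>] A(2) lo up])
    qed
  qed
  then show ?thesis by (rule that[OF A(1) fA A(2)])
qed

section \<open>Martingale couplings\<close>

text \<open>The integral condition states that the conditional mean of the first coordinate given
  the second is the second. The first marginal is the more informative one. Tests bounded by 1
  suffice by homogeneity.\<close>

definition martingale_coupling :: "(real \<times> real) measure \<Rightarrow> real measure \<Rightarrow> real measure \<Rightarrow> bool" where
  "martingale_coupling \<pi> B A \<longleftrightarrow> prob_space \<pi> \<and> sets \<pi> = sets (borel \<Otimes>\<^sub>M borel) \<and>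
     distr \<pi> borel fst = B \<and> distr \<pi> borel snd = A \<and>
     (\<forall>g \<in> borel_measurable borel. (\<forall>y. \<bar>g y\<bar> \<le> 1) \<longrightarrow>
        (\<integral>z. fst z * g (snd z) \<partial>\<pi>) = (\<integral>z. snd z * g (snd z) \<partial>\<pi>))"

lemma martingale_couplingD:
  assumes "martingale_coupling \<pi> B A"
  shows "prob_space \<pi>" "sets \<pi> = sets (borel \<Otimes>\<^sub>M borel)" "distr \<pi> borel fst = B" "distr \<pi> borel snd = A"
    "\<And>g. g \<in> borel_measurable borel \<Longrightarrow> (\<And>y. \<bar>g y\<bar> \<le> 1) \<Longrightarrow>
        (\<integral>z. fst z * g (snd z) \<partial>\<pi>) = (\<integral>z. snd z * g (snd z) \<partial>\<pi>)"
  using assms by (auto simp: martingale_coupling_def)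

lemma coupling_AE:
  assumes \<pi>: "martingale_coupling \<pi> B A" and A: "bias_law A" and B: "bias_law B"
  shows "AE z in \<pi>. \<bar>fst z\<bar> \<le> 1 \<and> \<bar>snd z\<bar> \<le> 1"
proof -
  note [measurable_cong] = martingale_couplingD(2)[OF \<pi>]
  have "AE z in \<pi>. \<bar>fst z\<bar> \<le> 1"
    using bias_lawD(3)[OF B] unfolding martingale_couplingD(3)[OF \<pi>, symmetric] by (subst (asm) AE_distr_iff) auto
  moreover have "AE z in \<pi>. \<bar>snd z\<bar> \<le> 1"
    using bias_lawD(3)[OF A] unfolding martingale_couplingD(4)[OF \<pi>, symmetric] by (subst (asm) AE_distr_iff) auto
  ultimately show ?thesis by simp
qed

lemma coupling_test_bounded:
  assumes \<pi>: "martingale_coupling \<pi> B A" and g: "g \<in> borel_measurable borel" "\<And>y. \<bar>g y\<bar> \<le> C"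
  shows "(\<integral>z. fst z * g (snd z) \<partial>\<pi>) = (\<integral>z. snd z * g (snd z) \<partial>\<pi>)"
proof -
  have C: "0 \<le> C" using g(2)[of 0] by linarith
  have "(\<integral>z. fst z * (g (snd z) / (C + 1)) \<partial>\<pi>) = (\<integral>z. snd z * (g (snd z) / (C + 1)) \<partial>\<pi>)"
    by (rule martingale_couplingD(5)[OF \<pi>, of "\<lambda>y. g y / (C + 1)"])
       (use g C in \<open>auto simp: abs_divide divide_le_eq_1 intro: order_trans[OF g(2)]\<close>)
  then show ?thesis using C by simp
qed

lemma integral_fair: "f \<in> borel_measurable borel \<Longrightarrow> (\<integral>x. f x \<partial>fair_law) = (f (- 1) + f 1) / (2::real)"
  unfolding fair_law_def by (subst integral_distr) (auto simp: integral_pmf_of_set)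

lemma bias_law_nn_integral_affine:
  assumes A: "bias_law A" and y: "\<bar>y\<bar> \<le> 1"
  shows "(\<integral>\<^sup>+x. ennreal (1 + y * x) \<partial>A) = 1"
proof -
  have "AE x in A. 0 \<le> 1 + y * x" using bias_lawD(3)[OF A] by eventually_elim (rule one_add_mult_nonneg[OF y])
  moreover have "integrable A (\<lambda>x. 1 + y * x)"
  proof (rule bias_law_integrable[OF A, of _ 2])
    fix x :: real assume "\<bar>x\<bar> \<le> 1"
    then have "\<bar>y * x\<bar> \<le> 1" using y by (simp add: abs_mult mult_le_one)
    then show "\<bar>1 + y * x\<bar> \<le> 2" by linarith
  qed auto
  ultimately show ?thesis using bias_law_integral_affine[OF A, of 1 y] by (simp add: nn_integral_eq_integral)
qed

text \<open>Given \<open>y\<close>, the first coordinate is 1 or -1 with probabilities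
  \<open>(1 + y) / 2\<close> and \<open>(1 - y) / 2\<close>, so its mean is \<open>y\<close>. The
  marginals are the given ones because both laws are centred.\<close>

lemma coupling_fair:
  assumes A: "bias_law A"
  shows "martingale_coupling (density (fair_law \<Otimes>\<^sub>M A) (\<lambda>z. ennreal (1 + fst z * snd z))) fair_law A"
    (is "martingale_coupling ?\<pi> _ _")
proof -
  note B = bias_law_fair
  interpret pair_prob_space fair_law A by (rule pair_bias_law(1)[OF B A])
  note [measurable_cong] = bias_lawD(2)[OF A] bias_lawD(2)[OF B]
  have s: "sets ?\<pi> = sets (borel \<Otimes>\<^sub>M borel)" using pair_bias_law(2)[OF B A] by simp
  note [measurable_cong] = s
  have 1: "distr ?\<pi> borel fst = fair_law"
  proof (rule measure_eqI)
    show "sets (distr ?\<pi> borel fst) = sets fair_law" using bias_lawD(2)[OF B] by simp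
    fix S assume "S \<in> sets (distr ?\<pi> borel fst)"
    then have [measurable]: "S \<in> sets borel" by simp
    have "emeasure (distr ?\<pi> borel fst) S = (\<integral>\<^sup>+x. indicator S x \<partial>distr ?\<pi> borel fst)" by simp
    also have "\<dots> = (\<integral>\<^sup>+z. ennreal (1 + fst z * snd z) * indicator S (fst z) \<partial>(fair_law \<Otimes>\<^sub>M A))"
      by (subst nn_integral_distr) (auto simp: nn_integral_density)
    also have "\<dots> = (\<integral>\<^sup>+x. (\<integral>\<^sup>+y. ennreal (1 + x * y) * indicator S x \<partial>A) \<partial>fair_law)"
      by (subst M2.nn_integral_fst[symmetric]) auto
    also have "\<dots> = (\<integral>\<^sup>+x. indicator S x \<partial>fair_law)"
    proof (rule nn_integral_cong_AE)
      show "AE x in fair_law. (\<integral>\<^sup>+y. ennreal (1 + x * y) * indicator S x \<partial>A) = indicator S x"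
        using bias_lawD(3)[OF B]
        by eventually_elim (subst nn_integral_multc, auto simp: bias_law_nn_integral_affine[OF A])
    qed
    also have "\<dots> = emeasure fair_law S" using bias_lawD(2)[OF B] by simp
    finally show "emeasure (distr ?\<pi> borel fst) S = emeasure fair_law S" .
  qed
  have 2: "distr ?\<pi> borel snd = A"
  proof (rule measure_eqI)
    show "sets (distr ?\<pi> borel snd) = sets A" using bias_lawD(2)[OF A] by simp
    fix S assume "S \<in> sets (distr ?\<pi> borel snd)"
    then have [measurable]: "S \<in> sets borel" by simp
    have "emeasure (distr ?\<pi> borel snd) S = (\<integral>\<^sup>+x. indicator S x \<partial>distr ?\<pi> borel snd)" by simp
    also have "\<dots> = (\<integral>\<^sup>+z. ennreal (1 + snd z * fst z) * indicator S (snd z) \<partial>(fair_law \<Otimes>\<^sub>M A))"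
      by (subst nn_integral_distr) (auto simp: nn_integral_density mult.commute)
    also have "\<dots> = (\<integral>\<^sup>+y. (\<integral>\<^sup>+x. ennreal (1 + y * x) * indicator S y \<partial>fair_law) \<partial>A)"
      by (subst nn_integral_snd[symmetric]) auto
    also have "\<dots> = (\<integral>\<^sup>+y. indicator S y \<partial>A)"
    proof (rule nn_integral_cong_AE)
      show "AE y in A. (\<integral>\<^sup>+x. ennreal (1 + y * x) * indicator S y \<partial>fair_law) = indicator S y"
        using bias_lawD(3)[OF A]
        by eventually_elim (subst nn_integral_multc, auto simp: bias_law_nn_integral_affine[OF B])
    qed
    also have "\<dots> = emeasure A S" using bias_lawD(2)[OF A] by simp
    finally show "emeasure (distr ?\<pi> borel snd) S = emeasure A S" .
  qed
  have ps: "prob_space ?\<pi>"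
    by (rule prob_space_distrD[of fst _ borel]) (use B 1 in \<open>auto simp: bias_law_def\<close>)
  have w: "AE z in fair_law \<Otimes>\<^sub>M A. 0 \<le> 1 + fst z * snd z"
    using pair_bias_law(3)[OF B A] by eventually_elim (auto intro: one_add_mult_nonneg)
  have eq: "(\<integral>z. f z \<partial>?\<pi>) = (\<integral>y. ((1 - y) * f (- 1, y) + (1 + y) * f (1, y)) / 2 \<partial>A)"
    if [measurable]: "f \<in> borel_measurable (borel \<Otimes>\<^sub>M borel)" and b: "\<And>x y. \<bar>x\<bar> \<le> 1 \<Longrightarrow> \<bar>y\<bar> \<le> 1 \<Longrightarrow> \<bar>f (x, y)\<bar> \<le> 1" for f :: "real \<times> real \<Rightarrow> real"
  proof -
    have b2: "\<bar>(1 + x * y) * f (x, y)\<bar> \<le> 2" if "\<bar>x\<bar> \<le> 1" "\<bar>y\<bar> \<le> 1" for x y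
    proof -
      have "\<bar>x * y\<bar> \<le> 1" using that by (simp add: abs_mult mult_le_one)
      then have "\<bar>1 + x * y\<bar> \<le> 2" by linarith
      then show ?thesis using b[OF that] mult_mono[of "\<bar>1 + x * y\<bar>" 2 "\<bar>f (x, y)\<bar>" 1] by (simp add: abs_mult)
    qed
    have i: "integrable (fair_law \<Otimes>\<^sub>M A) (\<lambda>z. (1 + fst z * snd z) * f z)"
      by (rule pair_bias_law_integrable[OF B A, of _ 2]) (auto intro: b2)
    have "(\<integral>z. f z \<partial>?\<pi>) = (\<integral>z. (1 + fst z * snd z) * f z \<partial>(fair_law \<Otimes>\<^sub>M A))"
      using w by (subst integral_density) auto
    also have "\<dots> = (\<integral>x. (\<integral>y. (1 + x * y) * f (x, y) \<partial>A) \<partial>fair_law)"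
      using integral_fst'[OF i] by simp
    also have "\<dots> = ((\<integral>y. (1 - y) * f (- 1, y) \<partial>A) + (\<integral>y. (1 + y) * f (1, y) \<partial>A)) / 2"
      by (subst integral_fair) auto
    also have "\<dots> = (\<integral>y. ((1 - y) * f (- 1, y) + (1 + y) * f (1, y)) / 2 \<partial>A)"
    proof -
      have "integrable A (\<lambda>y. (1 - y) * f (- 1, y))" "integrable A (\<lambda>y. (1 + y) * f (1, y))"
        using b2[of "-1"] b2[of 1] by (auto intro!: bias_law_integrable[OF A, of _ 2])
      then show ?thesis by simp
    qed
    finally show ?thesis .
  qed
  have m: "(\<integral>z. fst z * g (snd z) \<partial>?\<pi>) = (\<integral>z. snd z * g (snd z) \<partial>?\<pi>)"
    if [measurable]: "g \<in> borel_measurable borel" and g: "\<forall>y. \<bar>g y\<bar> \<le> 1" for g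
    by (subst (1 2) eq) (use g in \<open>auto simp: abs_mult mult_le_one algebra_simps intro!: Bochner_Integration.integral_cong\<close>)
  show ?thesis unfolding martingale_coupling_def using ps s 1 2 m by auto
qed

lemma coupling_scale:
  assumes \<pi>: "martingale_coupling \<pi> B A"
  shows "martingale_coupling (distr \<pi> (borel \<Otimes>\<^sub>M borel) (\<lambda>z. (c * fst z, c * snd z))) (scale c B) (scale c A)"
proof -
  interpret prob_space \<pi> by (rule martingale_couplingD(1)[OF \<pi>])
  note [measurable_cong] = martingale_couplingD(2)[OF \<pi>]
  show ?thesis unfolding martingale_coupling_def scale_def
  proof (intro conjI ballI impI)
    show "distr (distr \<pi> (borel \<Otimes>\<^sub>M borel) (\<lambda>z. (c * fst z, c * snd z))) borel fst = distr B borel ((*) c)"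
      by (subst martingale_couplingD(3)[OF \<pi>, symmetric]) (simp add: distr_distr comp_def)
    show "distr (distr \<pi> (borel \<Otimes>\<^sub>M borel) (\<lambda>z. (c * fst z, c * snd z))) borel snd = distr A borel ((*) c)"
      by (subst martingale_couplingD(4)[OF \<pi>, symmetric]) (simp add: distr_distr comp_def)
    fix g :: "real \<Rightarrow> real" assume [measurable]: "g \<in> borel_measurable borel" and g: "\<forall>y. \<bar>g y\<bar> \<le> 1"
    show "(\<integral>z. fst z * g (snd z) \<partial>distr \<pi> (borel \<Otimes>\<^sub>M borel) (\<lambda>z. (c * fst z, c * snd z)))
        = (\<integral>z. snd z * g (snd z) \<partial>distr \<pi> (borel \<Otimes>\<^sub>M borel) (\<lambda>z. (c * fst z, c * snd z)))"
      using martingale_couplingD(5)[OF \<pi>, of "\<lambda>y. g (c * y)"] g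
      by (simp add: integral_distr mult.assoc)
  qed (auto intro!: prob_space_distr)
qed

text \<open>In an independent pair of couplings, the first coordinate of one of them may be replaced
  by its second one, provided that the other factor sees this coupling through its second coordinate
  only; it may depend on all of the other coupling. The two forms serve the two positions in the
  product.\<close>

lemma coupling_pair_exchange:
  fixes H :: "real \<times> (real \<times> real) \<Rightarrow> real"
  assumes \<pi>1: "martingale_coupling \<pi>1 B1 A1" and \<pi>2: "martingale_coupling \<pi>2 B2 A2"
    and A: "bias_law A1" "bias_law B1"
    and [measurable]: "H \<in> borel_measurable (borel \<Otimes>\<^sub>M (borel \<Otimes>\<^sub>M borel))" and H: "\<And>z. \<bar>H z\<bar> \<le> C"
  shows "(\<integral>z. fst (fst z) * H (snd (fst z), snd z) \<partial>(\<pi>1 \<Otimes>\<^sub>M \<pi>2)) = (\<integral>z. snd (fst z) * H (snd (fst z), snd z) \<partial>(\<pi>1 \<Otimes>\<^sub>M \<pi>2))"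
    and "(\<integral>z. fst (snd z) * H (snd (snd z), fst z) \<partial>(\<pi>2 \<Otimes>\<^sub>M \<pi>1)) = (\<integral>z. snd (snd z) * H (snd (snd z), fst z) \<partial>(\<pi>2 \<Otimes>\<^sub>M \<pi>1))"
proof -
  interpret M1: prob_space \<pi>1 by (rule martingale_couplingD(1)[OF \<pi>1])
  interpret M2: prob_space \<pi>2 by (rule martingale_couplingD(1)[OF \<pi>2])
  interpret P: pair_prob_space \<pi>1 \<pi>2 ..
  interpret Q: pair_prob_space \<pi>2 \<pi>1 ..
  note [measurable_cong] = martingale_couplingD(2)[OF \<pi>1] martingale_couplingD(2)[OF \<pi>2]
  have C: "0 \<le> C" using H[of undefined] by linarith
  note ae = coupling_AE[OF \<pi>1 A]
  have inner: "(\<integral>z1. fst z1 * H (snd z1, z2) \<partial>\<pi>1) = (\<integral>z1. snd z1 * H (snd z1, z2) \<partial>\<pi>1)" for z2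
  proof (rule coupling_test_bounded[OF \<pi>1, of "\<lambda>y. H (y, z2)" C])
    have "(\<lambda>y. (y, z2)) \<in> borel \<rightarrow>\<^sub>M borel \<Otimes>\<^sub>M (borel \<Otimes>\<^sub>M borel)"
      by (intro measurable_Pair measurable_ident measurable_const) (auto simp: space_pair_measure)
    from measurable_compose[OF this, of H borel] show "(\<lambda>y. H (y, z2)) \<in> borel_measurable borel" by simp
  qed (rule H)
  have bd: "norm (x * H z) \<le> C" if "\<bar>x\<bar> \<le> 1" for x z
    using mult_mono[of "\<bar>x\<bar>" 1 "\<bar>H z\<bar>" C] that H[of z] by (simp add: abs_mult)
  have ae1: "AE z in \<pi>1 \<Otimes>\<^sub>M \<pi>2. \<bar>fst (fst z)\<bar> \<le> 1 \<and> \<bar>snd (fst z)\<bar> \<le> 1"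
    by (rule P.AE_pair_measure) (use ae in \<open>auto elim!: eventually_mono\<close>)
  have i1: "integrable (\<pi>1 \<Otimes>\<^sub>M \<pi>2) (\<lambda>z. fst (fst z) * H (snd (fst z), snd z))"
    "integrable (\<pi>1 \<Otimes>\<^sub>M \<pi>2) (\<lambda>z. snd (fst z) * H (snd (fst z), snd z))"
    by (rule P.P.integrable_const_bound[of _ C], use ae1 in \<open>eventually_elim, blast intro: bd\<close>, measurable)+
  have i1': "integrable (\<pi>1 \<Otimes>\<^sub>M \<pi>2) (\<lambda>(z1, z2). fst z1 * H (snd z1, z2))"
    "integrable (\<pi>1 \<Otimes>\<^sub>M \<pi>2) (\<lambda>(z1, z2). snd z1 * H (snd z1, z2))"
    using i1 by (simp_all add: case_prod_beta')
  show "(\<integral>z. fst (fst z) * H (snd (fst z), snd z) \<partial>(\<pi>1 \<Otimes>\<^sub>M \<pi>2)) = (\<integral>z. snd (fst z) * H (snd (fst z), snd z) \<partial>(\<pi>1 \<Otimes>\<^sub>M \<pi>2))"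
    using P.integral_snd[OF i1'(1)] P.integral_snd[OF i1'(2)] inner by (simp add: case_prod_beta')
  have ae2: "AE z in \<pi>2 \<Otimes>\<^sub>M \<pi>1. \<bar>fst (snd z)\<bar> \<le> 1 \<and> \<bar>snd (snd z)\<bar> \<le> 1"
    by (rule Q.AE_pair_measure) (use ae in \<open>auto elim!: eventually_mono\<close>)
  have i2: "integrable (\<pi>2 \<Otimes>\<^sub>M \<pi>1) (\<lambda>z. fst (snd z) * H (snd (snd z), fst z))"
    "integrable (\<pi>2 \<Otimes>\<^sub>M \<pi>1) (\<lambda>z. snd (snd z) * H (snd (snd z), fst z))"
    by (rule Q.P.integrable_const_bound[of _ C], use ae2 in \<open>eventually_elim, blast intro: bd\<close>, measurable)+
  show "(\<integral>z. fst (snd z) * H (snd (snd z), fst z) \<partial>(\<pi>2 \<Otimes>\<^sub>M \<pi>1)) = (\<integral>z. snd (snd z) * H (snd (snd z), fst z) \<partial>(\<pi>2 \<Otimes>\<^sub>M \<pi>1))"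
    using Q.integral_fst'[OF i2(1)] Q.integral_fst'[OF i2(2)] inner by simp
qed

text \<open>The density is taken from the first coordinates, which makes the first marginal evident.
  Against functions of the second coordinates the exchange lemma turns \<open>1 + x1 x2\<close> into
  \<open>1 + y1 y2\<close> and \<open>x1 + x2\<close> into \<open>y1 + y2\<close>: the former
  identifies the second marginal, the latter gives the martingale property.\<close>

lemma coupling_star:
  assumes \<pi>1: "martingale_coupling \<pi>1 B1 A1" and \<pi>2: "martingale_coupling \<pi>2 B2 A2"
    and A1: "bias_law A1" and B1: "bias_law B1" and A2: "bias_law A2" and B2: "bias_law B2"
  shows "martingale_coupling (distr (density (\<pi>1 \<Otimes>\<^sub>M \<pi>2) (\<lambda>z. ennreal (1 + fst (fst z) * fst (snd z)))) (borel \<Otimes>\<^sub>M borel)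
     (\<lambda>z. (fst (fst z) \<boxplus> fst (snd z), snd (fst z) \<boxplus> snd (snd z)))) (star B1 B2) (star A1 A2)"
    (is "martingale_coupling ?\<pi> _ _")
proof -
  interpret M1: prob_space \<pi>1 by (rule martingale_couplingD(1)[OF \<pi>1])
  interpret M2: prob_space \<pi>2 by (rule martingale_couplingD(1)[OF \<pi>2])
  interpret P: pair_prob_space \<pi>1 \<pi>2 ..
  note [measurable_cong] = martingale_couplingD(2)[OF \<pi>1] martingale_couplingD(2)[OF \<pi>2]
  let ?M = "\<pi>1 \<Otimes>\<^sub>M \<pi>2"
  have pair: "distr \<pi>1 borel f \<Otimes>\<^sub>M distr \<pi>2 borel g = distr ?M (borel \<Otimes>\<^sub>M borel) (\<lambda>z. (f (fst z), g (snd z)))"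
    if [measurable]: "f \<in> borel_measurable (borel \<Otimes>\<^sub>M borel)" "g \<in> borel_measurable (borel \<Otimes>\<^sub>M borel)" for f g :: "real \<times> real \<Rightarrow> real"
    by (subst pair_measure_distr) (auto simp: case_prod_beta' intro!: prob_space_imp_sigma_finite M2.prob_space_distr)
  have star_eq: "star (distr \<pi>1 borel f) (distr \<pi>2 borel g) =
      distr (density ?M (\<lambda>z. ennreal (1 + f (fst z) * g (snd z)))) borel (\<lambda>z. f (fst z) \<boxplus> g (snd z))"
    if [measurable]: "f \<in> borel_measurable (borel \<Otimes>\<^sub>M borel)" "g \<in> borel_measurable (borel \<Otimes>\<^sub>M borel)" for f g :: "real \<times> real \<Rightarrow> real"
    unfolding star_def pair[OF that] case_prod_beta'
    by (subst density_distr) (auto simp: distr_distr comp_def)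
  have ae: "AE z in ?M. (\<bar>fst (fst z)\<bar> \<le> 1 \<and> \<bar>snd (fst z)\<bar> \<le> 1) \<and> \<bar>fst (snd z)\<bar> \<le> 1 \<and> \<bar>snd (snd z)\<bar> \<le> 1"
  proof (rule P.AE_pair_measure)
    show "AE x in \<pi>1. AE y in \<pi>2. (\<bar>fst (fst (x, y))\<bar> \<le> 1 \<and> \<bar>snd (fst (x, y))\<bar> \<le> 1) \<and> \<bar>fst (snd (x, y))\<bar> \<le> 1 \<and> \<bar>snd (snd (x, y))\<bar> \<le> 1"
      using coupling_AE[OF \<pi>1 A1 B1]
    proof eventually_elim
      case (elim x)
      show ?case using coupling_AE[OF \<pi>2 A2 B2] by eventually_elim (use elim in auto)
    qed
  qed measurable
  have w0: "AE z in ?M. 0 \<le> 1 + fst (fst z) * fst (snd z)" using ae by eventually_elim (auto intro: one_add_mult_nonneg)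
  have v0: "AE z in ?M. 0 \<le> 1 + snd (fst z) * snd (snd z)" using ae by eventually_elim (auto intro: one_add_mult_nonneg)
  have bint: "integrable ?M f" if [measurable]: "f \<in> borel_measurable ?M" and "\<And>x1 y1 x2 y2. \<bar>x1\<bar> \<le> 1 \<Longrightarrow> \<bar>y1\<bar> \<le> 1 \<Longrightarrow> \<bar>x2\<bar> \<le> 1 \<Longrightarrow> \<bar>y2\<bar> \<le> 1 \<Longrightarrow> \<bar>f ((x1, y1), (x2, y2))\<bar> \<le> C" for f :: "_ \<Rightarrow> real" and C
  proof (rule P.P.integrable_const_bound[of _ C])
    show "AE z in ?M. norm (f z) \<le> C"
      using ae by eventually_elim (use that(2) in \<open>auto simp: split_paired_all\<close>)
  qed measurable
  \<comment> \<open>One exchange rule for both polynomials: \<open>p = 1, q = 0\<close> is the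
    numerator of the bias addition and \<open>p = 0, q = 1\<close> the density.\<close>
  have ex: "(\<integral>z. (p * (fst (fst z) + fst (snd z)) + q * (1 + fst (fst z) * fst (snd z))) * G (snd (fst z), snd (snd z)) \<partial>?M)
      = (\<integral>z. (p * (snd (fst z) + snd (snd z)) + q * (1 + snd (fst z) * snd (snd z))) * G (snd (fst z), snd (snd z)) \<partial>?M)"
    if [measurable]: "G \<in> borel_measurable (borel \<Otimes>\<^sub>M borel)" and G: "\<And>z. \<bar>G z\<bar> \<le> 1" for p q and G :: "real \<times> real \<Rightarrow> real"
  proof -
    have ab: "\<bar>a * G z\<bar> \<le> 1" if "\<bar>a\<bar> \<le> 1" for a z using that G[of z] by (simp add: abs_mult mult_le_one)
    have ab2: "\<bar>a * b * G z\<bar> \<le> 1" if "\<bar>a\<bar> \<le> 1" "\<bar>b\<bar> \<le> 1" for a b z using ab[of "a * b" z] that by (simp add: abs_mult mult_le_one)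
    let ?G = "\<lambda>z. G (snd (fst z), snd (snd z))"
    have i: "integrable ?M (\<lambda>z. fst (fst z) * ?G z)" "integrable ?M (\<lambda>z. snd (fst z) * ?G z)"
      "integrable ?M (\<lambda>z. fst (snd z) * ?G z)" "integrable ?M (\<lambda>z. snd (snd z) * ?G z)"
      "integrable ?M (\<lambda>z. fst (fst z) * fst (snd z) * ?G z)" "integrable ?M (\<lambda>z. snd (fst z) * snd (snd z) * ?G z)" "integrable ?M ?G"
      by (rule bint[of _ 1]; measurable?; simp add: ab ab2 G)+
    have e1: "(\<integral>z. fst (fst z) * ?G z \<partial>?M) = (\<integral>z. snd (fst z) * ?G z \<partial>?M)"
      using coupling_pair_exchange(1)[OF \<pi>1 \<pi>2 A1 B1, of "\<lambda>z. G (fst z, snd (snd z))" 1] G by simp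
    have e2: "(\<integral>z. fst (snd z) * ?G z \<partial>?M) = (\<integral>z. snd (snd z) * ?G z \<partial>?M)"
      using coupling_pair_exchange(2)[OF \<pi>2 \<pi>1 A2 B2, of "\<lambda>z. G (snd (snd z), fst z)" 1] G by simp
    have cl: "\<bar>clamp1 a * G z\<bar> \<le> 1" for a z by (rule ab) simp
    \<comment> \<open>The product is exchanged one factor at a time; the factor not yet treated
      belongs to the test function and is clamped to keep the latter bounded.\<close>
    have "(\<integral>z. fst (fst z) * fst (snd z) * ?G z \<partial>?M) = (\<integral>z. fst (fst z) * (clamp1 (fst (snd z)) * ?G z) \<partial>?M)"
      by (rule integral_cong_AE; measurable?; use ae in \<open>eventually_elim, simp\<close>)
    also have "\<dots> = (\<integral>z. snd (fst z) * (clamp1 (fst (snd z)) * ?G z) \<partial>?M)"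
      using coupling_pair_exchange(1)[OF \<pi>1 \<pi>2 A1 B1, of "\<lambda>z. clamp1 (fst (snd z)) * G (fst z, snd (snd z))" 1] cl by simp
    also have "\<dots> = (\<integral>z. fst (snd z) * (clamp1 (snd (fst z)) * ?G z) \<partial>?M)"
      by (rule integral_cong_AE; measurable?; use ae in \<open>eventually_elim, simp\<close>)
    also have "\<dots> = (\<integral>z. snd (snd z) * (clamp1 (snd (fst z)) * ?G z) \<partial>?M)"
      using coupling_pair_exchange(2)[OF \<pi>2 \<pi>1 A2 B2, of "\<lambda>z. clamp1 (snd (snd z)) * G (snd (snd z), fst z)" 1] cl by simp
    also have "\<dots> = (\<integral>z. snd (fst z) * snd (snd z) * ?G z \<partial>?M)"
      by (rule integral_cong_AE; measurable?; use ae in \<open>eventually_elim, simp\<close>)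
    finally have e3: "(\<integral>z. fst (fst z) * fst (snd z) * ?G z \<partial>?M) = (\<integral>z. snd (fst z) * snd (snd z) * ?G z \<partial>?M)" .
    have "(\<integral>z. (p * (fst (fst z) + fst (snd z)) + q * (1 + fst (fst z) * fst (snd z))) * ?G z \<partial>?M)
      = p * ((\<integral>z. fst (fst z) * ?G z \<partial>?M) + (\<integral>z. fst (snd z) * ?G z \<partial>?M)) + q * ((\<integral>z. ?G z \<partial>?M) + (\<integral>z. fst (fst z) * fst (snd z) * ?G z \<partial>?M))"
      using i by (simp add: distrib_right distrib_left mult.assoc)
    also have "\<dots> = (\<integral>z. (p * (snd (fst z) + snd (snd z)) + q * (1 + snd (fst z) * snd (snd z))) * ?G z \<partial>?M)"
      unfolding e1 e2 e3 using i by (simp add: distrib_right distrib_left mult.assoc)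
    finally show ?thesis .
  qed
  have 1: "distr ?\<pi> borel fst = star B1 B2"
    using star_eq[of fst fst] by (simp add: martingale_couplingD(3)[OF \<pi>1] martingale_couplingD(3)[OF \<pi>2] distr_distr comp_def)
  have 2: "distr ?\<pi> borel snd = star A1 A2"
  proof (rule measure_eqI)
    fix S assume "S \<in> sets (distr ?\<pi> borel snd)"
    then have [measurable]: "S \<in> sets borel" by simp
    let ?I = "\<lambda>z. indicator S (snd (fst z) \<boxplus> snd (snd z)) :: real"
    have I: "indicator S x = ennreal (indicator S x)" for x :: real by (simp add: indicator_def)
    have bI: "\<bar>(1 + a * b) * indicator S x\<bar> \<le> 2" if "\<bar>a\<bar> \<le> 1" "\<bar>b\<bar> \<le> 1" for a b x :: real
    proof -
      have "\<bar>a * b\<bar> \<le> 1" using that by (simp add: abs_mult mult_le_one)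
      then show ?thesis by (auto simp: indicator_def)
    qed
    have "emeasure (distr ?\<pi> borel snd) S = (\<integral>\<^sup>+x. indicator S x \<partial>distr ?\<pi> borel snd)" by simp
    also have "\<dots> = (\<integral>\<^sup>+z. ennreal (1 + fst (fst z) * fst (snd z)) * ennreal (?I z) \<partial>?M)"
      by (simp add: nn_integral_distr nn_integral_density I del: nn_integral_indicator)
    also have "\<dots> = (\<integral>\<^sup>+z. ennreal ((1 + fst (fst z) * fst (snd z)) * ?I z) \<partial>?M)"
      by (simp add: ennreal_mult'' del: nn_integral_indicator)
    also have "\<dots> = ennreal (\<integral>z. (1 + fst (fst z) * fst (snd z)) * ?I z \<partial>?M)"
    proof (rule nn_integral_eq_integral)
      show "integrable ?M (\<lambda>z. (1 + fst (fst z) * fst (snd z)) * ?I z)" by (rule bint[of _ 2]; measurable?; simp add: bI)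
      show "AE z in ?M. 0 \<le> (1 + fst (fst z) * fst (snd z)) * ?I z" using w0 by eventually_elim simp
    qed
    also have "(\<integral>z. (1 + fst (fst z) * fst (snd z)) * ?I z \<partial>?M) = (\<integral>z. (1 + snd (fst z) * snd (snd z)) * ?I z \<partial>?M)"
      using ex[of "\<lambda>z. indicator S (fst z \<boxplus> snd z)" 0 1] by simp
    also have "ennreal \<dots> = (\<integral>\<^sup>+z. ennreal ((1 + snd (fst z) * snd (snd z)) * ?I z) \<partial>?M)"
    proof (rule nn_integral_eq_integral[symmetric])
      show "integrable ?M (\<lambda>z. (1 + snd (fst z) * snd (snd z)) * ?I z)" by (rule bint[of _ 2]; measurable?; simp add: bI)
      show "AE z in ?M. 0 \<le> (1 + snd (fst z) * snd (snd z)) * ?I z" using v0 by eventually_elim simp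
    qed
    also have "\<dots> = (\<integral>\<^sup>+z. ennreal (1 + snd (fst z) * snd (snd z)) * ennreal (?I z) \<partial>?M)"
      by (simp add: ennreal_mult'' del: nn_integral_indicator)
    also have "\<dots> = (\<integral>\<^sup>+x. indicator S x \<partial>star (distr \<pi>1 borel snd) (distr \<pi>2 borel snd))"
      by (subst star_eq) (simp_all add: nn_integral_distr nn_integral_density I del: nn_integral_indicator)
    also have "\<dots> = emeasure (star A1 A2) S"
      by (simp add: martingale_couplingD(4)[OF \<pi>1] martingale_couplingD(4)[OF \<pi>2])
    finally show "emeasure (distr ?\<pi> borel snd) S = emeasure (star A1 A2) S" .
  qed simp
  have ps: "prob_space ?\<pi>"
    by (rule prob_space_distrD[of fst _ borel]) (use bias_law_star[OF B1 B2] 1 in \<open>auto simp: bias_law_def\<close>)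
  have m: "(\<integral>z. fst z * g (snd z) \<partial>?\<pi>) = (\<integral>z. snd z * g (snd z) \<partial>?\<pi>)"
    if [measurable]: "g \<in> borel_measurable borel" and g: "\<forall>y. \<bar>g y\<bar> \<le> 1" for g
  proof -
    have int: "(\<integral>z. f z \<partial>?\<pi>) = (\<integral>z. (1 + fst (fst z) * fst (snd z)) * f (fst (fst z) \<boxplus> fst (snd z), snd (fst z) \<boxplus> snd (snd z)) \<partial>?M)"
      if [measurable]: "f \<in> borel_measurable (borel \<Otimes>\<^sub>M borel)" for f :: "real \<times> real \<Rightarrow> real"
      using w0 by (subst integral_distr) (auto simp: integral_density)
    let ?G = "\<lambda>z. g (fst z \<boxplus> snd z)"
    have "(\<integral>z. fst z * g (snd z) \<partial>?\<pi>) = (\<integral>z. (1 * (fst (fst z) + fst (snd z)) + 0 * (1 + fst (fst z) * fst (snd z))) * ?G (snd (fst z), snd (snd z)) \<partial>?M)"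
    proof (subst int, measurable, rule integral_cong_AE)
      show "AE z in ?M. (1 + fst (fst z) * fst (snd z)) * (fst (fst (fst z) \<boxplus> fst (snd z), snd (fst z) \<boxplus> snd (snd z)) * g (snd (fst (fst z) \<boxplus> fst (snd z), snd (fst z) \<boxplus> snd (snd z))))
         = (1 * (fst (fst z) + fst (snd z)) + 0 * (1 + fst (fst z) * fst (snd z))) * ?G (snd (fst z), snd (snd z))"
        using ae
      proof eventually_elim
        case (elim z)
        then show ?case using bias_add_cancel[of "fst (fst z)" "fst (snd z)"] by (simp flip: mult.assoc)
      qed
    qed measurable
    also have "\<dots> = (\<integral>z. (1 * (snd (fst z) + snd (snd z)) + 0 * (1 + snd (fst z) * snd (snd z))) * ?G (snd (fst z), snd (snd z)) \<partial>?M)"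
      by (rule ex) (use g in auto)
    \<comment> \<open>The numerator \<open>y1 + y2\<close> is rewritten as density times
      \<open>y1 \<boxplus> y2\<close>, so that a second exchange can return the density to the first
      coordinates.\<close>
    also have "\<dots> = (\<integral>z. (0 * (snd (fst z) + snd (snd z)) + 1 * (1 + snd (fst z) * snd (snd z))) * (clamp1 (snd (fst z) \<boxplus> snd (snd z)) * ?G (snd (fst z), snd (snd z))) \<partial>?M)"
    proof (rule integral_cong_AE)
      show "AE z in ?M. (1 * (snd (fst z) + snd (snd z)) + 0 * (1 + snd (fst z) * snd (snd z))) * ?G (snd (fst z), snd (snd z))
        = (0 * (snd (fst z) + snd (snd z)) + 1 * (1 + snd (fst z) * snd (snd z))) * (clamp1 (snd (fst z) \<boxplus> snd (snd z)) * ?G (snd (fst z), snd (snd z)))"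
        using ae
      proof eventually_elim
        case (elim z)
        then show ?case using bias_add_cancel[of "snd (fst z)" "snd (snd z)"] abs_bias_add_le_1[of "snd (fst z)" "snd (snd z)"]
          by (simp flip: mult.assoc)
      qed
    qed measurable
    also have "\<dots> = (\<integral>z. (0 * (fst (fst z) + fst (snd z)) + 1 * (1 + fst (fst z) * fst (snd z))) * (clamp1 (snd (fst z) \<boxplus> snd (snd z)) * ?G (snd (fst z), snd (snd z))) \<partial>?M)"
      using ex[of "\<lambda>z. clamp1 (fst z \<boxplus> snd z) * ?G z" 0 1] g by (simp add: abs_mult mult_le_one)
    also have "\<dots> = (\<integral>z. snd z * g (snd z) \<partial>?\<pi>)"
    proof (subst int, measurable, rule integral_cong_AE)
      show "AE z in ?M. (0 * (fst (fst z) + fst (snd z)) + 1 * (1 + fst (fst z) * fst (snd z))) * (clamp1 (snd (fst z) \<boxplus> snd (snd z)) * ?G (snd (fst z), snd (snd z)))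
        = (1 + fst (fst z) * fst (snd z)) * (snd (fst (fst z) \<boxplus> fst (snd z), snd (fst z) \<boxplus> snd (snd z)) * g (snd (fst (fst z) \<boxplus> fst (snd z), snd (fst z) \<boxplus> snd (snd z))))"
        using ae by eventually_elim (simp add: abs_bias_add_le_1)
    qed measurable
    finally show ?thesis .
  qed
  show ?thesis unfolding martingale_coupling_def using ps 1 2 m by auto
qed

lemma coupling_return_0: "martingale_coupling (return (borel \<Otimes>\<^sub>M borel) (0, 0)) (return borel 0) (return borel 0)"
  unfolding martingale_coupling_def
  by (auto simp: prob_space_return space_pair_measure distr_return integral_return)

lemma coupling_star_power:
  assumes \<pi>: "martingale_coupling \<pi> B A" and A: "bias_law A" and B: "bias_law B"
  shows "\<exists>\<pi>'. martingale_coupling \<pi>' (star_power d B) (star_power d A)"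
proof (induction d)
  case 0
  then show ?case using coupling_return_0 by auto
next
  case (Suc d)
  then obtain \<pi>' where "martingale_coupling \<pi>' (star_power d B) (star_power d A)" by blast
  from coupling_star[OF \<pi> this A B bias_law_star_power[OF A] bias_law_star_power[OF B]]
  show ?case unfolding star_power_simps by (rule exI)
qed

lemma coupling_mixture:
  assumes \<pi>: "\<And>d. martingale_coupling (\<pi> d) (K d) (K' d)" and K: "\<And>d. bias_law (K d)" "\<And>d. bias_law (K' d)"
  shows "martingale_coupling (measure_pmf (P :: nat pmf) \<bind> \<pi>) (measure_pmf P \<bind> K) (measure_pmf P \<bind> K')"
proof -
  note c = martingale_couplingD[OF \<pi>]
  have m: "\<pi> \<in> measurable (measure_pmf P) (subprob_algebra (borel \<Otimes>\<^sub>M borel))"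
    by (intro measurable_pmf_kernel) (use c in \<open>auto simp: prob_space_imp_subprob_space\<close>)
  have s: "sets (measure_pmf P \<bind> \<pi>) = sets (borel \<Otimes>\<^sub>M borel)" by (subst sets_bind[where N = "borel \<Otimes>\<^sub>M borel"]) (use c in auto)
  have ps: "prob_space (measure_pmf P \<bind> \<pi>)"
    by (rule measure_pmf.prob_space_bind[OF _ m]) (use c in auto)
  have 1: "distr (measure_pmf P \<bind> \<pi>) borel fst = measure_pmf P \<bind> K"
    by (subst distr_bind[OF m]) (auto simp: c)
  have 2: "distr (measure_pmf P \<bind> \<pi>) borel snd = measure_pmf P \<bind> K'"
    by (subst distr_bind[OF m]) (auto simp: c)
  have ae: "AE z in measure_pmf P \<bind> \<pi>. \<bar>fst z\<bar> \<le> 1 \<and> \<bar>snd z\<bar> \<le> 1"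
    by (subst AE_bind[OF m]) (use coupling_AE[OF \<pi> K(2,1)] in auto)
  have mm: "(\<integral>z. fst z * g (snd z) \<partial>(measure_pmf P \<bind> \<pi>)) = (\<integral>z. snd z * g (snd z) \<partial>(measure_pmf P \<bind> \<pi>))"
    if [measurable]: "g \<in> borel_measurable borel" and g: "\<forall>y. \<bar>g y\<bar> \<le> 1" for g
  proof -
    have b: "\<bar>clamp1 x * g y\<bar> \<le> 1" for x y using g by (simp add: abs_mult mult_le_one)
    note [measurable_cong] = s c(2)
    have int: "(\<integral>z. f z * g (snd z) \<partial>(measure_pmf P \<bind> \<pi>)) = (\<integral>d. (\<integral>z. f z * g (snd z) \<partial>\<pi> d) \<partial>P)" if f: "f = fst \<or> f = snd" for f
    proof -
      have [measurable]: "f \<in> borel_measurable (borel \<Otimes>\<^sub>M borel)" using f by auto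
      have "(\<integral>z. f z * g (snd z) \<partial>(measure_pmf P \<bind> \<pi>)) = (\<integral>z. clamp1 (f z) * g (snd z) \<partial>(measure_pmf P \<bind> \<pi>))"
        by (rule integral_cong_AE; measurable?; use ae in \<open>eventually_elim, use f in auto\<close>)
      also have "\<dots> = (\<integral>d. (\<integral>z. clamp1 (f z) * g (snd z) \<partial>\<pi> d) \<partial>P)"
        by (intro integral_bind[where K = "borel \<Otimes>\<^sub>M borel" and B = 1 and B' = 1])
           (use m b c(1) in \<open>auto simp: prob_space.emeasure_space_1\<close>)
      also have "\<dots> = (\<integral>d. (\<integral>z. f z * g (snd z) \<partial>\<pi> d) \<partial>P)"
      proof (rule Bochner_Integration.integral_cong[OF refl])
        fix d
        show "(\<integral>z. clamp1 (f z) * g (snd z) \<partial>\<pi> d) = (\<integral>z. f z * g (snd z) \<partial>\<pi> d)"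
          by (rule integral_cong_AE; measurable?; use coupling_AE[OF \<pi> K(2,1), of d] in \<open>eventually_elim, use f in auto\<close>)
      qed
      finally show ?thesis .
    qed
    show ?thesis using int[of fst] int[of snd] c(5)[of g] g by simp
  qed
  show ?thesis unfolding martingale_coupling_def using ps s 1 2 mm by auto
qed

lemma coupling_step:
  assumes \<pi>: "martingale_coupling \<pi> B A" and A: "bias_law A" and B: "bias_law B" and l: "\<bar>l\<bar> \<le> 1"
  shows "\<exists>\<pi>'. martingale_coupling \<pi>' (bias_step P l B) (bias_step P l A)"
proof -
  note sA = bias_law_scale[OF A l] and sB = bias_law_scale[OF B l]
  obtain \<pi>' where \<pi>': "\<And>d. martingale_coupling (\<pi>' d) (star_power d (scale l B)) (star_power d (scale l A))"
    using coupling_star_power[OF coupling_scale[OF \<pi>] sA sB] by metis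
  show ?thesis
    unfolding bias_step_def
    using coupling_mixture[OF \<pi>' bias_law_star_power[OF sB] bias_law_star_power[OF sA]] by (rule exI)
qed

lemma coupling_iterate_fair:
  assumes A: "bias_law A" and l: "\<bar>l\<bar> \<le> 1"
  shows "\<exists>\<pi>. martingale_coupling \<pi> ((bias_step P l ^^ h) fair_law) ((bias_step P l ^^ h) A)"
proof (induction h)
  case 0
  then show ?case using coupling_fair[OF A] by auto
next
  case (Suc h)
  then show ?case using coupling_step[OF _ bias_law_iterate[OF A l] bias_law_iterate[OF bias_law_fair l] l] by auto
qed

subsection \<open>Coding the unit square by a line\<close>

text \<open>The point of the middle-thirds Cantor set whose ternary digits are
  \<open>2 * d k\<close>.\<close>

definition cantor_code :: "(nat \<Rightarrow> real) \<Rightarrow> real" where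
  "cantor_code d = (\<Sum>k. 2 * d k / 3 ^ Suc k)"

text \<open>A continuous function of period 2 which is 0 on [0, 1/3] and 1 on [2/3, 1]; on the
  Cantor set it reads off the first digit.\<close>

definition ternary_wave :: "real \<Rightarrow> real" where
  "ternary_wave t = max 0 (min 1 (1 / 2 - cos (pi * t)))"

lemma cantor_code_facts:
  assumes d: "\<And>k. d k \<in> {0, 1}"
  shows "summable (\<lambda>k. 2 * d k / 3 ^ Suc k)" "0 \<le> cantor_code d" "cantor_code d \<le> 1"
    "cantor_code d = 2 * d 0 / 3 + cantor_code (\<lambda>k. d (Suc k)) / 3"
proof -
  have "(\<lambda>k. 2 / 3 * (1 / 3) ^ k :: real) sums (2 / 3 * (1 / (1 - 1 / 3)))"
    by (rule sums_mult[OF geometric_sums]) simp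
  moreover have "(\<lambda>k. 2 / 3 * (1 / 3) ^ k :: real) = (\<lambda>k. 2 * (1 / 3) ^ Suc k)" by (rule ext) simp
  moreover have "2 / 3 * (1 / (1 - 1 / 3)) = (1 :: real)" by simp
  ultimately have g: "(\<lambda>k. 2 * (1 / 3) ^ Suc k :: real) sums 1" by (simp only:)
  have le: "2 * d k / 3 ^ Suc k \<le> 2 * (1 / 3) ^ Suc k" and ge: "0 \<le> 2 * d k / 3 ^ Suc k"
    if "d k \<in> {0, 1}" for d :: "nat \<Rightarrow> real" and k
    using that by (auto simp: power_divide)
  have sum: "summable (\<lambda>k. 2 * d k / 3 ^ Suc k)" if "\<And>k. d k \<in> {0, 1}" for d :: "nat \<Rightarrow> real"
  proof (rule summable_comparison_test[OF _ sums_summable[OF g]], intro exI allI impI)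
    show "norm (2 * d k / 3 ^ Suc k) \<le> 2 * (1 / 3) ^ Suc k" for k
      unfolding real_norm_def abs_of_nonneg[OF ge[of d, OF that]] by (rule le[of d, OF that])
  qed
  show "summable (\<lambda>k. 2 * d k / 3 ^ Suc k)" by (rule sum[of d, OF d])
  show "0 \<le> cantor_code d" unfolding cantor_code_def by (rule suminf_nonneg[OF sum[of d, OF d]]) (rule ge[of d, OF d])
  have "cantor_code d \<le> (\<Sum>k. 2 * (1 / 3) ^ Suc k)"
    unfolding cantor_code_def by (rule suminf_le[OF _ sum[of d, OF d] sums_summable[OF g]]) (rule le[of d, OF d])
  then show "cantor_code d \<le> 1" using sums_unique[OF g] by simp
  have "cantor_code d = (\<Sum>k. 2 * d (Suc k) / 3 ^ Suc (Suc k)) + 2 * d 0 / 3 ^ Suc 0"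
    unfolding cantor_code_def using suminf_split_head[OF sum[of d, OF d]] by simp
  also have "(\<Sum>k. 2 * d (Suc k) / 3 ^ Suc (Suc k)) = (\<Sum>k. 2 * d (Suc k) / 3 ^ Suc k / 3)" by (simp add: field_simps)
  also have "\<dots> = cantor_code (\<lambda>k. d (Suc k)) / 3"
    unfolding cantor_code_def by (rule suminf_divide) (rule sum[of "\<lambda>k. d (Suc k)"], rule d)
  finally show "cantor_code d = 2 * d 0 / 3 + cantor_code (\<lambda>k. d (Suc k)) / 3" by simp
qed

lemma cos_shift_even: "cos (pi * (2 * real m + t)) = cos (pi * t)"
proof (induction m)
  case (Suc m)
  have "pi * (2 * real (Suc m) + t) = pi * (2 * real m + t) + 2 * pi" by (simp add: algebra_simps)
  then show ?case using Suc by (simp only: cos_periodic)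
qed simp

lemma ternary_wave_first:
  assumes d: "\<And>k. d k \<in> {0, 1}"
  shows "ternary_wave (cantor_code d) = d 0"
proof -
  note f = cantor_code_facts(2-4)[of d, OF d]
  note g = cantor_code_facts(2,3)[of "\<lambda>k. d (Suc k)", OF d]
  have "d 0 = 0 \<or> d 0 = 1" using d[of 0] by simp
  then consider "d 0 = 0" | "d 0 = 1" by (elim disjE)
  then show ?thesis
  proof cases
    case 1
    have "cantor_code d \<le> 1 / 3" using f(3) g(2) 1 by linarith
    then have "cos (pi * (1 / 3)) \<le> cos (pi * cantor_code d)"
      using f(1,2) mult_left_mono[of "cantor_code d" "1 / 3" pi] mult_nonneg_nonneg[of pi "cantor_code d"] pi_ge_zero
      by (intro cos_monotone_0_pi_le) auto
    then have "1 / 2 \<le> cos (pi * cantor_code d)" by (simp add: cos_60)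
    then show ?thesis using 1 unfolding ternary_wave_def by linarith
  next
    case 2
    have "2 / 3 \<le> cantor_code d" using f(3) g(1) 2 by linarith
    then have "cos (pi * cantor_code d) \<le> cos (pi * (2 / 3))"
      using f(1,2) mult_left_mono[of "2 / 3" "cantor_code d" pi] mult_left_mono[of "cantor_code d" 1 pi] pi_ge_zero
      by (intro cos_monotone_0_pi_le) auto
    also have "cos (pi * (2 / 3)) = - (1 / 2)" using cos_120' by simp
    finally show ?thesis using 2 unfolding ternary_wave_def by linarith
  qed
qed

text \<open>Multiplication by 3 shifts the digits and splits off the integer \<open>2 * d 0\<close>;
  being even, it is invisible to a wave of period 2.\<close>

lemma ternary_wave_nth:
  assumes d: "\<And>k. d k \<in> {0, 1}"
  shows "ternary_wave (3 ^ k * cantor_code d) = d k"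
  using d
proof (induction k arbitrary: d)
  case 0
  then show ?case by (simp add: ternary_wave_first)
next
  case (Suc k)
  obtain m :: nat where m: "d 0 = real m" using Suc.prems[of 0] by (metis insertE of_nat_0 of_nat_1 singletonD)
  have "3 ^ Suc k * cantor_code d = 2 * real (3 ^ k * m) + 3 ^ k * cantor_code (\<lambda>k. d (Suc k))"
    using cantor_code_facts(4)[of d, OF Suc.prems] m by (simp add: algebra_simps)
  then have "ternary_wave (3 ^ Suc k * cantor_code d) = ternary_wave (3 ^ k * cantor_code (\<lambda>k. d (Suc k)))"
    unfolding ternary_wave_def by (simp only: cos_shift_even)
  then show ?case using Suc.IH[of "\<lambda>k. d (Suc k)"] Suc.prems by simp
qed

definition bit_of :: "nat \<Rightarrow> real \<Rightarrow> real" where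
  "bit_of n x = of_int (\<lfloor>2 ^ Suc n * x\<rfloor> mod 2)"

lemma bit_of_01: "bit_of n x \<in> {0, 1}"
proof -
  have "\<lfloor>2 ^ Suc n * x\<rfloor> mod 2 = 0 \<or> \<lfloor>2 ^ Suc n * x\<rfloor> mod 2 = 1" by presburger
  then show ?thesis by (auto simp: bit_of_def)
qed

lemma bit_of_sums:
  assumes x: "0 \<le> x" "x < 1"
  shows "(\<lambda>n. bit_of n x / 2 ^ Suc n) sums x"
proof -
  \<comment> \<open>Partial binary expansions are truncations of \<open>x\<close>. The first
    instance, without any digits, needs \<open>0 \<le> x < 1\<close>.\<close>
  have s: "(\<Sum>n<N. bit_of n x / 2 ^ Suc n) = of_int \<lfloor>2 ^ N * x\<rfloor> / 2 ^ N" for N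
  proof (induction N)
    case 0
    then show ?case using x by (simp add: floor_eq_iff)
  next
    case (Suc N)
    let ?m = "\<lfloor>2 ^ Suc N * x\<rfloor>"
    have "\<lfloor>2 ^ N * x\<rfloor> = ?m div 2" using floor_divide_real_eq_div[of 2 "2 ^ Suc N * x"] by simp
    moreover have "?m = 2 * (?m div 2) + ?m mod 2" by presburger
    ultimately have "real_of_int ?m = 2 * of_int \<lfloor>2 ^ N * x\<rfloor> + of_int (?m mod 2)" by (metis of_int_add of_int_mult of_int_numeral)
    then show ?case using Suc by (simp add: bit_of_def field_simps)
  qed
  have "(\<lambda>N. of_int \<lfloor>2 ^ N * x\<rfloor> / 2 ^ N - x) \<longlonglongrightarrow> 0"
  proof (rule Lim_null_comparison)
    show "\<forall>\<^sub>F N in sequentially. norm (of_int \<lfloor>2 ^ N * x\<rfloor> / 2 ^ N - x) \<le> (1 / 2) ^ N"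
    proof (rule always_eventually, rule allI)
      fix N
      have "\<bar>of_int \<lfloor>2 ^ N * x\<rfloor> - 2 ^ N * x\<bar> \<le> 1" by linarith
      then have "\<bar>of_int \<lfloor>2 ^ N * x\<rfloor> - 2 ^ N * x\<bar> / 2 ^ N \<le> 1 / 2 ^ N" by (rule divide_right_mono) simp
      also have "\<bar>of_int \<lfloor>2 ^ N * x\<rfloor> - 2 ^ N * x\<bar> / 2 ^ N = \<bar>(of_int \<lfloor>2 ^ N * x\<rfloor> - 2 ^ N * x) / 2 ^ N\<bar>" by simp
      also have "(of_int \<lfloor>2 ^ N * x\<rfloor> - 2 ^ N * x) / 2 ^ N = of_int \<lfloor>2 ^ N * x\<rfloor> / 2 ^ N - x" by (simp add: diff_divide_distrib)
      finally show "norm (of_int \<lfloor>2 ^ N * x\<rfloor> / 2 ^ N - x) \<le> (1 / 2) ^ N" by (simp add: power_divide)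
    qed
    show "(\<lambda>N. (1 / 2) ^ N :: real) \<longlonglongrightarrow> 0" by (rule LIMSEQ_power_zero) simp
  qed
  then show ?thesis unfolding sums_def s by (simp add: LIM_zero_iff)
qed

text \<open>Schoenberg's space-filling curve; only the existence of a Borel right inverse matters.\<close>

definition schoenberg :: "nat \<Rightarrow> real \<Rightarrow> real" where
  "schoenberg i t = (\<Sum>n. ternary_wave (3 ^ (2 * n + i) * t) / 2 ^ Suc n)"

lemma ternary_wave_bounds: "0 \<le> ternary_wave t" "ternary_wave t \<le> 1"
  by (auto simp: ternary_wave_def)

lemma continuous_on_schoenberg: "continuous_on UNIV (schoenberg i)"
proof (rule uniform_limit_theorem)
  show "uniform_limit UNIV (\<lambda>N t. \<Sum>n<N. ternary_wave (3 ^ (2 * n + i) * t) / 2 ^ Suc n) (schoenberg i) sequentially"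
    unfolding schoenberg_def
  proof (rule Weierstrass_m_test)
    fix n and t :: real
    show "norm (ternary_wave (3 ^ (2 * n + i) * t) / 2 ^ Suc n) \<le> (1 / 2) ^ Suc n"
      using ternary_wave_bounds by (simp add: power_divide divide_right_mono)
  qed (simp add: summable_Suc_iff del: power_Suc)
  show "\<forall>\<^sub>F N in sequentially. continuous_on UNIV (\<lambda>t. \<Sum>n<N. ternary_wave (3 ^ (2 * n + i) * t) / 2 ^ Suc n)"
    unfolding ternary_wave_def by (intro always_eventually allI continuous_intros) auto
qed auto

text \<open>The binary digits of the coordinates are interleaved, at even and odd positions, to
  match the exponents \<open>2 * n + i\<close> in \<open>schoenberg\<close>.\<close>

definition square_code :: "real \<times> real \<Rightarrow> real" where
  "square_code z = cantor_code (\<lambda>k. bit_of (k div 2) (if even k then fst z else snd z))"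

lemma schoenberg_square_code:
  assumes "0 \<le> fst z" "fst z < 1" "0 \<le> snd z" "snd z < 1"
  shows "schoenberg 0 (square_code z) = fst z" "schoenberg 1 (square_code z) = snd z"
proof -
  have d: "bit_of (k div 2) (if even k then fst z else snd z) \<in> {0, 1}" for k by (rule bit_of_01)
  note e = ternary_wave_nth[of "\<lambda>k. bit_of (k div 2) (if even k then fst z else snd z)", OF d]
  show "schoenberg 0 (square_code z) = fst z" "schoenberg 1 (square_code z) = snd z"
    unfolding schoenberg_def square_code_def e
    using sums_unique[OF bit_of_sums[OF assms(1,2)]] sums_unique[OF bit_of_sums[OF assms(3,4)]] by auto
qed

lemma measurable_square_code [measurable]: "square_code \<in> borel_measurable (borel \<Otimes>\<^sub>M borel)"
proof -
  have "(\<lambda>z. bit_of (k div 2) (if even k then fst z else snd z)) \<in> borel_measurable (borel \<Otimes>\<^sub>M borel)" for k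
    unfolding bit_of_def by (cases "even k") auto
  then show ?thesis unfolding square_code_def[abs_def] cantor_code_def by measurable
qed

lemma square_code_bounds: "0 \<le> square_code z" "square_code z \<le> 1"
  unfolding square_code_def by (auto intro!: cantor_code_facts bit_of_01)

subsection \<open>Limits of couplings\<close>

text \<open>Ramps of slope \<open>-n\<close> decrease to the indicator of a closed half-line. They
  pass from continuous tests to distribution functions.\<close>

lemma test_function_limit:
  fixes X Y :: "'a \<Rightarrow> real"
  assumes "finite_measure M" and [measurable]: "X \<in> borel_measurable M" "Y \<in> borel_measurable M" and X: "\<And>t. \<bar>X t\<bar> \<le> 1"
  shows "(\<lambda>n. \<integral>t. X t * max 0 (min 1 (1 - real n * (Y t - a))) \<partial>M) \<longlonglongrightarrow> (\<integral>t. X t * indicator {..a} (Y t) \<partial>M)"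
proof -
  interpret finite_measure M by fact
  show ?thesis
  proof (rule integral_dominated_convergence[where w = "\<lambda>_. 1"])
    show "AE t in M. (\<lambda>n. X t * max 0 (min 1 (1 - real n * (Y t - a)))) \<longlonglongrightarrow> X t * indicator {..a} (Y t)"
    proof (rule AE_I2)
      fix t
      have "(\<lambda>n. max 0 (min 1 (1 - real n * (Y t - a)))) \<longlonglongrightarrow> indicator {..a} (Y t)"
      proof (cases "Y t \<le> a")
        case True
        then have "1 - real n * (Y t - a) \<ge> 1" for n by (simp add: mult_nonneg_nonpos)
        then have "max 0 (min 1 (1 - real n * (Y t - a))) = 1" for n by (simp add: min_absorb1)
        then show ?thesis using True by simp
      next
        case False
        obtain N :: nat where N: "1 / (Y t - a) \<le> real N" using real_arch_simple by blast
        have "max 0 (min 1 (1 - real n * (Y t - a))) = 0" if "n \<ge> N" for n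
        proof -
          have "1 / (Y t - a) \<le> real n" using N that by linarith
          then have "1 \<le> real n * (Y t - a)" using False by (simp add: divide_le_eq)
          then show ?thesis by simp
        qed
        then have "\<forall>\<^sub>F n in sequentially. max 0 (min 1 (1 - real n * (Y t - a))) = 0"
          by (auto simp: eventually_sequentially)
        then show ?thesis using False by (simp add: tendsto_eventually)
      qed
      then show "(\<lambda>n. X t * max 0 (min 1 (1 - real n * (Y t - a)))) \<longlonglongrightarrow> X t * indicator {..a} (Y t)"
        by (rule tendsto_mult_left)
    qed
    show "AE t in M. norm (X t * max 0 (min 1 (1 - real n * (Y t - a)))) \<le> 1" for n
      using X by (auto simp: abs_mult intro!: mult_le_one)
  qed auto
qed

text \<open>The couplings are coded on the line, where tightness yields a weak subsequential limit,
  and this limit is decoded by continuous maps. Marginals and the martingale property are integrals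
  of continuous functions of the decoded pair, hence are inherited.\<close>

lemma coupling_limit:
  assumes \<pi>: "\<And>h. martingale_coupling (\<pi> h) (B h) A" and A: "bias_law A" and B: "\<And>h. bias_law (B h)"
    and B': "bias_law B'" and conv: "spread_conv B B'"
  shows "\<exists>\<pi>'. martingale_coupling \<pi>' B' A"
proof -
  note c = martingale_couplingD[OF \<pi>]
  note [measurable_cong] = c(2)
  define code where "code z = square_code ((fst z + 2) / 4, (snd z + 2) / 4)" for z
  define X Y where "X t = clamp1 (4 * schoenberg 0 t - 2)" and "Y t = clamp1 (4 * schoenberg 1 t - 2)" for t
  have [measurable]: "code \<in> borel_measurable (borel \<Otimes>\<^sub>M borel)" unfolding code_def by measurable
  have contX: "continuous_on UNIV X" and contY: "continuous_on UNIV Y"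
    unfolding X_def Y_def by (intro continuous_intros continuous_on_schoenberg)+
  have [measurable]: "X \<in> borel_measurable borel" "Y \<in> borel_measurable borel"
    using contX contY by (auto intro: borel_measurable_continuous_onI)
  have XY1: "\<bar>X t\<bar> \<le> 1" "\<bar>Y t\<bar> \<le> 1" for t by (auto simp: X_def Y_def)
  have decode: "X (code z) = fst z" "Y (code z) = snd z" if "\<bar>fst z\<bar> \<le> 1" "\<bar>snd z\<bar> \<le> 1" for z
    using schoenberg_square_code[of "((fst z + 2) / 4, (snd z + 2) / 4)"] that
    by (auto simp: X_def Y_def code_def abs_le_iff)
  define M where "M h = distr (\<pi> h) borel code" for h
  have Mp: "prob_space (M h)" for h unfolding M_def by (intro prob_space.prob_space_distr c) auto
  have Mr: "real_distribution (M h)" for h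
    using Mp by (auto simp: real_distribution_def real_distribution_axioms_def M_def)
  have "tight M" unfolding tight_def
  proof (intro conjI allI impI Mr)
    fix e :: real assume e: "0 < e"
    have "1 - e < measure (M h) {-1<..1}" for h
    proof -
      interpret prob_space "M h" by (rule Mp)
      have "AE t in M h. t \<in> {-1<..1}"
        unfolding M_def by (subst AE_distr_iff)
          (auto simp: code_def square_code_bounds less_le_trans[OF _ square_code_bounds(1)])
      then have "prob {-1<..1} = 1" by (subst prob_eq_1) (auto simp: M_def)
      then show ?thesis using e by simp
    qed
    then show "\<exists>a b. a < b \<and> (\<forall>h. 1 - e < measure (M h) {a<..b})" by (intro exI[of _ "-1"] exI[of _ 1]) auto
  qed
  then obtain r N where r: "strict_mono (r :: nat \<Rightarrow> nat)" and N: "real_distribution N" and w: "weak_conv_m (M \<circ> r) N"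
    using tight_imp_convergent_subsubsequence[of M id] by (auto simp: strict_mono_def)
  interpret N: real_distribution N by (rule N)
  \<comment> \<open>Although \<open>code\<close> is only Borel, \<open>X\<close> and
    \<open>Y\<close> are continuous, so a continuous function of the pair is a continuous function
    of the code.\<close>
  have lim: "(\<lambda>n. \<integral>z. f (fst z) (snd z) \<partial>\<pi> (r n)) \<longlonglongrightarrow> (\<integral>t. f (X t) (Y t) \<partial>N)"
    if f: "continuous_on UNIV (\<lambda>z. f (fst z) (snd z))" and b: "\<And>x y. \<bar>x\<bar> \<le> 1 \<Longrightarrow> \<bar>y\<bar> \<le> 1 \<Longrightarrow> \<bar>f x y\<bar> \<le> C" for f :: "real \<Rightarrow> real \<Rightarrow> real" and C
  proof -
    have [measurable]: "(\<lambda>z. f (fst z) (snd z)) \<in> borel_measurable (borel \<Otimes>\<^sub>M borel)"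
      using f by (simp add: borel_prod borel_measurable_continuous_onI)
    have fXY: "continuous_on UNIV (\<lambda>t. f (X t) (Y t))"
      using continuous_on_compose2[OF f continuous_on_Pair[OF contX contY]] by simp
    then have [measurable]: "(\<lambda>t. f (X t) (Y t)) \<in> borel_measurable borel" by (rule borel_measurable_continuous_onI)
    have "(\<lambda>n. \<integral>t. f (X t) (Y t) \<partial>(M \<circ> r) n) \<longlonglongrightarrow> (\<integral>t. f (X t) (Y t) \<partial>N)"
      using fXY b XY1 by (intro weak_conv_imp_integral_bdd_continuous_conv[OF _ N w, where B = C])
        (auto simp: Mr continuous_on_eq_continuous_at)
    moreover have "(\<integral>t. f (X t) (Y t) \<partial>M h) = (\<integral>z. f (fst z) (snd z) \<partial>\<pi> h)" for h
    proof -
      have "(\<integral>t. f (X t) (Y t) \<partial>M h) = (\<integral>z. f (X (code z)) (Y (code z)) \<partial>\<pi> h)"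
        unfolding M_def by (subst integral_distr) auto
      also have "\<dots> = (\<integral>z. f (fst z) (snd z) \<partial>\<pi> h)"
      proof (rule integral_cong_AE)
        show "AE z in \<pi> h. f (X (code z)) (Y (code z)) = f (fst z) (snd z)"
          using coupling_AE[OF \<pi> A B] by eventually_elim (simp add: decode)
      qed measurable
      finally show ?thesis .
    qed
    ultimately show ?thesis by simp
  qed
  define \<pi>' where "\<pi>' = distr N (borel \<Otimes>\<^sub>M borel) (\<lambda>t. (X t, Y t))"
  have [measurable]: "(\<lambda>t. (X t, Y t)) \<in> N \<rightarrow>\<^sub>M borel \<Otimes>\<^sub>M borel" by measurable
  have ps: "prob_space \<pi>'" unfolding \<pi>'_def by (rule N.prob_space_distr) measurable
  have law_eq: "distr N borel Z = C"
    if C: "bias_law C" and [measurable]: "Z \<in> borel_measurable borel" and Z: "\<And>t. \<bar>Z t\<bar> \<le> 1"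
      and l: "\<And>f. continuous_on UNIV f \<Longrightarrow> (\<integral>t. f (Z t) \<partial>N) = (\<integral>x. (f (clamp1 x) :: real) \<partial>C)" for Z C
  proof (rule bias_law_eqI[OF _ C])
    note [measurable_cong] = bias_lawD(2)[OF C]
    have "(\<integral>t. Z t \<partial>N) = 0" using l[of "\<lambda>x. x"] integral_clamp1[OF C, of "\<lambda>x. x"] bias_lawD(4)[OF C] by simp
    then show b: "bias_law (distr N borel Z)"
      using Z by (auto simp: bias_law_def N.prob_space_distr AE_distr_iff integral_distr)
    fix p q
    have "spread (distr N borel Z) p q = (\<integral>t. \<bar>p + q * Z t\<bar> \<partial>N)" unfolding spread_def by (subst integral_distr) auto
    also have "\<dots> = spread C p q" unfolding spread_clamp1[OF C] by (rule l) (intro continuous_intros)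
    finally show "spread (distr N borel Z) p q = spread C p q" .
  qed
  have bdd: "\<exists>C. \<forall>x. \<bar>f (clamp1 x)\<bar> \<le> (C::real)" if "continuous_on UNIV f" for f
  proof -
    have "compact (f ` {-1..1})" using that by (intro compact_continuous_image) (auto intro: continuous_on_subset)
    then obtain C where "\<forall>y\<in>f ` {-1..1}. norm y \<le> C" using compact_imp_bounded bounded_iff by metis
    then show ?thesis by (intro exI[of _ C]) (auto simp: clamp1_def)
  qed
  have 1: "distr N borel X = B'"
  proof (rule law_eq[OF B' _ XY1(1)])
    fix f :: "real \<Rightarrow> real" assume f: "continuous_on UNIV f"
    then obtain C where C: "\<And>x. \<bar>f (clamp1 x)\<bar> \<le> C" using bdd by metis
    have [measurable]: "f \<in> borel_measurable borel" by (rule borel_measurable_continuous_onI[OF f])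
    have "(\<lambda>n. \<integral>z. f (clamp1 (fst z)) \<partial>\<pi> (r n)) \<longlonglongrightarrow> (\<integral>t. f (clamp1 (X t)) \<partial>N)"
    proof (rule lim[of "\<lambda>x y. f (clamp1 x)" C])
      show "continuous_on UNIV (\<lambda>z. f (clamp1 (fst z)))" by (intro continuous_on_compose2[OF f] continuous_intros) auto
    qed (rule C)
    moreover have "(\<integral>z. f (clamp1 (fst z)) \<partial>\<pi> (r n)) = (\<integral>x. f (clamp1 x) \<partial>B (r n))" for n
      unfolding c(3)[of "r n", symmetric] by (subst integral_distr) auto
    moreover have "(\<lambda>n. \<integral>x. f (clamp1 x) \<partial>B (r n)) \<longlonglongrightarrow> (\<integral>x. f (clamp1 x) \<partial>B')"
      using LIMSEQ_subseq_LIMSEQ[OF spread_conv_integral[OF B B' conv continuous_on_subset[OF f]] r] by (simp add: comp_def)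
    ultimately have "(\<integral>t. f (clamp1 (X t)) \<partial>N) = (\<integral>x. f (clamp1 x) \<partial>B')" by (metis (no_types, lifting) LIMSEQ_unique ext)
    then show "(\<integral>t. f (X t) \<partial>N) = (\<integral>x. f (clamp1 x) \<partial>B')" using XY1 by simp
  qed measurable
  have 2: "distr N borel Y = A"
  proof (rule law_eq[OF A _ XY1(2)])
    fix f :: "real \<Rightarrow> real" assume f: "continuous_on UNIV f"
    then obtain C where C: "\<And>x. \<bar>f (clamp1 x)\<bar> \<le> C" using bdd by metis
    have [measurable]: "f \<in> borel_measurable borel" by (rule borel_measurable_continuous_onI[OF f])
    have "(\<lambda>n. \<integral>z. f (clamp1 (snd z)) \<partial>\<pi> (r n)) \<longlonglongrightarrow> (\<integral>t. f (clamp1 (Y t)) \<partial>N)"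
    proof (rule lim[of "\<lambda>x y. f (clamp1 y)" C])
      show "continuous_on UNIV (\<lambda>z. f (clamp1 (snd z)))" by (intro continuous_on_compose2[OF f] continuous_intros) auto
    qed (rule C)
    moreover have "(\<integral>z. f (clamp1 (snd z)) \<partial>\<pi> (r n)) = (\<integral>x. f (clamp1 x) \<partial>A)" for n
      unfolding c(4)[of "r n", symmetric] by (subst integral_distr) auto
    ultimately have "(\<integral>t. f (clamp1 (Y t)) \<partial>N) = (\<integral>x. f (clamp1 x) \<partial>A)" by (simp add: LIMSEQ_const_iff)
    then show "(\<integral>t. f (Y t) \<partial>N) = (\<integral>x. f (clamp1 x) \<partial>A)" using XY1 by simp
  qed measurable
  have cont_test: "(\<integral>t. X t * g (Y t) \<partial>N) = (\<integral>t. Y t * g (Y t) \<partial>N)"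
    if g: "continuous_on UNIV g" "\<And>y. \<bar>g y\<bar> \<le> 1" for g
  proof -
    have [measurable]: "g \<in> borel_measurable borel" by (rule borel_measurable_continuous_onI[OF g(1)])
    have b: "\<bar>x * g y\<bar> \<le> 1" if "\<bar>x\<bar> \<le> 1" for x y using that g(2) by (simp add: abs_mult mult_le_one)
    have l1: "(\<lambda>n. \<integral>z. fst z * g (snd z) \<partial>\<pi> (r n)) \<longlonglongrightarrow> (\<integral>t. X t * g (Y t) \<partial>N)"
      by (rule lim[of "\<lambda>x y. x * g y" 1]) (auto intro!: continuous_intros continuous_on_compose2[OF g(1)] b)
    have l2: "(\<lambda>n. \<integral>z. snd z * g (snd z) \<partial>\<pi> (r n)) \<longlonglongrightarrow> (\<integral>t. Y t * g (Y t) \<partial>N)"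
      by (rule lim[of "\<lambda>x y. y * g y" 1]) (auto intro!: continuous_intros continuous_on_compose2[OF g(1)] b)
    show ?thesis using l1 l2 c(5)[of g] g(2) LIMSEQ_unique by simp
  qed
  have ind: "(\<integral>t. X t * indicator {..a} (Y t) \<partial>N) = (\<integral>t. Y t * indicator {..a} (Y t) \<partial>N)" for a
  proof -
    let ?g = "\<lambda>n y. max 0 (min 1 (1 - real n * (y - a)))"
    have "(\<integral>t. X t * ?g n (Y t) \<partial>N) = (\<integral>t. Y t * ?g n (Y t) \<partial>N)" for n
      by (rule cont_test[of "?g n"]) (auto intro!: continuous_intros)
    then show ?thesis
      using test_function_limit[of N X Y a] test_function_limit[of N Y Y a] XY1 N.finite_measure_axioms LIMSEQ_unique by simp
  qed
  have nn: "0 \<le> 1 + X t" "0 \<le> 1 + Y t" for t using XY1[of t] by (auto simp: abs_le_iff)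
  have iN: "integrable N f" if "f \<in> borel_measurable borel" "\<And>t. \<bar>f t\<bar> \<le> 2" for f :: "real \<Rightarrow> real"
    using that by (intro N.integrable_const_bound[of _ 2]) auto
  \<comment> \<open>Weighting by \<open>1 + Z\<close> gives probability measures instead of the
    signed ones with density \<open>Z\<close>, so equality on half-lines extends to all Borel tests
    by uniqueness of the cdf.\<close>
  define m where "m Z = distr (density N (\<lambda>t. ennreal (1 + Z t))) borel Y" for Z :: "real \<Rightarrow> real"
  have m_int: "(\<integral>y. g y \<partial>m Z) = (\<integral>t. g (Y t) \<partial>N) + (\<integral>t. Z t * g (Y t) \<partial>N)"
    if Z: "Z = X \<or> Z = Y" and [measurable]: "g \<in> borel_measurable borel" and g: "\<And>y. \<bar>g y\<bar> \<le> 1" for Z g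
  proof -
    have [measurable]: "Z \<in> borel_measurable borel" and Z1: "\<And>t. \<bar>Z t\<bar> \<le> 1" and Z0: "\<And>t. 0 \<le> 1 + Z t"
      using Z XY1 nn by auto
    have b: "\<bar>Z t * g (Y t)\<bar> \<le> 1" for t using Z1 g by (simp add: abs_mult mult_le_one)
    have "(\<integral>y. g y \<partial>m Z) = (\<integral>t. (1 + Z t) * g (Y t) \<partial>N)"
      unfolding m_def by (subst integral_distr) (auto simp: integral_density Z0)
    also have "\<dots> = (\<integral>t. g (Y t) + Z t * g (Y t) \<partial>N)" by (simp add: algebra_simps)
    also have "\<dots> = (\<integral>t. g (Y t) \<partial>N) + (\<integral>t. Z t * g (Y t) \<partial>N)"
      using order_trans[OF g, of 2] order_trans[OF b, of 2]
      by (intro Bochner_Integration.integral_add iN) auto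
    finally show ?thesis .
  qed
  have mr: "real_distribution (m Z)" if Z: "Z = X \<or> Z = Y" for Z
  proof -
    have [measurable]: "Z \<in> borel_measurable borel" using Z by auto
    have "(\<integral>t. X t \<partial>N) = 0" using bias_lawD(4)[OF B'] unfolding 1[symmetric] by (subst (asm) integral_distr) auto
    moreover have "(\<integral>t. Y t \<partial>N) = 0" using bias_lawD(4)[OF A] unfolding 2[symmetric] by (subst (asm) integral_distr) auto
    ultimately have Z0: "(\<integral>t. Z t \<partial>N) = 0" using Z by auto
    have iZ: "integrable N Z" using Z XY1 by (intro iN) (auto intro: order_trans[of _ 1])
    have "emeasure (density N (\<lambda>t. ennreal (1 + Z t))) UNIV = (\<integral>\<^sup>+t. ennreal (1 + Z t) \<partial>N)"
      by (subst emeasure_density) auto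
    also have "\<dots> = ennreal (\<integral>t. 1 + Z t \<partial>N)"
      using Z nn iZ by (intro nn_integral_eq_integral) auto
    also have "(\<integral>t. 1 + Z t \<partial>N) = 1" using iZ Z0 N.prob_space by simp
    finally have "prob_space (density N (\<lambda>t. ennreal (1 + Z t)))" by (intro prob_spaceI) simp
    then have "prob_space (m Z)" unfolding m_def by (rule prob_space.prob_space_distr) measurable
    then show ?thesis by (simp add: real_distribution_def real_distribution_axioms_def m_def)
  qed
  have "m X = m Y"
  proof (rule cdf_unique[OF mr mr])
    show "cdf (m X) = cdf (m Y)"
    proof
      fix a
      have "cdf (m Z) a = (\<integral>y. indicator {..a} y \<partial>m Z)" for Z by (simp add: cdf_def m_def)
      then show "cdf (m X) a = cdf (m Y) a" using m_int[of X "indicator {..a}"] m_int[of Y "indicator {..a}"] ind[of a] by simp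
    qed
  qed auto
  then have mart: "(\<integral>t. X t * g (Y t) \<partial>N) = (\<integral>t. Y t * g (Y t) \<partial>N)"
    if "g \<in> borel_measurable borel" "\<And>y. \<bar>g y\<bar> \<le> 1" for g
    using m_int[of X g] m_int[of Y g] that by simp
  have "martingale_coupling \<pi>' B' A"
    unfolding martingale_coupling_def
  proof (intro conjI ballI impI ps)
    show "distr \<pi>' borel fst = B'" "distr \<pi>' borel snd = A"
      unfolding \<pi>'_def by (simp_all add: distr_distr comp_def 1 2)
    fix g :: "real \<Rightarrow> real" assume [measurable]: "g \<in> borel_measurable borel" and "\<forall>y. \<bar>g y\<bar> \<le> 1"
    then show "(\<integral>z. fst z * g (snd z) \<partial>\<pi>') = (\<integral>z. snd z * g (snd z) \<partial>\<pi>')"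
      unfolding \<pi>'_def using mart[of g] by (simp add: integral_distr)
  qed (simp add: \<pi>'_def)
  then show ?thesis by blast
qed

subsection \<open>Disintegration\<close>

definition coupled_part :: "(real \<times> real) measure \<Rightarrow> real set \<Rightarrow> real measure" where
  "coupled_part \<pi> T = distr (density \<pi> (\<lambda>z. indicator T (snd z))) borel fst"

lemma nn_integral_coupled_part:
  assumes \<pi>: "martingale_coupling \<pi> B A" and [measurable]: "T \<in> sets borel" "f \<in> borel_measurable borel"
  shows "(\<integral>\<^sup>+x. f x \<partial>coupled_part \<pi> T) = (\<integral>\<^sup>+z. indicator T (snd z) * f (fst z) \<partial>\<pi>)"
proof -
  note [measurable_cong] = martingale_couplingD(2)[OF \<pi>]
  show ?thesis unfolding coupled_part_def by (subst nn_integral_distr) (auto simp: nn_integral_density)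
qed

lemma emeasure_coupled_part:
  assumes \<pi>: "martingale_coupling \<pi> B A" and T: "T \<in> sets borel" and S: "S \<in> sets borel"
  shows "emeasure (coupled_part \<pi> T) S = (\<integral>\<^sup>+z. indicator T (snd z) * indicator S (fst z) \<partial>\<pi>)"
  using nn_integral_coupled_part[OF \<pi> T, of "indicator S"] S by (simp add: coupled_part_def)

text \<open>A version of the conditional probability, given the first coordinate, that the second
  one lies in \<open>T\<close>.\<close>

definition coupled_density :: "(real \<times> real) measure \<Rightarrow> real measure \<Rightarrow> real set \<Rightarrow> real \<Rightarrow> ennreal" where
  "coupled_density \<pi> B T = RN_deriv B (coupled_part \<pi> T)"

lemma measurable_coupled_density: "bias_law B \<Longrightarrow> coupled_density \<pi> B T \<in> borel_measurable borel"
  unfolding coupled_density_def using borel_measurable_RN_deriv[of B "coupled_part \<pi> T"]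
  by (simp add: bias_law_def cong: measurable_cong_sets)

lemma density_coupled_density:
  assumes \<pi>: "martingale_coupling \<pi> B A" and B: "bias_law B" and T: "T \<in> sets borel"
  shows "density B (coupled_density \<pi> B T) = coupled_part \<pi> T"
proof -
  interpret prob_space B using B by (simp add: bias_law_def)
  note [measurable_cong] = martingale_couplingD(2)[OF \<pi>]
  have "absolutely_continuous B (coupled_part \<pi> T)"
    unfolding absolutely_continuous_def
  proof
    fix S assume S: "S \<in> null_sets B"
    then have Sb: "S \<in> sets borel" using bias_lawD(2)[OF B] by auto
    have "emeasure (coupled_part \<pi> T) S \<le> (\<integral>\<^sup>+z. indicator S (fst z) \<partial>\<pi>)"
      unfolding emeasure_coupled_part[OF \<pi> T Sb] by (intro nn_integral_mono) (auto simp: indicator_def)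
    also have "\<dots> = emeasure (distr \<pi> borel fst) S"
      using nn_integral_distr[of fst \<pi> borel "indicator S"] Sb by simp
    also have "\<dots> = 0" using S by (simp add: martingale_couplingD(3)[OF \<pi>] null_setsD1)
    finally show "S \<in> null_sets (coupled_part \<pi> T)" using Sb by (auto simp: null_sets_def coupled_part_def)
  qed
  then show ?thesis unfolding coupled_density_def
    using bias_lawD(2)[OF B] by (intro density_RN_deriv) (auto simp: coupled_part_def)
qed

lemma coupled_density_union:
  assumes \<pi>: "martingale_coupling \<pi> B A" and B: "bias_law B" and T[measurable]: "T \<in> sets borel" "T' \<in> sets borel"
    and disj: "T \<inter> T' = {}"
  shows "AE x in B. coupled_density \<pi> B (T \<union> T') x = coupled_density \<pi> B T x + coupled_density \<pi> B T' x"
proof -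
  interpret prob_space B using B by (simp add: bias_law_def)
  note [measurable_cong] = bias_lawD(2)[OF B]
  note [measurable] = measurable_coupled_density[OF B]
  note [measurable_cong] = martingale_couplingD(2)[OF \<pi>]
  show ?thesis
  proof (rule density_unique)
    show "density B (coupled_density \<pi> B (T \<union> T')) = density B (\<lambda>x. coupled_density \<pi> B T x + coupled_density \<pi> B T' x)"
    proof (rule measure_eqI)
      fix S assume "S \<in> sets (density B (coupled_density \<pi> B (T \<union> T')))"
      then have [measurable]: "S \<in> sets borel" using bias_lawD(2)[OF B] by simp
      have S: "S \<in> sets B" using bias_lawD(2)[OF B] by simp
      have "emeasure (density B (\<lambda>x. coupled_density \<pi> B T x + coupled_density \<pi> B T' x)) S
          = emeasure (density B (coupled_density \<pi> B T)) S + emeasure (density B (coupled_density \<pi> B T')) S"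
        using S by (simp add: emeasure_density distrib_right nn_integral_add)
      also have "\<dots> = (\<integral>\<^sup>+z. indicator T (snd z) * indicator S (fst z) + indicator T' (snd z) * indicator S (fst z) \<partial>\<pi>)"
        unfolding density_coupled_density[OF \<pi> B T(1)] density_coupled_density[OF \<pi> B T(2)]
        by (simp add: emeasure_coupled_part[OF \<pi>] nn_integral_add)
      also have "\<dots> = (\<integral>\<^sup>+z. indicator (T \<union> T') (snd z) * indicator S (fst z) \<partial>\<pi>)"
        using disj by (intro nn_integral_cong) (auto simp: indicator_def)
      also have "\<dots> = emeasure (density B (coupled_density \<pi> B (T \<union> T'))) S"
        by (subst density_coupled_density[OF \<pi> B]) (simp_all add: emeasure_coupled_part[OF \<pi>])
      finally show "emeasure (density B (coupled_density \<pi> B (T \<union> T'))) S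
        = emeasure (density B (\<lambda>x. coupled_density \<pi> B T x + coupled_density \<pi> B T' x)) S" ..
    qed simp
  qed measurable
qed

lemma coupled_density_full:
  assumes \<pi>: "martingale_coupling \<pi> B A" and B: "bias_law B" and T[measurable]: "T \<in> sets borel"
    and c: "AE z in \<pi>. indicator T (snd z) = (c :: ennreal)"
  shows "AE x in B. coupled_density \<pi> B T x = c"
proof -
  interpret prob_space B using B by (simp add: bias_law_def)
  note [measurable_cong] = bias_lawD(2)[OF B]
  note [measurable] = measurable_coupled_density[OF B]
  note [measurable_cong] = martingale_couplingD(2)[OF \<pi>]
  show ?thesis
  proof (rule density_unique)
    show "density B (coupled_density \<pi> B T) = density B (\<lambda>_. c)"
    proof (rule measure_eqI)
      fix S assume "S \<in> sets (density B (coupled_density \<pi> B T))"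
      then have [measurable]: "S \<in> sets borel" using bias_lawD(2)[OF B] by simp
      have S: "S \<in> sets B" using bias_lawD(2)[OF B] by simp
      have "emeasure (density B (coupled_density \<pi> B T)) S = (\<integral>\<^sup>+z. indicator T (snd z) * indicator S (fst z) \<partial>\<pi>)"
        by (subst density_coupled_density[OF \<pi> B]) (simp_all add: emeasure_coupled_part[OF \<pi>])
      also have "\<dots> = (\<integral>\<^sup>+z. c * indicator S (fst z) \<partial>\<pi>)"
        by (rule nn_integral_cong_AE) (use c in \<open>eventually_elim, simp\<close>)
      also have "\<dots> = (\<integral>\<^sup>+x. c * indicator S x \<partial>distr \<pi> borel fst)"
        by (subst nn_integral_distr) auto
      also have "\<dots> = emeasure (density B (\<lambda>_. c)) S"
        using S by (simp add: emeasure_density martingale_couplingD(3)[OF \<pi>])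
      finally show "emeasure (density B (coupled_density \<pi> B T)) S = emeasure (density B (\<lambda>_. c)) S" .
    qed simp
  qed measurable
qed

text \<open>Conditional distribution functions at rational points are regularised to a kernel from
  the first coordinate to the second. Under the weight \<open>1 + \<sigma> * x\<close> the
  martingale property replaces \<open>x\<close> by \<open>y\<close> against functions of
  \<open>y\<close>; hence one kernel serves both values of \<sigma>.\<close>

lemma coupling_kernel:
  assumes \<pi>: "martingale_coupling \<pi> B A" and A: "bias_law A" and B: "bias_law B"
  shows "\<exists>\<kappa> \<in> borel \<rightarrow>\<^sub>M prob_algebra borel. \<forall>\<sigma>\<in>{1, -1}.
     density B (\<lambda>x. ennreal (1 + \<sigma> * x)) \<bind> \<kappa> = density A (\<lambda>y. ennreal (1 + \<sigma> * y))"
proof -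
  interpret B: prob_space B using B by (simp add: bias_law_def)
  interpret A: prob_space A using A by (simp add: bias_law_def)
  interpret \<pi>: prob_space \<pi> by (rule martingale_couplingD(1)[OF \<pi>])
  note sB[measurable_cong] = bias_lawD(2)[OF B] and sA[measurable_cong] = bias_lawD(2)[OF A]
    and s\<pi>[measurable_cong] = martingale_couplingD(2)[OF \<pi>]
  note mk[measurable] = measurable_coupled_density[OF B]
  define k where "k q = coupled_density \<pi> B {..of_rat q :: real}" for q :: rat
  have k_meas[measurable]: "k q \<in> borel_measurable borel" for q unfolding k_def by (rule mk)
  \<comment> \<open>The values outside [-1, 1) are prescribed, which agrees almost surely with
    \<open>k\<close>. Thus every \<open>x\<close>, not only almost every one, yields limits 0 and 1
    of the distribution function.\<close>
  define h where "h q x = (if 1 \<le> q then 1 else if q < -1 then 0 else min 1 (enn2real (k q x)))" for q and x :: real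
  have [measurable]: "h q \<in> borel_measurable borel" for q unfolding h_def[abs_def] by measurable
  have h01: "0 \<le> h q x" "h q x \<le> 1" for q x by (auto simp: h_def)
  have rat_le: "(of_rat q :: real) \<le> of_rat r \<longleftrightarrow> q \<le> r" for q r by (rule of_rat_less_eq)
  have k_le: "AE x in B. k q x \<le> k r x" if "q \<le> r" for q r
  proof -
    have T: "{..of_rat r} = {..of_rat q} \<union> {real_of_rat q<..real_of_rat r}" "{..of_rat q} \<inter> {real_of_rat q<..real_of_rat r} = {}"
      using that by (auto simp: rat_le intro: order_trans)
    have "AE x in B. k r x = k q x + coupled_density \<pi> B {of_rat q<..of_rat r} x"
      unfolding k_def T(1) by (rule coupled_density_union[OF \<pi> B _ _ T(2)]) auto
    then show ?thesis by eventually_elim simp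
  qed
  have k_le1: "AE x in B. k q x \<le> 1" for q
  proof -
    have T: "UNIV = {..of_rat q} \<union> {real_of_rat q<..}" "{..of_rat q} \<inter> {real_of_rat q<..} = {}" by auto
    have "AE x in B. coupled_density \<pi> B UNIV x = k q x + coupled_density \<pi> B {of_rat q<..} x"
      unfolding k_def by (subst T(1), rule coupled_density_union[OF \<pi> B _ _ T(2)]) auto
    moreover have "AE x in B. coupled_density \<pi> B UNIV x = 1"
      by (rule coupled_density_full[OF \<pi> B]) auto
    ultimately show ?thesis
    proof eventually_elim
      case (elim x)
      then have "k q x + coupled_density \<pi> B {of_rat q<..} x = 1" by simp
      then show ?case by (metis le_iff_add)
    qed
  qed
  have hk: "AE x in B. k q x = ennreal (h q x)" for q
  proof -
    consider "1 \<le> q" | "q < -1" | "\<not> 1 \<le> q" "\<not> q < -1" by blast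
    then show ?thesis
    proof cases
      case 1
      then have q: "1 \<le> (of_rat q :: real)" using rat_le[of 1 q] by simp
      have "AE x in B. k q x = 1" unfolding k_def
      proof (rule coupled_density_full[OF \<pi> B])
        show "AE z in \<pi>. indicator {..of_rat q} (snd z) = (1 :: ennreal)"
          using coupling_AE[OF \<pi> A B]
        proof eventually_elim
          case (elim z)
          then have "snd z \<le> of_rat q" using q by linarith
          then show ?case by simp
        qed
      qed auto
      then show ?thesis by eventually_elim (use 1 in \<open>simp add: h_def\<close>)
    next
      case 2
      then have q: "(of_rat q :: real) < -1" using of_rat_less[of q "-1", where ?'a = real] by simp
      have "AE x in B. k q x = 0" unfolding k_def
      proof (rule coupled_density_full[OF \<pi> B])
        show "AE z in \<pi>. indicator {..of_rat q} (snd z) = (0 :: ennreal)"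
          using coupling_AE[OF \<pi> A B]
        proof eventually_elim
          case (elim z)
          then have "\<not> snd z \<le> of_rat q" using q by linarith
          then show ?case by simp
        qed
      qed auto
      then show ?thesis by eventually_elim (use 2 in \<open>simp add: h_def\<close>)
    next
      case 3
      show ?thesis using k_le1[of q]
      proof eventually_elim
        case (elim x)
        then have "k q x < \<top>" by (simp add: le_less_trans[OF _ ennreal_one_less_top])
        moreover from elim have "enn2real (k q x) \<le> 1" by (metis enn2real_mono enn2real_1 ennreal_one_less_top)
        ultimately show ?case using 3 by (simp add: h_def min_absorb2)
      qed
    qed
  qed
  have "AE x in B. \<forall>q r. q \<le> r \<longrightarrow> h q x \<le> h r x"
    unfolding AE_all_countable
  proof (intro allI)
    fix q r
    show "AE x in B. q \<le> r \<longrightarrow> h q x \<le> h r x"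
    proof (cases "q \<le> r")
      case True
      from k_le[OF True] hk[of q] hk[of r] show ?thesis
      proof eventually_elim
        case (elim x)
        then show ?case by (simp add: h01)
      qed
    qed simp
  qed
  note h_mono = this
  have h_int: "(\<integral>x. h q x * f x \<partial>B) = (\<integral>z. indicator {..of_rat q} (snd z) * f (fst z) \<partial>\<pi>)"
    if [measurable]: "f \<in> borel_measurable borel" for q and f :: "real \<Rightarrow> real"
  proof -
    have I: "indicator {..of_rat q} y = ennreal (indicator {..of_rat q} y)" for y :: real by (simp add: indicator_def)
    have "(\<integral>x. h q x * f x \<partial>B) = (\<integral>x. f x \<partial>density B (\<lambda>x. ennreal (h q x)))"
      by (subst integral_density) (auto simp: h01)
    also have "density B (\<lambda>x. ennreal (h q x)) = density B (k q)"
      by (rule density_cong) (use hk[of q] in \<open>auto elim!: eventually_mono\<close>)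
    also have "\<dots> = coupled_part \<pi> {..of_rat q}" unfolding k_def by (rule density_coupled_density[OF \<pi> B]) simp
    also have "(\<integral>x. f x \<partial>coupled_part \<pi> {..of_rat q}) = (\<integral>z. indicator {..of_rat q} (snd z) * f (fst z) \<partial>\<pi>)"
      unfolding coupled_part_def I by (subst integral_distr) (auto simp: integral_density)
    finally show ?thesis .
  qed
  \<comment> \<open>The infimum over larger rationals is increasing and right-continuous for every
    \<open>x\<close>, even where \<open>h\<close> fails to be monotone.\<close>
  define F where "F x c = (INF q\<in>{q. c < of_rat q}. h q x)" for x c :: real
  have bdd: "bdd_below ((\<lambda>q. h q x) ` Q)" for x Q using h01 by (auto intro!: bdd_belowI2)
  have ne: "{q. c < (of_rat q :: real)} \<noteq> {}" for c
    using of_rat_dense[of c "c + 1"] by auto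
  have F_le: "F x c \<le> h q x" if "c < of_rat q" for x c q
    unfolding F_def using that by (intro cINF_lower bdd) auto
  have F_ge: "y \<le> F x c" if "\<And>q. c < of_rat q \<Longrightarrow> y \<le> h q x" for x c y
    unfolding F_def using that by (intro cINF_greatest ne) auto
  have F01: "0 \<le> F x c" "F x c \<le> 1" for x c
  proof -
    show "0 \<le> F x c" by (rule F_ge) (rule h01)
    obtain q where "c < of_rat q" using ne[of c] by blast
    from F_le[OF this, of x] h01(2)[of q x] show "F x c \<le> 1" by linarith
  qed
  have F_mono: "F x c \<le> F x d" if "c \<le> d" for x c d
    using that by (intro F_ge F_le) auto
  have F_right: "continuous (at_right a) (F x)" for x a
  proof (subst continuous_at_right_real_increasing)
    show "F x c \<le> F x d" if "c \<le> d" for c d by (rule F_mono[OF that])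
    show "\<forall>e>0. \<exists>d>0. F x (a + d) - F x a < e"
    proof (intro allI impI)
      fix e :: real assume e: "0 < e"
      obtain q where q: "a < of_rat q" "h q x < F x a + e"
      proof -
        have "(INF q\<in>{q. a < of_rat q}. h q x) < F x a + e" using e by (simp add: F_def)
        then show ?thesis using that cINF_less_iff[OF ne bdd, of x a] by auto
      qed
      then have "F x (a + (of_rat q - a) / 2) \<le> h q x" by (intro F_le) (simp add: field_simps)
      then show "\<exists>d>0. F x (a + d) - F x a < e" using q by (intro exI[of _ "(of_rat q - a) / 2"]) auto
    qed
  qed
  have F_bot: "(F x \<longlongrightarrow> 0) at_bot" for x
  proof (rule tendsto_eventually)
    have "F x c = 0" if c: "c < -1" for c
    proof -
      obtain q where q: "c < of_rat q" "of_rat q < (-1 :: real)" using of_rat_dense[OF c] by blast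
      then have "q < -1" using of_rat_less[of q "-1", where ?'a = real] by simp
      then have "h q x = 0" by (simp add: h_def)
      then show ?thesis using F_le[OF q(1), of x] F01(1)[of x c] by simp
    qed
    then show "\<forall>\<^sub>F c in at_bot. F x c = 0" by (auto simp: eventually_at_bot_dense)
  qed
  have F_top: "(F x \<longlongrightarrow> 1) at_top" for x
  proof (rule tendsto_eventually)
    have "F x c = 1" if "1 \<le> c" for c
    proof (rule antisym[OF F01(2)], rule F_ge)
      fix q assume "c < of_rat q"
      then have "(of_rat 1 :: real) \<le> of_rat q" using that by (simp only: of_rat_1)
      then have "1 \<le> q" by (simp only: rat_le)
      then show "1 \<le> h q x" by (simp add: h_def)
    qed
    then show "\<forall>\<^sub>F c in at_top. F x c = 1" by (auto simp: eventually_at_top_linorder)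
  qed
  have [measurable]: "(\<lambda>x. F x c) \<in> borel_measurable borel" for c unfolding F_def by measurable
  define \<kappa> where "\<kappa> x = interval_measure (F x)" for x
  have \<kappa>r: "real_distribution (\<kappa> x)" for x
    unfolding \<kappa>_def by (rule real_distribution_interval_measure[OF F_mono F_right F_bot F_top])
  then have \<kappa>p: "prob_space (\<kappa> x)" for x by (simp add: real_distribution_def)
  have \<kappa>c: "emeasure (\<kappa> x) {..c} = ennreal (F x c)" for x c
  proof -
    interpret prob_space "\<kappa> x" by (rule \<kappa>p)
    have "cdf (\<kappa> x) = F x" unfolding \<kappa>_def by (rule cdf_interval_measure[OF F_mono F_right F_bot])
    then show ?thesis by (simp add: emeasure_eq_measure cdf_def fun_eq_iff)
  qed
  have \<kappa>: "\<kappa> \<in> borel \<rightarrow>\<^sub>M prob_algebra borel"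
  proof (rule measurable_prob_algebra_generated[where \<Omega> = UNIV and G = "range (\<lambda>a::real. {..a})"])
    show "sets borel = sigma_sets UNIV (range (\<lambda>a::real. {..a}))"
      by (subst borel_eq_atMost) simp
    show "Int_stable (range (\<lambda>a::real. {..a}))" by (auto simp: Int_stable_def)
    show "prob_space (\<kappa> x)" for x by (rule \<kappa>p)
    show "(\<lambda>x. emeasure (\<kappa> x) T) \<in> borel_measurable borel" if "T \<in> range (\<lambda>a::real. {..a})" for T
      using that by (auto simp: \<kappa>c)
  qed (auto simp: \<kappa>_def)
  have fin: "density B (\<lambda>x. ennreal (1 + \<sigma> * x)) \<bind> \<kappa> = density A (\<lambda>y. ennreal (1 + \<sigma> * y))" if \<sigma>: "\<bar>\<sigma>\<bar> \<le> 1" for \<sigma>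
  proof -
    have dens: "prob_space (density C (\<lambda>x. ennreal (1 + \<sigma> * x)))" if C: "bias_law C" for C
    proof (rule prob_spaceI)
      note [measurable_cong] = bias_lawD(2)[OF C]
      have "emeasure (density C (\<lambda>x. ennreal (1 + \<sigma> * x))) (space C) = (\<integral>\<^sup>+x. ennreal (1 + \<sigma> * x) \<partial>C)"
        by (subst emeasure_density) (auto intro!: nn_integral_cong)
      then show "emeasure (density C (\<lambda>x. ennreal (1 + \<sigma> * x))) (space (density C (\<lambda>x. ennreal (1 + \<sigma> * x)))) = 1"
        using bias_law_nn_integral_affine[OF C \<sigma>] by simp
    qed
    have nnB: "AE x in B. 0 \<le> 1 + \<sigma> * x" using bias_lawD(3)[OF B] by eventually_elim (rule one_add_mult_nonneg[OF \<sigma>])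
    have nnA: "AE x in A. 0 \<le> 1 + \<sigma> * x" using bias_lawD(3)[OF A] by eventually_elim (rule one_add_mult_nonneg[OF \<sigma>])
    have w2: "\<bar>f x * (1 + \<sigma> * x)\<bar> \<le> 2" if "\<bar>x\<bar> \<le> 1" "0 \<le> f x" "f x \<le> 1" for x and f :: "real \<Rightarrow> real"
    proof -
      have "\<bar>\<sigma> * x\<bar> \<le> 1" using \<sigma> that by (simp add: abs_mult mult_le_one)
      then have "\<bar>1 + \<sigma> * x\<bar> \<le> 2" by linarith
      then show ?thesis using mult_mono[of "\<bar>f x\<bar>" 1 "\<bar>1 + \<sigma> * x\<bar>" 2] that by (simp add: abs_mult)
    qed
    let ?N = "density B (\<lambda>x. ennreal (1 + \<sigma> * x))"
    have \<kappa>N: "\<kappa> \<in> ?N \<rightarrow>\<^sub>M subprob_algebra borel"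
      using measurable_prob_algebraD[OF \<kappa>] by (simp add: sB cong: measurable_cong_sets)
    interpret N: prob_space ?N by (rule dens[OF B])
    have r1: "real_distribution (?N \<bind> \<kappa>)"
      unfolding real_distribution_def real_distribution_axioms_def
    proof (intro conjI)
      show "prob_space (?N \<bind> \<kappa>)" by (rule N.prob_space_bind[OF _ \<kappa>N]) (simp add: \<kappa>p)
      show "sets (?N \<bind> \<kappa>) = sets borel"
        by (subst sets_bind[where N = borel]) (auto simp: \<kappa>_def B.not_empty)
    qed
    have r2: "real_distribution (density A (\<lambda>y. ennreal (1 + \<sigma> * y)))"
      using dens[OF A] sA sets_eq_imp_space_eq[OF sA] by (simp add: real_distribution_def real_distribution_axioms_def)
    show ?thesis
    proof (rule cdf_unique[OF r1 r2], rule ext)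
      fix c
      obtain q where q: "\<And>n. c < of_rat (q n)" "\<And>n. of_rat (q n) < c + inverse (real (Suc n))"
      proof -
        have "\<exists>q. c < of_rat q \<and> of_rat q < c + inverse (real (Suc n))" for n by (rule of_rat_dense) simp
        then show ?thesis using that by metis
      qed
      have qlim: "(\<lambda>n. of_rat (q n) :: real) \<longlonglongrightarrow> c"
      proof (rule tendsto_sandwich[of "\<lambda>_. c" _ _ "\<lambda>n. c + inverse (real (Suc n))"])
        show "(\<lambda>n. c + inverse (real (Suc n))) \<longlonglongrightarrow> c"
          using tendsto_add[OF tendsto_const LIMSEQ_inverse_real_of_nat, of c] by simp
      qed (use q in \<open>auto intro!: always_eventually less_imp_le simp del: of_nat_Suc\<close>)
      have l1: "(\<lambda>n. \<integral>x. h (q n) x * (1 + \<sigma> * x) \<partial>B) \<longlonglongrightarrow> (\<integral>x. F x c * (1 + \<sigma> * x) \<partial>B)"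
      proof (rule integral_dominated_convergence[where w = "\<lambda>_. 2"])
        show "AE x in B. (\<lambda>n. h (q n) x * (1 + \<sigma> * x)) \<longlonglongrightarrow> F x c * (1 + \<sigma> * x)"
          using h_mono
        proof eventually_elim
          case (elim x)
          have "(\<lambda>n. h (q n) x) \<longlonglongrightarrow> F x c"
          proof (rule order_tendstoI)
            fix y assume "y < F x c"
            then have "y < h (q n) x" for n using F_le[OF q(1), of x n] by linarith
            then show "\<forall>\<^sub>F n in sequentially. y < h (q n) x" by simp
          next
            fix y assume "F x c < y"
            then obtain r where r: "c < of_rat r" "h r x < y"
              using cINF_less_iff[OF ne bdd, of x c y] by (auto simp: F_def)
            have "\<forall>\<^sub>F n in sequentially. of_rat (q n) < (of_rat r :: real)" by (rule order_tendstoD(2)[OF qlim r(1)])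
            then show "\<forall>\<^sub>F n in sequentially. h (q n) x < y"
            proof eventually_elim
              case (elim n)
              then have "q n \<le> r" by (simp add: of_rat_less)
              then have "h (q n) x \<le> h r x" using \<open>\<forall>q r. q \<le> r \<longrightarrow> h q x \<le> h r x\<close> by blast
              then show ?case using r(2) by linarith
            qed
          qed
          then show ?case by (rule tendsto_mult_right)
        qed
        show "AE x in B. norm (h (q n) x * (1 + \<sigma> * x)) \<le> 2" for n
          using bias_lawD(3)[OF B] by eventually_elim (use w2 h01 in auto)
      qed auto
      have step: "(\<integral>x. h (q n) x * (1 + \<sigma> * x) \<partial>B) = (\<integral>y. indicator {..of_rat (q n)} y * (1 + \<sigma> * y) \<partial>A)" for n
      proof -
        let ?g = "indicator {..of_rat (q n)} :: real \<Rightarrow> real"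
        have i: "integrable \<pi> (\<lambda>z. ?g (snd z))" "integrable \<pi> (\<lambda>z. fst z * ?g (snd z))" "integrable \<pi> (\<lambda>z. snd z * ?g (snd z))"
          by (rule \<pi>.integrable_const_bound[of _ 1]; measurable?;
              use coupling_AE[OF \<pi> A B] in \<open>eventually_elim, auto simp: indicator_def\<close>)+
        have "(\<integral>x. h (q n) x * (1 + \<sigma> * x) \<partial>B) = (\<integral>z. ?g (snd z) * (1 + \<sigma> * fst z) \<partial>\<pi>)" by (rule h_int) auto
        also have "\<dots> = (\<integral>z. ?g (snd z) + \<sigma> * (fst z * ?g (snd z)) \<partial>\<pi>)" by (simp add: algebra_simps)
        also have "\<dots> = (\<integral>z. ?g (snd z) \<partial>\<pi>) + \<sigma> * (\<integral>z. fst z * ?g (snd z) \<partial>\<pi>)" using i by simp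
        \<comment> \<open>The martingale property enters here, and only against indicators of
          half-lines.\<close>
        also have "(\<integral>z. fst z * ?g (snd z) \<partial>\<pi>) = (\<integral>z. snd z * ?g (snd z) \<partial>\<pi>)"
          by (rule martingale_couplingD(5)[OF \<pi>]) (auto simp: indicator_def)
        also have "(\<integral>z. ?g (snd z) \<partial>\<pi>) + \<sigma> * (\<integral>z. snd z * ?g (snd z) \<partial>\<pi>) = (\<integral>z. ?g (snd z) + \<sigma> * (snd z * ?g (snd z)) \<partial>\<pi>)" using i by simp
        also have "\<dots> = (\<integral>z. ?g (snd z) * (1 + \<sigma> * snd z) \<partial>\<pi>)" by (simp add: algebra_simps)
        also have "\<dots> = (\<integral>y. ?g y * (1 + \<sigma> * y) \<partial>distr \<pi> borel snd)" by (subst integral_distr) auto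
        finally show ?thesis by (simp add: martingale_couplingD(4)[OF \<pi>])
      qed
      have l2: "(\<lambda>n. \<integral>y. indicator {..of_rat (q n)} y * (1 + \<sigma> * y) \<partial>A) \<longlonglongrightarrow> (\<integral>y. indicator {..c} y * (1 + \<sigma> * y) \<partial>A)"
      proof (rule integral_dominated_convergence[where w = "\<lambda>_. 2"])
        show "AE y in A. (\<lambda>n. indicator {..of_rat (q n)} y * (1 + \<sigma> * y)) \<longlonglongrightarrow> indicator {..c} y * (1 + \<sigma> * y)"
        proof (rule AE_I2, rule tendsto_mult_right, rule tendsto_eventually)
          fix y
          show "\<forall>\<^sub>F n in sequentially. indicator {..of_rat (q n)} y = (indicator {..c} y :: real)"
          proof (cases "y \<le> c")
            case True
            then have "y \<le> of_rat (q n)" for n using q(1)[of n] by linarith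
            then show ?thesis using True by simp
          next
            case False
            then have "\<forall>\<^sub>F n in sequentially. of_rat (q n) < y" using qlim by (intro order_tendstoD) auto
            then show ?thesis by eventually_elim (use False in auto)
          qed
        qed
        show "AE y in A. norm (indicator {..of_rat (q n)} y * (1 + \<sigma> * y)) \<le> 2" for n
          using bias_lawD(3)[OF A] by eventually_elim (use w2[of _ "indicator {..of_rat (q n)}"] in auto)
      qed auto
      have eq: "(\<integral>x. F x c * (1 + \<sigma> * x) \<partial>B) = (\<integral>y. indicator {..c} y * (1 + \<sigma> * y) \<partial>A)"
        using l1 l2 unfolding step by (rule LIMSEQ_unique)
      interpret L: prob_space "?N \<bind> \<kappa>" using r1 by (simp add: real_distribution_def)
      interpret R: prob_space "density A (\<lambda>y. ennreal (1 + \<sigma> * y))" by (rule dens[OF A])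
      have "ennreal (cdf (?N \<bind> \<kappa>) c) = (\<integral>\<^sup>+x. emeasure (\<kappa> x) {..c} \<partial>?N)"
        unfolding cdf_def L.emeasure_eq_measure[symmetric]
        by (rule emeasure_bind[OF _ \<kappa>N]) (auto simp: B.not_empty)
      also have "\<dots> = (\<integral>\<^sup>+x. ennreal (1 + \<sigma> * x) * ennreal (F x c) \<partial>B)"
        by (simp add: \<kappa>c nn_integral_density)
      also have "\<dots> = (\<integral>\<^sup>+x. ennreal (F x c * (1 + \<sigma> * x)) \<partial>B)"
        by (simp add: ennreal_mult' F01 mult.commute[of "ennreal (1 + _)"])
      also have "\<dots> = ennreal (\<integral>x. F x c * (1 + \<sigma> * x) \<partial>B)"
        by (rule nn_integral_eq_integral, rule bias_law_integrable[OF B, of _ 2])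
           (use nnB F01 w2[of _ "\<lambda>x. F x c"] in \<open>auto elim!: eventually_mono\<close>)
      also have "\<dots> = ennreal (\<integral>y. indicator {..c} y * (1 + \<sigma> * y) \<partial>A)" by (simp add: eq)
      also have "\<dots> = (\<integral>\<^sup>+y. ennreal (indicator {..c} y * (1 + \<sigma> * y)) \<partial>A)"
        by (rule nn_integral_eq_integral[symmetric], rule bias_law_integrable[OF A, of _ 2])
           (use nnA w2[of _ "indicator {..c}"] in \<open>auto elim!: eventually_mono\<close>)
      also have "\<dots> = (\<integral>\<^sup>+y. ennreal (1 + \<sigma> * y) * indicator {..c} y \<partial>A)"
        by (rule nn_integral_cong) (auto simp: indicator_def)
      also have "\<dots> = ennreal (cdf (density A (\<lambda>y. ennreal (1 + \<sigma> * y))) c)"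
        unfolding cdf_def R.emeasure_eq_measure[symmetric] by (subst emeasure_density) auto
      finally show "cdf (?N \<bind> \<kappa>) c = cdf (density A (\<lambda>y. ennreal (1 + \<sigma> * y))) c"
        by (simp add: cdf_def)
    qed
  qed
  show ?thesis by (rule bexI[OF _ \<kappa>], rule ballI, rule fin) auto
qed

section \<open>Log-likelihood ratios\<close>

definition bias_llr :: "real \<Rightarrow> ereal" where
  "bias_llr x = (if 1 \<le> x then \<infinity> else if x \<le> -1 then -\<infinity> else ereal (ln ((1 + x) / (1 - x))))"

text \<open>On real arguments this is \<open>tanh (r / 2)\<close>.\<close>

definition llr_bias :: "ereal \<Rightarrow> real" where
  "llr_bias r = (if r = \<infinity> then 1 else if r = -\<infinity> then -1 else (exp (real_of_ereal r) - 1) / (exp (real_of_ereal r) + 1))"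

lemma measurable_bias_llr [measurable]: "bias_llr \<in> borel_measurable borel"
  unfolding bias_llr_def[abs_def] by measurable

lemma measurable_llr_bias [measurable]: "llr_bias \<in> borel_measurable borel"
  unfolding llr_bias_def[abs_def] by measurable

lemma abs_llr_bias_le [simp]: "\<bar>llr_bias r\<bar> \<le> 1"
proof (cases r)
  case (real x)
  have "\<bar>exp x - 1\<bar> \<le> exp x + 1" using exp_gt_zero[of x] by linarith
  moreover have "0 < exp x + 1" using exp_gt_zero[of x] by linarith
  ultimately show ?thesis using real by (simp add: llr_bias_def abs_divide)
qed (auto simp: llr_bias_def)

lemma llr_bias_inverse: "llr_bias (bias_llr x) = clamp1 x"
proof -
  consider "1 \<le> x" | "x \<le> -1" | "-1 < x" "x < 1" by linarith
  then show ?thesis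
  proof cases
    case 3
    then have "0 < (1 + x) / (1 - x)" by simp
    then have "llr_bias (bias_llr x) = ((1 + x) / (1 - x) - 1) / ((1 + x) / (1 - x) + 1)"
      using 3 by (simp add: bias_llr_def llr_bias_def)
    also have "\<dots> = x" using 3 by (simp add: divide_simps)
    finally show ?thesis using 3 by (simp add: clamp1_def)
  qed (auto simp: bias_llr_def llr_bias_def clamp1_def)
qed

lemma llr_bias_real:
  "1 + llr_bias (ereal x) = 2 * exp x / (exp x + 1)" "1 - llr_bias (ereal x) = 2 / (exp x + 1)"
proof -
  have "exp x + 1 \<noteq> 0" using exp_gt_zero[of x] by linarith
  then show "1 + llr_bias (ereal x) = 2 * exp x / (exp x + 1)" "1 - llr_bias (ereal x) = 2 / (exp x + 1)"
    by (simp_all add: llr_bias_def field_simps)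
qed

lemma bias_llr_inverse: "bias_llr (llr_bias r) = r"
proof (cases r)
  case (real x)
  have p: "0 < exp x + 1" using exp_gt_zero[of x] by linarith
  have "0 < 1 + llr_bias (ereal x)" "0 < 1 - llr_bias (ereal x)" unfolding llr_bias_real using p by auto
  moreover have "(1 + llr_bias (ereal x)) / (1 - llr_bias (ereal x)) = exp x" unfolding llr_bias_real using p by simp
  ultimately show ?thesis using real by (auto simp: bias_llr_def)
qed (auto simp: llr_bias_def bias_llr_def)

text \<open>For a bias law \<open>A\<close>, the parameters \<open>s = 1\<close> and \<open>s = - 1\<close> give the law of the log-likelihood
  ratio under input 0 and input 1; intermediate values arise for noisy inputs.\<close>

definition llr_law :: "real \<Rightarrow> real measure \<Rightarrow> ereal measure" where
  "llr_law s A = distr (density A (\<lambda>x. ennreal (1 + s * x))) borel bias_llr"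

lemma sets_llr_law [simp, measurable_cong]: "sets (llr_law s A) = sets borel"
  by (simp add: llr_law_def)

lemma space_llr_law [simp]: "space (llr_law s A) = UNIV"
  by (simp add: llr_law_def)

lemma nn_integral_llr_law:
  assumes A: "bias_law A" and [measurable]: "f \<in> borel_measurable borel"
  shows "(\<integral>\<^sup>+r. f r \<partial>llr_law s A) = (\<integral>\<^sup>+x. ennreal (1 + s * x) * f (bias_llr x) \<partial>A)"
proof -
  note [measurable_cong] = bias_lawD(2)[OF A]
  show ?thesis unfolding llr_law_def by (subst nn_integral_distr) (auto simp: nn_integral_density)
qed

lemma emeasure_llr_law:
  assumes A: "bias_law A" and E: "E \<in> sets borel"
  shows "emeasure (llr_law s A) E = (\<integral>\<^sup>+x. ennreal (1 + s * x) * indicator E (bias_llr x) \<partial>A)"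
  using nn_integral_llr_law[OF A, of "indicator E" s] E by simp

lemma AE_one_add_nonneg: "bias_law A \<Longrightarrow> \<bar>s\<bar> \<le> 1 \<Longrightarrow> AE x in A. 0 \<le> 1 + s * x"
  by (drule bias_lawD(3), erule eventually_mono) (rule one_add_mult_nonneg)

lemma integral_llr_law:
  assumes A: "bias_law A" and s: "\<bar>s\<bar> \<le> 1" and [measurable]: "f \<in> borel_measurable borel"
  shows "(\<integral>r. f r \<partial>llr_law s A) = (\<integral>x. (1 + s * x) * (f (bias_llr x) :: real) \<partial>A)"
proof -
  note [measurable_cong] = bias_lawD(2)[OF A]
  show ?thesis unfolding llr_law_def
    using AE_one_add_nonneg[OF A s] by (subst integral_distr) (auto simp: integral_density)
qed

lemma prob_space_llr_law: "bias_law A \<Longrightarrow> \<bar>s\<bar> \<le> 1 \<Longrightarrow> prob_space (llr_law s A)"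
  using nn_integral_llr_law[of A "\<lambda>_. 1" s] bias_law_nn_integral_affine[of A s]
  by (intro prob_spaceI) simp

text \<open>Since \<open>exp (-r) = (1 - x) / (1 + x)\<close>, the tilt by \<open>exp_neg\<close>
  turns the weight \<open>1 + x\<close> into \<open>1 - x\<close>. At \<open>x = -1\<close> only the
  latter is positive: this is the mass that the tilt misses and the complement places at
  -\<infinity>.\<close>

lemma llr_distribution_llr_law:
  assumes A: "bias_law A"
  shows "llr_distribution (llr_law 1 A)" "complement (llr_law 1 A) = llr_law (-1) A"
proof -
  have ae: "AE x in A. \<bar>x\<bar> \<le> 1" by (rule bias_lawD(3)[OF A])
  have w: "ennreal (1 + 1 * x) * (exp_neg (bias_llr x) * indicator E (bias_llr x)) = ennreal (1 + (-1) * x) * indicator E (bias_llr x)"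
    if "\<bar>x\<bar> \<le> 1" "-\<infinity> \<notin> E" for x E
  proof -
    consider "x = 1" | "x = -1" | "-1 < x" "x < 1" using \<open>\<bar>x\<bar> \<le> 1\<close> by linarith
    then show ?thesis
    proof cases
      case 3
      then have p: "0 < (1 + x) / (1 - x)" by simp
      then have "exp_neg (bias_llr x) = ennreal ((1 - x) / (1 + x))"
        using 3 by (simp add: bias_llr_def exp_minus inverse_eq_divide)
      moreover have "(1 + x) * ((1 - x) / (1 + x)) = 1 - x" using 3 by simp
      ultimately have "ennreal (1 + x) * exp_neg (bias_llr x) = ennreal (1 - x)"
        using 3 by (metis ennreal_mult' less_eq_real_def add.commute less_iff_diff_less_0 diff_minus_eq_add neg_less_iff_less add_pos_pos linorder_not_less add_less_cancel_left)
      then show ?thesis by (simp flip: mult.assoc)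
    qed (use that in \<open>auto simp: bias_llr_def\<close>)
  qed
  have m: "emeasure (llr_law 1 A) {-\<infinity>} = 0"
  proof -
    have "emeasure (llr_law 1 A) {-\<infinity>} = (\<integral>\<^sup>+x. 0 \<partial>A)"
      unfolding emeasure_llr_law[OF A borel_singleton[OF sets.empty_sets]]
    proof (rule nn_integral_cong_AE)
      show "AE x in A. ennreal (1 + 1 * x) * indicator {-\<infinity>} (bias_llr x) = 0"
        using ae by eventually_elim (auto simp: bias_llr_def indicator_def)
    qed
    then show ?thesis by simp
  qed
  have d: "dist_above_MInf (llr_law 1 A)"
    using prob_space_llr_law[OF A, of 1] m by (simp add: dist_above_MInf_def)
  have "(\<integral>\<^sup>+r. exp_neg r \<partial>llr_law 1 A) = (\<integral>\<^sup>+r. exp_neg r * indicator (- {-\<infinity>}) r \<partial>llr_law 1 A)"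
  proof (rule nn_integral_cong_AE)
    have "AE r in llr_law 1 A. r \<notin> {-\<infinity>}" by (rule AE_not_in) (use m in auto)
    then show "AE r in llr_law 1 A. exp_neg r = exp_neg r * indicator (- {-\<infinity>}) r" by eventually_elim auto
  qed
  also have "\<dots> = (\<integral>\<^sup>+x. ennreal (1 + (-1) * x) * indicator (- {-\<infinity>}) (bias_llr x) \<partial>A)"
    by (subst nn_integral_llr_law[OF A]) (use ae in \<open>auto intro!: nn_integral_cong_AE elim!: eventually_mono simp: w[simplified]\<close>)
  also have "\<dots> \<le> (\<integral>\<^sup>+x. ennreal (1 + (-1) * x) \<partial>A)" by (intro nn_integral_mono) (auto simp: indicator_def)
  also have "\<dots> = 1" by (rule bias_law_nn_integral_affine[OF A]) simp
  finally show L: "llr_distribution (llr_law 1 A)" using d by (simp add: llr_distribution_def)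
  have top: "emeasure (llr_law (-1) A) {\<infinity>} = 0"
  proof -
    have "emeasure (llr_law (-1) A) {\<infinity>} = (\<integral>\<^sup>+x. 0 \<partial>A)"
      unfolding emeasure_llr_law[OF A borel_singleton[OF sets.empty_sets]]
    proof (rule nn_integral_cong_AE)
      show "AE x in A. ennreal (1 + (-1) * x) * indicator {\<infinity>} (bias_llr x) = 0"
        using ae by eventually_elim (auto simp: bias_llr_def indicator_def)
    qed
    then show ?thesis by simp
  qed
  show "complement (llr_law 1 A) = llr_law (-1) A"
  proof (rule complement_unique[OF L, symmetric])
    fix E :: "ereal set" assume [measurable]: "E \<in> sets borel" and E: "E \<subseteq> {-\<infinity><..<\<infinity>}"
    then have "-\<infinity> \<notin> E" by auto
    then show "emeasure (llr_law (-1) A) E = (\<integral>\<^sup>+r. exp_neg r * indicator E r \<partial>llr_law 1 A)"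
      by (subst nn_integral_llr_law[OF A], measurable, subst emeasure_llr_law[OF A])
         (use ae w in \<open>auto intro!: nn_integral_cong_AE elim!: eventually_mono\<close>)
  qed (use top prob_space_llr_law[OF A, of "-1"] in auto)
qed

text \<open>The weights \<open>1 + x\<close> and \<open>1 - x\<close> add up to 2, so an LLR law and
  its complement together give back twice the bias law.\<close>

lemma llr_law_inject:
  assumes A: "bias_law A" and B: "bias_law B" and eq: "llr_law 1 A = llr_law 1 B"
  shows "A = B"
proof (rule measure_eqI)
  show "sets A = sets B" using bias_lawD(2)[OF A] bias_lawD(2)[OF B] by simp
  have eq': "llr_law (-1) A = llr_law (-1) B"
    using eq llr_distribution_llr_law(2)[OF A] llr_distribution_llr_law(2)[OF B] by simp
  have two: "emeasure (llr_law 1 C) (llr_bias -` S) + emeasure (llr_law (-1) C) (llr_bias -` S) = 2 * emeasure C S"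
    if C: "bias_law C" and [measurable]: "S \<in> sets borel" for C S
  proof -
    note [measurable_cong] = bias_lawD(2)[OF C]
    have V: "llr_bias -` S \<in> sets borel" using measurable_sets[OF measurable_llr_bias, of S] by simp
    have "emeasure (llr_law 1 C) (llr_bias -` S) + emeasure (llr_law (-1) C) (llr_bias -` S)
      = (\<integral>\<^sup>+x. ennreal (1 + 1 * x) * indicator S (clamp1 x) + ennreal (1 + (-1) * x) * indicator S (clamp1 x) \<partial>C)"
      unfolding emeasure_llr_law[OF C V] by (subst nn_integral_add) (auto simp: indicator_vimage llr_bias_inverse)
    also have "\<dots> = (\<integral>\<^sup>+x. 2 * indicator S x \<partial>C)"
    proof (rule nn_integral_cong_AE)
      show "AE x in C. ennreal (1 + 1 * x) * indicator S (clamp1 x) + ennreal (1 + (-1) * x) * indicator S (clamp1 x) = 2 * indicator S x"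
        using bias_lawD(3)[OF C]
      proof eventually_elim
        case (elim x)
        then have "ennreal (1 + 1 * x) + ennreal (1 + (-1) * x) = ennreal 2"
          by (subst ennreal_plus[symmetric]) auto
        then show ?case using elim by (simp flip: distrib_right)
      qed
    qed
    also have "\<dots> = 2 * emeasure C S" using bias_lawD(2)[OF C] by (simp add: nn_integral_cmult)
    finally show ?thesis .
  qed
  fix S assume "S \<in> sets A"
  then have "S \<in> sets borel" using bias_lawD(2)[OF A] by simp
  from two[OF A this] two[OF B this] have "2 * emeasure A S = 2 * emeasure B S" by (simp add: eq eq')
  then show "emeasure A S = emeasure B S" by (simp add: ennreal_mult_cancel_left)
qed

section \<open>From LLR distributions to bias laws\<close>

lemma mixture_eq_bind:
  assumes M: "prob_space M" "sets M = sets borel" and N: "prob_space N" "sets N = sets borel" and p: "0 \<le> p" "p \<le> 1"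
  shows "mixture p M N = measure_pmf (bernoulli_pmf p) \<bind> (\<lambda>b. if b then N else M)"
proof (rule measure_eqI)
  have m: "(\<lambda>b. if b then N else M) \<in> measurable (measure_pmf (bernoulli_pmf p)) (subprob_algebra borel)"
    using M N by (auto simp: measurable_pmf_measure1 space_subprob_algebra prob_space_imp_subprob_space)
  show "sets (mixture p M N) = sets (measure_pmf (bernoulli_pmf p) \<bind> (\<lambda>b. if b then N else M))"
    by (subst sets_bind[where N = borel]) (use M N in auto)
  fix E assume "E \<in> sets (mixture p M N)"
  then have E: "E \<in> sets borel" by simp
  show "emeasure (mixture p M N) E = emeasure (measure_pmf (bernoulli_pmf p) \<bind> (\<lambda>b. if b then N else M)) E"
    using p by (simp add: emeasure_mixture[OF M(2) N(2) E] emeasure_bind[OF _ m E] mult.commute add.commute)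
qed

lemma nn_integral_complement_vanishing:
  assumes s: "sets \<mu> = sets borel" and [measurable]: "f \<in> borel_measurable borel" and f: "f (-\<infinity>) = 0"
  shows "(\<integral>\<^sup>+r. f r \<partial>complement \<mu>) = (\<integral>\<^sup>+r. exp_neg r * f r \<partial>\<mu>)"
proof -
  note [measurable_cong] = s
  have "density (complement \<mu>) (indicator (- {-\<infinity>})) = density \<mu> (\<lambda>r. exp_neg r * indicator (- {-\<infinity>}) r)"
  proof (rule measure_eqI)
    fix E assume "E \<in> sets (density (complement \<mu>) (indicator (- {-\<infinity>})))"
    then have [measurable]: "E \<in> sets borel" by simp
    have "emeasure (density (complement \<mu>) (indicator (- {-\<infinity>}))) E = (\<integral>\<^sup>+r. indicator (- {-\<infinity>} \<inter> E) r \<partial>complement \<mu>)"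
      by (subst emeasure_density) (auto simp: indicator_inter_arith[symmetric])
    also have "\<dots> = emeasure (complement \<mu>) (- {-\<infinity>} \<inter> E)" by simp
    also have "\<dots> = (\<integral>\<^sup>+r. exp_neg r * indicator (- {-\<infinity>} \<inter> E) r \<partial>\<mu>)"
      by (subst emeasure_complement[OF s]) auto
    also have "\<dots> = emeasure (density \<mu> (\<lambda>r. exp_neg r * indicator (- {-\<infinity>}) r)) E"
      using s by (subst emeasure_density) (auto intro!: nn_integral_cong simp: indicator_def)
    finally show "emeasure (density (complement \<mu>) (indicator (- {-\<infinity>}))) E
       = emeasure (density \<mu> (\<lambda>r. exp_neg r * indicator (- {-\<infinity>}) r)) E" .
  qed (simp add: s)
  then have "(\<integral>\<^sup>+r. f r \<partial>density (complement \<mu>) (indicator (- {-\<infinity>})))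
      = (\<integral>\<^sup>+r. f r \<partial>density \<mu> (\<lambda>r. exp_neg r * indicator (- {-\<infinity>}) r))" by simp
  moreover have "(\<integral>\<^sup>+r. f r \<partial>density (complement \<mu>) (indicator (- {-\<infinity>}))) = (\<integral>\<^sup>+r. f r \<partial>complement \<mu>)"
    by (subst nn_integral_density) (auto intro!: nn_integral_cong simp: indicator_def f)
  moreover have "(\<integral>\<^sup>+r. f r \<partial>density \<mu> (\<lambda>r. exp_neg r * indicator (- {-\<infinity>}) r)) = (\<integral>\<^sup>+r. exp_neg r * f r \<partial>\<mu>)"
    by (subst nn_integral_density) (auto intro!: nn_integral_cong simp: indicator_def f)
  ultimately show ?thesis by simp
qed

text \<open>The bias law is the law of the bias when the input bit is fair, that is, under the equal
  mixture of \<mu> and its complement.\<close>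

lemma llr_distribution_obtain_bias_law:
  assumes \<mu>: "llr_distribution \<mu>"
  obtains A where "bias_law A" "\<mu> = llr_law 1 A"
proof -
  have s[measurable_cong]: "sets \<mu> = sets borel" and ps: "prob_space \<mu>" and m: "emeasure \<mu> {-\<infinity>} = 0"
    using \<mu> by (auto simp: llr_distribution_def dist_above_MInf_def)
  note c = complement_LLR(1)[OF \<mu>]
  define N where "N = mixture (1 / 2) \<mu> (complement \<mu>)"
  have Nb: "N = measure_pmf (bernoulli_pmf (1 / 2)) \<bind> (\<lambda>b. if b then complement \<mu> else \<mu>)"
    unfolding N_def by (rule mixture_eq_bind) (use s ps c in auto)
  have meas: "(\<lambda>b. if b then complement \<mu> else \<mu>) \<in> measurable (measure_pmf (bernoulli_pmf (1 / 2))) (subprob_algebra borel)"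
    using s ps c by (auto simp: measurable_pmf_measure1 space_subprob_algebra prob_space_imp_subprob_space)
  have Np: "prob_space N" unfolding Nb by (rule measure_pmf.prob_space_bind[OF _ meas]) (use ps c in auto)
  have [measurable_cong]: "sets N = sets borel" by (simp add: N_def)
  define A where "A = distr N borel llr_bias"
  \<comment> \<open>Relative to \<mu>, the mixture has the weight \<open>(1 + exp (-r)) / 2\<close>
    at finite \<open>r\<close>, and \<open>1 + llr_bias r\<close> is its reciprocal; at \<infinity>
    the two are 1/2 and 2. The constant test gives the centring of \<open>A\<close>.\<close>
  have key: "(\<integral>\<^sup>+x. ennreal (1 + x) * G (bias_llr x) \<partial>A) = (\<integral>\<^sup>+r. G r \<partial>\<mu>)"
    if [measurable]: "G \<in> borel_measurable borel" for G
  proof -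
    define g where "g r = ennreal (1 + llr_bias r) * G r" for r
    have [measurable]: "g \<in> borel_measurable borel" unfolding g_def by measurable
    have "(\<integral>\<^sup>+x. ennreal (1 + x) * G (bias_llr x) \<partial>A) = (\<integral>\<^sup>+r. g r \<partial>N)"
      unfolding A_def by (subst nn_integral_distr) (auto simp: bias_llr_inverse g_def[abs_def])
    also have "\<dots> = (\<integral>\<^sup>+r. g r \<partial>complement \<mu>) * ennreal (1 / 2) + (\<integral>\<^sup>+r. g r \<partial>\<mu>) * ennreal (1 / 2)"
      unfolding Nb by (subst nn_integral_bind[OF _ meas]) auto
    also have "(\<integral>\<^sup>+r. g r \<partial>complement \<mu>) = (\<integral>\<^sup>+r. exp_neg r * g r \<partial>\<mu>)"
      by (rule nn_integral_complement_vanishing[OF s]) (auto simp: g_def llr_bias_def)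
    also have "(\<integral>\<^sup>+r. exp_neg r * g r \<partial>\<mu>) * ennreal (1 / 2) + (\<integral>\<^sup>+r. g r \<partial>\<mu>) * ennreal (1 / 2)
       = (\<integral>\<^sup>+r. exp_neg r * g r + g r \<partial>\<mu>) * ennreal (1 / 2)"
      by (subst nn_integral_add) (auto simp: distrib_right)
    also have "\<dots> = (\<integral>\<^sup>+r. 2 * G r \<partial>\<mu>) * ennreal (1 / 2)"
    proof (rule arg_cong[where f = "\<lambda>x. x * ennreal (1 / 2)"], rule nn_integral_cong_AE)
      have "AE r in \<mu>. r \<noteq> -\<infinity>" using AE_not_in[of "{-\<infinity>}" \<mu>] m s by (auto simp: null_sets_def)
      then show "AE r in \<mu>. exp_neg r * g r + g r = 2 * G r"
      proof eventually_elim
        case (elim r)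
        have "exp_neg r * ennreal (1 + llr_bias r) + ennreal (1 + llr_bias r) = 2"
        proof (cases r)
          case (real x)
          have p: "0 < exp x + 1" using exp_gt_zero[of x] by linarith
          have e: "exp (- x) * (2 * exp x / (exp x + 1)) + 2 * exp x / (exp x + 1) = 2"
          proof -
            have "exp (- x) * (2 * exp x / (exp x + 1)) = 2 / (exp x + 1)" by (simp add: exp_minus)
            also have "2 / (exp x + 1) + 2 * exp x / (exp x + 1) = 2 * (exp x + 1) / (exp x + 1)"
              by (simp only: add_divide_distrib[symmetric]) simp
            also have "\<dots> = 2" by (rule nonzero_mult_div_cancel_right) (use p in linarith)
            finally show ?thesis .
          qed
          have "exp_neg r * ennreal (1 + llr_bias r) + ennreal (1 + llr_bias r)
             = ennreal (exp (- x) * (2 * exp x / (exp x + 1)) + 2 * exp x / (exp x + 1))"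
          proof -
            have "ennreal (exp (- x) * t + t) = ennreal (exp (- x)) * ennreal t + ennreal t" if "0 \<le> t" for t
              using that by (simp add: ennreal_mult ennreal_plus)
            moreover have "0 \<le> 2 * exp x / (exp x + 1)" using p by simp
            ultimately show ?thesis unfolding real llr_bias_real exp_neg_simps by metis
          qed
          then show ?thesis unfolding e by simp
        qed (use elim in \<open>auto simp: llr_bias_def\<close>)
        then have "(exp_neg r * ennreal (1 + llr_bias r) + ennreal (1 + llr_bias r)) * G r = 2 * G r" by simp
        then show ?case by (simp add: g_def distrib_right mult.assoc)
      qed
    qed
    also have "\<dots> = (\<integral>\<^sup>+r. G r \<partial>\<mu>)"
    proof -
      have "(2 :: ennreal) * ennreal (1 / 2) = 1" by (metis ennreal_1 ennreal_mult ennreal_numeral mult.commute nonzero_divide_eq_eq zero_le_numeral zero_neq_numeral divide_nonneg_nonneg zero_le_one)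
      then show ?thesis by (simp add: nn_integral_cmult) (metis mult.assoc mult.commute mult.right_neutral)
    qed
    finally show ?thesis .
  qed
  have Ap: "prob_space A" unfolding A_def by (rule prob_space.prob_space_distr[OF Np]) measurable
  interpret A: prob_space A by (rule Ap)
  have sA[measurable_cong]: "sets A = sets borel" by (simp add: A_def)
  have ae: "AE x in A. \<bar>x\<bar> \<le> 1" unfolding A_def by (subst AE_distr_iff) auto
  have i: "integrable A (\<lambda>x. x)" by (rule A.integrable_const_bound[of _ 1]) (use ae in auto)
  have "ennreal (\<integral>x. 1 + x \<partial>A) = (\<integral>\<^sup>+x. ennreal (1 + x) \<partial>A)"
    by (rule nn_integral_eq_integral[symmetric]) (use i ae in \<open>auto elim!: eventually_mono\<close>)
  also have "\<dots> = 1" using key[of "\<lambda>_. 1"] prob_space.emeasure_space_1[OF ps] by simp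
  finally have "(\<integral>x. 1 + x \<partial>A) = 1" by simp
  then have "(\<integral>x. x \<partial>A) = 0" using i by (simp add: A.prob_space)
  then have A: "bias_law A" using Ap sA ae by (simp add: bias_law_def)
  have "\<mu> = llr_law 1 A"
  proof (rule measure_eqI)
    fix E assume "E \<in> sets \<mu>"
    then have E: "E \<in> sets borel" using s by simp
    show "emeasure \<mu> E = emeasure (llr_law 1 A) E"
      using key[of "indicator E"] E s by (simp add: emeasure_llr_law[OF A E])
  qed (simp add: s)
  with A show ?thesis by (rule that)
qed

lemma llr_law_return_0: "llr_law 1 (return borel 0) = trivial_dist"
proof (rule measure_eqI)
  fix E assume "E \<in> sets (llr_law 1 (return borel 0))"
  then have [measurable]: "E \<in> sets borel" by simp
  then show "emeasure (llr_law 1 (return borel 0)) E = emeasure trivial_dist E"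
    by (subst emeasure_llr_law[OF bias_law_return_0]) (auto simp: nn_integral_return bias_llr_def emeasure_return zero_ereal_def)
qed simp

lemma llr_law_fair: "llr_law 1 fair_law = noiseless_dist"
proof (rule measure_eqI)
  fix E assume "E \<in> sets (llr_law 1 fair_law)"
  then have [measurable]: "E \<in> sets borel" by simp
  have "emeasure (llr_law 1 fair_law) E = (\<integral>\<^sup>+x. ennreal (1 + x) * indicator E (bias_llr x) \<partial>measure_pmf (pmf_of_set {-1, 1}))"
    unfolding fair_law_def by (subst emeasure_llr_law[OF bias_law_fair[unfolded fair_law_def]]) (auto simp: nn_integral_distr)
  also have "\<dots> = indicator E \<infinity>"
  proof -
    define g where "g x = ennreal (1 + x) * indicator E (bias_llr x)" for x
    have "(\<integral>\<^sup>+x. g x \<partial>measure_pmf (pmf_of_set {-1, 1})) = (g (-1) + g 1) / 2"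
      by (subst nn_integral_pmf_of_set) auto
    also have "g (-1) = 0" by (simp add: g_def)
    also have "g 1 = 2 * indicator E \<infinity>" by (simp add: g_def bias_llr_def)
    also have "(0 + 2 * indicator E \<infinity>) / 2 = (indicator E \<infinity> :: ennreal)" by (simp add: indicator_def)
    finally show ?thesis by (simp add: g_def)
  qed
  finally show "emeasure (llr_law 1 fair_law) E = emeasure noiseless_dist E" by (simp add: emeasure_return)
qed simp

subsection \<open>The belief propagation operator in terms of bias laws\<close>

lemma measurable_bp_edge: "0 \<le> \<delta> \<Longrightarrow> \<delta> \<le> 1 \<Longrightarrow> bp_edge \<delta> \<in> borel_measurable borel"
  by (intro borel_measurable_continuous_onI continuous_on_bp_edge)

lemma bp_edge_bias_llr:
  assumes x: "\<bar>x\<bar> \<le> 1" and d: "0 \<le> \<delta>" "\<delta> \<le> 1"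
  shows "bp_edge \<delta> (bias_llr x) = bias_llr ((1 - 2 * \<delta>) * x)"
proof -
  consider "x = 1" | "x = -1" | "-1 < x" "x < 1" using x by linarith
  then show ?thesis
  proof cases
    case 1
    consider "\<delta> = 0" | "\<delta> = 1" | "0 < \<delta>" "\<delta> < 1" using d by linarith
    then show ?thesis
    proof cases
      case 3
      have "(1 + (1 - 2 * \<delta>)) / (1 - (1 - 2 * \<delta>)) = (1 - \<delta>) / \<delta>" using 3 by (simp add: field_simps)
      then show ?thesis using 1 3 by (simp add: bias_llr_def bp_edge_def)
    qed (use 1 in \<open>auto simp: bias_llr_def bp_edge_def\<close>)
  next
    case 2
    consider "\<delta> = 0" | "\<delta> = 1" | "0 < \<delta>" "\<delta> < 1" using d by linarith
    then show ?thesis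
    proof cases
      case 3
      have "(1 + (1 - 2 * \<delta>) * (-1)) / (1 - (1 - 2 * \<delta>) * (-1)) = \<delta> / (1 - \<delta>)" using 3 by (simp add: field_simps)
      then show ?thesis using 2 3 by (simp add: bias_llr_def bp_edge_def)
    qed (use 2 in \<open>auto simp: bias_llr_def bp_edge_def\<close>)
  next
    case 3
    let ?y = "(1 - 2 * \<delta>) * x"
    have "\<bar>?y\<bar> \<le> \<bar>x\<bar>" using d by (simp add: abs_mult mult_left_le_one_le)
    moreover have "\<bar>x\<bar> < 1" using 3 by auto
    ultimately have y: "-1 < ?y" "?y < 1" by linarith+
    have e: "exp (ln ((1 + x) / (1 - x))) = (1 + x) / (1 - x)" using 3 by simp
    have nz: "1 - x \<noteq> 0" using 3 by simp
    have "(1 - \<delta>) * ((1 + x) / (1 - x)) + \<delta> = ((1 - \<delta>) * (1 + x) + \<delta> * (1 - x)) / (1 - x)"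
      "\<delta> * ((1 + x) / (1 - x)) + (1 - \<delta>) = (\<delta> * (1 + x) + (1 - \<delta>) * (1 - x)) / (1 - x)"
      using nz by (simp_all add: field_simps)
    then have "((1 - \<delta>) * ((1 + x) / (1 - x)) + \<delta>) / (\<delta> * ((1 + x) / (1 - x)) + (1 - \<delta>))
        = (((1 - \<delta>) * (1 + x) + \<delta> * (1 - x)) / (1 - x)) / ((\<delta> * (1 + x) + (1 - \<delta>) * (1 - x)) / (1 - x))"
      by (simp only:)
    also have "\<dots> = ((1 - \<delta>) * (1 + x) + \<delta> * (1 - x)) / (\<delta> * (1 + x) + (1 - \<delta>) * (1 - x))"
      using 3 by simp
    also have "\<dots> = (1 + ?y) / (1 - ?y)" by (simp add: algebra_simps)
    finally show ?thesis using 3 y by (simp add: bias_llr_def bp_edge_def e del: mult_less_cancel_right)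
  qed
qed

lemma mixture_llr_law:
  assumes A: "bias_law A" and d: "0 \<le> \<delta>" "\<delta> \<le> 1"
  shows "mixture \<delta> (llr_law 1 A) (llr_law (-1) A) = llr_law (1 - 2 * \<delta>) A"
proof (rule measure_eqI)
  fix E assume "E \<in> sets (mixture \<delta> (llr_law 1 A) (llr_law (-1) A))"
  then have E[measurable]: "E \<in> sets borel" by simp
  note [measurable_cong] = bias_lawD(2)[OF A]
  have "emeasure (mixture \<delta> (llr_law 1 A) (llr_law (-1) A)) E
     = ennreal (1 - \<delta>) * (\<integral>\<^sup>+x. ennreal (1 + 1 * x) * indicator E (bias_llr x) \<partial>A)
      + ennreal \<delta> * (\<integral>\<^sup>+x. ennreal (1 + (-1) * x) * indicator E (bias_llr x) \<partial>A)"
    by (simp only: emeasure_mixture[OF sets_llr_law sets_llr_law E] emeasure_llr_law[OF A E])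
  also have "\<dots> = (\<integral>\<^sup>+x. ennreal (1 - \<delta>) * (ennreal (1 + 1 * x) * indicator E (bias_llr x)) + ennreal \<delta> * (ennreal (1 + (-1) * x) * indicator E (bias_llr x)) \<partial>A)"
    by (subst nn_integral_add) (auto simp: nn_integral_cmult)
  also have "\<dots> = (\<integral>\<^sup>+x. ennreal (1 + (1 - 2 * \<delta>) * x) * indicator E (bias_llr x) \<partial>A)"
  proof (rule nn_integral_cong_AE)
    show "AE x in A. ennreal (1 - \<delta>) * (ennreal (1 + 1 * x) * indicator E (bias_llr x)) + ennreal \<delta> * (ennreal (1 + (-1) * x) * indicator E (bias_llr x))
        = ennreal (1 + (1 - 2 * \<delta>) * x) * indicator E (bias_llr x)"
      using bias_lawD(3)[OF A]
    proof eventually_elim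
      case (elim x)
      then have "ennreal (1 - \<delta>) * ennreal (1 + 1 * x) + ennreal \<delta> * ennreal (1 + (-1) * x)
          = ennreal ((1 - \<delta>) * (1 + 1 * x) + \<delta> * (1 + (-1) * x))"
        using d by (simp add: ennreal_mult ennreal_plus)
      also have "(1 - \<delta>) * (1 + 1 * x) + \<delta> * (1 + (-1) * x) = 1 + (1 - 2 * \<delta>) * x" by (simp add: algebra_simps)
      finally show ?case by (simp only: mult.assoc[symmetric] distrib_right[symmetric])
    qed
  qed
  finally show "emeasure (mixture \<delta> (llr_law 1 A) (llr_law (-1) A)) E = emeasure (llr_law (1 - 2 * \<delta>) A) E"
    by (simp only: emeasure_llr_law[OF A E])
qed simp

text \<open>The weight \<open>1 + (1 - 2 * \<delta>) * x\<close> of the noisy input is precisely the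
  weight \<open>1 + y\<close> of the attenuated bias
  \<open>y = (1 - 2 * \<delta>) * x\<close>.\<close>

lemma distr_bp_edge_llr_law:
  assumes A: "bias_law A" and d: "0 \<le> \<delta>" "\<delta> \<le> 1"
  shows "distr (llr_law (1 - 2 * \<delta>) A) borel (bp_edge \<delta>) = llr_law 1 (scale (1 - 2 * \<delta>) A)"
proof (rule measure_eqI)
  have l: "\<bar>1 - 2 * \<delta>\<bar> \<le> 1" using d by auto
  note [measurable] = measurable_bp_edge[OF d]
  note [measurable_cong] = bias_lawD(2)[OF A]
  fix E assume "E \<in> sets (distr (llr_law (1 - 2 * \<delta>) A) borel (bp_edge \<delta>))"
  then have E[measurable]: "E \<in> sets borel" by simp
  have "emeasure (distr (llr_law (1 - 2 * \<delta>) A) borel (bp_edge \<delta>)) E = (\<integral>\<^sup>+r. indicator E (bp_edge \<delta> r) \<partial>llr_law (1 - 2 * \<delta>) A)"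
    using nn_integral_distr[of "bp_edge \<delta>" "llr_law (1 - 2 * \<delta>) A" borel "indicator E"] by simp
  also have "\<dots> = (\<integral>\<^sup>+x. ennreal (1 + (1 - 2 * \<delta>) * x) * indicator E (bp_edge \<delta> (bias_llr x)) \<partial>A)"
    by (rule nn_integral_llr_law[OF A]) measurable
  also have "\<dots> = (\<integral>\<^sup>+x. ennreal (1 + 1 * ((1 - 2 * \<delta>) * x)) * indicator E (bias_llr ((1 - 2 * \<delta>) * x)) \<partial>A)"
    by (rule nn_integral_cong_AE) (use bias_lawD(3)[OF A] in \<open>eventually_elim, simp add: bp_edge_bias_llr[OF _ d]\<close>)
  also have "\<dots> = (\<integral>\<^sup>+x. ennreal (1 + 1 * x) * indicator E (bias_llr x) \<partial>scale (1 - 2 * \<delta>) A)"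
    unfolding scale_def by (subst nn_integral_distr) auto
  also have "\<dots> = emeasure (llr_law 1 (scale (1 - 2 * \<delta>) A)) E"
    by (simp only: emeasure_llr_law[OF bias_law_scale[OF A l] E])
  finally show "emeasure (distr (llr_law (1 - 2 * \<delta>) A) borel (bp_edge \<delta>)) E = emeasure (llr_law 1 (scale (1 - 2 * \<delta>) A)) E" .
qed simp

lemma bias_llr_add:
  assumes "-1 < a" "a \<le> 1" "-1 < b" "b \<le> 1"
  shows "bias_llr (a \<boxplus> b) = bias_llr a + bias_llr b"
proof -
  have nm: "bias_llr x \<noteq> -\<infinity>" if "-1 < x" for x using that by (simp add: bias_llr_def)
  consider "a = 1" | "b = 1" | "a < 1" "b < 1" using assms by linarith
  then show ?thesis
  proof cases
    case 1
    then have "a \<boxplus> b = 1" using assms by (simp add: bias_add_def)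
    then show ?thesis using 1 nm[of b] assms by (simp add: bias_llr_def)
  next
    case 2
    then have "a \<boxplus> b = 1" using assms by (simp add: bias_add_def add.commute)
    then show ?thesis using 2 nm[of a] assms by (simp add: bias_llr_def)
  next
    case 3
    have ab: "\<bar>a\<bar> \<le> 1" "\<bar>b\<bar> \<le> 1" "\<bar>a\<bar> < 1" using assms 3 by auto
    have p: "0 < 1 + a * b" by (rule one_add_mult_pos[OF ab(3,2)])
    note e = bias_add_one_plus_minus[OF ab(1,2)]
    have pos: "0 < 1 + (a \<boxplus> b)" "0 < 1 - (a \<boxplus> b)"
    proof -
      have "0 < (1 + a * b) * (1 + (a \<boxplus> b))" "0 < (1 + a * b) * (1 - (a \<boxplus> b))"
        unfolding e using assms 3 by simp_all
      then show "0 < 1 + (a \<boxplus> b)" "0 < 1 - (a \<boxplus> b)" using p by (simp_all add: zero_less_mult_iff)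
    qed
    have "(1 + (a \<boxplus> b)) / (1 - (a \<boxplus> b)) = ((1 + a * b) * (1 + (a \<boxplus> b))) / ((1 + a * b) * (1 - (a \<boxplus> b)))"
      using p by simp
    also have "\<dots> = (1 + a) / (1 - a) * ((1 + b) / (1 - b))" unfolding e by simp
    finally have "ln ((1 + (a \<boxplus> b)) / (1 - (a \<boxplus> b))) = ln ((1 + a) / (1 - a) * ((1 + b) / (1 - b)))"
      by (simp only:)
    also have "\<dots> = ln ((1 + a) / (1 - a)) + ln ((1 + b) / (1 - b))"
      using assms 3 by (subst ln_mult) simp_all
    finally have "ln ((1 + (a \<boxplus> b)) / (1 - (a \<boxplus> b))) = ln ((1 + a) / (1 - a)) + ln ((1 + b) / (1 - b))" .
    then show ?thesis using assms 3 pos by (simp add: bias_llr_def)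
  qed
qed

text \<open>The weights satisfy \<open>(1 + a) (1 + b) = (1 + a b) (1 + (a \<boxplus> b))\<close>.
  Pairs with a bias -1 have weight zero, so the sum of opposite infinities never has to be
  evaluated.\<close>

lemma distr_add_llr_law:
  assumes A: "bias_law A" and B: "bias_law B"
  shows "distr (llr_law 1 A \<Otimes>\<^sub>M llr_law 1 B) borel (\<lambda>(r, s). r + s) = llr_law 1 (star A B)"
proof (rule measure_eqI)
  interpret LB: prob_space "llr_law 1 B" by (rule prob_space_llr_law[OF B]) simp
  interpret pair_prob_space A B by (rule pair_bias_law(1)[OF A B])
  note [measurable_cong] = bias_lawD(2)[OF A] bias_lawD(2)[OF B]
  fix E assume "E \<in> sets (distr (llr_law 1 A \<Otimes>\<^sub>M llr_law 1 B) borel (\<lambda>(r, s). r + s))"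
  then have E[measurable]: "E \<in> sets borel" by simp
  have "emeasure (distr (llr_law 1 A \<Otimes>\<^sub>M llr_law 1 B) borel (\<lambda>(r, s). r + s)) E
     = (\<integral>\<^sup>+z. indicator E (fst z + snd z) \<partial>(llr_law 1 A \<Otimes>\<^sub>M llr_law 1 B))"
    using nn_integral_distr[of "\<lambda>(r, s). r + s" "llr_law 1 A \<Otimes>\<^sub>M llr_law 1 B" borel "indicator E"] by (simp add: case_prod_beta')
  also have "\<dots> = (\<integral>\<^sup>+r. (\<integral>\<^sup>+s. indicator E (r + s) \<partial>llr_law 1 B) \<partial>llr_law 1 A)"
    by (subst LB.nn_integral_fst[symmetric]) auto
  also have "\<dots> = (\<integral>\<^sup>+a. ennreal (1 + 1 * a) * (\<integral>\<^sup>+b. ennreal (1 + 1 * b) * indicator E (bias_llr a + bias_llr b) \<partial>B) \<partial>A)"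
    by (subst nn_integral_llr_law[OF A], measurable, subst nn_integral_llr_law[OF B], measurable)
  also have "\<dots> = (\<integral>\<^sup>+a. (\<integral>\<^sup>+b. ennreal (1 + 1 * a) * (ennreal (1 + 1 * b) * indicator E (bias_llr a + bias_llr b)) \<partial>B) \<partial>A)"
    by (subst nn_integral_cmult) auto
  also have "\<dots> = (\<integral>\<^sup>+z. ennreal (1 + fst z) * (ennreal (1 + snd z) * indicator E (bias_llr (fst z) + bias_llr (snd z))) \<partial>(A \<Otimes>\<^sub>M B))"
    by (subst M2.nn_integral_fst[symmetric]) auto
  also have "\<dots> = (\<integral>\<^sup>+z. ennreal (1 + fst z * snd z) * (ennreal (1 + 1 * (fst z \<boxplus> snd z)) * indicator E (bias_llr (fst z \<boxplus> snd z))) \<partial>(A \<Otimes>\<^sub>M B))"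
  proof (rule nn_integral_cong_AE)
    show "AE z in A \<Otimes>\<^sub>M B. ennreal (1 + fst z) * (ennreal (1 + snd z) * indicator E (bias_llr (fst z) + bias_llr (snd z)))
      = ennreal (1 + fst z * snd z) * (ennreal (1 + 1 * (fst z \<boxplus> snd z)) * indicator E (bias_llr (fst z \<boxplus> snd z)))"
      using pair_bias_law(3)[OF A B]
    proof eventually_elim
      case (elim z)
      define a b where "a = fst z" and "b = snd z"
      have ab: "\<bar>a\<bar> \<le> 1" "\<bar>b\<bar> \<le> 1" using elim by (auto simp: a_def b_def)
      have w: "ennreal (1 + a * b) * ennreal (1 + 1 * (a \<boxplus> b)) = ennreal (1 + a) * ennreal (1 + b)"
        using ab one_add_mult_nonneg[OF ab] abs_bias_add_le_1[OF ab] bias_add_one_plus_minus(1)[OF ab]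
        by (simp add: abs_le_iff flip: ennreal_mult)
      have "ennreal (1 + a) * ennreal (1 + b) * indicator E (bias_llr a + bias_llr b)
          = ennreal (1 + a) * ennreal (1 + b) * indicator E (bias_llr (a \<boxplus> b))"
      proof (cases "a = -1 \<or> b = -1")
        case False
        then have "-1 < a" "a \<le> 1" "-1 < b" "b \<le> 1" using ab by auto
        then show ?thesis by (simp add: bias_llr_add)
      qed auto
      then show ?case unfolding a_def[symmetric] b_def[symmetric] by (simp only: mult.assoc[symmetric] w)
    qed
  qed
  also have "\<dots> = emeasure (llr_law 1 (star A B)) E"
    by (subst emeasure_llr_law[OF bias_law_star[OF A B] E], subst nn_integral_star[OF A B]) auto
  finally show "emeasure (distr (llr_law 1 A \<Otimes>\<^sub>M llr_law 1 B) borel (\<lambda>(r, s). r + s)) E = emeasure (llr_law 1 (star A B)) E" .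
qed simp

text \<open>Only the first \<open>d\<close> of the infinitely many coordinates enter. Splitting
  coordinate \<open>d\<close> from the earlier ones, which are independent of it, matches the
  recursion of \<open>star_power\<close>.\<close>

lemma distr_sum_PiM_ereal:
  fixes N :: "ereal measure" and F :: "ereal \<Rightarrow> ereal"
  assumes N: "prob_space N" "sets N = sets borel" and F: "F \<in> borel_measurable borel"
    and A: "bias_law A" and one: "distr N borel F = llr_law 1 A"
  shows "distr (\<Pi>\<^sub>M u\<in>(UNIV :: nat set). N) borel (\<lambda>r. \<Sum>u<d. F (r u)) = llr_law 1 (star_power d A)"
proof (induction d)
  case 0
  interpret P: prob_space "\<Pi>\<^sub>M u\<in>(UNIV :: nat set). N" by (rule prob_space_PiM) (rule N)
  show ?case by (simp add: P.distr_const llr_law_return_0)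
next
  case (Suc d)
  note [measurable] = F and [measurable_cong] = N(2)
  let ?P = "\<Pi>\<^sub>M u\<in>(UNIV :: nat set). N"
  interpret P: prob_space ?P by (rule prob_space_PiM) (rule N)
  have comp: "distr ?P N (\<lambda>r. r u) = N" for u using distr_PiM_component[of UNIV "\<lambda>_. N" u] N by simp
  have "P.indep_vars (\<lambda>_. N) (\<lambda>u r. r u) (UNIV :: nat set)"
    by (subst P.indep_vars_iff_distr_eq_PiM) (auto simp: comp restrict_def[abs_def] distr_id2)
  then have "P.indep_vars (\<lambda>_. borel) (\<lambda>u r. F (r u)) (UNIV :: nat set)"
    by (rule P.indep_vars_compose2) measurable
  from P.indep_var_restrict[OF this, of "{d}" "{..<d}"]
  have "P.indep_var (PiM {d} (\<lambda>_. borel)) (\<lambda>r. restrict (\<lambda>u. F (r u)) {d}) (PiM {..<d} (\<lambda>_. borel)) (\<lambda>r. restrict (\<lambda>u. F (r u)) {..<d})"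
    by auto
  then have "P.indep_var borel ((\<lambda>f. f d) \<circ> (\<lambda>r. restrict (\<lambda>u. F (r u)) {d})) borel ((\<lambda>f. \<Sum>u<d. f u) \<circ> (\<lambda>r. restrict (\<lambda>u. F (r u)) {..<d}))"
    by (rule P.indep_var_compose) auto
  moreover have "(\<lambda>f. f d) \<circ> (\<lambda>r. restrict (\<lambda>u. F (r u)) {d}) = (\<lambda>r. F (r d))" by auto
  moreover have "(\<lambda>f. \<Sum>u<d. f u) \<circ> (\<lambda>r. restrict (\<lambda>u. F (r u)) {..<d}) = (\<lambda>r. \<Sum>u<d. F (r u))" by auto
  ultimately have "P.indep_var borel (\<lambda>r. F (r d)) borel (\<lambda>r. \<Sum>u<d. F (r u))" by simp
  then have ind: "distr ?P borel (\<lambda>r. F (r d)) \<Otimes>\<^sub>M distr ?P borel (\<lambda>r. \<Sum>u<d. F (r u))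
      = distr ?P (borel \<Otimes>\<^sub>M borel) (\<lambda>r. (F (r d), \<Sum>u<d. F (r u)))"
    by (subst (asm) P.indep_var_distribution_eq) auto
  have Fd: "distr ?P borel (\<lambda>r. F (r d)) = llr_law 1 A"
  proof -
    have "distr ?P borel (\<lambda>r. F (r d)) = distr (distr ?P N (\<lambda>r. r d)) borel F"
      by (subst distr_distr) (auto simp: comp_def)
    then show ?thesis by (simp add: comp one)
  qed
  have "distr ?P borel (\<lambda>r. \<Sum>u<Suc d. F (r u)) = distr (distr ?P (borel \<Otimes>\<^sub>M borel) (\<lambda>r. (F (r d), \<Sum>u<d. F (r u)))) borel (\<lambda>(r, s). r + s)"
    by (subst distr_distr) (auto simp: comp_def add.commute)
  also have "\<dots> = llr_law 1 (star A (star_power d A))"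
    unfolding ind[symmetric] Fd Suc.IH by (rule distr_add_llr_law[OF A bias_law_star_power[OF A]])
  finally show ?case by simp
qed

lemma bp_op_llr_law:
  assumes A: "bias_law A" and d: "0 \<le> \<delta>" "\<delta> \<le> 1"
  shows "bp_op P \<delta> (llr_law 1 A) = llr_law 1 (bias_step P (1 - 2 * \<delta>) A)"
proof -
  have l: "\<bar>1 - 2 * \<delta>\<bar> \<le> 1" using d by auto
  let ?N = "mixture \<delta> (llr_law 1 A) (complement (llr_law 1 A))"
  let ?P = "\<Pi>\<^sub>M u\<in>(UNIV :: nat set). ?N"
  have N: "?N = llr_law (1 - 2 * \<delta>) A"
    unfolding llr_distribution_llr_law(2)[OF A] by (rule mixture_llr_law[OF A d])
  have Np: "prob_space ?N" unfolding N by (rule prob_space_llr_law[OF A l])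
  interpret P: prob_space ?P by (rule prob_space_PiM) (rule Np)
  have sc: "bias_law (scale (1 - 2 * \<delta>) A)" by (rule bias_law_scale[OF A l])
  have K: "bias_law (star_power d (scale (1 - 2 * \<delta>) A))" for d by (rule bias_law_star_power[OF sc])
  have law: "distr ?P borel (\<lambda>r. \<Sum>u<d. bp_edge \<delta> (r u)) = llr_law 1 (star_power d (scale (1 - 2 * \<delta>) A))" for d
    by (rule distr_sum_PiM_ereal[OF Np _ measurable_bp_edge[OF d] sc]) (simp_all only: N sets_llr_law distr_bp_edge_llr_law[OF A d])
  have ms: "(\<lambda>(d, r). \<Sum>u<d. bp_edge \<delta> (r u)) \<in> borel_measurable (measure_pmf P \<Otimes>\<^sub>M ?P)"
    by (rule measurable_bp_sum[OF d])
  note [measurable] = measurable_bp_edge[OF d]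
  show ?thesis
  proof (rule measure_eqI)
    show "sets (bp_op P \<delta> (llr_law 1 A)) = sets (llr_law 1 (bias_step P (1 - 2 * \<delta>) A))" by (simp add: bp_op_def)
    fix E assume "E \<in> sets (bp_op P \<delta> (llr_law 1 A))"
    then have E[measurable]: "E \<in> sets borel" by (simp add: bp_op_def)
    have "emeasure (bp_op P \<delta> (llr_law 1 A)) E = (\<integral>\<^sup>+z. indicator E ((\<lambda>(d, r). \<Sum>u<d. bp_edge \<delta> (r u)) z) \<partial>(measure_pmf P \<Otimes>\<^sub>M ?P))"
      unfolding bp_op_def using nn_integral_distr[OF ms, of "indicator E"] by simp
    also have "\<dots> = (\<integral>\<^sup>+d. (\<integral>\<^sup>+r. indicator E (\<Sum>u<d. bp_edge \<delta> (r u)) \<partial>?P) \<partial>measure_pmf P)"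
    proof (subst P.nn_integral_fst[symmetric])
      show "(\<lambda>z. indicator E ((\<lambda>(d, r). \<Sum>u<d. bp_edge \<delta> (r u)) z)) \<in> borel_measurable (measure_pmf P \<Otimes>\<^sub>M ?P)"
        using measurable_compose[OF ms, of "indicator E"] by simp
    qed simp
    also have "\<dots> = (\<integral>\<^sup>+d. emeasure (llr_law 1 (star_power d (scale (1 - 2 * \<delta>) A))) E \<partial>measure_pmf P)"
    proof (rule nn_integral_cong)
      fix d
      have "(\<lambda>r. \<Sum>u<d. bp_edge \<delta> (r u)) \<in> borel_measurable ?P" by measurable
      from nn_integral_distr[OF this, of "indicator E"]
      show "(\<integral>\<^sup>+r. indicator E (\<Sum>u<d. bp_edge \<delta> (r u)) \<partial>?P) = emeasure (llr_law 1 (star_power d (scale (1 - 2 * \<delta>) A))) E"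
        by (simp add: law)
    qed
    also have "\<dots> = (\<integral>\<^sup>+d. (\<integral>\<^sup>+x. ennreal (1 + 1 * x) * indicator E (bias_llr x) \<partial>star_power d (scale (1 - 2 * \<delta>) A)) \<partial>measure_pmf P)"
      by (simp only: emeasure_llr_law[OF K E])
    also have "\<dots> = (\<integral>\<^sup>+x. ennreal (1 + 1 * x) * indicator E (bias_llr x) \<partial>bias_step P (1 - 2 * \<delta>) A)"
      unfolding bias_step_def
      by (subst nn_integral_bind[where B = borel])
         (use K in \<open>auto intro!: measurable_pmf_kernel simp: bias_law_def space_subprob_algebra prob_space_imp_subprob_space\<close>)
    also have "\<dots> = emeasure (llr_law 1 (bias_step P (1 - 2 * \<delta>) A)) E"
      by (simp only: emeasure_llr_law[OF bias_law_step[OF A l] E])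
    finally show "emeasure (bp_op P \<delta> (llr_law 1 A)) E = emeasure (llr_law 1 (bias_step P (1 - 2 * \<delta>) A)) E" .
  qed
qed

lemma bp_op_iterate_llr_law:
  assumes A: "bias_law A" and d: "0 \<le> \<delta>" "\<delta> \<le> 1"
  shows "(bp_op P \<delta> ^^ h) (llr_law 1 A) = llr_law 1 ((bias_step P (1 - 2 * \<delta>) ^^ h) A)"
proof (induction h)
  case (Suc h)
  have "\<bar>1 - 2 * \<delta>\<bar> \<le> 1" using d by auto
  then show ?case using Suc bp_op_llr_law[OF bias_law_iterate[OF A] d] by simp
qed simp

subsection \<open>Weak convergence of log-likelihood ratio laws\<close>

lemma at_PInf_filtermap: "at (\<infinity>::ereal) = filtermap ereal at_top"
proof -
  have "UNIV - {\<infinity>} = {..<\<infinity>::ereal} - {\<infinity>}" by auto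
  then show ?thesis unfolding at_left_PInf[symmetric] at_within_def by simp
qed

lemma continuous_on_llr_bias: "continuous_on {-\<infinity><..} llr_bias"
proof -
  have "(llr_bias \<longlongrightarrow> llr_bias r) (at r)" if "r \<noteq> -\<infinity>" for r
  proof (cases r)
    case (real x)
    have "exp x + 1 \<noteq> 0" using exp_gt_zero[of x] by linarith
    then have "isCont (\<lambda>x. (exp x - 1) / (exp x + 1)) x" by (intro continuous_intros)
    then show ?thesis unfolding real at_ereal
      by (simp add: filterlim_filtermap llr_bias_def isCont_def)
  next
    case PInf
    have "((\<lambda>x::real. (exp x - 1) / (exp x + 1)) \<longlongrightarrow> 1) at_top" by real_asymp
    then show ?thesis unfolding PInf at_PInf_filtermap by (simp add: filterlim_filtermap llr_bias_def)
  qed (use that in simp)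
  then show ?thesis by (intro continuous_at_imp_continuous_on) (auto simp: isCont_def)
qed

lemma isCont_bias_llr:
  assumes "-1 < x" "x < 1"
  shows "isCont bias_llr x"
proof -
  have "isCont (\<lambda>x. ereal (ln ((1 + x) / (1 - x)))) x"
    using assms by (intro continuous_intros) auto
  moreover have "eventually (\<lambda>y. bias_llr y = ereal (ln ((1 + y) / (1 - y)))) (nhds x)"
    using eventually_nhds_in_open[of "{-1<..<1::real}" x] assms
    by (auto simp: bias_llr_def elim!: eventually_mono)
  ultimately show ?thesis by (simp add: isCont_cong)
qed

lemma tendsto_bias_llr_1: "(bias_llr \<longlongrightarrow> \<infinity>) (at_left 1)"
proof -
  have "filterlim (\<lambda>x::real. ln ((1 + x) / (1 - x))) at_top (at_left 1)" by real_asymp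
  then have "((\<lambda>x. ereal (ln ((1 + x) / (1 - x)))) \<longlongrightarrow> \<infinity>) (at_left 1)"
    by (simp add: tendsto_PInfty_eq_at_top)
  moreover have "eventually (\<lambda>x. ereal (ln ((1 + x) / (1 - x))) = bias_llr x) (at_left 1)"
    using eventually_at_left[of 0 "1::real"]
    by (auto simp: bias_llr_def intro!: exI[of _ 0])
  ultimately show ?thesis by (rule Lim_transform_eventually)
qed

text \<open>A test function need not extend to -\<infinity>, but it is bounded, and the weight
  \<open>1 + x\<close> vanishes at the corresponding bias -1; this restores continuity on the closed
  interval.\<close>

lemma continuous_on_llr_test_function:
  fixes f :: "ereal \<Rightarrow> real"
  assumes f: "continuous_on {-\<infinity><..} f" and C: "\<And>r. r \<noteq> -\<infinity> \<Longrightarrow> \<bar>f r\<bar> \<le> C"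
  shows "continuous_on {-1..1} (\<lambda>x. (1 + x) * (indicator {-\<infinity><..} (bias_llr x) * f (bias_llr x)))"
    (is "continuous_on _ ?g")
proof -
  have fc: "isCont f r" if "r \<noteq> -\<infinity>" for r
    using f that by (auto simp: continuous_on_eq_continuous_at)
  have "(?g \<longlongrightarrow> ?g x) (at x within {-1..1})" if x: "x \<in> {-1..1}" for x
  proof -
    consider "x = 1" | "x = -1" | "-1 < x" "x < 1" using x by force
    then show ?thesis
    proof cases
      case 1
      have w: "at (1::real) within {-1..1} = at_left 1"
        by (simp add: at_within_Icc_at_left)
      have "((\<lambda>x. f (bias_llr x)) \<longlongrightarrow> f \<infinity>) (at_left 1)"
        by (rule isCont_tendsto_compose[OF fc tendsto_bias_llr_1]) simp
      then have "((\<lambda>x. (1 + x) * f (bias_llr x)) \<longlongrightarrow> (1 + 1) * f \<infinity>) (at_left 1)"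
        by (intro tendsto_intros)
      moreover have "eventually (\<lambda>x. (1 + x) * f (bias_llr x) = ?g x) (at_left 1)"
        using tendsto_bias_llr_1[THEN order_tendstoD(1), of "-\<infinity>"] by (auto elim!: eventually_mono)
      ultimately have "(?g \<longlongrightarrow> (1 + 1) * f \<infinity>) (at_left 1)" by (rule Lim_transform_eventually)
      moreover have "?g 1 = (1 + 1) * f \<infinity>" by (simp add: bias_llr_def)
      ultimately show ?thesis unfolding 1 w by (simp only:)
    next
      case 2
      have "0 \<le> C" using C[of 0] by simp
      have "(?g \<longlongrightarrow> 0) (at (-1) within {-1..1})"
      proof (rule Lim_null_comparison)
        show "eventually (\<lambda>x. norm (?g x) \<le> \<bar>1 + x\<bar> * C) (at (-1) within {-1..1})"
          using C \<open>0 \<le> C\<close> by (auto simp: abs_mult indicator_def intro!: always_eventually mult_left_mono)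
        have "((\<lambda>x::real. \<bar>1 + x\<bar> * C) \<longlongrightarrow> \<bar>1 + (-1)\<bar> * C) (at (-1) within {-1..1})" by (intro tendsto_intros)
        then show "((\<lambda>x::real. \<bar>1 + x\<bar> * C) \<longlongrightarrow> 0) (at (-1) within {-1..1})" by simp
      qed
      then show ?thesis unfolding 2 by (simp only: add.right_inverse mult_zero_left)
    next
      case 3
      have nz: "bias_llr x \<noteq> -\<infinity>" using 3 by (simp add: bias_llr_def)
      have "isCont (\<lambda>x. f (bias_llr x)) x"
        by (rule isCont_o2[OF isCont_bias_llr[OF 3] fc[OF nz]])
      then have c: "isCont (\<lambda>x. (1 + x) * f (bias_llr x)) x" by (intro continuous_intros)
      have "eventually (\<lambda>y. (1 + y) * f (bias_llr y) = ?g y) (nhds x)"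
        using eventually_nhds_in_open[of "{-1<..<1::real}" x] 3
        by (auto simp: bias_llr_def elim!: eventually_mono)
      from isCont_cong[OF this] c have "isCont ?g x" by simp
      then show ?thesis unfolding isCont_def by (rule tendsto_within_subset) simp
    qed
  qed
  then show ?thesis by (auto simp: continuous_on_def)
qed

lemma spread_conv_llr_weakly_converges:
  assumes A: "\<And>h. bias_law (A h)" and B: "bias_law B" and conv: "spread_conv A B"
  shows "llr_weakly_converges (\<lambda>h. llr_law 1 (A h)) (llr_law 1 B)"
  unfolding llr_weakly_converges_def
proof (intro conjI allI impI)
  show "dist_above_MInf (llr_law 1 (A h))" "dist_above_MInf (llr_law 1 B)" for h
    using llr_distribution_llr_law(1)[OF A] llr_distribution_llr_law(1)[OF B] by (simp_all add: llr_distribution_def)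
  fix f :: "ereal \<Rightarrow> real" assume f: "continuous_on {-\<infinity><..} f" and "bounded (f ` {-\<infinity><..})"
  then obtain C where "\<And>y. y \<in> f ` {-\<infinity><..} \<Longrightarrow> norm y \<le> C" by (auto simp: bounded_iff)
  then have C: "\<bar>f r\<bar> \<le> C" if "r \<noteq> -\<infinity>" for r using that by force
  have m: "(\<lambda>r. indicator {-\<infinity><..} r * f r) \<in> borel_measurable borel"
    using borel_measurable_continuous_on_indicator[OF _ f] by simp
  let ?g = "\<lambda>x. (1 + x) * (indicator {-\<infinity><..} (bias_llr x) * f (bias_llr x))"
  have gm: "?g \<in> borel_measurable borel" using m by measurable
  have e: "(LINT r:{-\<infinity><..}|llr_law 1 D. f r) = (\<integral>x. ?g (clamp1 x) \<partial>D)" if D: "bias_law D" for D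
    unfolding integral_clamp1[OF D gm] set_lebesgue_integral_def
    using integral_llr_law[OF D _ m, of 1] by simp
  show "(\<lambda>h. LINT r:{-\<infinity><..}|llr_law 1 (A h). f r) \<longlonglongrightarrow> (LINT r:{-\<infinity><..}|llr_law 1 B. f r)"
    unfolding e[OF A] e[OF B]
    by (rule spread_conv_integral[OF A B conv continuous_on_llr_test_function[OF f C]])
qed

text \<open>Ramps of \<open>llr_bias\<close> are admissible tests. They determine the cdf of the
  image under \<open>llr_bias\<close>, from which \<open>bias_llr\<close> recovers the law.\<close>

lemma llr_weakly_converges_unique:
  assumes 1: "llr_weakly_converges M \<nu>1" and 2: "llr_weakly_converges M \<nu>2"
  shows "\<nu>1 = \<nu>2"
proof -
  have d: "dist_above_MInf \<nu>1" "dist_above_MInf \<nu>2" using 1 2 by (auto simp: llr_weakly_converges_def)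
  have rd: "real_distribution (distr \<nu> borel llr_bias)" if \<nu>: "dist_above_MInf \<nu>" for \<nu>
  proof -
    have [measurable_cong]: "sets \<nu> = sets borel" using \<nu> by (simp add: dist_above_MInf_def)
    have "prob_space (distr \<nu> borel llr_bias)"
      by (rule prob_space.prob_space_distr) (use \<nu> in \<open>auto simp: dist_above_MInf_def\<close>)
    then show ?thesis by (simp add: real_distribution_def real_distribution_axioms_def)
  qed
  have lim: "(\<lambda>n. LINT r:{-\<infinity><..}|\<nu>. max 0 (min 1 (1 - real n * (llr_bias r - a)))) \<longlonglongrightarrow> cdf (distr \<nu> borel llr_bias) a"
    if \<nu>: "dist_above_MInf \<nu>" for \<nu> a
  proof -
    have [measurable_cong]: "sets \<nu> = sets borel" and ps: "prob_space \<nu>" and z: "emeasure \<nu> {-\<infinity>} = 0"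
      using \<nu> by (auto simp: dist_above_MInf_def)
    interpret prob_space \<nu> by (rule ps)
    have "AE r in \<nu>. r \<noteq> -\<infinity>" using AE_not_in[of "{-\<infinity>}" \<nu>] z by (auto simp: null_sets_def)
    then have ae: "AE r in \<nu>. r \<in> {-\<infinity><..}" by eventually_elim auto
    have drop: "(LINT r:{-\<infinity><..}|\<nu>. f r) = (\<integral>r. 1 * f r \<partial>\<nu>)" if [measurable]: "f \<in> borel_measurable \<nu>" for f :: "ereal \<Rightarrow> real"
      unfolding set_lebesgue_integral_def
      by (rule integral_cong_AE) (measurable, use ae in \<open>eventually_elim, simp\<close>)
    have "(LINT r:{-\<infinity><..}|\<nu>. max 0 (min 1 (1 - real n * (llr_bias r - a))))
        = (\<integral>r. 1 * max 0 (min 1 (1 - real n * (llr_bias r - a))) \<partial>\<nu>)" for n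
      by (rule drop) measurable
    moreover have "(\<lambda>n. \<integral>r. 1 * max 0 (min 1 (1 - real n * (llr_bias r - a))) \<partial>\<nu>) \<longlonglongrightarrow> (\<integral>r. 1 * indicator {..a} (llr_bias r) \<partial>\<nu>)"
      by (rule test_function_limit[OF prob_space.finite_measure[OF ps]]) simp_all
    moreover have "(\<integral>r. 1 * indicator {..a} (llr_bias r) \<partial>\<nu>) = cdf (distr \<nu> borel llr_bias) a"
    proof -
      have "(\<integral>r. indicator {..a} (llr_bias r) \<partial>\<nu>) = (\<integral>x. (indicator {..a} x :: real) \<partial>distr \<nu> borel llr_bias)"
        by (subst integral_distr) simp_all
      then show ?thesis by (simp only: cdf_def mult_1) simp
    qed
    ultimately show ?thesis by (simp only:)
  qed
  have "cdf (distr \<nu>1 borel llr_bias) a = cdf (distr \<nu>2 borel llr_bias) a" for a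
  proof (rule LIMSEQ_unique[OF lim[OF d(1)]])
    have "(LINT r:{-\<infinity><..}|\<nu>1. max 0 (min 1 (1 - real n * (llr_bias r - a))))
        = (LINT r:{-\<infinity><..}|\<nu>2. max 0 (min 1 (1 - real n * (llr_bias r - a))))" for n
    proof -
      let ?f = "\<lambda>r. max 0 (min 1 (1 - real n * (llr_bias r - a)))"
      have c: "continuous_on {-\<infinity><..} ?f"
        by (intro continuous_intros continuous_on_llr_bias)
      have b: "bounded (?f ` {-\<infinity><..})"
        unfolding bounded_iff by (rule exI[of _ 1]) force
      have "(\<lambda>h. LINT r:{-\<infinity><..}|M h. ?f r) \<longlonglongrightarrow> (LINT r:{-\<infinity><..}|\<nu>1. ?f r)"
        "(\<lambda>h. LINT r:{-\<infinity><..}|M h. ?f r) \<longlonglongrightarrow> (LINT r:{-\<infinity><..}|\<nu>2. ?f r)"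
        using 1 2 c b unfolding llr_weakly_converges_def by simp_all
      then show ?thesis by (rule LIMSEQ_unique)
    qed
    with lim[OF d(2), of a]
    show "(\<lambda>n. LINT r:{-\<infinity><..}|\<nu>1. max 0 (min 1 (1 - real n * (llr_bias r - a)))) \<longlonglongrightarrow> cdf (distr \<nu>2 borel llr_bias) a"
      by (simp only:)
  qed
  then have eq: "distr \<nu>1 borel llr_bias = distr \<nu>2 borel llr_bias"
    by (intro cdf_unique rd d) auto
  have recover: "distr (distr \<nu> borel llr_bias) borel bias_llr = \<nu>" if \<nu>: "dist_above_MInf \<nu>" for \<nu>
  proof -
    have s[measurable_cong]: "sets \<nu> = sets borel" using \<nu> by (simp add: dist_above_MInf_def)
    have "distr (distr \<nu> borel llr_bias) borel bias_llr = distr \<nu> borel (\<lambda>r. r)"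
      by (subst distr_distr) (auto simp: comp_def bias_llr_inverse)
    then show ?thesis using s by (simp add: distr_id2)
  qed
  show ?thesis by (rule trans[OF recover[OF d(1), unfolded eq, symmetric] recover[OF d(2)]])
qed

subsection \<open>Degradation\<close>

text \<open>The kernel of \<open>coupling_kernel\<close> is conjugated by the bijection of biases
  and LLRs. Its two values of \<sigma> are the law and the complement in the definition of
  degradation.\<close>

lemma coupling_degraded:
  assumes \<pi>: "martingale_coupling \<pi> B A" and A: "bias_law A" and B: "bias_law B"
  shows "llr_law 1 A \<preceq>\<^sub>L llr_law 1 B"
proof -
  obtain \<kappa> where k[measurable]: "\<kappa> \<in> borel \<rightarrow>\<^sub>M prob_algebra borel"
    and eq: "\<And>\<sigma>. \<sigma> \<in> {1, -1} \<Longrightarrow> density B (\<lambda>x. ennreal (1 + \<sigma> * x)) \<bind> \<kappa> = density A (\<lambda>y. ennreal (1 + \<sigma> * y))"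
    using coupling_kernel[OF \<pi> A B] by blast
  define K where "K r = distr (\<kappa> (llr_bias r)) borel bias_llr" for r
  have K[measurable]: "K \<in> borel \<rightarrow>\<^sub>M prob_algebra borel"
    unfolding K_def by (rule measurable_compose[OF _ measurable_distr_prob_space2[where L = borel]]) measurable
  note ks = measurable_prob_algebraD[OF k] and Ks = measurable_prob_algebraD[OF K]
  have "llr_law \<sigma> B \<bind> K = llr_law \<sigma> A" if s: "\<sigma> \<in> {1, -1}" for \<sigma>
  proof (rule measure_eqI)
    note [measurable_cong] = bias_lawD(2)[OF B]
    show "sets (llr_law \<sigma> B \<bind> K) = sets (llr_law \<sigma> A)"
      by (subst sets_bind[where N = borel]) (simp_all add: sets_kernel[OF Ks])
    fix E assume "E \<in> sets (llr_law \<sigma> B \<bind> K)"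
    then have E[measurable]: "E \<in> sets borel"
      by (subst (asm) sets_bind[where N = borel]) (simp_all add: sets_kernel[OF Ks])
    have V: "bias_llr -` E \<in> sets borel" using measurable_sets[OF measurable_bias_llr E] by simp
    have sk: "sets (\<kappa> x) = sets borel" for x using sets_kernel[OF ks] by simp
    have "emeasure (llr_law \<sigma> B \<bind> K) E = (\<integral>\<^sup>+r. emeasure (K r) E \<partial>llr_law \<sigma> B)"
      by (rule emeasure_bind[OF _ _ E]) (use Ks in \<open>simp_all cong: measurable_cong_sets\<close>)
    also have "\<dots> = (\<integral>\<^sup>+x. ennreal (1 + \<sigma> * x) * emeasure (K (bias_llr x)) E \<partial>B)"
      by (rule nn_integral_llr_law[OF B]) (rule measurable_emeasure_kernel[OF Ks E])
    also have "\<dots> = (\<integral>\<^sup>+x. ennreal (1 + \<sigma> * x) * emeasure (\<kappa> x) (bias_llr -` E) \<partial>B)"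
    proof (rule nn_integral_cong_AE)
      show "AE x in B. ennreal (1 + \<sigma> * x) * emeasure (K (bias_llr x)) E = ennreal (1 + \<sigma> * x) * emeasure (\<kappa> x) (bias_llr -` E)"
        using bias_lawD(3)[OF B]
      proof eventually_elim
        case (elim x)
        have "emeasure (K (bias_llr x)) E = emeasure (\<kappa> x) (bias_llr -` E \<inter> space (\<kappa> x))"
          unfolding K_def using elim sk[of x]
          by (subst emeasure_distr) (auto simp: llr_bias_inverse cong: measurable_cong_sets)
        then show ?case using sets_eq_imp_space_eq[OF sk[of x]] by simp
      qed
    qed
    also have "\<dots> = (\<integral>\<^sup>+x. emeasure (\<kappa> x) (bias_llr -` E) \<partial>density B (\<lambda>x. ennreal (1 + \<sigma> * x)))"
      by (rule nn_integral_density[symmetric]) (use measurable_emeasure_kernel[OF ks V] in \<open>auto cong: measurable_cong_sets\<close>)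
    also have "\<dots> = emeasure (density B (\<lambda>x. ennreal (1 + \<sigma> * x)) \<bind> \<kappa>) (bias_llr -` E)"
      by (rule emeasure_bind[symmetric]) (use V ks bias_lawD(2)[OF B] prob_space.not_empty[OF bias_lawD(1)[OF B]] in \<open>auto cong: measurable_cong_sets\<close>)
    also have "\<dots> = emeasure (llr_law \<sigma> A) E"
      unfolding eq[OF s] llr_law_def using bias_lawD(2)[OF A] sets_eq_imp_space_eq[OF bias_lawD(2)[OF A]]
      by (subst emeasure_distr) (auto cong: measurable_cong_sets)
    finally show "emeasure (llr_law \<sigma> B \<bind> K) E = emeasure (llr_law \<sigma> A) E" .
  qed
  from this[of 1] this[of "-1"] show ?thesis
    unfolding degraded_def llr_distribution_llr_law(2)[OF A] llr_distribution_llr_law(2)[OF B]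
    by (intro bexI[OF _ K] conjI) simp_all
qed

text \<open>The spread is the best value of \<open>\<integral>x. (p + q * x) * t x\<close> over
  tests \<open>t\<close> bounded by 1, attained by the sign. The optimal test for \<open>A\<close>,
  preceded by the kernel, is a randomised test for \<open>B\<close>, so it cannot exceed the spread
  of \<open>B\<close>. This direction yields uniqueness of the dominant fixed point.\<close>

lemma degraded_less_informative:
  assumes A: "bias_law A" and B: "bias_law B" and le: "llr_law 1 A \<preceq>\<^sub>L llr_law 1 B"
  shows "A \<sqsubseteq> B"
  unfolding less_informative_def
proof (intro allI)
  fix p q :: real
  obtain K where K[measurable]: "K \<in> borel \<rightarrow>\<^sub>M prob_algebra borel"
    and eq: "llr_law 1 A = llr_law 1 B \<bind> K" "llr_law (-1) A = llr_law (-1) B \<bind> K"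
    using le unfolding degraded_def llr_distribution_llr_law(2)[OF A] llr_distribution_llr_law(2)[OF B]
    by (elim bexE conjE) (rule that)
  note Ks = measurable_prob_algebraD[OF K]
  interpret A: prob_space A by (rule bias_lawD(1)[OF A])
  interpret B: prob_space B by (rule bias_lawD(1)[OF B])
  note [measurable_cong] = bias_lawD(2)[OF A] bias_lawD(2)[OF B]
  define s where "s x = sgn (p + q * x)" for x
  have s1: "\<bar>s x\<bar> \<le> 1" for x by (simp add: s_def sgn_real_def)
  have [measurable]: "s \<in> borel_measurable borel" unfolding s_def by measurable
  define t where "t x = (\<integral>r. s (llr_bias r) \<partial>K (bias_llr x))" for x
  have tm[measurable]: "t \<in> borel_measurable borel"
    unfolding t_def by (rule measurable_compose[OF measurable_bias_llr], rule measurable_compose[OF Ks integral_measurable_subprob_algebra]) measurable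
  have t1: "\<bar>t x\<bar> \<le> 1" for x
  proof -
    have "prob_space (K (bias_llr x))" "sets (K (bias_llr x)) = sets borel"
      using measurable_space[OF K, of "bias_llr x"] by (auto simp: space_prob_algebra)
    then interpret prob_space "K (bias_llr x)" by simp
    have "\<bar>t x\<bar> \<le> (\<integral>r. \<bar>s (llr_bias r)\<bar> \<partial>K (bias_llr x))" unfolding t_def by (rule integral_abs_bound)
    also have "\<dots> \<le> (\<integral>r. 1 \<partial>K (bias_llr x))" by (rule integral_mono') (auto simp: s1)
    finally show ?thesis by (simp add: prob_space)
  qed
  have ae: "AE x in A. \<bar>x\<bar> \<le> 1" "AE x in B. \<bar>x\<bar> \<le> 1" using bias_lawD(3)[OF A] bias_lawD(3)[OF B] by auto
  have key: "(\<integral>x. (1 + \<sigma> * x) * s x \<partial>A) = (\<integral>x. (1 + \<sigma> * x) * t x \<partial>B)" if "\<sigma> \<in> {1, -1}" for \<sigma>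
  proof -
    have \<sigma>: "\<bar>\<sigma>\<bar> \<le> 1" using that by auto
    have "(\<integral>x. (1 + \<sigma> * x) * s x \<partial>A) = (\<integral>x. (1 + \<sigma> * x) * s (llr_bias (bias_llr x)) \<partial>A)"
      by (rule integral_cong_AE) (use ae(1) in \<open>auto simp: llr_bias_inverse\<close>)
    also have "\<dots> = (\<integral>r. s (llr_bias r) \<partial>llr_law \<sigma> A)"
      by (rule integral_llr_law[OF A \<sigma>, symmetric]) measurable
    also have "\<dots> = (\<integral>r. s (llr_bias r) \<partial>(llr_law \<sigma> B \<bind> K))" using that eq by auto
    also have "\<dots> = (\<integral>r. (\<integral>r'. s (llr_bias r') \<partial>K r) \<partial>llr_law \<sigma> B)"
    proof (rule integral_bind[where K = borel and B = 1 and B' = 1])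
      show "finite_measure (llr_law \<sigma> B)" using prob_space_llr_law[OF B \<sigma>] by (simp add: prob_space_def)
      show "AE r in llr_law \<sigma> B. emeasure (K r) (space (K r)) \<le> ennreal 1"
        using Ks by (intro AE_I2) (auto dest!: measurable_space simp: space_subprob_algebra intro: subprob_space.subprob_emeasure_le_1)
    qed (auto simp: s1 cong: measurable_cong_sets intro: Ks)
    also have "\<dots> = (\<integral>x. (1 + \<sigma> * x) * t x \<partial>B)"
      unfolding t_def by (rule integral_llr_law[OF B \<sigma>], rule measurable_compose[OF Ks integral_measurable_subprob_algebra]) measurable
    finally show ?thesis .
  qed
  have iA: "integrable A (\<lambda>x. (1 + \<sigma> * x) * s x)" and iB: "integrable B (\<lambda>x. (1 + \<sigma> * x) * t x)"
    if "\<sigma> \<in> {1, -1}" for \<sigma>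
  proof -
    have b: "\<bar>(1 + \<sigma> * x) * u\<bar> \<le> 2 * 1" if "\<bar>x\<bar> \<le> 1" "\<bar>u\<bar> \<le> 1" for x u
      unfolding abs_mult by (rule mult_mono) (use that \<open>\<sigma> \<in> {1, -1}\<close> in auto)
    show "integrable A (\<lambda>x. (1 + \<sigma> * x) * s x)"
      by (rule A.integrable_const_bound[of _ "2 * 1"], use ae(1) in eventually_elim) (simp only: real_norm_def b s1, measurable)
    show "integrable B (\<lambda>x. (1 + \<sigma> * x) * t x)"
      by (rule B.integrable_const_bound[of _ "2 * 1"], use ae(2) in eventually_elim) (simp only: real_norm_def b t1, measurable)
  qed
  have split: "(p + q * x) * u = (p + q) / 2 * ((1 + 1 * x) * u) + (p - q) / 2 * ((1 + (-1) * x) * u)" for x u :: real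
    by (simp add: field_simps)
  have "spread A p q = (\<integral>x. (p + q * x) * s x \<partial>A)"
    unfolding spread_def s_def by (intro Bochner_Integration.integral_cong) (auto simp: abs_sgn)
  also have "\<dots> = (p + q) / 2 * (\<integral>x. (1 + 1 * x) * s x \<partial>A) + (p - q) / 2 * (\<integral>x. (1 + (-1) * x) * s x \<partial>A)"
    unfolding split using iA[of 1] iA[of "-1"] by (subst Bochner_Integration.integral_add) simp_all
  also have "\<dots> = (p + q) / 2 * (\<integral>x. (1 + 1 * x) * t x \<partial>B) + (p - q) / 2 * (\<integral>x. (1 + (-1) * x) * t x \<partial>B)"
    using key[of 1] key[of "-1"] by simp
  also have "\<dots> = (\<integral>x. (p + q * x) * t x \<partial>B)"
    unfolding split using iB[of 1] iB[of "-1"] by (subst Bochner_Integration.integral_add) simp_all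
  also have "\<dots> \<le> spread B p q"
    unfolding spread_def
  proof (rule integral_mono)
    have "integrable B (\<lambda>x. x)" by (rule B.integrable_const_bound[of _ 1]) (use ae(2) in auto)
    then show "integrable B (\<lambda>x. \<bar>p + q * x\<bar>)" by auto
    show "integrable B (\<lambda>x. (p + q * x) * t x)"
      unfolding split using iB[of 1] iB[of "-1"] by (intro Bochner_Integration.integrable_add integrable_mult_right) simp_all
    fix x
    have "(p + q * x) * t x \<le> \<bar>p + q * x\<bar> * \<bar>t x\<bar>" by (simp flip: abs_mult)
    also have "\<dots> \<le> \<bar>p + q * x\<bar> * 1" by (rule mult_left_mono[OF t1]) simp
    finally show "(p + q * x) * t x \<le> \<bar>p + q * x\<bar>" by simp
  qed
  finally show "spread A p q \<le> spread B p q" .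
qed

theorem theorem34:
  fixes P :: "nat pmf" and \<delta> :: real
  assumes "0 \<le> \<delta>" and "\<delta> \<le> 1"
    and "\<not> ((AE d in measure_pmf P. d = 1) \<and> \<delta> \<in> {0, 1})"
  shows "\<exists>\<mu>s.
    (\<forall>\<nu>. llr_weakly_converges (\<lambda>h. (bp_op P \<delta> ^^ h) noiseless_dist) \<nu> \<longleftrightarrow> \<nu> = \<mu>s) \<and>
    (\<forall>\<mu>r. llr_distribution \<mu>r \<and> \<mu>r \<noteq> trivial_dist \<longrightarrow>
       (\<forall>\<nu>. llr_weakly_converges (\<lambda>h. (bp_op P \<delta> ^^ h) \<mu>r) \<nu> \<longleftrightarrow> \<nu> = \<mu>s)) \<and>
    (\<forall>\<nu>. dominant_bp_fixed_point P \<delta> \<nu> \<longleftrightarrow> \<nu> = \<mu>s)"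
proof -
  define l where "l = 1 - 2 * \<delta>"
  have l: "\<bar>l\<bar> \<le> 1" using assms by (auto simp: l_def)
  have nd: "\<not> ((AE d in measure_pmf P. d = 1) \<and> \<bar>l\<bar> = 1)" using assms by (auto simp: l_def)
  obtain A where A: "bias_law A" "bias_step P l A = A"
    and fair: "spread_conv (\<lambda>h. (bias_step P l ^^ h) fair_law) A"
    and robust: "\<And>C. bias_law C \<Longrightarrow> C \<noteq> return borel 0 \<Longrightarrow> spread_conv (\<lambda>h. (bias_step P l ^^ h) C) A"
    by (rule bias_recursion_converges[OF l nd]) blast
  note iter = bp_op_iterate_llr_law[OF _ assms(1,2), folded l_def]
  have conv: "llr_weakly_converges (\<lambda>h. (bp_op P \<delta> ^^ h) (llr_law 1 C)) \<nu> \<longleftrightarrow> \<nu> = llr_law 1 A"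
    if C: "bias_law C" and sc: "spread_conv (\<lambda>h. (bias_step P l ^^ h) C) A" for C \<nu>
  proof -
    have "llr_weakly_converges (\<lambda>h. (bp_op P \<delta> ^^ h) (llr_law 1 C)) (llr_law 1 A)"
      unfolding iter[OF C]
      by (rule spread_conv_llr_weakly_converges[OF bias_law_iterate[OF C l] A(1) sc])
    then show ?thesis using llr_weakly_converges_unique by blast
  qed
  have fixed: "bp_fixed_point P \<delta> (llr_law 1 A)"
    using llr_distribution_llr_law(1)[OF A(1)] bp_op_llr_law[OF A(1) assms(1,2), where P = P] A(2)
    by (simp add: bp_fixed_point_def l_def)
  have below: "\<exists>C. bias_law C \<and> \<nu> = llr_law 1 C \<and> \<nu> \<preceq>\<^sub>L llr_law 1 A" if \<nu>: "bp_fixed_point P \<delta> \<nu>" for \<nu>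
  proof -
    obtain C where C: "bias_law C" "\<nu> = llr_law 1 C"
      by (rule llr_distribution_obtain_bias_law[of \<nu>]) (use \<nu> in \<open>auto simp: bp_fixed_point_def\<close>)
    have "llr_law 1 (bias_step P l C) = llr_law 1 C"
      using \<nu> bp_op_llr_law[OF C(1) assms(1,2), where P = P] by (simp add: bp_fixed_point_def C(2) l_def)
    then have "bias_step P l C = C" by (rule llr_law_inject[OF bias_law_step[OF C(1) l] C(1)])
    then have Ch: "(bias_step P l ^^ h) C = C" for h by (induction h) auto
    \<comment> \<open>As a fixed law, \<open>C\<close> is its own iterate, so the second marginal
      stays constant along the couplings, as \<open>coupling_limit\<close> requires.\<close>
    have "\<forall>h. \<exists>\<pi>. martingale_coupling \<pi> ((bias_step P l ^^ h) fair_law) C"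
      using coupling_iterate_fair[OF C(1) l, where P = P] by (simp add: Ch)
    then obtain \<pi> where \<pi>: "\<And>h. martingale_coupling (\<pi> h) ((bias_step P l ^^ h) fair_law) C" by metis
    obtain \<pi>' where "martingale_coupling \<pi>' A C"
      using coupling_limit[OF \<pi> C(1) bias_law_iterate[OF bias_law_fair l] A(1) fair] by blast
    from coupling_degraded[OF this C(1) A(1)] C show ?thesis by blast
  qed
  have dom: "dominant_bp_fixed_point P \<delta> \<nu> \<longleftrightarrow> \<nu> = llr_law 1 A" for \<nu>
  proof
    assume "\<nu> = llr_law 1 A"
    then show "dominant_bp_fixed_point P \<delta> \<nu>"
      using fixed below by (auto simp: dominant_bp_fixed_point_def)
  next
    assume \<nu>: "dominant_bp_fixed_point P \<delta> \<nu>"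
    then have "bp_fixed_point P \<delta> \<nu>" by (simp add: dominant_bp_fixed_point_def)
    from below[OF this] obtain C where C: "bias_law C" "\<nu> = llr_law 1 C" "\<nu> \<preceq>\<^sub>L llr_law 1 A" by blast
    show "\<nu> = llr_law 1 A"
    proof (rule ccontr)
      assume "\<nu> \<noteq> llr_law 1 A"
      then have "llr_law 1 A \<preceq>\<^sub>L \<nu>" using \<nu> fixed by (auto simp: dominant_bp_fixed_point_def)
      \<comment> \<open>Degradation in both directions gives comparison of spreads in both
        directions, and that order is antisymmetric.\<close>
      then have "A \<sqsubseteq> C" "C \<sqsubseteq> A"
        using C degraded_less_informative[OF A(1) C(1)] degraded_less_informative[OF C(1) A(1)] by auto
      then have "A = C" by (rule less_informative_antisym[OF _ _ A(1) C(1)])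
      then show False using \<open>\<nu> \<noteq> llr_law 1 A\<close> C(2) by simp
    qed
  qed
  show ?thesis
  proof (intro exI[of _ "llr_law 1 A"] conjI allI impI)
    show "llr_weakly_converges (\<lambda>h. (bp_op P \<delta> ^^ h) noiseless_dist) \<nu> \<longleftrightarrow> \<nu> = llr_law 1 A" for \<nu>
      using conv[OF bias_law_fair fair] by (simp add: llr_law_fair)
    show "llr_weakly_converges (\<lambda>h. (bp_op P \<delta> ^^ h) \<mu>r) \<nu> \<longleftrightarrow> \<nu> = llr_law 1 A"
      if \<mu>r: "llr_distribution \<mu>r \<and> \<mu>r \<noteq> trivial_dist" for \<mu>r \<nu>
    proof -
      obtain C where C: "bias_law C" "\<mu>r = llr_law 1 C"
        by (rule llr_distribution_obtain_bias_law[of \<mu>r]) (use \<mu>r in auto)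
      then have "C \<noteq> return borel 0" using \<mu>r llr_law_return_0 by auto
      then show ?thesis using conv[OF C(1) robust[OF C(1)]] C(2) by simp
    qed
    show "dominant_bp_fixed_point P \<delta> \<nu> \<longleftrightarrow> \<nu> = llr_law 1 A" for \<nu> by (rule dom)
  qed
qed

end
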